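(* Let $N\geq 5$ and $2_*=\frac{2N}{N-4}$. Let $V:\mathbb{R}^N\to\mathbb{R}$ and $f:\mathbb{R}\to\mathbb{R}$ satisfy: (V1) $V\in C^0(\mathbb{R}^N)\cap L^\infty(\mathbb{R}^N)$; (V2) there exist a bounded domain $\Omega\subset\mathbb{R}^N$ and $x_0\in\Omega$ such that $0<V(x_0)=V_0=\inf_{\mathbb{R}^N}V<\inf_{\partial\Omega}V$; (f1) $f\in C^1(\mathbb{R})$; (f2) $f(0)=f'(0)=0$; (f3) there exist constants $c_1,c_2>0$ and $p\in(1,2_*-1)$ such that $|f(s)|\leq c_1|s|+c_2|s|^p$ for all $s\in\mathbb{R}$; (f4) there exists $\mu>2$ such that $0<\mu F(s)\leq sf(s)$ for all $s\neq 0$, where $F(s)=\int_0^s f(t)\,dt$; (f5) the function $f(s)/s$ is increasing for $s>0$ and decreasing for $s<0$. Then for each sequence $\epsilon_n\to 0$ of positive numbers there exists a subsequence $\{\epsilon_k\}_{k\in\mathbb{N}}$ such that, for every $k\in\mathbb{N}$, there exists a nontrivial weak solution $u_k\in H^2(\mathbb{R}^N)$ of $$\epsilon_k^4\Delta^2u+V(x)u=f(u)\quad\text{in }\mathbb{R}^N.$$ Moreover, if $x_k$ is a maximum point of $|u_k|$, then $x_k\in\Omega$ and $\lim_{k\to\infty}V(x_k)=\inf_{\mathbb{R}^N}V$.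
   Context: $\Delta^2$ denotes the biharmonic operator. A weak solution $u\in H^2(\mathbb{R}^N)$ means $\int_{\mathbb{R}^N}(\epsilon^4\Delta u\Delta\varphi+V u\varphi)\,dx=\int_{\mathbb{R}^N}f(u)\varphi\,dx$ for all $\varphi\in H^2(\mathbb{R}^N)$. *)

theory Defs
  imports "HOL-Analysis.Analysis"
begin

definition pd :: "'n::finite \<Rightarrow> (real^'n \<Rightarrow> real) \<Rightarrow> real^'n \<Rightarrow> real" where
  "pd i \<phi> x = deriv (\<lambda>t. \<phi> (x + t *\<^sub>R axis i 1)) 0"

fun Ck :: "nat \<Rightarrow> (real^'n::finite \<Rightarrow> real) \<Rightarrow> bool" where
  "Ck 0 \<phi> = continuous_on UNIV \<phi>"
| "Ck (Suc k) \<phi> = (\<phi> differentiable_on UNIV \<and> (\<forall>i. Ck k (pd i \<phi>)))"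

definition test_fun :: "(real^'n::finite \<Rightarrow> real) \<Rightarrow> bool" where
  "test_fun \<phi> \<longleftrightarrow> (\<forall>k. Ck k \<phi>) \<and> bounded {x. \<phi> x \<noteq> 0}"

definition lap :: "(real^'n::finite \<Rightarrow> real) \<Rightarrow> real^'n \<Rightarrow> real" where
  "lap \<phi> x = (\<Sum>i\<in>UNIV. pd i (pd i \<phi>) x)"

definition L2 :: "(real^'n::finite \<Rightarrow> real) \<Rightarrow> bool" where
  "L2 u \<longleftrightarrow> u \<in> borel_measurable lebesgue \<and> integrable lebesgue (\<lambda>x. (u x)^2)"

definition weak_pd :: "'n::finite \<Rightarrow> (real^'n \<Rightarrow> real) \<Rightarrow> (real^'n \<Rightarrow> real) \<Rightarrow> bool" where
  "weak_pd i u g \<longleftrightarrow> (\<forall>\<phi>. test_fun \<phi> \<longrightarrow>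
      (LINT x|lebesgue. u x * pd i \<phi> x) = - (LINT x|lebesgue. g x * \<phi> x))"

definition H2 :: "(real^'n::finite \<Rightarrow> real) \<Rightarrow> bool" where
  "H2 u \<longleftrightarrow> L2 u \<and> (\<exists>D1 D2. \<forall>i. L2 (D1 i) \<and> weak_pd i u (D1 i) \<and>
      (\<forall>j. L2 (D2 i j) \<and> weak_pd j (D1 i) (D2 i j)))"

definition weak_lap :: "(real^'n::finite \<Rightarrow> real) \<Rightarrow> (real^'n \<Rightarrow> real) \<Rightarrow> bool" where
  "weak_lap u w \<longleftrightarrow> L2 w \<and> (\<forall>\<phi>. test_fun \<phi> \<longrightarrow>
      (LINT x|lebesgue. u x * lap \<phi> x) = (LINT x|lebesgue. w x * \<phi> x))"

definition weak_solution ::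
    "real \<Rightarrow> (real^'n::finite \<Rightarrow> real) \<Rightarrow> (real \<Rightarrow> real) \<Rightarrow> (real^'n \<Rightarrow> real) \<Rightarrow> bool" where
  "weak_solution eps V f u \<longleftrightarrow> H2 u \<and>
     (\<forall>\<phi> Lu L\<phi>. H2 \<phi> \<longrightarrow> weak_lap u Lu \<longrightarrow> weak_lap \<phi> L\<phi> \<longrightarrow>
        (LINT x|lebesgue. eps^4 * Lu x * L\<phi> x + V x * u x * \<phi> x)
          = (LINT x|lebesgue. f (u x) * \<phi> x))"

end

theory Submission
  imports Defs "HOL-Library.Diagonal_Subsequence"
begin

text \<open>
  In the coordinates \<open>x = x\<^sub>0 + \<epsilon>y\<close> the equation becomes \<open>\<Delta>\<^sup>2u + V(x\<^sub>0 + \<epsilon>y)u = f(u)\<close>. Following del Pino and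
  Felmer, \<open>f\<close> is truncated to linear growth with small slope outside a sublevel set of \<open>V\<close> in \<open>\<Omega>\<close>; the
  resulting functional is compact near its Nehari set, so it has a minimiser there, which is a critical
  point. Bootstrapping with a compactly supported parametrix \<open>K\<close> of \<open>-\<Delta>\<close> (\<open>u = \<rho> * u - K * \<Delta>u\<close>) makes the
  minimisers bounded and Lipschitz uniformly in \<open>\<epsilon>\<close>. If \<open>|u|\<close> stays above the truncation threshold \<open>a\<close> at points
  whose images converge to \<open>b\<close>, a translated limit lies in the Nehari set for the constant coefficient \<open>V(b)\<close>
  with energy at most the ground-state level for \<open>inf V\<close>, whence \<open>V(b) = inf V\<close>; points where the penalisation is
  active in the limit are excluded because the truncated problem has no nontrivial solution. Hence \<open>|u| < a\<close> wherever
  the truncation differs from \<open>f\<close>, and \<open>u\<close> solves the original equation.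
\<close>

text \<open>Two features of the problem shape the proof. And the truncated nonlinearity is merely
  continuous, so the Nehari set is not treated as a manifold and no Lagrange multiplier occurs: a
  perturbation of the minimiser is scaled back onto the set, and only the monotonicity of
  \<open>f s / s\<close> is used, which makes a Nehari point the maximum of the energy on its ray.
  The admissible slope \<open>\<kappa> = min (V0 / 2) (\<nu> * V0)\<close> has two duties: the first
  bound lets the quadratic form absorb the truncated term, the second keeps the energy coercive on
  the Nehari set. A function always travels with its weak Laplacian, as a pair
  \<open>Wsp u v\<close>. The parametrix identity for such pairs gives the Sobolev inequality, the
  local compactness and the second derivatives as well; \<open>H2\<close> is needed only to match
  the final definition.\<close>

abbreviation (input) LI :: "('a::euclidean_space => real) => real" where "LI f \<equiv> integral\<^sup>L lborel f"

abbreviation (input) sqn :: "('a::euclidean_space => real) => real" where "sqn f \<equiv> LI (%x. (f x)^2)"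

abbreviation (input) Lint :: "('a::euclidean_space => real) => bool" where "Lint f \<equiv> integrable lborel f"

abbreviation (input) bmeas :: "('a::topological_space => 'b::topological_space) set" where "bmeas \<equiv> borel_measurable borel"

abbreviation (input) tends :: "(nat => 'a::topological_space) => 'a => bool" (infix "-->>" 60) where "X -->> L \<equiv> X \<longlonglongrightarrow> L"

lemmas integrable_bnd = Bochner_Integration.integrable_bound

section \<open>Square-integrable functions\<close>

text \<open>Over \<open>lborel\<close> this means Borel measurable, as convolutions and Fubini
  require. \<open>L2\<close> and the completed measure enter only where \<open>H2\<close> and
  \<open>weak_solution\<close> have to be matched.\<close>

definition sq_int :: "'a measure => ('a => real) => bool" where
 "sq_int M f \<longleftrightarrow> f \<in> borel_measurable M & integrable M (%x. (f x)^2)"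

lemma sq_int_measurable [measurable_dest]: "sq_int M f ==> f \<in> borel_measurable M"
 by (simp add: sq_int_def)

lemma sq_int_integrable: "sq_int M f ==> integrable M (%x. (f x)^2)"
 by (simp add: sq_int_def)

lemma sq_int_mult:
 assumes "sq_int M f" "sq_int M g"
 shows "integrable M (%x. f x * g x)"
proof (rule integrable_bnd)
 show "integrable M (%x. (f x)^2 + (g x)^2)"
  using assms by (auto simp: sq_int_def)
 show "(%x. f x * g x) \<in> borel_measurable M"
  using assms by (auto simp: sq_int_def)
 have "\<bar>a * b\<bar> <= a^2 + b^2" for a b :: real
 proof -
  have "0 <= (\<bar>a\<bar> - \<bar>b\<bar>)^2" by simp
  hence "2 * \<bar>a * b\<bar> <= a^2 + b^2" by (simp add: power2_diff abs_mult)
  thus ?thesis by (smt (verit) zero_le_power2)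
 qed
 thus "AE x in M. norm (f x * g x) <= norm ((f x)\<^sup>2 + (g x)\<^sup>2)" by auto
qed

lemma sq_int_add_cmult:
 assumes "sq_int M f" "sq_int M g"
 shows "sq_int M (%x. f x + c * g x)"
proof -
 have "integrable M (%x. (f x)^2 + 2 * c * (f x * g x) + c^2 * (g x)^2)"
  using assms sq_int_mult[OF assms] by (auto simp: sq_int_def)
 moreover have "(%x. (f x)^2 + 2 * c * (f x * g x) + c^2 * (g x)^2) = (%x. (f x + c * g x)^2)"
  by (auto simp: power2_eq_square algebra_simps)
 ultimately show ?thesis using assms by (auto simp: sq_int_def)
qed

lemma sq_int_zero: "sq_int M (%x. 0)"
 by (simp add: sq_int_def)

lemma sq_int_add: "sq_int M f ==> sq_int M g ==> sq_int M (%x. f x + g x)"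
 using sq_int_add_cmult[of M f g 1] by simp

lemma sq_int_diff: "sq_int M f ==> sq_int M g ==> sq_int M (%x. f x - g x)"
 using sq_int_add_cmult[of M f g "-1"] by simp

lemma sq_int_cmult: "sq_int M f ==> sq_int M (%x. c * f x)"
 using sq_int_add_cmult[of M "%x. 0" f c] by (simp add: sq_int_zero)

lemma sq_int_bound:
 assumes "sq_int M f" "g \<in> borel_measurable M" "AE x in M. \<bar>g x\<bar> <= C * \<bar>f x\<bar>"
 shows "sq_int M g"
 unfolding sq_int_def
proof
 show "integrable M (%x. (g x)^2)"
 proof (rule integrable_bnd)
  show "integrable M (%x. C^2 * (f x)^2)" using assms by (simp add: sq_int_def)
  show "(%x. (g x)^2) \<in> borel_measurable M" using assms by simp
  show "AE x in M. norm ((g x)\<^sup>2) <= norm (C\<^sup>2 * (f x)\<^sup>2)"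
   using assms(3)
  proof eventually_elim
   case (elim x)
   hence "\<bar>g x\<bar>^2 <= (C * \<bar>f x\<bar>)^2" by (intro power_mono) auto
   thus ?case by (simp add: power_mult_distrib)
  qed
 qed
qed (use assms in auto)

lemma sq_int_expand:
 assumes "sq_int M f" "sq_int M g"
 shows "(\<integral>x. (f x + c * g x)^2 \<partial>M) = (\<integral>x. (f x)^2 \<partial>M) + 2 * c * (\<integral>x. f x * g x \<partial>M) + c^2 * (\<integral>x. (g x)^2 \<partial>M)"
proof -
 have "(%x. (f x + c * g x)^2) = (%x. (f x)^2 + 2 * c * (f x * g x) + c^2 * (g x)^2)"
  by (auto simp: power2_eq_square algebra_simps)
 thus ?thesis
  using assms sq_int_mult[OF assms] by (simp add: sq_int_def)
qed

lemma integral_add_cmult_right: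
 assumes "sq_int M f" "sq_int M g" "sq_int M h"
 shows "(\<integral>x. (f x + c * g x) * h x \<partial>M) = (\<integral>x. f x * h x \<partial>M) + c * (\<integral>x. g x * h x \<partial>M)"
proof -
 have "(%x. (f x + c * g x) * h x) = (%x. f x * h x + c * (g x * h x))"
  by (auto simp: algebra_simps)
 thus ?thesis using sq_int_mult[OF assms(1,3)] sq_int_mult[OF assms(2,3)] by simp
qed

lemma nonneg_quadratic_discrim:
 fixes A B C :: real
 assumes "!!t. 0 <= A + 2 * t * B + t^2 * C" "C >= 0"
 shows "B^2 <= A * C"
proof (cases "C = 0")
 case True
 have "B = 0"
 proof (rule ccontr)
  assume B: "B \<noteq> 0"
  \<comment> \<open>This value of \<open>t\<close> makes the affine function equal to -1.\<close>
  have "0 <= A + 2 * (-(A + 1) / (2 * B)) * B" using assms(1)[of "-(A + 1) / (2 * B)"] True by simp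
  thus False using B by (simp add: field_simps)
 qed
 thus ?thesis using True by simp
next
 case False
 hence C: "C > 0" using assms(2) by simp
 have "0 <= A + 2 * (- B / C) * B + (- B / C)^2 * C" by (rule assms)
 also have "\<dots> = A - B^2 / C" using C by (simp add: field_simps power2_eq_square)
 finally show ?thesis using C by (simp add: field_simps)
qed

lemma integral_Cauchy_Schwarz:
 assumes "sq_int M f" "sq_int M g"
 shows "(\<integral>x. f x * g x \<partial>M)^2 <= (\<integral>x. (f x)^2 \<partial>M) * (\<integral>x. (g x)^2 \<partial>M)"
proof (rule nonneg_quadratic_discrim)
 fix t :: real
 have "0 <= (\<integral>x. (f x + t * g x)^2 \<partial>M)" by simp
 thus "0 <= (\<integral>x. (f x)^2 \<partial>M) + 2 * t * (\<integral>x. f x * g x \<partial>M) + t^2 * (\<integral>x. (g x)^2 \<partial>M)"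
  using sq_int_expand[OF assms, of t] by simp
qed simp

lemma integral_Cauchy_Schwarz_sqrt:
 assumes "sq_int M f" "sq_int M g"
 shows "\<bar>\<integral>x. f x * g x \<partial>M\<bar> <= sqrt (\<integral>x. (f x)^2 \<partial>M) * sqrt (\<integral>x. (g x)^2 \<partial>M)"
 using integral_Cauchy_Schwarz[OF assms]
 by (metis real_sqrt_abs real_sqrt_le_mono real_sqrt_mult)

lemma integral_square_triangle:
 assumes "sq_int M f" "sq_int M g"
 shows "(\<integral>x. (f x + g x)^2 \<partial>M) <= 2 * (\<integral>x. (f x)^2 \<partial>M) + 2 * (\<integral>x. (g x)^2 \<partial>M)"
proof -
 have "0 <= (\<integral>x. (f x + (-1) * g x)^2 \<partial>M)" by (rule integral_nonneg_AE) auto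
 thus ?thesis using sq_int_expand[OF assms, of 1] unfolding sq_int_expand[OF assms, of "-1"] by simp
qed

text \<open>The upper bounds \<open>C n\<close> may vary with \<open>n\<close>; the lower
  semicontinuity of the energy needs this, because its bounds contain terms that converge by
  compactness.\<close>

lemma integral_Fatou:
 fixes f :: "nat => 'a => real"
 assumes int: "!!n. integrable M (f n)" and nn: "!!n. AE x in M. 0 <= f n x"
  and lim: "AE x in M. (%n. f n x) -->> g x" and g [measurable]: "g \<in> borel_measurable M"
  and bd: "!!n. (\<integral>x. f n x \<partial>M) <= C n" and C: "C -->> L"
 shows "integrable M g" "(\<integral>x. g x \<partial>M) <= L"
proof -
 have [measurable]: "f n \<in> borel_measurable M" for n using int[of n] by auto
 have nn': "AE x in M. \<forall>n. 0 <= f n x" using nn by (simp add: AE_all_countable)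
 have g0: "AE x in M. 0 <= g x"
  using nn' lim by eventually_elim (auto intro: LIMSEQ_le_const)
 have "(\<integral>\<^sup>+x. ennreal (g x) \<partial>M) = (\<integral>\<^sup>+x. liminf (%n. ennreal (f n x)) \<partial>M)"
 proof (rule nn_integral_cong_AE, use lim in eventually_elim)
  case (elim x)
  hence "(%n. ennreal (f n x)) -->> ennreal (g x)" by (intro tendsto_ennrealI)
  thus ?case by (simp add: lim_imp_Liminf)
 qed
 also have "\<dots> <= liminf (%n. \<integral>\<^sup>+x. ennreal (f n x) \<partial>M)"
  by (rule nn_integral_liminf) auto
 also have "\<dots> = liminf (%n. ennreal (\<integral>x. f n x \<partial>M))"
  by (subst nn_integral_eq_integral[OF int nn]) auto
 also have "\<dots> <= liminf (%n. ennreal (C n))"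
  by (intro Liminf_mono always_eventually allI ennreal_leI bd)
 also have "\<dots> = ennreal L"
  by (intro lim_imp_Liminf tendsto_ennrealI C) auto
 finally have le: "(\<integral>\<^sup>+x. ennreal (g x) \<partial>M) <= ennreal L" .
 hence "(\<integral>\<^sup>+x. ennreal (g x) \<partial>M) < \<infinity>" by (simp add: order_le_less_trans)
 thus int_g: "integrable M g" using g0 by (intro integrableI_nonneg) auto
 have "0 <= L" using C
 proof (rule LIMSEQ_le_const)
  show "\<exists>N. \<forall>n\<ge>N. 0 <= C n" using bd integral_nonneg_AE[OF nn] by (meson order_trans)
 qed
 thus "(\<integral>x. g x \<partial>M) <= L"
  using le nn_integral_eq_integral[OF int_g g0] by simp
qed

text \<open>Riesz-Fischer: a subsequence with fast decreasing steps converges almost everywhere, and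
  Fatou in one index of the Cauchy condition turns this limit into the L2 limit of the whole
  sequence.\<close>

lemma sq_int_complete:
 fixes f :: "nat => 'a => real"
 assumes f: "!!n. sq_int M (f n)"
  and Cauchy: "!!e. e > 0 ==> \<exists>N. \<forall>m\<ge>N. \<forall>n\<ge>N. (\<integral>x. (f m x - f n x)^2 \<partial>M) < e"
 shows "\<exists>g. sq_int M g & (%n. \<integral>x. (f n x - g x)^2 \<partial>M) -->> 0"
proof -
 have [measurable]: "f n \<in> borel_measurable M" for n using f by (simp add: sq_int_def)
 have "\<exists>N. \<forall>m\<ge>N. \<forall>n\<ge>N. (\<integral>x. (f m x - f n x)^2 \<partial>M) < 1 / 8^k" for k :: nat
  by (rule Cauchy) simp
 then obtain N where N: "!!k m n. m >= N k ==> n >= N k ==> (\<integral>x. (f m x - f n x)^2 \<partial>M) < 1 / 8^k"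
  by metis
 \<comment> \<open>Summing all earlier thresholds and adding \<open>k\<close> makes \<open>r\<close>
   strictly increasing with \<open>r k >= N k\<close>.\<close>
 define r where "r k = (\<Sum>i\<le>k. N i) + k" for k
 have rN: "N k <= r k" for k
 proof -
  have "N k <= (\<Sum>i\<le>k. N i)" by (rule member_le_sum) auto
  thus ?thesis by (simp add: r_def)
 qed
 have r_mono: "strict_mono r" by (rule strict_monoI_Suc) (simp add: r_def)
 have rk: "m >= k ==> r k <= r m" for k m using r_mono by (simp add: strict_mono_less_eq)
 \<comment> \<open>The squared increments have integral at most \<open>1 / 8^k\<close>. With weights
   \<open>4^k\<close> their series is still integrable, hence finite almost everywhere, and this
   forces \<open>\<bar>d k x\<bar> <= sqrt B * (1/2)^k\<close>.\<close>
 define d where "d k x = f (r (Suc k)) x - f (r k) x" for k x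
 have d_int: "integrable M (%x. (d k x)^2)" for k
  using sq_int_diff[OF f f] by (auto simp: sq_int_def d_def)
 have d_small: "(\<integral>x. (d k x)^2 \<partial>M) <= 1 / 8^k" for k
  unfolding d_def using N[of k "r (Suc k)" "r k"] rN[of k] rk[of k "Suc k"] by force
 have [measurable]: "d k \<in> borel_measurable M" for k unfolding d_def by measurable
 have "(\<integral>\<^sup>+x. (\<Sum>k. ennreal (4^k * (d k x)^2)) \<partial>M) = (\<Sum>k. \<integral>\<^sup>+x. ennreal (4^k * (d k x)^2) \<partial>M)"
  by (rule nn_integral_suminf) auto
 also have "\<dots> = (\<Sum>k. ennreal (4^k * (\<integral>x. (d k x)^2 \<partial>M)))"
  using d_int by (subst nn_integral_eq_integral) auto
 also have "\<dots> <= (\<Sum>k. ennreal ((1/2)^k))"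
 proof (intro suminf_le ennreal_leI)
  fix k
  have "4^k * (\<integral>x. (d k x)^2 \<partial>M) <= 4^k * (1 / 8^k)" by (intro mult_left_mono d_small) auto
  also have "\<dots> = (1/2)^k" by (simp add: power_divide[symmetric])
  finally show "4^k * (\<integral>x. (d k x)^2 \<partial>M) <= (1/2)^k" .
 qed auto
 also have "\<dots> = ennreal (\<Sum>k. (1/2)^k)" by (intro suminf_ennreal2) (auto intro!: summable_geometric)
 finally have "(\<integral>\<^sup>+x. (\<Sum>k. ennreal (4^k * (d k x)^2)) \<partial>M) \<noteq> \<infinity>"
  using ennreal_less_top order_le_less_trans by (metis infinity_ennreal_def less_irrefl)
 hence "AE x in M. (\<Sum>k. ennreal (4^k * (d k x)^2)) \<noteq> \<infinity>"
  by (intro nn_integral_PInf_AE) auto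
 hence conv: "AE x in M. convergent (%k. f (r k) x)"
 proof eventually_elim
  case (elim x)
  have sm: "summable (%k. 4^k * (d k x)^2)"
   using elim by (intro summable_suminf_not_top) auto
  hence "Bseq (%k. 4^k * (d k x)^2)" by (intro convergent_imp_Bseq) (auto simp: convergent_def dest: summable_LIMSEQ_zero)
  then obtain B where B: "B > 0" "!!k. norm (4^k * (d k x)^2) <= B" by (auto simp: Bseq_def)
  have "\<bar>d k x\<bar> <= sqrt B * (1/2)^k" for k
  proof -
   have "sqrt (4^k * (d k x)^2) <= sqrt B" using B(2)[of k] by (intro real_sqrt_le_mono) auto
   moreover have "sqrt (4^k) = 2^k"
   proof -
    have "(4::real)^k = (2^k)^2" by (simp add: power_mult[symmetric] mult.commute[of k] power_mult)
    thus ?thesis by simp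
   qed
   ultimately show ?thesis by (simp add: real_sqrt_mult field_simps power_divide)
  qed
  moreover have "summable (%k. sqrt B * (1/2::real)^k)" by (rule summable_mult[OF summable_geometric]) simp
  ultimately have "summable (%k. d k x)"
   using summable_comparison_test'[of "%k. sqrt B * (1/2)^k" 0 "%k. d k x"] by simp
  hence "convergent (%n. \<Sum>k<n. d k x)" by (simp add: summable_iff_convergent)
  moreover have "(\<Sum>k<n. d k x) = f (r n) x - f (r 0) x" for n
   unfolding d_def by (induction n) auto
  ultimately have "convergent (%n. f (r n) x - f (r 0) x)" by simp
  thus ?case by (simp add: convergent_diff_const_right_iff)
 qed
 define g where "g x = lim (%k. f (r k) x)" for x
 have [measurable]: "g \<in> borel_measurable M" unfolding g_def by measurable
 have limg: "AE x in M. (%k. f (r k) x) -->> g x"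
  using conv by eventually_elim (simp add: g_def convergent_LIMSEQ_iff)
 \<comment> \<open>Fatou in the second index: \<open>r (i + k) >= N k\<close>, so the estimate at
   level \<open>k\<close> survives the limit in \<open>i\<close>, for every \<open>n >= N k\<close>
   and not just along \<open>r\<close>.\<close>
 have key: "integrable M (%x. (f n x - g x)^2) & (\<integral>x. (f n x - g x)^2 \<partial>M) <= 1 / 8^k" if n: "n >= N k" for n k
 proof -
  have 1: "integrable M (%x. (f n x - f (r (i + k)) x)^2)" for i using sq_int_diff[OF f f] by (auto simp: sq_int_def)
  have 2: "AE x in M. (%i. (f n x - f (r (i + k)) x)^2) -->> (f n x - g x)^2"
   using limg
  proof eventually_elim
   case (elim x)
   show ?case by (intro tendsto_intros LIMSEQ_ignore_initial_segment elim)
  qed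
  have 3: "(\<integral>x. (f n x - f (r (i + k)) x)^2 \<partial>M) <= 1 / 8^k" for i
  proof -
   have "N k <= r (i + k)" using rN[of k] rk[of k "i + k"] by simp
   thus ?thesis using N[of k n "r (i + k)"] n by simp
  qed
  show ?thesis using integral_Fatou[OF 1 _ 2 _ 3 tendsto_const] by auto
 qed
 have "sq_int M (%x. f (N 0) x - (f (N 0) x - g x))"
  by (rule sq_int_diff[OF f]) (use key[of 0 "N 0"] in \<open>auto simp: sq_int_def\<close>)
 hence "sq_int M g" by simp
 moreover have "(%n. \<integral>x. (f n x - g x)^2 \<partial>M) -->> 0"
 proof (rule LIMSEQ_I)
  fix e :: real assume "e > 0"
  then obtain k :: nat where k: "(1/8)^k < e" using real_arch_pow_inv[of e "1/8"] by auto
  show "\<exists>N. \<forall>n\<ge>N. norm ((\<integral>x. (f n x - g x)^2 \<partial>M) - 0) < e"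
  proof (intro exI allI impI)
   fix n assume "n >= N k"
   thus "norm ((\<integral>x. (f n x - g x)^2 \<partial>M) - 0) < e"
    using key[of k n] k by (simp add: power_divide)
  qed
 qed
 ultimately show ?thesis by blast
qed

lemma sq_int_tendsto_inner:
 assumes "!!n. sq_int M (s n)" "sq_int M g" "sq_int M h" "(%n. \<integral>x. (s n x - g x)^2 \<partial>M) -->> 0"
 shows "(%n. \<integral>x. s n x * h x \<partial>M) -->> (\<integral>x. g x * h x \<partial>M)"
proof -
 have "(%n. (\<integral>x. s n x * h x \<partial>M) - (\<integral>x. g x * h x \<partial>M)) -->> 0"
 proof (rule Lim_null_comparison)
  show "\<forall>\<^sub>F n in sequentially. norm ((\<integral>x. s n x * h x \<partial>M) - (\<integral>x. g x * h x \<partial>M))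
   <= sqrt (\<integral>x. (s n x - g x)^2 \<partial>M) * sqrt (\<integral>x. (h x)^2 \<partial>M)"
  proof (rule always_eventually, rule allI)
   fix n
   have "(\<integral>x. s n x * h x \<partial>M) - (\<integral>x. g x * h x \<partial>M) = (\<integral>x. (s n x - g x) * h x \<partial>M)"
    using integral_add_cmult_right[of M "s n" g h "-1"] assms by simp
   thus "norm ((\<integral>x. s n x * h x \<partial>M) - (\<integral>x. g x * h x \<partial>M))
   <= sqrt (\<integral>x. (s n x - g x)^2 \<partial>M) * sqrt (\<integral>x. (h x)^2 \<partial>M)"
    using integral_Cauchy_Schwarz_sqrt[OF sq_int_diff[OF assms(1)[of n] assms(2)] assms(3)] by simp
  qed
  show "(%n. sqrt (\<integral>x. (s n x - g x)^2 \<partial>M) * sqrt (\<integral>x. (h x)^2 \<partial>M)) -->> 0"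
   using tendsto_mult[OF tendsto_real_sqrt[OF assms(4)] tendsto_const[of "sqrt (\<integral>x. (h x)^2 \<partial>M)"]] by simp
 qed
 thus ?thesis by (simp add: LIM_zero_iff)
qed

text \<open>Riesz representation on a linear space of square-integrable functions that need not be
 closed: the quadratic functional \<open>\<integral>g\<^sup>2 - 2 L g\<close> is minimised over the space.\<close>

lemma Riesz_representation:
 fixes L :: "('a => real) => real"
 assumes S: "S \<noteq> {}" "!!g. g \<in> S ==> sq_int M g"
  and lin: "!!g h c. g \<in> S ==> h \<in> S ==> (%x. g x + c * h x) \<in> S"
  and L: "!!g h c. g \<in> S ==> h \<in> S ==> L (%x. g x + c * h x) = L g + c * L h"
  and bd: "!!g. g \<in> S ==> \<bar>L g\<bar> <= C * sqrt (\<integral>x. (g x)^2 \<partial>M)"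
 shows "\<exists>f s. sq_int M f & (\<forall>g\<in>S. L g = (\<integral>x. f x * g x \<partial>M)) &
  (\<forall>n::nat. s n \<in> S) & (%n. \<integral>x. (s n x - f x)^2 \<partial>M) -->> 0"
proof -
 define ph where "ph g = (\<integral>x. (g x)^2 \<partial>M) - 2 * L g" for g
 have lower: "-(C^2) <= ph g" if "g \<in> S" for g
 proof -
  define n where "n = sqrt (\<integral>x. (g x)^2 \<partial>M)"
  have n2: "(\<integral>x. (g x)^2 \<partial>M) = n^2" by (simp add: n_def)
  have "0 <= (n - C)^2" by simp
  moreover have "L g <= C * n" using bd[OF that] by (simp add: n_def)
  ultimately show ?thesis by (simp add: ph_def n2 power2_diff mult.commute)
 qed
 define m where "m = Inf (ph ` S)"
 have m_le: "m <= ph g" if "g \<in> S" for g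
  unfolding m_def using that lower by (intro cInf_lower bdd_belowI2[of _ "-(C^2)"]) auto
 have "\<exists>g\<in>S. ph g < m + 1 / real (Suc n)" for n
 proof -
  have "Inf (ph ` S) < m + 1 / real (Suc n)" by (simp add: m_def)
  thus ?thesis using S(1) lower by (subst (asm) cInf_less_iff) (auto intro!: bdd_belowI2[of _ "-(C^2)"])
 qed
 then obtain s where s: "!!n. s n \<in> S" "!!n. ph (s n) < m + 1 / real (Suc n)" by metis
 have sq: "!!n. sq_int M (s n)" using S s by auto
 have ph_expand: "ph (%x. g x + c * h x) = ph g + 2 * c * ((\<integral>x. g x * h x \<partial>M) - L h) + c^2 * (\<integral>x. (h x)^2 \<partial>M)"
  if "g \<in> S" "h \<in> S" for g h c
  using sq_int_expand[of M g h c] S that L[OF that] by (simp add: ph_def algebra_simps)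
 \<comment> \<open>Parallelogram argument: \<open>s i + h / 2\<close> is the midpoint of
   \<open>s i\<close> and \<open>s j\<close>, and \<open>ph\<close> is at least \<open>m\<close>
   there too.\<close>
 have par: "(\<integral>x. (s i x - s j x)^2 \<partial>M) <= 2 / real (Suc i) + 2 / real (Suc j)" for i j
 proof -
  define D where "D = (\<integral>x. (s i x - s j x)^2 \<partial>M)"
  define h where "h x = s j x + (-1) * s i x" for x
  have h: "h \<in> S" unfolding h_def by (intro lin s)
  have "m <= ph (%x. s i x + (1/2) * h x)" by (intro m_le lin s h)
  hence 1: "m <= ph (s i) + ((\<integral>x. s i x * h x \<partial>M) - L h) + 1/4 * (\<integral>x. (h x)^2 \<partial>M)"
   by (subst (asm) ph_expand[OF s(1) h]) (simp add: power2_eq_square)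
  have "ph (%x. s i x + 1 * h x) = ph (s i) + 2 * ((\<integral>x. s i x * h x \<partial>M) - L h) + (\<integral>x. (h x)^2 \<partial>M)"
   by (subst ph_expand[OF s(1) h]) (simp add: power2_eq_square)
  moreover have "(%x. s i x + 1 * h x) = s j" by (auto simp: h_def)
  ultimately have 2: "ph (s j) = ph (s i) + 2 * ((\<integral>x. s i x * h x \<partial>M) - L h) + (\<integral>x. (h x)^2 \<partial>M)" by simp
  have 3: "(\<integral>x. (h x)^2 \<partial>M) = D" unfolding D_def h_def by (intro Bochner_Integration.integral_cong) (auto simp: power2_commute)
  have "D <= 2 * (ph (s i) - m) + 2 * (ph (s j) - m)" using 1 2 3 by simp
  also have "\<dots> <= 2 / real (Suc i) + 2 / real (Suc j)" using s(2)[of i] s(2)[of j] by simp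
  finally show ?thesis by (simp add: D_def)
 qed
 have "\<exists>f. sq_int M f & (%n. \<integral>x. (s n x - f x)^2 \<partial>M) -->> 0"
 proof (rule sq_int_complete[OF sq])
  fix e :: real assume e: "e > 0"
  obtain N where N: "inverse (real (Suc N)) < e / 4" using reals_Archimedean[of "e/4"] e by auto
  have "2 / real (Suc i) < e / 2" if "i >= N" for i
  proof -
   have "inverse (real (Suc i)) <= inverse (real (Suc N))" using that by (intro le_imp_inverse_le) auto
   moreover have "2 / real (Suc i) = 2 * inverse (real (Suc i))" by (simp only: divide_inverse)
   ultimately show ?thesis using N by linarith
  qed
  note small = this
  have "\<forall>i\<ge>N. \<forall>j\<ge>N. (\<integral>x. (s i x - s j x)^2 \<partial>M) < e"
  proof (intro allI impI)
   fix i j assume "i >= N" "j >= N"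
   thus "(\<integral>x. (s i x - s j x)^2 \<partial>M) < e" using par[of i j] small[of i] small[of j] by linarith
  qed
  thus "\<exists>N. \<forall>m\<ge>N. \<forall>n\<ge>N. (\<integral>x. (s m x - s n x)^2 \<partial>M) < e" by blast
 qed
 then obtain f where f: "sq_int M f" "(%n. \<integral>x. (s n x - f x)^2 \<partial>M) -->> 0" by blast
 \<comment> \<open>The limit \<open>f\<close> may lie outside \<open>S\<close>, where
   \<open>L\<close> says nothing. So the minimality inequality is written at \<open>s n\<close>, up
   to the error \<open>1 / (n + 1)\<close>, and passed to the limit; the resulting quadratic in
   \<open>t\<close> has no constant term, hence no linear term either.\<close>
 have "L g = (\<integral>x. f x * g x \<partial>M)" if g: "g \<in> S" for g
 proof -
  define B where "B = (\<integral>x. f x * g x \<partial>M) - L g"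
  define G where "G = (\<integral>x. (g x)^2 \<partial>M)"
  have "0 <= 0 + 2 * t * B + t^2 * G" for t
  proof -
   have "(%n. 1 / real (Suc n) + 2 * t * ((\<integral>x. s n x * g x \<partial>M) - L g) + t^2 * G) -->> 0 + 2 * t * B + t^2 * G"
    unfolding B_def by (intro tendsto_intros sq_int_tendsto_inner[OF sq f(1) S(2)[OF g] f(2)] LIMSEQ_Suc[OF lim_1_over_n])
   moreover have "0 <= 1 / real (Suc n) + 2 * t * ((\<integral>x. s n x * g x \<partial>M) - L g) + t^2 * G" for n
    using m_le[OF lin[OF s(1)[of n] g, of t]] ph_expand[OF s(1)[of n] g, of t] s(2)[of n] by (simp add: G_def)
   ultimately show ?thesis by (intro LIMSEQ_le_const) auto
  qed
  hence "B^2 <= 0 * G" by (rule nonneg_quadratic_discrim) (simp add: G_def)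
  thus ?thesis by (simp add: B_def)
 qed
 thus ?thesis using f s by blast
qed

lemma weak_compactness_sq_int:
 fixes f :: "nat => 'a => real"
 assumes f: "!!n. sq_int M (f n)" and bd: "!!n. (\<integral>x. (f n x)^2 \<partial>M) <= C"
 shows "\<exists>r g. strict_mono (r :: nat => nat) & sq_int M g &
  (\<forall>h. sq_int M h --> (%n. \<integral>x. f (r n) x * h x \<partial>M) -->> (\<integral>x. g x * h x \<partial>M))"
proof -
 have C0: "C >= 0" using bd[of 0] by (smt (verit) integral_nonneg_AE AE_I2 zero_le_power2)
 have bdi: "\<bar>\<integral>x. f n x * h x \<partial>M\<bar> <= sqrt C * sqrt (\<integral>x. (h x)^2 \<partial>M)" if "sq_int M h" for n h
 proof -
  have "sqrt (\<integral>x. (f n x)^2 \<partial>M) * sqrt (\<integral>x. (h x)^2 \<partial>M) <= sqrt C * sqrt (\<integral>x. (h x)^2 \<partial>M)"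
   using bd[of n] by (intro mult_right_mono) auto
  thus ?thesis using integral_Cauchy_Schwarz_sqrt[OF f[of n] that] by linarith
 qed
 interpret D: subseqs "%m s. convergent (%n. \<integral>x. f (s n) x * f m x \<partial>M)"
 proof
  fix m and s :: "nat => nat" assume "strict_mono s"
  have "bounded (range (%n. \<integral>x. f (s n) x * f m x \<partial>M))"
   using bdi[OF f[of m]] by (auto simp: bounded_iff)
  then obtain l r where "strict_mono r" "((%n. \<integral>x. f (s n) x * f m x \<partial>M) \<circ> r) -->> l"
   using bounded_imp_convergent_subsequence by blast
  thus "\<exists>r. strict_mono r & convergent (%n. \<integral>x. f ((s \<circ> r) n) x * f m x \<partial>M)"
   by (auto simp: convergent_def o_def)
 qed
 define r where "r = D.diagseq"
 have r: "strict_mono r" unfolding r_def by (rule D.subseq_diagseq)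
 have conv: "convergent (%n. \<integral>x. f (r n) x * f m x \<partial>M)" for m
 proof -
  have "convergent (%n. \<integral>x. f ((D.diagseq \<circ> ((+) (Suc m))) n) x * f m x \<partial>M)"
  proof (rule D.diagseq_holds)
   fix n and s t :: "nat => nat" assume s: "strict_mono t" and c: "convergent (%k. \<integral>x. f (s k) x * f n x \<partial>M)"
   show "convergent (%k. \<integral>x. f ((s \<circ> t) k) x * f n x \<partial>M)"
    using convergent_subseq_convergent[OF c s] by (simp add: o_def)
  qed
  hence "convergent (%n. \<integral>x. f (r (n + Suc m)) x * f m x \<partial>M)" by (simp add: r_def o_def add.commute)
  thus ?thesis using convergent_ignore_initial_segment[of "%n. \<integral>x. f (r n) x * f m x \<partial>M" "Suc m"] by simp
 qed
 define S where "S = {%x. \<Sum>i<n. c i * f i x | n c. True}"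
 have S_sq: "sq_int M g" if "g \<in> S" for g
 proof -
  have "sq_int M (%x. \<Sum>i<n. c i * f i x)" for n c
   by (induction n) (auto intro!: sq_int_zero sq_int_add_cmult f)
  thus ?thesis using that by (auto simp: S_def)
 qed
 have S_lin: "(%x. g x + c * h x) \<in> S" if gh: "g \<in> S" "h \<in> S" for g h c
 proof -
  obtain n a k b where g: "g = (%x. \<Sum>i<n. a i * f i x)" and h: "h = (%x. \<Sum>i<k. b i * f i x)"
   using gh by (auto simp: S_def)
  define a' where "a' i = (if i < n then a i else 0)" for i
  define b' where "b' i = (if i < k then b i else 0)" for i
  have 1: "(\<Sum>i<n. a i * f i x) = (\<Sum>i<max n k. a' i * f i x)" for x
   by (intro sum.mono_neutral_cong_left) (auto simp: a'_def)
  have 2: "(\<Sum>i<k. b i * f i x) = (\<Sum>i<max n k. b' i * f i x)" for x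
   by (intro sum.mono_neutral_cong_left) (auto simp: b'_def)
  have "g x + c * h x = (\<Sum>i<max n k. (a' i + c * b' i) * f i x)" for x
   unfolding g h 1 2 by (simp add: sum_distrib_left sum.distrib algebra_simps)
  thus ?thesis by (auto simp: S_def)
 qed
 have "S \<noteq> {}" by (auto simp: S_def)
 have Sconv: "convergent (%n. \<integral>x. f (r n) x * g x \<partial>M)" if "g \<in> S" for g
 proof -
  have "convergent (%n. \<integral>x. f (r n) x * (\<Sum>i<k. c i * f i x) \<partial>M)" for k c
  proof (induction k)
   case (Suc k)
   have sk: "sq_int M (%x. \<Sum>i<k. c i * f i x)" by (rule S_sq) (auto simp: S_def)
   have "(\<integral>x. f (r n) x * (\<Sum>i<Suc k. c i * f i x) \<partial>M)
     = (\<integral>x. f (r n) x * (\<Sum>i<k. c i * f i x) \<partial>M) + c k * (\<integral>x. f (r n) x * f k x \<partial>M)" for n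
    using integral_add_cmult_right[OF sk f[of k] f[of "r n"], of "c k"] by (simp add: mult.commute)
   thus ?case using Suc conv by (auto intro!: convergent_add convergent_mult convergent_const)
  qed (simp add: convergent_const)
  thus ?thesis using that by (auto simp: S_def)
 qed
 define L where "L g = lim (%n. \<integral>x. f (r n) x * g x \<partial>M)" for g
 have L: "(%n. \<integral>x. f (r n) x * g x \<partial>M) -->> L g" if "g \<in> S" for g
  using Sconv[OF that] by (simp add: L_def convergent_LIMSEQ_iff)
 have Llin: "L (%x. g x + c * h x) = L g + c * L h" if "g \<in> S" "h \<in> S" for g h c
 proof (rule LIMSEQ_unique[OF L[OF S_lin[OF that]]])
  have "(\<integral>x. f (r n) x * (g x + c * h x) \<partial>M) = (\<integral>x. f (r n) x * g x \<partial>M) + c * (\<integral>x. f (r n) x * h x \<partial>M)" for n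
   using integral_add_cmult_right[OF S_sq[OF that(1)] S_sq[OF that(2)] f[of "r n"], of c] by (simp add: mult.commute)
  thus "(%n. \<integral>x. f (r n) x * (g x + c * h x) \<partial>M) -->> L g + c * L h"
   using L that by (auto intro!: tendsto_intros)
 qed
 have Lbd: "\<bar>L g\<bar> <= sqrt C * sqrt (\<integral>x. (g x)^2 \<partial>M)" if "g \<in> S" for g
  by (rule LIMSEQ_le_const2[OF tendsto_rabs[OF L[OF that]]]) (use bdi[OF S_sq[OF that]] in auto)
 obtain g s where g: "sq_int M g" "!!h. h \<in> S ==> L h = (\<integral>x. g x * h x \<partial>M)"
  and s: "!!n::nat. s n \<in> S" "(%n. \<integral>x. (s n x - g x)^2 \<partial>M) -->> 0"
  using Riesz_representation[OF \<open>S \<noteq> {}\<close> S_sq S_lin Llin Lbd] by blast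
 have "(%n. \<integral>x. f (r n) x * y x \<partial>M) -->> (\<integral>x. g x * y x \<partial>M)" if y: "sq_int M y" for y
 proof -
  \<comment> \<open>Representing the functional of \<open>y\<close> on the span yields
    \<open>z\<close>, the projection of \<open>y\<close> onto the closure of the span, together with
    approximants \<open>t n\<close> from the span.\<close>
  define Y where "Y g = (\<integral>x. y x * g x \<partial>M)" for g
  have Ylin: "Y (%x. g x + c * h x) = Y g + c * Y h" if "g \<in> S" "h \<in> S" for g h c
   unfolding Y_def using integral_add_cmult_right[OF S_sq[OF that(1)] S_sq[OF that(2)] y, of c] by (simp add: mult.commute)
  have Ybd: "\<bar>Y g\<bar> <= sqrt (\<integral>x. (y x)^2 \<partial>M) * sqrt (\<integral>x. (g x)^2 \<partial>M)" if "g \<in> S" for g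
   unfolding Y_def by (rule integral_Cauchy_Schwarz_sqrt[OF y S_sq[OF that]])
  obtain z t where z: "sq_int M z" "!!h. h \<in> S ==> Y h = (\<integral>x. z x * h x \<partial>M)"
   and t: "!!n::nat. t n \<in> S" "(%n. \<integral>x. (t n x - z x)^2 \<partial>M) -->> 0"
   using Riesz_representation[OF \<open>S \<noteq> {}\<close> S_sq S_lin Ylin Ybd] by blast
  have fS: "f n \<in> S" for n
  proof -
   have comb: "(%x. \<Sum>i<k. c i * f i x) \<in> S" for k c by (auto simp: S_def)
   have "f n = (%x. \<Sum>i<Suc n. (if i = n then 1 else 0) * f i x)" by auto
   thus ?thesis using comb[of "%i. if i = n then 1 else 0" "Suc n"] by simp
  qed
  have 1: "(\<integral>x. f n x * y x \<partial>M) = (\<integral>x. f n x * z x \<partial>M)" for n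
   using z(2)[OF fS[of n]] by (simp add: Y_def mult.commute)
  have 2: "(\<integral>x. g x * y x \<partial>M) = (\<integral>x. g x * z x \<partial>M)"
  proof (rule LIMSEQ_unique)
   have "(\<integral>x. s n x * y x \<partial>M) = (\<integral>x. s n x * z x \<partial>M)" for n
    using z(2)[OF s(1)[of n]] by (simp add: Y_def mult.commute)
   thus "(%n. \<integral>x. s n x * z x \<partial>M) -->> (\<integral>x. g x * y x \<partial>M)"
    using sq_int_tendsto_inner[OF S_sq[OF s(1)] g(1) y s(2)] by simp
   show "(%n. \<integral>x. s n x * z x \<partial>M) -->> (\<integral>x. g x * z x \<partial>M)"
    using sq_int_tendsto_inner[OF S_sq[OF s(1)] g(1) z(1) s(2)] by simp
  qed
  \<comment> \<open>An \<open>e/3\<close> argument: \<open>t k\<close> is close to \<open>z\<close>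
    in norm, and for the fixed \<open>t k\<close> convergence is known.\<close>
  show ?thesis unfolding 1 2
  proof (rule LIMSEQ_I)
   fix e :: real assume e: "e > 0"
   have "(%k. sqrt C * sqrt (\<integral>x. (t k x - z x)^2 \<partial>M)) -->> 0"
    using tendsto_mult[OF tendsto_const[of "sqrt C"] tendsto_real_sqrt[OF t(2)]] by simp
   hence "\<forall>\<^sub>F k in sequentially. sqrt C * sqrt (\<integral>x. (t k x - z x)^2 \<partial>M) < e/3"
    using e by (intro order_tendstoD(2)[where y = 0]) auto
   moreover have "\<forall>\<^sub>F k in sequentially. \<bar>(\<integral>x. t k x * g x \<partial>M) - (\<integral>x. z x * g x \<partial>M)\<bar> < e/3"
    using tendstoD[OF sq_int_tendsto_inner[OF S_sq[OF t(1)] z(1) g(1) t(2)], of "e/3"] e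
    by (simp add: dist_real_def)
   ultimately have "\<forall>\<^sub>F k in sequentially. sqrt C * sqrt (\<integral>x. (t k x - z x)^2 \<partial>M) < e/3 & \<bar>(\<integral>x. t k x * g x \<partial>M) - (\<integral>x. z x * g x \<partial>M)\<bar> < e/3"
    by eventually_elim auto
   then obtain k where k: "sqrt C * sqrt (\<integral>x. (t k x - z x)^2 \<partial>M) < e/3"
    "\<bar>(\<integral>x. t k x * g x \<partial>M) - (\<integral>x. z x * g x \<partial>M)\<bar> < e/3"
    by (auto simp: eventually_sequentially)
   have "\<forall>\<^sub>F n in sequentially. \<bar>(\<integral>x. f (r n) x * t k x \<partial>M) - (\<integral>x. g x * t k x \<partial>M)\<bar> < e/3"
    using tendstoD[OF L[OF t(1)[of k]], of "e/3"] g(2)[OF t(1)[of k]] e by (simp add: dist_real_def)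
   then obtain N where N: "!!n. n >= N ==> \<bar>(\<integral>x. f (r n) x * t k x \<partial>M) - (\<integral>x. g x * t k x \<partial>M)\<bar> < e/3"
    by (auto simp: eventually_sequentially)
   show "\<exists>no. \<forall>n\<ge>no. norm ((\<integral>x. f (r n) x * z x \<partial>M) - (\<integral>x. g x * z x \<partial>M)) < e"
   proof (intro exI allI impI)
    fix n assume n: "n >= N"
    have "(\<integral>x. f (r n) x * (t k x - z x) \<partial>M) = (\<integral>x. f (r n) x * t k x \<partial>M) - (\<integral>x. f (r n) x * z x \<partial>M)"
     using integral_add_cmult_right[OF S_sq[OF t(1)[of k]] z(1) f[of "r n"], of "-1"] by (simp add: mult.commute)
    hence "\<bar>(\<integral>x. f (r n) x * t k x \<partial>M) - (\<integral>x. f (r n) x * z x \<partial>M)\<bar> < e/3"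
     using bdi[OF sq_int_diff[OF S_sq[OF t(1)[of k]] z(1)], of "r n"] k(1) by simp
    thus "norm ((\<integral>x. f (r n) x * z x \<partial>M) - (\<integral>x. g x * z x \<partial>M)) < e"
     using N[OF n] k(2) unfolding mult.commute[of "g _"] real_norm_def by linarith
   qed
  qed
 qed
 thus ?thesis using r g(1) by blast
qed

section \<open>Calculus of test functions\<close>

lemma pd_eq:
 fixes ph :: "real^'n::finite => real"
 assumes "(ph has_derivative D) (at x)"
 shows "pd i ph x = D (axis i 1)"
proof -
 interpret D: bounded_linear D using assms by (rule has_derivative_bounded_linear)
 have "((%t::real. x + t *\<^sub>R axis i 1) has_derivative (%t. t *\<^sub>R axis i 1)) (at 0)"
  by (auto intro!: derivative_eq_intros)
 from has_derivative_compose[OF this, of ph D] assms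
 have "((%t::real. ph (x + t *\<^sub>R axis i 1)) has_derivative (%t. D (t *\<^sub>R axis i 1))) (at 0)" by simp
 moreover have "(%t. D (t *\<^sub>R axis i 1)) = (*) (D (axis i 1))" by (auto simp: D.scaleR)
 ultimately show ?thesis
  unfolding pd_def by (intro DERIV_imp_deriv) (simp add: has_field_derivative_def)
qed

lemma has_derivative_pd:
 fixes ph :: "real^'n::finite => real"
 assumes "ph differentiable (at x)"
 shows "(ph has_derivative (%h. \<Sum>i\<in>UNIV. pd i ph x * h $ i)) (at x)"
proof -
 obtain D where D: "(ph has_derivative D) (at x)" using assms by (auto simp: differentiable_def)
 interpret D: bounded_linear D using D by (rule has_derivative_bounded_linear)
 have "D h = (\<Sum>i\<in>UNIV. pd i ph x * h $ i)" for h
 proof -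
  have "h = (\<Sum>i\<in>UNIV. h $ i *\<^sub>R axis i 1)"
   using basis_expansion[of h] by (simp add: scalar_mult_eq_scaleR)
  hence "D h = D (\<Sum>i\<in>UNIV. h $ i *\<^sub>R axis i 1)" by simp
  also have "\<dots> = (\<Sum>i\<in>UNIV. h $ i * D (axis i 1))" by (simp add: D.sum D.scaleR)
  finally show ?thesis by (simp add: pd_eq[OF D] mult.commute)
 qed
 hence "D = (%h. \<Sum>i\<in>UNIV. pd i ph x * h $ i)" by auto
 thus ?thesis using D by simp
qed

lemma Ck_SucD: "Ck (Suc k) ph ==> Ck k ph"
proof (induction k arbitrary: ph)
 case 0
 thus ?case by (auto intro: differentiable_imp_continuous_on)
next
 case (Suc k)
 thus ?case by (metis Ck.simps(2))
qed

lemma differentiable_on_UNIV: "ph differentiable_on UNIV ==> ph differentiable (at x)"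
 by (simp add: differentiable_on_def)

lemmas has_derivative_pd_on = has_derivative_pd[OF differentiable_on_UNIV]

lemma pd_add:
 assumes "f differentiable_on UNIV" "g differentiable_on UNIV"
 shows "pd i (%x. f x + g x) = (%x. pd i f x + pd i g x)"
proof
 fix x
 show "pd i (%x. f x + g x) x = pd i f x + pd i g x"
  by (subst pd_eq[OF has_derivative_add[OF has_derivative_pd_on[OF assms(1)] has_derivative_pd_on[OF assms(2)]]])
   (simp add: axis_def if_distrib cong: if_cong)
qed

lemma pd_mult:
 assumes "f differentiable_on UNIV" "g differentiable_on UNIV"
 shows "pd i (%x. f x * g x) = (%x. f x * pd i g x + pd i f x * g x)"
proof
 fix x
 show "pd i (%x. f x * g x) x = f x * pd i g x + pd i f x * g x"
  by (subst pd_eq[OF has_derivative_mult[OF has_derivative_pd_on[OF assms(1)] has_derivative_pd_on[OF assms(2)]]])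
   (simp add: axis_def if_distrib cong: if_cong)
qed

lemma pd_const: "pd i (%x. c) = (%x. 0)"
 by (rule ext, subst pd_eq[OF has_derivative_const]) simp

lemma pd_cmult:
 assumes "f differentiable_on UNIV"
 shows "pd i (%x. c * f x) = (%x. c * pd i f x)"
 using pd_mult[of "%x. c" f i] assms by (simp add: pd_const)

lemma pd_compose:
 assumes "si differentiable_on UNIV" "!!s. (h has_real_derivative h' s) (at s)"
 shows "pd i (%x. h (si x)) = (%x. h' (si x) * pd i si x)" "(%x. h (si x)) differentiable_on UNIV"
proof -
 have "((%x. h (si x)) has_derivative (%d. h' (si x) * (\<Sum>i\<in>UNIV. pd i si x * d $ i))) (at x)" for x
  using has_derivative_compose[OF has_derivative_pd_on[OF assms(1)], of h "(*) (h' (si x))" x] assms(2)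
  by (simp add: has_field_derivative_def)
 note * = this
 show "pd i (%x. h (si x)) = (%x. h' (si x) * pd i si x)"
  by (rule ext, subst pd_eq[OF *]) (simp add: axis_def if_distrib cong: if_cong)
 show "(%x. h (si x)) differentiable_on UNIV"
  using * by (auto simp: differentiable_on_def differentiable_def)
qed

lemma pd_affine:
 fixes f :: "real^'n::finite => real"
 assumes "f differentiable_on UNIV"
 shows "pd i (%x. f (b + c *\<^sub>R x)) = (%x. c * pd i f (b + c *\<^sub>R x))" "(%x. f (b + c *\<^sub>R x)) differentiable_on UNIV"
proof -
 have "((%x. b + c *\<^sub>R x) has_derivative (%d. c *\<^sub>R d)) (at x)" for x :: "real^'n"
  by (auto intro!: derivative_eq_intros)
 from has_derivative_compose[OF this has_derivative_pd_on[OF assms]]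
 have *: "((%x. f (b + c *\<^sub>R x)) has_derivative (%d. \<Sum>i\<in>UNIV. pd i f (b + c *\<^sub>R x) * (c *\<^sub>R d) $ i)) (at x)" for x
  by simp
 show "pd i (%x. f (b + c *\<^sub>R x)) = (%x. c * pd i f (b + c *\<^sub>R x))"
  by (rule ext, subst pd_eq[OF *]) (simp add: axis_def if_distrib cong: if_cong)
 show "(%x. f (b + c *\<^sub>R x)) differentiable_on UNIV"
  using * by (auto simp: differentiable_on_def differentiable_def)
qed

lemma Ck_const: "Ck k (%x. c)"
 by (induction k arbitrary: c) (auto simp: pd_const)

lemma Ck_add: "Ck k f ==> Ck k g ==> Ck k (%x. f x + g x)"
 by (induction k arbitrary: f g) (auto intro!: continuous_intros derivative_intros simp: pd_add)

lemma Ck_mult: "Ck k f ==> Ck k g ==> Ck k (%x. f x * g x)"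
proof (induction k arbitrary: f g)
 case 0
 thus ?case by (auto intro!: continuous_intros)
next
 case (Suc k)
 have "Ck k (pd i (%x. f x * g x))" for i
  using Suc.prems Ck_SucD[OF Suc.prems(1)] Ck_SucD[OF Suc.prems(2)] by (subst pd_mult) (auto intro!: Ck_add Suc.IH)
 thus ?case using Suc.prems by (auto intro!: derivative_intros)
qed

lemma Ck_affine: "Ck k f ==> Ck k (%x. f (b + c *\<^sub>R x))"
proof (induction k arbitrary: f)
 case 0
 thus ?case by (auto intro!: continuous_on_compose2[of UNIV f] continuous_intros)
next
 case (Suc k)
 thus ?case by (auto simp: pd_affine intro!: Ck_mult Ck_const)
qed

definition smooth :: "(real^'n::finite => real) => bool" where
 "smooth ph \<longleftrightarrow> (\<forall>k. Ck k ph)"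

lemma smooth_differentiable: "smooth ph ==> ph differentiable_on UNIV"
 using Ck.simps(2)[of 0 ph] by (auto simp: smooth_def)

lemma smooth_continuous: "smooth ph ==> continuous_on UNIV ph"
 by (metis smooth_def Ck.simps(1))

lemma smooth_pd: "smooth ph ==> smooth (pd i ph)"
 by (metis smooth_def Ck.simps(2))

lemma smooth_const: "smooth (%x. c)" by (simp add: smooth_def Ck_const)
lemma smooth_add: "smooth f ==> smooth g ==> smooth (%x. f x + g x)" by (simp add: smooth_def Ck_add)
lemma smooth_mult: "smooth f ==> smooth g ==> smooth (%x. f x * g x)" by (simp add: smooth_def Ck_mult)
lemma smooth_affine: "smooth f ==> smooth (%x. f (b + c *\<^sub>R x))" by (simp add: smooth_def Ck_affine)
lemma smooth_diff: "smooth f ==> smooth g ==> smooth (%x. f x - g x)"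
 using smooth_add[OF _ smooth_mult[OF smooth_const[of "-1"]], of f g] by simp

lemma smooth_power: "smooth f ==> smooth (%x. f x ^ j)"
 by (induction j) (auto intro: smooth_const smooth_mult)

lemma smooth_sum: "(!!i. i \<in> A ==> smooth (f i)) ==> smooth (%x. \<Sum>i\<in>A. f i x)"
 by (induction A rule: infinite_finite_induct) (auto intro: smooth_const smooth_add)

lemma smooth_prod: "(!!i. i \<in> A ==> smooth (f i)) ==> smooth (%x. \<Prod>i\<in>A. f i x)"
 by (induction A rule: infinite_finite_induct) (auto intro: smooth_const smooth_mult)

lemma pd_coord: "pd i (%x::real^'n::finite. x $ j) = (%x. if i = j then 1 else 0)"
proof
 fix x :: "real^'n"
 have "((%x::real^'n. x $ j) has_derivative (%x. x $ j)) (at x)"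
  by (intro bounded_linear_imp_has_derivative bounded_linear_vec_nth)
 from pd_eq[OF this] show "pd i (%x. x $ j) x = (if i = j then 1 else 0)" by (simp add: axis_def)
qed

lemma smooth_coord: "smooth (%x::real^'n::finite. x $ j)"
 unfolding smooth_def
proof
 fix k
 show "Ck k (%x::real^'n. x $ j)"
 proof (cases k)
  case (Suc k')
  have "(%x::real^'n. x $ j) differentiable_on UNIV"
   by (intro bounded_linear_imp_differentiable_on bounded_linear_vec_nth)
  thus ?thesis using Suc by (simp add: pd_coord Ck_const)
 qed (auto intro!: continuous_intros)
qed

text \<open>The factor \<open>1 / s ^ m\<close> makes the family closed under differentiation, up to
  linear combinations, so smoothness follows by induction over the order for all \<open>m\<close> at
  once.\<close>

definition flat :: "nat => real => real" where
 "flat m s = (if s <= 0 then 0 else exp (- 1 / s) / s ^ m)"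

lemma flat_tendsto_0: "((%s. exp (- 1 / s) / s ^ m) \<longlongrightarrow> (0::real)) (at_right 0)"
proof -
 have "((%y::real. y ^ m / exp y) \<longlongrightarrow> 0) at_top" by (rule tendsto_power_div_exp_0)
 hence "((%s::real. inverse s ^ m / exp (inverse s)) \<longlongrightarrow> 0) (at_right 0)"
  using filterlim_compose filterlim_inverse_at_top_right by blast
 moreover have "inverse s ^ m / exp (inverse s) = exp (- 1 / s) / s ^ m" for s :: real
  by (simp add: exp_minus field_simps power_divide inverse_eq_divide)
 ultimately show ?thesis by simp
qed

lemma flat_has_derivative:
 "(flat m has_real_derivative flat (m + 2) s - real m * flat (m + 1) s) (at s)"
proof -
 consider "s > 0" | "s < 0" | "s = 0" by linarith
 thus ?thesis
 proof cases
  case 1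
  have "((%s. exp (- 1 / s) / s ^ m) has_real_derivative flat (m + 2) s - real m * flat (m + 1) s) (at s)"
   using 1
   by (cases m) (auto intro!: derivative_eq_intros simp: flat_def field_simps power2_eq_square, metis One_nat_def power_eq_if)
  moreover have "\<forall>\<^sub>F x in nhds s. exp (- 1 / x) / x ^ m = flat m x"
   using eventually_nhds_in_open[of "{0<..}" s] 1 by (auto elim!: eventually_mono simp: flat_def)
  ultimately show ?thesis by (subst (asm) DERIV_cong_ev[OF refl _ refl]) auto
 next
  case 2
  have "((%s. 0) has_real_derivative flat (m + 2) s - real m * flat (m + 1) s) (at s)"
   using 2 by (auto simp: flat_def)
  moreover have "\<forall>\<^sub>F x in nhds s. 0 = flat m x"
   using eventually_nhds_in_open[of "{..<0}" s] 2 by (auto elim!: eventually_mono simp: flat_def)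
  ultimately show ?thesis by (subst (asm) DERIV_cong_ev[OF refl _ refl]) auto
 next
  case 3
  have "((%y. (flat m y - flat m 0) / (y - 0)) \<longlongrightarrow> 0) (at 0)"
  proof (rule filterlim_split_at)
   show "((%y. (flat m y - flat m 0) / (y - 0)) \<longlongrightarrow> 0) (at_left 0)"
    by (rule tendsto_eventually) (auto simp: flat_def eventually_at_filter)
   show "((%y. (flat m y - flat m 0) / (y - 0)) \<longlongrightarrow> 0) (at_right 0)"
    by (rule Lim_transform_eventually[OF flat_tendsto_0[of "Suc m"]])
     (auto simp: flat_def eventually_at_filter)
  qed
  hence "(flat m has_real_derivative 0) (at 0)" by (simp add: has_field_derivative_iff)
  thus ?thesis using 3 by (simp add: flat_def)
 qed
qed

lemma smooth_flat_compose:
 assumes "smooth si" shows "smooth (%x. flat m (si x))"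
proof -
 have "Ck k (%x. flat m (si x))" for k
 proof (induction k arbitrary: m)
  case 0
  have "continuous_on UNIV (flat m)"
   using flat_has_derivative DERIV_isCont continuous_at_imp_continuous_on by blast
  thus ?case using smooth_continuous[OF assms] by (auto intro: continuous_on_compose2)
 next
  case (Suc k)
  note d = smooth_differentiable[OF assms]
  have "pd i (%x. flat m (si x)) = (%x. (flat (m + 2) (si x) + (- real m) * flat (m + 1) (si x)) * pd i si x)" for i
   using pd_compose(1)[OF d flat_has_derivative] by simp
  moreover have "Ck k (%x. (flat (m + 2) (si x) + (- real m) * flat (m + 1) (si x)) * pd i si x)" for i
   using smooth_pd[OF assms, of i] by (intro Ck_mult Ck_add Ck_const Suc) (auto simp: smooth_def)
  ultimately show ?case using pd_compose(2)[OF d flat_has_derivative] by simp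
 qed
 thus ?thesis by (simp add: smooth_def)
qed

lemma flat_nonneg: "0 <= flat m s" by (simp add: flat_def)
lemma flat_pos_iff: "0 < flat m s \<longleftrightarrow> 0 < s" by (simp add: flat_def)
lemma flat_0_less_1: "flat 0 s < 1" by (simp add: flat_def)

section \<open>Test functions: closure properties and uniform bounds\<close>

lemma test_fun_iff: "test_fun ph \<longleftrightarrow> smooth ph & bounded {x. ph x \<noteq> 0}"
 by (simp add: test_fun_def smooth_def)

lemma test_fun_smooth: "test_fun ph ==> smooth ph" by (simp add: test_fun_iff)
lemma test_fun_continuous: "test_fun ph ==> continuous_on UNIV ph" by (simp add: test_fun_iff smooth_continuous)
lemma test_fun_differentiable: "test_fun ph ==> ph differentiable_on UNIV" by (simp add: test_fun_iff smooth_differentiable)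
lemma test_fun_measurable [measurable_dest]: "test_fun ph ==> ph \<in> bmeas"
 by (intro borel_measurable_continuous_onI test_fun_continuous)

lemma test_fun_support: "test_fun ph ==> \<exists>R>0. \<forall>x. norm x > R --> ph x = 0"
proof -
 assume "test_fun ph"
 then obtain R where "\<forall>x\<in>{x. ph x \<noteq> 0}. norm x <= R" by (auto simp: test_fun_def bounded_iff)
 hence "\<forall>x. norm x > \<bar>R\<bar> + 1 --> ph x = 0" by force
 thus ?thesis by (intro exI[of _ "\<bar>R\<bar> + 1"]) auto
qed

lemma bounded_supportI:
 assumes "\<forall>x. norm x > R --> ph x = 0" shows "bounded {x. ph x \<noteq> (0::real)}"
 using assms by (intro boundedI[of _ R]) (auto simp: not_less[symmetric])

lemma pd_zero_outside:
 assumes "\<forall>x. norm x > R --> ph x = 0" "norm (x::real^'n::finite) > R"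
 shows "pd i ph x = 0"
proof -
 have "open {x::real^'n. norm x > R}" by (intro open_Collect_less continuous_intros)
 hence "(ph has_derivative (%h. 0)) (at x)"
  by (rule has_derivative_transform_within_open[where f = "%x. 0" and s = "{x. norm x > R}", rotated]) (use assms in auto)
 thus ?thesis by (subst pd_eq) auto
qed

lemma test_fun_pd: "test_fun ph ==> test_fun (pd i ph)"
proof -
 assume ph: "test_fun ph"
 obtain R where "\<forall>x. norm x > R --> ph x = 0" using test_fun_support[OF ph] by blast
 hence "\<forall>x. norm x > R --> pd i ph x = 0" using pd_zero_outside by blast
 thus ?thesis using ph by (auto simp: test_fun_iff smooth_pd intro: bounded_supportI)
qed

lemma test_fun_mult: "test_fun f ==> smooth g ==> test_fun (%x. f x * g x)"
 unfolding test_fun_iff by (auto intro: smooth_mult bounded_subset[of "{x. f x \<noteq> 0}"])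

lemma test_fun_add: "test_fun f ==> test_fun g ==> test_fun (%x. f x + g x)"
 unfolding test_fun_iff
 by (auto intro!: smooth_add intro: bounded_subset[of "{x. f x \<noteq> 0} \<union> {x. g x \<noteq> 0}"])

lemma test_fun_cmult: "test_fun f ==> test_fun (%x. c * f x)"
 using test_fun_mult[OF _ smooth_const, of f c] by (simp add: mult.commute)

lemma test_fun_diff: "test_fun f ==> test_fun g ==> test_fun (%x. f x - g x)"
 using test_fun_add[OF _ test_fun_cmult[of g "-1"], of f] by simp

lemma test_fun_zero: "test_fun (%x. 0)" by (simp add: test_fun_iff smooth_const)

lemma test_fun_sum: "(!!i. i \<in> A ==> test_fun (f i)) ==> test_fun (%x. \<Sum>i\<in>A. f i x)"
 by (induction A rule: infinite_finite_induct) (auto intro: test_fun_zero test_fun_add)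

lemma test_fun_lap: "test_fun f ==> test_fun (lap f)"
 unfolding lap_def by (intro test_fun_sum test_fun_pd)

lemma test_fun_affine:
 assumes "test_fun f" "c \<noteq> 0"
 shows "test_fun (%x. f (b + c *\<^sub>R x))"
proof -
 obtain R where R: "\<forall>x. norm x > R --> f x = 0" using test_fun_support[OF assms(1)] by blast
 have "f (b + c *\<^sub>R x) = 0" if "norm x > (R + norm b) / \<bar>c\<bar>" for x
 proof -
  have "norm (c *\<^sub>R x) > R + norm b" using that assms(2) by (simp add: field_simps)
  moreover have "norm (c *\<^sub>R x) <= norm (b + c *\<^sub>R x) + norm b"
   by (metis add.commute add_diff_cancel_left' norm_triangle_sub norm_minus_commute norm_triangle_ineq4)
  ultimately show ?thesis using R by auto
 qed
 thus ?thesis using assms by (auto simp: test_fun_iff intro!: smooth_affine bounded_supportI[of "(R + norm b) / \<bar>c\<bar>"])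
qed

lemma lap_affine:
 assumes "smooth f"
 shows "lap (%x. f (b + c *\<^sub>R x)) = (%x. c\<^sup>2 * lap f (b + c *\<^sub>R x))"
proof -
 have "pd i (pd i (%x. f (b + c *\<^sub>R x))) = (%x. c\<^sup>2 * pd i (pd i f) (b + c *\<^sub>R x))" for i
  using assms by (simp add: pd_affine pd_cmult smooth_differentiable smooth_pd power2_eq_square mult.assoc)
 thus ?thesis by (simp add: lap_def sum_distrib_left fun_eq_iff)
qed

lemma test_fun_integrable:
 assumes "test_fun ph" shows "Lint ph"
proof -
 obtain R where R: "\<forall>x. norm x > R --> ph x = 0" using test_fun_support[OF assms] by blast
 have "Lint (%x. indicator (cball 0 R) x *\<^sub>R ph x)"
  using test_fun_continuous[OF assms] by (intro borel_integrable_compact) (auto intro: continuous_on_subset)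
 moreover have "(%x. indicator (cball 0 R) x *\<^sub>R ph x) = ph"
  using R by (auto simp: fun_eq_iff indicator_def not_le)
 ultimately show ?thesis by simp
qed

lemma test_fun_sq_int: "test_fun ph ==> sq_int lborel ph"
 using test_fun_integrable[OF test_fun_mult[OF _ test_fun_smooth, of ph ph]]
 by (auto simp: sq_int_def power2_eq_square)

lemma test_fun_bounded:
 assumes "test_fun ph" shows "\<exists>B>0. \<forall>x. \<bar>ph x\<bar> <= B"
proof -
 obtain R where R: "\<forall>x. norm x > R --> ph x = 0" using test_fun_support[OF assms] by blast
 have "compact (ph ` cball 0 R)"
  using test_fun_continuous[OF assms] by (intro compact_continuous_image) (auto intro: continuous_on_subset)
 then obtain B where B: "\<forall>y\<in>ph ` cball 0 R. \<bar>y\<bar> <= B" by (auto dest!: compact_imp_bounded simp: bounded_iff)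
 have "\<bar>ph x\<bar> <= \<bar>B\<bar> + 1" for x
 proof (cases "norm x > R")
  case False
  hence "ph x \<in> ph ` cball 0 R" by auto
  hence "\<bar>ph x\<bar> <= B" using B by blast
  thus ?thesis by linarith
 qed (use R in auto)
 thus ?thesis by (intro exI[of _ "\<bar>B\<bar> + 1"]) auto
qed

lemma test_fun_Lipschitz:
 assumes "test_fun (ph :: real^'n::finite => real)" shows "\<exists>B>0. \<forall>x y. \<bar>ph x - ph y\<bar> <= B * norm (x - y)"
proof -
 have "\<exists>B>0. \<forall>x. \<bar>pd i ph x\<bar> <= B" for i by (intro test_fun_bounded test_fun_pd assms)
 then obtain B where B: "!!i. B i > 0" "!!i x. \<bar>pd i ph x\<bar> <= B i" by metis
 have "norm (ph x - ph y) <= (\<Sum>i\<in>UNIV. B i) * norm (x - y)" for x y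
 proof (rule differentiable_bound[of UNIV ph "%x h. \<Sum>i\<in>UNIV. pd i ph x * h $ i"])
  fix x
  show "onorm (%h. \<Sum>i\<in>UNIV. pd i ph x * h $ i) <= sum B UNIV"
  proof (rule onorm_le)
   fix h :: "real^'n"
   have "norm (\<Sum>i\<in>UNIV. pd i ph x * h $ i) <= (\<Sum>i\<in>UNIV. \<bar>pd i ph x * h $ i\<bar>)" by (simp add: sum_abs)
   also have "\<dots> <= (\<Sum>i\<in>UNIV. B i * norm h)"
    unfolding abs_mult using B less_imp_le component_le_norm_cart by (intro sum_mono mult_mono) (auto simp: less_imp_le)
   finally show "norm (\<Sum>i\<in>UNIV. pd i ph x * h $ i) <= sum B UNIV * norm h" by (simp add: sum_distrib_right)
  qed
 qed (use assms in \<open>auto intro!: has_derivative_pd_on test_fun_differentiable\<close>)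
 moreover have "(\<Sum>i\<in>UNIV. B i) > 0" by (intro sum_pos B) auto
 ultimately show ?thesis by auto
qed

section \<open>Affine substitution, integration by parts and energy identities for test
  functions\<close>

lemma nn_integral_lborel_affine:
 fixes f :: "'a::euclidean_space => ennreal"
 assumes [measurable]: "f \<in> bmeas" and c: "c \<noteq> 0"
 shows "(\<integral>\<^sup>+x. f x \<partial>lborel) = ennreal (\<bar>c\<bar> ^ DIM('a)) * (\<integral>\<^sup>+x. f (t + c *\<^sub>R x) \<partial>lborel)"
 by (subst lborel_affine[OF c, of t]) (simp add: nn_integral_density nn_integral_distr nn_integral_cmult)

lemma integrable_lborel_affine:
 fixes f :: "'a::euclidean_space => real"
 assumes f: "Lint f" and c: "c \<noteq> 0"
 shows "Lint (%x. f (t + c *\<^sub>R x))"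
proof -
 have [measurable]: "f \<in> bmeas" using borel_measurable_integrable[OF f] by simp
 have "(\<integral>\<^sup>+x. norm (f x) \<partial>lborel) < \<infinity>" using f by (simp add: integrable_iff_bounded)
 moreover have "(\<integral>\<^sup>+x. norm (f x) \<partial>lborel) = ennreal (\<bar>c\<bar> ^ DIM('a)) * (\<integral>\<^sup>+x. norm (f (t + c *\<^sub>R x)) \<partial>lborel)"
  by (rule nn_integral_lborel_affine[OF _ c]) auto
 ultimately show ?thesis using c by (auto simp: integrable_iff_bounded ennreal_mult_less_top)
qed

lemma integral_lborel_affine:
 fixes f :: "'a::euclidean_space => real"
 assumes [measurable]: "f \<in> bmeas" and c: "c \<noteq> 0"
 shows "LI (%x. f x) = \<bar>c\<bar> ^ DIM('a) * LI (%x. f (t + c *\<^sub>R x))"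
 by (subst lborel_affine[OF c, of t]) (simp add: integral_density integral_distr)

lemma integral_lborel_translate:
 fixes f :: "'a::euclidean_space => real"
 assumes "f \<in> bmeas" shows "LI (%x. f (x + t)) = LI (%x. f x)"
 using integral_lborel_affine[OF assms, of 1 t] by (simp add: add.commute)

lemma integrable_lborel_translate:
 fixes f :: "'a::euclidean_space => real"
 assumes "Lint f" shows "Lint (%x. f (x + t))"
 using integrable_lborel_affine[OF assms, of 1 t] by (simp add: add.commute)

lemma difference_quotient_tendsto:
 assumes "ph differentiable_on UNIV"
 shows "(%n. (ph (x + (1 / real (Suc n)) *\<^sub>R axis i 1) - ph x) * real (Suc n)) -->> pd i ph x"
proof -
 have "((%t::real. x + t *\<^sub>R axis i 1) has_derivative (%t. t *\<^sub>R axis i 1)) (at 0)"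
  by (auto intro!: derivative_eq_intros)
 hence "((%t::real. ph (x + t *\<^sub>R axis i 1)) has_derivative (%t. \<Sum>j\<in>UNIV. pd j ph x * (t *\<^sub>R axis i 1) $ j)) (at 0)"
  by (rule has_derivative_compose) (use has_derivative_pd_on[OF assms, of x] in simp)
 moreover have "(%t. \<Sum>j\<in>UNIV. pd j ph x * (t *\<^sub>R axis i 1) $ j) = (*) (pd i ph x)"
  by (auto simp: axis_def if_distrib cong: if_cong)
 ultimately have "((%t::real. ph (x + t *\<^sub>R axis i 1)) has_real_derivative pd i ph x) (at 0)"
  by (simp add: has_field_derivative_def)
 hence "((%t::real. (ph (x + t *\<^sub>R axis i 1) - ph x) / t) \<longlongrightarrow> pd i ph x) (at 0)"
  by (simp add: has_field_derivative_iff)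
 moreover have "filterlim (%n. 1 / real (Suc n)) (at 0) sequentially"
  unfolding filterlim_at using LIMSEQ_Suc[OF lim_1_over_n] by auto
 ultimately have "(%n. (ph (x + (1 / real (Suc n)) *\<^sub>R axis i 1) - ph x) / (1 / real (Suc n))) -->> pd i ph x"
  by (rule filterlim_compose)
 thus ?thesis by simp
qed

text \<open>Dominated convergence: the shifts have length at most 1, so the quotients live on the
  ball of radius \<open>R + 1\<close> and are bounded there by the Lipschitz constant.\<close>

lemma integral_difference_quotient:
 fixes ph et :: "real^'n::finite => real"
 assumes ph: "test_fun ph" and et: "smooth et"
 shows "(%n. LI (%x. (ph (x + (1 / real (Suc n)) *\<^sub>R axis i 1) - ph x) * real (Suc n) * et x))
  -->> LI (%x. pd i ph x * et x)"
proof -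
 obtain R where R: "\<forall>x. norm x > R --> ph x = 0" using test_fun_support[OF ph] by blast
 obtain B where B: "B > 0" "!!x y. \<bar>ph x - ph y\<bar> <= B * norm (x - y)" using test_fun_Lipschitz[OF ph] by blast
 note [measurable] = test_fun_measurable[OF ph] test_fun_measurable[OF test_fun_pd[OF ph]]
 have [measurable]: "et \<in> bmeas" by (intro borel_measurable_continuous_onI smooth_continuous et)
 have int: "Lint (%x. indicator (cball 0 (R + 1)) x *\<^sub>R (B * \<bar>et x\<bar>))"
  by (intro borel_integrable_compact) (auto intro!: continuous_intros continuous_on_subset[OF smooth_continuous[OF et]])
 show ?thesis
 proof (rule integral_dominated_convergence[OF _ _ int])
  show "AE x in lborel. (%n. (ph (x + (1 / real (Suc n)) *\<^sub>R axis i 1) - ph x) * real (Suc n) * et x) -->> pd i ph x * et x"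
   by (intro always_eventually allI tendsto_intros difference_quotient_tendsto test_fun_differentiable ph)
  fix n
  have "\<bar>(ph (x + (1 / real (Suc n)) *\<^sub>R axis i 1) - ph x) * real (Suc n) * et x\<bar> <= indicator (cball 0 (R + 1)) x * (B * \<bar>et x\<bar>)" for x
  proof (cases "norm x <= R + 1")
   case True
   have "\<bar>ph (x + (1 / real (Suc n)) *\<^sub>R axis i 1) - ph x\<bar> <= B * norm ((1 / real (Suc n)) *\<^sub>R (axis i 1 :: real^'n))"
    using B(2)[of "x + (1 / real (Suc n)) *\<^sub>R axis i 1" x] by simp
   also have "\<dots> = B / real (Suc n)" by simp
   finally have "\<bar>ph (x + (1 / real (Suc n)) *\<^sub>R axis i 1) - ph x\<bar> * real (Suc n) <= B" by (simp add: field_simps)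
   hence "\<bar>ph (x + (1 / real (Suc n)) *\<^sub>R axis i 1) - ph x\<bar> * real (Suc n) * \<bar>et x\<bar> <= B * \<bar>et x\<bar>"
    by (rule mult_right_mono) simp
   thus ?thesis using True by (simp add: abs_mult)
  next
   case False
   have "norm x <= norm (x + (1 / real (Suc n)) *\<^sub>R axis i 1) + norm ((1 / real (Suc n)) *\<^sub>R (axis i 1 :: real^'n))"
    by (metis add_diff_cancel_right' norm_triangle_ineq4)
   also have "norm ((1 / real (Suc n)) *\<^sub>R (axis i 1 :: real^'n)) <= 1" by simp
   finally have "ph (x + (1 / real (Suc n)) *\<^sub>R axis i 1) = 0" using R False by auto
   thus ?thesis using R False by auto
  qed
  thus "AE x in lborel. norm ((ph (x + (1 / real (Suc n)) *\<^sub>R axis i 1) - ph x) * real (Suc n) * et x)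
     <= indicator (cball 0 (R + 1)) x *\<^sub>R (B * \<bar>et x\<bar>)" by (intro always_eventually) auto
 qed auto
qed

text \<open>By translation invariance each difference quotient already has integral zero.\<close>

lemma integral_pd_eq_0:
 assumes ph: "test_fun ph" shows "LI (%x. pd i ph x) = 0"
proof (rule LIMSEQ_unique)
 show "(%n. LI (%x. (ph (x + (1 / real (Suc n)) *\<^sub>R axis i 1) - ph x) * real (Suc n) * 1)) -->> LI (%x. pd i ph x)"
  using integral_difference_quotient[OF ph smooth_const[of 1]] by simp
 note [measurable] = test_fun_measurable[OF ph]
 have "LI (%x. (ph (x + (1 / real (Suc n)) *\<^sub>R axis i 1) - ph x) * real (Suc n) * 1) = 0" for n
  using test_fun_integrable[OF ph] by (simp add: integrable_lborel_translate integral_lborel_translate)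
 thus "(%n. LI (%x. (ph (x + (1 / real (Suc n)) *\<^sub>R axis i 1) - ph x) * real (Suc n) * 1)) -->> 0" by simp
qed

lemma integration_by_parts:
 assumes ph: "test_fun ph" and ps: "smooth ps"
 shows "LI (%x. pd i ph x * ps x) = - LI (%x. ph x * pd i ps x)"
proof -
 have "LI (%x. pd i (%x. ph x * ps x) x) = 0"
  by (intro integral_pd_eq_0 test_fun_mult assms)
 moreover have "pd i (%x. ph x * ps x) = (%x. ph x * pd i ps x + pd i ph x * ps x)"
  by (intro pd_mult test_fun_differentiable smooth_differentiable assms)
 moreover have "Lint (%x. ph x * pd i ps x)" "Lint (%x. pd i ph x * ps x)"
  by (intro test_fun_integrable test_fun_mult smooth_pd test_fun_pd assms)+
 ultimately show ?thesis by simp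
qed

lemma AE_zero_continuous:
 assumes "continuous_on UNIV (d :: 'a::euclidean_space => real)" "AE x in lborel. d x = 0"
 shows "d x = 0"
proof -
 have o: "open {x. d x \<noteq> 0}" using assms(1) by (intro open_Collect_neq continuous_intros) auto
 have "{x. d x \<noteq> 0} \<in> null_sets lborel"
  using assms(2) AE_iff_null[of lborel "%x. d x = 0"] o by simp
 hence "negligible {x. d x \<noteq> 0}" by (simp add: negligible_iff_null_sets null_sets_completionI)
 hence "{x. d x \<noteq> 0} = {}" using open_not_negligible[OF o] by blast
 thus ?thesis by blast
qed

text \<open>The difference \<open>d\<close> of the two mixed derivatives is orthogonal to itself:
  one differentiation is moved by parts, the other is replaced by a difference quotient in direction
  \<open>j\<close>, which commutes with \<open>pd i\<close>. A continuous function with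
  \<open>d\<twosuperior>\<close> of integral zero vanishes.\<close>

lemma pd_commute:
 assumes ph: "test_fun ph"
 shows "pd i (pd j ph) = pd j (pd i ph)"
proof -
 define d where "d x = pd i (pd j ph) x - pd j (pd i ph) x" for x
 have d: "test_fun d" unfolding d_def by (intro test_fun_diff test_fun_pd ph)
 note [measurable] = test_fun_measurable[OF ph] test_fun_measurable[OF d] test_fun_measurable[OF test_fun_pd[OF ph]] test_fun_measurable[OF test_fun_pd[OF d]]
 have 1: "LI (%x. pd i (pd j ph) x * d x) = - LI (%x. pd j ph x * pd i d x)"
  by (intro integration_by_parts test_fun_pd test_fun_smooth ph d)
 have 2: "LI (%x. pd j ph x * pd i d x) = - LI (%x. pd j (pd i ph) x * d x)"
 proof (rule LIMSEQ_unique)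
  show "(%n. LI (%x. (ph (x + (1 / real (Suc n)) *\<^sub>R axis j 1) - ph x) * real (Suc n) * pd i d x)) -->> LI (%x. pd j ph x * pd i d x)"
   by (intro integral_difference_quotient ph smooth_pd test_fun_smooth d)
  have "LI (%x. (ph (x + (1 / real (Suc n)) *\<^sub>R axis j 1) - ph x) * real (Suc n) * pd i d x)
   = - LI (%x. (pd i ph (x + (1 / real (Suc n)) *\<^sub>R axis j 1) - pd i ph x) * real (Suc n) * d x)" for n
  proof -
   define ps where "ps x = (ph ((1 / real (Suc n)) *\<^sub>R axis j 1 + 1 *\<^sub>R x) - ph x) * real (Suc n)" for x
   have t: "test_fun ps" unfolding ps_def by (intro test_fun_mult test_fun_diff test_fun_affine ph smooth_const) simp
   have "pd i ps = (%x. (pd i ph (x + (1 / real (Suc n)) *\<^sub>R axis j 1) - pd i ph x) * real (Suc n))"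
   proof -
    have a: "(%x. ph ((1 / real (Suc n)) *\<^sub>R axis j 1 + 1 *\<^sub>R x)) differentiable_on UNIV"
     by (intro pd_affine test_fun_differentiable ph)
    have "ps = (%x. real (Suc n) * (ph ((1 / real (Suc n)) *\<^sub>R axis j 1 + 1 *\<^sub>R x) + (-1) * ph x))"
     by (auto simp: ps_def algebra_simps)
    hence "pd i ps = pd i (%x. real (Suc n) * (ph ((1 / real (Suc n)) *\<^sub>R axis j 1 + 1 *\<^sub>R x) + (-1) * ph x))" by simp
    also have "\<dots> = (%x. real (Suc n) * (pd i ph ((1 / real (Suc n)) *\<^sub>R axis j 1 + 1 *\<^sub>R x) + (-1) * pd i ph x))"
     using a test_fun_differentiable[OF ph]
     by (subst pd_cmult, (intro derivative_intros; simp)) (subst pd_add, simp, (intro derivative_intros; simp), subst pd_affine(1), simp, subst pd_cmult, simp_all)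
    finally show ?thesis by (auto simp: algebra_simps)
   qed
   moreover have "ps = (%x. (ph (x + (1 / real (Suc n)) *\<^sub>R axis j 1) - ph x) * real (Suc n))"
    by (auto simp: ps_def add.commute)
   ultimately show ?thesis using integration_by_parts[OF t test_fun_smooth[OF d], of i] by simp
  qed
  moreover have "(%n. LI (%x. (pd i ph (x + (1 / real (Suc n)) *\<^sub>R axis j 1) - pd i ph x) * real (Suc n) * d x))
    -->> LI (%x. pd j (pd i ph) x * d x)"
   by (intro integral_difference_quotient test_fun_pd test_fun_smooth ph d)
  ultimately show "(%n. LI (%x. (ph (x + (1 / real (Suc n)) *\<^sub>R axis j 1) - ph x) * real (Suc n) * pd i d x)) -->> - LI (%x. pd j (pd i ph) x * d x)"
   by (auto intro!: tendsto_intros)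
 qed
 have "Lint (%x. pd i (pd j ph) x * d x)" "Lint (%x. pd j (pd i ph) x * d x)"
  by (intro sq_int_mult test_fun_sq_int test_fun_pd ph d)+
 hence "LI (%x. d x * d x) = 0" using 1 2 by (simp add: d_def left_diff_distrib)
 moreover have "Lint (%x. d x * d x)" by (intro sq_int_mult test_fun_sq_int d)
 ultimately have "AE x in lborel. d x * d x = 0" by (subst (asm) integral_nonneg_eq_0_iff_AE) auto
 hence "AE x in lborel. d x = 0" by simp
 hence "d x = 0" for x by (rule AE_zero_continuous[OF test_fun_continuous[OF d]])
 thus ?thesis by (auto simp: d_def)
qed

text \<open>Two integrations by parts turn the square of a mixed derivative into the product of the
  pure ones. Summed over all pairs of indices these products give the squared Laplacian, and every
  summand is nonnegative.\<close>

lemma integral_second_derivatives_le: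
 assumes ps: "test_fun (ps :: real^'n::finite => real)"
 shows "LI (%x. (pd i (pd j ps) x)^2) <= sqn (lap ps)"
proof -
 note t = test_fun_pd[OF test_fun_pd[OF ps]]
 have eq: "LI (%x. (pd i (pd j ps) x)^2) = LI (%x. pd i (pd i ps) x * pd j (pd j ps) x)" for i j
 proof -
  have "LI (%x. (pd i (pd j ps) x)^2) = - LI (%x. pd j ps x * pd i (pd i (pd j ps)) x)"
   using integration_by_parts[OF test_fun_pd[OF ps, of j] test_fun_smooth[OF t[of i j]], of i]
   by (simp add: power2_eq_square)
  also have "pd i (pd i (pd j ps)) = pd j (pd i (pd i ps))"
   using pd_commute[OF ps, of i j] pd_commute[OF test_fun_pd[OF ps, of i], of i j] by simp
  also have "- LI (%x. pd j ps x * pd j (pd i (pd i ps)) x) = LI (%x. pd j (pd j ps) x * pd i (pd i ps) x)"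
   using integration_by_parts[OF test_fun_pd[OF ps, of j] test_fun_smooth[OF t[of i i]], of j] by simp
  finally show ?thesis by (simp add: mult.commute)
 qed
 have int: "Lint (%x. pd i (pd i ps) x * pd j (pd j ps) x)" for i j
  by (intro sq_int_mult test_fun_sq_int t)
 have "sqn (lap ps) = LI (%x. (\<Sum>i\<in>UNIV. \<Sum>j\<in>UNIV. pd i (pd i ps) x * pd j (pd j ps) x))"
  by (simp add: lap_def power2_eq_square sum_product)
 also have "\<dots> = (\<Sum>i\<in>UNIV. \<Sum>j\<in>UNIV. LI (%x. (pd i (pd j ps) x)^2))"
  using int by (simp add: eq)
 also have "\<dots> >= (\<Sum>j\<in>UNIV. LI (%x. (pd i (pd j ps) x)^2))"
  by (rule member_le_sum) (auto intro!: sum_nonneg)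
 also have "(\<Sum>j\<in>UNIV. LI (%x. (pd i (pd j ps) x)^2)) >= LI (%x. (pd i (pd j ps) x)^2)"
  by (rule member_le_sum) auto
 finally show ?thesis .
qed

lemma integral_gradient_le:
 assumes ps: "test_fun (ps :: real^'n::finite => real)"
 shows "LI (%x. (pd i ps x)^2) <= sqrt (sqn ps) * sqrt (sqn (lap ps))"
proof -
 have "LI (%x. (pd i ps x)^2) = - LI (%x. ps x * pd i (pd i ps) x)"
  using integration_by_parts[OF ps smooth_pd[OF test_fun_smooth[OF ps]], of i i] by (simp add: power2_eq_square)
 also have "\<dots> <= \<bar>LI (%x. ps x * pd i (pd i ps) x)\<bar>" by simp
 also have "\<dots> <= sqrt (sqn ps) * sqrt (LI (%x. (pd i (pd i ps) x)^2))"
  by (intro integral_Cauchy_Schwarz_sqrt test_fun_sq_int test_fun_pd ps)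
 also have "\<dots> <= sqrt (sqn ps) * sqrt (sqn (lap ps))"
  by (intro mult_left_mono real_sqrt_le_mono integral_second_derivatives_le ps) auto
 finally show ?thesis .
qed

section \<open>Locally integrable functions and convolution\<close>

definition loc_int :: "('a::euclidean_space => real) => bool" where
 "loc_int z \<longleftrightarrow> z \<in> bmeas & (\<forall>R. Lint (%x. indicator (cball 0 R) x * z x))"

lemma loc_int_measurable [measurable_dest]: "loc_int z ==> z \<in> bmeas"
 by (simp add: loc_int_def)

lemma loc_int_mult_bounded:
 assumes z: "loc_int z" and b [measurable]: "b \<in> bmeas"
  and B: "!!x. \<bar>b x\<bar> <= B" and R: "!!x. norm x > R ==> b x = 0"
 shows "Lint (%x. z x * b x)"
proof (rule integrable_bnd)
 note [measurable] = loc_int_measurable[OF z]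
 show "Lint (%x. B * (indicator (cball 0 R) x * z x))"
  using z by (auto simp: loc_int_def)
 show "(%x. z x * b x) \<in> borel_measurable lborel" by simp
 have B0: "0 <= B" using B[of 0] by linarith
 have "\<bar>z x * b x\<bar> <= \<bar>B * (indicator (cball 0 R) x * z x)\<bar>" for x
 proof (cases "norm x > R")
  case False
  have "\<bar>z x\<bar> * \<bar>b x\<bar> <= \<bar>z x\<bar> * B" by (intro mult_left_mono B) auto
  thus ?thesis using False B0 by (simp add: abs_mult mult.commute)
 qed (use R in auto)
 thus "AE x in lborel. norm (z x * b x) <= norm (B * (indicator (cball 0 R) x * z x))" by auto
qed

lemma loc_int_mult_test:
 assumes "loc_int z" "test_fun et"
 shows "Lint (%x. z x * et x)"
proof -
 obtain R where "\<forall>x. norm x > R --> et x = 0" using test_fun_support[OF assms(2)] by blast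
 moreover obtain B where "\<forall>x. \<bar>et x\<bar> <= B" using test_fun_bounded[OF assms(2)] by blast
 ultimately show ?thesis using assms by (intro loc_int_mult_bounded[of z et B R]) auto
qed

lemma sq_int_loc_int: "sq_int lborel z ==> loc_int z"
 unfolding loc_int_def
proof (intro conjI allI)
 fix R assume z: "sq_int lborel z"
 show "z \<in> bmeas" using sq_int_measurable[OF z] by simp
 have "sq_int lborel (indicator (cball 0 R) :: 'a => real)"
 proof -
  have "(%x. (indicator (cball 0 R) x :: real)^2) = (indicator (cball 0 R) :: 'a => real)"
   by (auto simp: indicator_def)
  thus ?thesis unfolding sq_int_def
   by (auto intro!: borel_measurable_indicator integrable_real_indicator emeasure_bounded_finite)
 qed
 thus "Lint (%x. indicator (cball 0 R) x * z x)" by (rule sq_int_mult[OF _ z])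
qed

lemma loc_int_add_cmult: "loc_int a ==> loc_int b ==> loc_int (%x. a x + c * b x)"
 unfolding loc_int_def
proof safe
 fix R
 assume "\<forall>R. Lint (%x. indicator (cball 0 R) x * a x)" "\<forall>R. Lint (%x. indicator (cball 0 R) x * b x)"
 hence "Lint (%x. indicator (cball 0 R) x * a x + c * (indicator (cball 0 R) x * b x))" by simp
 thus "Lint (%x. indicator (cball 0 R) x * (a x + c * b x))" by (simp add: algebra_simps)
qed simp_all

text \<open>\<open>P\<close> is a smooth bump that is positive exactly on the open box and at most
  1, so the test functions \<open>1 - (1 - P)^j\<close> converge to the indicator of the box and
  stay below it.\<close>

lemma integral_box_eq_0:
 fixes z :: "real^'n::finite => real"
 assumes z: "loc_int z" and 0: "!!et. test_fun et ==> LI (%x. z x * et x) = 0"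
 shows "LI (%x. z x * indicator (box a b) x) = 0"
proof -
 define P where "P x = (\<Prod>i\<in>UNIV. flat 0 (x $ i - a $ i) * flat 0 (b $ i - x $ i))" for x
 define et where "et j x = 1 - (1 - P x) ^ j" for j :: nat and x
 have box: "x \<in> box a b \<longleftrightarrow> (\<forall>i. a $ i < x $ i & x $ i < b $ i)" for x by (simp add: mem_box_cart)
 have P0: "0 <= P x" for x unfolding P_def by (intro prod_nonneg mult_nonneg_nonneg flat_nonneg)
 have P1: "P x <= 1" for x
  unfolding P_def
  by (intro prod_le_1 conjI mult_nonneg_nonneg flat_nonneg mult_le_one less_imp_le[OF flat_0_less_1])
 have Pz: "P x = 0" if xb: "x \<notin> box a b" for x
 proof -
  obtain i where "\<not> (a $ i < x $ i & x $ i < b $ i)" using xb box by auto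
  hence "flat 0 (x $ i - a $ i) * flat 0 (b $ i - x $ i) = 0" by (auto simp: flat_def)
  thus ?thesis unfolding P_def by (intro prod_zero) auto
 qed
 have Pp: "0 < P x" if "x \<in> box a b" for x
  unfolding P_def using that box by (intro prod_pos) (auto simp: flat_pos_iff)
 have sm: "smooth P"
 proof -
  have "smooth (%x::real^'n. x $ i - a $ i)" "smooth (%x::real^'n. b $ i - x $ i)" for i
   by (intro smooth_diff smooth_coord smooth_const)+
  thus ?thesis unfolding P_def by (intro smooth_prod smooth_mult smooth_flat_compose)
 qed
 have t: "test_fun (et j)" for j
  unfolding test_fun_iff
 proof
  show "smooth (et j)" unfolding et_def by (intro smooth_diff smooth_const smooth_power sm)
  have "et j x = 0" if "x \<notin> box a b" for x using Pz[OF that] by (simp add: et_def)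
  hence "{x. et j x \<noteq> 0} \<subseteq> box a b" by blast
  thus "bounded {x. et j x \<noteq> 0}" using bounded_box bounded_subset by blast
 qed
 note [measurable] = test_fun_measurable[OF t] loc_int_measurable[OF z]
 have etb: "\<bar>et j x\<bar> <= indicator (box a b) x" for j x
 proof (cases "x \<in> box a b")
  case True
  have "0 <= (1 - P x) ^ j" "(1 - P x) ^ j <= 1" using P0[of x] P1[of x] by (auto intro: power_le_one)
  thus ?thesis using True by (simp add: et_def)
 qed (auto simp: et_def Pz)
 obtain R where R: "\<forall>x\<in>box a b. norm x <= R" using bounded_box[of a b] by (auto simp: bounded_iff)
 have "(%j. LI (%x. z x * et j x)) -->> LI (%x. z x * indicator (box a b) x)"
 proof (rule integral_dominated_convergence[where w = "%x. \<bar>z x * indicator (box a b) x\<bar>"])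
  show "Lint (%x. \<bar>z x * indicator (box a b) x\<bar>)"
   using R by (intro integrable_abs loc_int_mult_bounded[OF z, of _ 1 R]) (auto simp: indicator_def)
  show "AE x in lborel. (%j. z x * et j x) -->> z x * indicator (box a b) x"
  proof (intro always_eventually allI tendsto_intros)
   fix x
   show "(%j. et j x) -->> indicator (box a b) x"
   proof (cases "x \<in> box a b")
    case True
    have "norm (1 - P x) < 1" using Pp[OF True] P1[of x] by simp
    hence "(%j. (1 - P x) ^ j) -->> 0" by (rule LIMSEQ_power_zero)
    hence "(%j. 1 - (1 - P x) ^ j) -->> 1 - 0" by (intro tendsto_diff tendsto_const)
    thus ?thesis using True by (simp add: et_def)
   qed (simp add: et_def Pz)
  qed
  show "AE x in lborel. norm (z x * et j x) <= \<bar>z x * indicator (box a b) x\<bar>" for j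
  proof (intro always_eventually allI)
   fix x
   have "\<bar>z x\<bar> * \<bar>et j x\<bar> <= \<bar>z x\<bar> * indicator (box a b) x" by (intro mult_left_mono etb) auto
   thus "norm (z x * et j x) <= \<bar>z x * indicator (box a b) x\<bar>" by (simp add: abs_mult)
  qed
 qed auto
 thus ?thesis using 0[OF t] by (simp add: LIMSEQ_const_iff)
qed

text \<open>Open boxes form an intersection-stable generator, so Dynkin's lemma extends the
  vanishing integrals to all Borel sets. Everything is cut with the cubes \<open>Q n\<close>,
  because \<open>z\<close> is only locally integrable; the sets where \<open>z\<close> has one sign
  then finish the proof.\<close>

lemma fundamental_lemma:
 fixes z :: "real^'n::finite => real"
 assumes z: "loc_int z" and 0: "!!et. test_fun et ==> LI (%x. z x * et x) = 0"
 shows "AE x in lborel. z x = 0"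
proof -
 note [measurable] = loc_int_measurable[OF z]
 define Q where "Q n = box (- (\<chi> i. real n)) (\<chi> i. real n :: real^'n)" for n :: nat
 have intQ: "Lint (%x. z x * indicator (A \<inter> Q n) x)" if [measurable]: "A \<in> sets borel" for A n
 proof -
  obtain R where R: "\<forall>x\<in>Q n. norm x <= R" using bounded_box by (metis bounded_iff Q_def)
  have [measurable]: "Q n \<in> sets borel" by (simp add: Q_def)
  show ?thesis using R by (intro loc_int_mult_bounded[OF z, of _ 1 R]) (auto simp: indicator_def)
 qed
 have [measurable]: "Q n \<in> sets borel" for n by (simp add: Q_def)
 have key: "LI (%x. z x * indicator (A \<inter> Q n) x) = 0" if A: "A \<in> sets borel" for A n
 proof -
  have gen: "A \<in> sigma_sets UNIV (range (%(a, b). box a b :: (real^'n) set))"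
   using A by (simp add: borel_eq_box)
  have "Int_stable (range (%(a, b). box a b :: (real^'n) set))"
   by (auto simp: Int_stable_def box_Int_box)
  moreover have "range (%(a, b). box a b :: (real^'n) set) \<subseteq> Pow UNIV" by simp
  ultimately show ?thesis using gen
  proof (induction rule: sigma_sets_induct_disjoint)
   case (basic A)
   then obtain a b where A: "A = box a b" by auto
   have "\<exists>c d. A \<inter> Q n = box c d" unfolding Q_def A box_Int_box by blast
   then obtain c d where "A \<inter> Q n = box c d" by blast
   thus ?case using integral_box_eq_0[OF z 0] by simp
  next
   case empty
   show ?case by simp
  next
   case (compl A)
   have [measurable]: "A \<in> sets borel" using compl(1) by (simp add: borel_eq_box)
   have "LI (%x. z x * indicator ((UNIV - A) \<inter> Q n) x)
     = LI (%x. z x * indicator (UNIV \<inter> Q n) x - z x * indicator (A \<inter> Q n) x)"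
    by (intro Bochner_Integration.integral_cong) (auto simp: indicator_def)
   also have "\<dots> = LI (%x. z x * indicator (UNIV \<inter> Q n) x) - 0"
    using intQ[of UNIV n] intQ[of A n] compl by simp
   also have "\<dots> = 0" using integral_box_eq_0[OF z 0] by (simp add: Q_def)
   finally show ?case .
  next
   case (union A)
   have [measurable]: "A i \<in> sets borel" for i using union(2) by (auto simp: borel_eq_box)
   have dj: "A i \<inter> Q n \<inter> (A j \<inter> Q n) = {}" if "i \<noteq> j" for i j
    using union(1) that by (auto simp: disjoint_family_on_def)
   have "set_integrable lborel (\<Union>i. A i \<inter> Q n) z"
    using intQ[of "\<Union>i. A i" n] by (simp add: set_integrable_def mult.commute)
   hence "(LINT x:(\<Union>i. A i \<inter> Q n)|lborel. z x) = (\<Sum>i. (LINT x:(A i \<inter> Q n)|lborel. z x))"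
    by (intro lebesgue_integral_countable_add dj) auto
   hence "LI (%x. z x * indicator (\<Union>i. A i \<inter> Q n) x) = (\<Sum>i. LI (%x. z x * indicator (A i \<inter> Q n) x))"
    by (simp add: set_lebesgue_integral_def mult.commute)
   moreover have "(\<Union>i. A i \<inter> Q n) = (\<Union>i. A i) \<inter> Q n" by auto
   ultimately show ?case using union(3) by simp
  qed
 qed
 have "AE x in lborel. x \<in> Q n --> z x = 0" for n
 proof -
  define A where "A = {x. z x > 0}"
  define B where "B = {x. z x < 0}"
  have [measurable]: "A \<in> sets borel" "B \<in> sets borel" unfolding A_def B_def by simp_all
  have nn: "AE x in lborel. 0 <= z x * indicator (A \<inter> Q n) x" "AE x in lborel. 0 <= - (z x * indicator (B \<inter> Q n) x)"
   by (auto simp: A_def B_def indicator_def intro!: AE_I2)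
  have iA: "Lint (%x. z x * indicator (A \<inter> Q n) x)" and iB: "Lint (%x. - (z x * indicator (B \<inter> Q n) x))"
   using intQ[of A n] intQ[of B n] by auto
  have "AE x in lborel. z x * indicator (A \<inter> Q n) x = 0"
   using integral_nonneg_eq_0_iff_AE[OF iA nn(1)] key[of A n] by simp
  moreover have "AE x in lborel. - (z x * indicator (B \<inter> Q n) x) = 0"
   using integral_nonneg_eq_0_iff_AE[OF iB nn(2)] key[of B n] by simp
  ultimately show ?thesis by eventually_elim (auto simp: A_def B_def indicator_def)
 qed
 hence "AE x in lborel. \<forall>n. x \<in> Q n --> z x = 0" by (intro AE_all_countable[THEN iffD2] allI)
 thus ?thesis
 proof eventually_elim
  case (elim x)
  obtain n :: nat where n: "norm x < real n" using reals_Archimedean2 by blast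
  have "x \<in> Q n"
   unfolding Q_def mem_box_cart
  proof
   fix i
   have "\<bar>x $ i\<bar> < real n" using component_le_norm_cart[of x i] n by linarith
   thus "(- (\<chi> i. real n)) $ i < x $ i & x $ i < (\<chi> i. real n) $ i" by auto
  qed
  thus ?case using elim by blast
 qed
qed

section \<open>Convolution with even kernels supported in the unit ball\<close>

definition cv :: "(real^'n::finite => real) => (real^'n => real) => real^'n => real" where
 "cv k h x = LI (%z. k z * h (x - z))"

text \<open>Evenness makes convolution with \<open>k\<close> symmetric under the integral; the
  bounded support lets it act on functions that are only locally integrable.\<close>

definition ball_kernel :: "(real^'n::finite => real) => bool" where
 "ball_kernel k \<longleftrightarrow> Lint k & (\<forall>z. norm z > 1 --> k z = 0) & (\<forall>z. k (- z) = k z)"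

lemma ball_kernel_measurable [measurable_dest]: "ball_kernel k ==> k \<in> bmeas"
 by (auto simp: ball_kernel_def)

lemma cv_measurable [measurable (raw)]:
 assumes [measurable]: "k \<in> bmeas" "h \<in> bmeas"
 shows "cv k h \<in> bmeas"
 unfolding cv_def by measurable

text \<open>Fubini is needed before and after the shift of \<open>x\<close> by \<open>z\<close>.
  Since \<open>k\<close> lives on the unit ball, the inner integral is at most
  \<open>B * I * \<bar>k z\<bar>\<close>, where \<open>I\<close> is the mass of \<open>v\<close> on
  the ball enlarged by 1.\<close>

lemma convolution_integrable_pair:
 assumes k: "ball_kernel k" and v: "loc_int v"
  and b [measurable]: "b \<in> bmeas" and B: "!!x. \<bar>b x\<bar> <= B" and R: "!!x. norm x > R ==> b x = 0"
 shows "integrable (lborel \<Otimes>\<^sub>M lborel) (%(z, x). k z * v (x - z) * b x)"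
  and "integrable (lborel \<Otimes>\<^sub>M lborel) (%(z, x). k z * v x * b (x + z))"
proof -
 note [measurable] = ball_kernel_measurable[OF k] loc_int_measurable[OF v]
 have B0: "0 <= B" using B[of 0] by linarith
 define I where "I = LI (%x. \<bar>indicator (cball 0 (R + 1)) x * v x\<bar>)"
 have vI: "Lint (%x. indicator (cball 0 (R + 1)) x * v x)" using v by (simp add: loc_int_def)
 have s: "Lint (%x. v x * b (x + z))" "LI (%x. \<bar>v x * b (x + z)\<bar>) <= B * I" if z: "norm z <= 1" for z
 proof -
  have "b (x + z) = 0" if "norm x > R + 1" for x
  proof -
   have "norm x <= norm (x + z) + norm z" by (metis add_diff_cancel_right' norm_triangle_ineq4)
   thus ?thesis using R that z by auto
  qed
  note bz = this
  show 1: "Lint (%x. v x * b (x + z))"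
   by (intro loc_int_mult_bounded[OF v, of _ B "R + 1"] B bz) auto
  have "LI (%x. \<bar>v x * b (x + z)\<bar>) <= LI (%x. B * \<bar>indicator (cball 0 (R + 1)) x * v x\<bar>)"
  proof (intro integral_mono integrable_abs 1 integrable_mult_right vI)
   fix x
   show "\<bar>v x * b (x + z)\<bar> <= B * \<bar>indicator (cball 0 (R + 1)) x * v x\<bar>"
   proof (cases "norm x > R + 1")
    case False
    have "\<bar>v x\<bar> * \<bar>b (x + z)\<bar> <= \<bar>v x\<bar> * B" by (intro mult_left_mono B) auto
    thus ?thesis using False by (simp add: abs_mult mult.commute)
   qed (auto simp: bz B0)
  qed
  thus "LI (%x. \<bar>v x * b (x + z)\<bar>) <= B * I" by (simp add: I_def)
 qed
 have s': "Lint (%x. v (x - z) * b x)" "LI (%x. \<bar>v (x - z) * b x\<bar>) <= B * I" if z: "norm z <= 1" for z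
  using integrable_lborel_translate[OF s(1)[OF z], of "- z"] s(2)[OF z]
   integral_lborel_translate[of "%x. \<bar>v x * b (x + z)\<bar>" "- z"] by auto
 have kB: "Lint (%z. B * I * \<bar>k z\<bar>)" using k by (simp add: ball_kernel_def)
 show "integrable (lborel \<Otimes>\<^sub>M lborel) (%(z, x). k z * v (x - z) * b x)"
 proof (rule lborel_pair.Fubini_integrable)
  show "Lint (%z. LI (%x. norm (case (z, x) of (z, x) => k z * v (x - z) * b x)))"
  proof (rule integrable_bnd[OF kB])
   show "AE z in lborel. norm (LI (%x. norm (case (z, x) of (z, x) => k z * v (x - z) * b x))) <= norm (B * I * \<bar>k z\<bar>)"
   proof (intro always_eventually allI)
    fix z
    have "LI (%x. norm (case (z, x) of (z, x) => k z * v (x - z) * b x)) = \<bar>k z\<bar> * LI (%x. \<bar>v (x - z) * b x\<bar>)"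
     by (simp add: abs_mult mult.assoc)
    moreover have "\<bar>k z\<bar> * LI (%x. \<bar>v (x - z) * b x\<bar>) <= \<bar>k z\<bar> * (B * I)"
     using s'(2)[of z] k by (cases "norm z <= 1") (auto simp: ball_kernel_def intro!: mult_left_mono)
    moreover have "0 <= \<bar>k z\<bar> * LI (%x. \<bar>v (x - z) * b x\<bar>)" by simp
    ultimately show "norm (LI (%x. norm (case (z, x) of (z, x) => k z * v (x - z) * b x))) <= norm (B * I * \<bar>k z\<bar>)"
     by (simp add: mult.commute)
   qed
  qed measurable
  show "AE z in lborel. Lint (%x. case (z, x) of (z, x) => k z * v (x - z) * b x)"
  proof (intro always_eventually allI)
   fix z
   show "Lint (%x. case (z, x) of (z, x) => k z * v (x - z) * b x)"
    using s'(1)[of z] k by (cases "norm z <= 1") (auto simp: ball_kernel_def mult.assoc)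
  qed
 qed measurable
 show "integrable (lborel \<Otimes>\<^sub>M lborel) (%(z, x). k z * v x * b (x + z))"
 proof (rule lborel_pair.Fubini_integrable)
  show "Lint (%z. LI (%x. norm (case (z, x) of (z, x) => k z * v x * b (x + z))))"
  proof (rule integrable_bnd[OF kB])
   show "AE z in lborel. norm (LI (%x. norm (case (z, x) of (z, x) => k z * v x * b (x + z)))) <= norm (B * I * \<bar>k z\<bar>)"
   proof (intro always_eventually allI)
    fix z
    have "LI (%x. norm (case (z, x) of (z, x) => k z * v x * b (x + z))) = \<bar>k z\<bar> * LI (%x. \<bar>v x * b (x + z)\<bar>)"
     by (simp add: abs_mult mult.assoc)
    moreover have "\<bar>k z\<bar> * LI (%x. \<bar>v x * b (x + z)\<bar>) <= \<bar>k z\<bar> * (B * I)"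
     using s(2)[of z] k by (cases "norm z <= 1") (auto simp: ball_kernel_def intro!: mult_left_mono)
    moreover have "0 <= \<bar>k z\<bar> * LI (%x. \<bar>v x * b (x + z)\<bar>)" by simp
    ultimately show "norm (LI (%x. norm (case (z, x) of (z, x) => k z * v x * b (x + z)))) <= norm (B * I * \<bar>k z\<bar>)"
     by (simp add: mult.commute)
   qed
  qed measurable
  show "AE z in lborel. Lint (%x. case (z, x) of (z, x) => k z * v x * b (x + z))"
  proof (intro always_eventually allI)
   fix z
   show "Lint (%x. case (z, x) of (z, x) => k z * v x * b (x + z))"
    using s(1)[of z] k by (cases "norm z <= 1") (auto simp: ball_kernel_def mult.assoc)
  qed
 qed measurable
qed

lemma integral_minus_lborel:
 fixes f :: "'a::euclidean_space => real"
 assumes "f \<in> bmeas" shows "LI (%x. f (- x)) = LI (%x. f x)"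
 using integral_lborel_affine[OF assms, of "-1" 0] by simp

lemma cv_even:
 assumes k: "ball_kernel k" and [measurable]: "b \<in> bmeas"
 shows "LI (%z. k z * b (x + z)) = cv k b x"
proof -
 note [measurable] = ball_kernel_measurable[OF k]
 have "LI (%z. k (- z) * b (x + (- z))) = LI (%z. k z * b (x + z))"
  by (rule integral_minus_lborel) measurable
 thus ?thesis using k by (simp add: cv_def ball_kernel_def)
qed

lemma cv_swap:
 assumes k: "ball_kernel k" and v: "loc_int v"
  and b [measurable]: "b \<in> bmeas" and B: "!!x. \<bar>b x\<bar> <= B" and R: "!!x. norm x > R ==> b x = 0"
 shows "Lint (%x. cv k v x * b x)"
  and "LI (%x. cv k v x * b x) = LI (%x. v x * cv k b x)"
proof -
 note [measurable] = ball_kernel_measurable[OF k] loc_int_measurable[OF v]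
 note I = convolution_integrable_pair[OF k v b B R]
 have "Lint (%x. LI (%z. k z * v (x - z) * b x))"
  by (rule lborel_pair.integrable_snd[OF I(1)])
 thus "Lint (%x. cv k v x * b x)" by (simp add: cv_def)
 have "LI (%x. cv k v x * b x) = LI (%x. LI (%z. k z * v (x - z) * b x))" by (simp add: cv_def)
 also have "\<dots> = LI (%z. LI (%x. k z * v (x - z) * b x))"
  by (rule lborel_pair.Fubini_integral[OF I(1)])
 also have "\<dots> = LI (%z. LI (%x. k z * v x * b (x + z)))"
 proof (rule Bochner_Integration.integral_cong[OF refl])
  fix z
  show "LI (%x. k z * v (x - z) * b x) = LI (%x. k z * v x * b (x + z))"
   using integral_lborel_translate[of "%x. k z * v (x - z) * b x" z] by simp
 qed
 also have "\<dots> = LI (%x. LI (%z. k z * v x * b (x + z)))"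
  by (rule lborel_pair.Fubini_integral[OF I(2), symmetric])
 also have "\<dots> = LI (%x. v x * cv k b x)"
 proof (rule Bochner_Integration.integral_cong[OF refl])
  fix x
  have "LI (%z. k z * v x * b (x + z)) = v x * LI (%z. k z * b (x + z))"
   by (simp add: mult.assoc mult.left_commute[of _ "v x"])
  thus "LI (%z. k z * v x * b (x + z)) = v x * cv k b x" using cv_even[OF k b] by simp
 qed
 finally show "LI (%x. cv k v x * b x) = LI (%x. v x * cv k b x)" .
qed

lemma loc_int_cv:
 assumes k: "ball_kernel k" and v: "loc_int v"
 shows "loc_int (cv k v)"
 unfolding loc_int_def
proof (intro conjI allI)
 note [measurable] = ball_kernel_measurable[OF k] loc_int_measurable[OF v]
 show "cv k v \<in> bmeas" by measurable
 fix R
 have "Lint (%x. cv k v x * indicator (cball 0 R) x)"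
  by (rule cv_swap(1)[OF k v, of _ 1 R]) (rule borel_measurable_indicator, auto simp: indicator_def)
 thus "Lint (%x. indicator (cball 0 R) x * cv k v x)" by (simp add: mult.commute)
qed

lemma cv_zero_outside:
 assumes k: "ball_kernel k" and R: "!!x. norm x > R ==> h x = 0" and x: "norm x > R + 1"
 shows "cv k h x = 0"
proof -
 have "k z * h (x - z) = 0" for z
 proof (cases "norm z > 1")
  case False
  have "norm x <= norm (x - z) + norm z" by (metis add.commute norm_triangle_sub)
  hence "norm (x - z) > R" using False x by linarith
  thus ?thesis using R by simp
 qed (use k in \<open>auto simp: ball_kernel_def\<close>)
 hence "(%z. k z * h (x - z)) = (%z. 0)" by (intro ext)
 thus ?thesis by (simp add: cv_def)
qed

lemma cv_test_integrable:
 assumes k: "Lint k" and et: "test_fun et"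
 shows "Lint (%z. k z * et (x - z))"
proof -
 obtain B where B: "!!x. \<bar>et x\<bar> <= B" using test_fun_bounded[OF et] by blast
 note [measurable] = test_fun_measurable[OF et]
 have [measurable]: "k \<in> bmeas" using k by auto
 show ?thesis
 proof (rule integrable_bnd)
  show "Lint (%z. B * k z)" using k by simp
  show "AE z in lborel. norm (k z * et (x - z)) <= norm (B * k z)"
  proof (intro always_eventually allI)
   fix z
   have "\<bar>k z\<bar> * \<bar>et (x - z)\<bar> <= \<bar>k z\<bar> * B" by (intro mult_left_mono B) auto
   thus "norm (k z * et (x - z)) <= norm (B * k z)" using B[of 0] by (simp add: abs_mult mult.commute)
  qed
 qed measurable
qed

text \<open>\<open>k\<close> is only integrable, so the derivative falls entirely on
  \<open>et\<close>. The remainder quotient \<open>r h\<close> is bounded by a Lipschitz constant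
  plus a gradient bound and tends to zero pointwise; dominated convergence along sequences does the
  rest.\<close>

lemma cv_has_derivative:
 fixes et :: "real^'n::finite => real"
 assumes k: "Lint k" and et: "test_fun et"
 shows "(cv k et has_derivative (%h. \<Sum>i\<in>UNIV. cv k (pd i et) x * h $ i)) (at x)"
 unfolding has_derivative_at
proof
 show "bounded_linear (%h. \<Sum>i\<in>UNIV. cv k (pd i et) x * h $ i)"
  by (intro bounded_linear_sum bounded_linear_const_mult bounded_linear_vec_nth)
 have [measurable]: "k \<in> bmeas" using k by auto
 note [measurable] = test_fun_measurable[OF et] test_fun_measurable[OF test_fun_pd[OF et]]
 obtain B where B: "B > 0" "!!x y. \<bar>et x - et y\<bar> <= B * norm (x - y)" using test_fun_Lipschitz[OF et] by blast
 have "\<exists>b. \<forall>x. \<bar>pd i et x\<bar> <= b" for i using test_fun_bounded[OF test_fun_pd[OF et]] by blast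
 then obtain b where b: "!!i x. \<bar>pd i et x\<bar> <= b i" by metis
 define r where "r h y = (et (y + h) - et y - (\<Sum>i\<in>UNIV. pd i et y * h $ i)) / norm h" for h y :: "real^'n"
 have r_bound: "\<bar>r h y\<bar> <= B + sum b UNIV" if "h \<noteq> 0" for h y
 proof -
  have "\<bar>\<Sum>i\<in>UNIV. pd i et y * h $ i\<bar> <= (\<Sum>i\<in>UNIV. \<bar>pd i et y * h $ i\<bar>)" by (rule sum_abs)
  also have "\<dots> <= (\<Sum>i\<in>UNIV. b i * norm h)"
   unfolding abs_mult by (intro sum_mono mult_mono b component_le_norm_cart order_trans[OF abs_ge_zero b]) auto
  finally have "\<bar>\<Sum>i\<in>UNIV. pd i et y * h $ i\<bar> <= sum b UNIV * norm h" by (simp add: sum_distrib_right)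
  moreover have "\<bar>et (y + h) - et y\<bar> <= B * norm h" using B(2)[of "y + h" y] by simp
  ultimately have "\<bar>et (y + h) - et y - (\<Sum>i\<in>UNIV. pd i et y * h $ i)\<bar> <= (B + sum b UNIV) * norm h"
   by (simp add: algebra_simps)
  thus ?thesis using that by (simp add: r_def field_simps)
 qed
 have r_lim: "((%h. r h y) \<longlongrightarrow> 0) (at 0)" for y
 proof -
  have "((%h. norm (et (y + h) - et y - (\<Sum>i\<in>UNIV. pd i et y * h $ i)) / norm h) \<longlongrightarrow> 0) (at 0)"
   using has_derivative_pd_on[OF test_fun_differentiable[OF et], of y] by (simp add: has_derivative_at)
  hence "((%h. norm (r h y)) \<longlongrightarrow> 0) (at 0)" by (simp add: r_def)
  thus ?thesis by (rule tendsto_norm_zero_cancel)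
 qed
 have [measurable]: "r h \<in> bmeas" for h unfolding r_def by measurable
 have eq: "(cv k et (x + h) - cv k et x - (\<Sum>i\<in>UNIV. cv k (pd i et) x * h $ i)) / norm h = LI (%z. k z * r h (x - z))" for h
 proof -
  have i1: "Lint (%z. k z * et (x + h - z))" "Lint (%z. k z * et (x - z))"
   "!!i. Lint (%z. k z * pd i et (x - z))"
   by (intro cv_test_integrable k et test_fun_pd)+
  have "LI (%z. k z * r h (x - z)) = LI (%z. (k z * et (x + h - z) - k z * et (x - z) - (\<Sum>i\<in>UNIV. k z * pd i et (x - z) * h $ i)) / norm h)"
  proof (rule Bochner_Integration.integral_cong[OF refl])
   fix z
   have *: "x - z + h = x + h - z" by simp
   show "k z * r h (x - z) = (k z * et (x + h - z) - k z * et (x - z) - (\<Sum>i\<in>UNIV. k z * pd i et (x - z) * h $ i)) / norm h"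
    unfolding r_def * by (simp add: right_diff_distrib sum_distrib_left mult.assoc)
  qed
  also have "\<dots> = (cv k et (x + h) - cv k et x - (\<Sum>i\<in>UNIV. cv k (pd i et) x * h $ i)) / norm h"
   using i1 by (simp add: cv_def)
  finally show ?thesis by simp
 qed
 have "((%h. LI (%z. k z * r h (x - z))) \<longlongrightarrow> 0) (at 0)"
  unfolding tendsto_at_iff_sequentially
 proof (intro allI impI)
  fix X :: "nat => real^'n" assume X: "\<forall>i. X i \<in> UNIV - {0}" "X -->> 0"
  have "(%n. LI (%z. k z * r (X n) (x - z))) -->> LI (%z::real^'n. 0)"
  proof (rule integral_dominated_convergence[where w = "%z. (B + sum b UNIV) * \<bar>k z\<bar>"])
   show "AE z in lborel. (%n. k z * r (X n) (x - z)) -->> 0"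
   proof (intro always_eventually allI tendsto_mult_right_zero)
    fix z
    show "(%n. r (X n) (x - z)) -->> 0"
     using r_lim[of "x - z"] X unfolding tendsto_at_iff_sequentially by (auto simp: o_def)
   qed
   show "AE z in lborel. norm (k z * r (X n) (x - z)) <= (B + sum b UNIV) * \<bar>k z\<bar>" for n
   proof (intro always_eventually allI)
    fix z
    have "\<bar>k z\<bar> * \<bar>r (X n) (x - z)\<bar> <= \<bar>k z\<bar> * (B + sum b UNIV)" using X by (intro mult_left_mono r_bound) auto
    thus "norm (k z * r (X n) (x - z)) <= (B + sum b UNIV) * \<bar>k z\<bar>" by (simp add: abs_mult mult.commute)
   qed
  qed (use k in auto)
  thus "((%h. LI (%z. k z * r h (x - z))) \<circ> X) -->> 0" by (simp add: o_def)
 qed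
 hence "((%h. (cv k et (x + h) - cv k et x - (\<Sum>i\<in>UNIV. cv k (pd i et) x * h $ i)) / norm h) \<longlongrightarrow> 0) (at 0)"
  by (simp only: eq)
 from tendsto_norm_zero[OF this]
 show "((%h. norm (cv k et (x + h) - cv k et x - (\<Sum>i\<in>UNIV. cv k (pd i et) x * h $ i)) / norm h) \<longlongrightarrow> 0) (at 0)"
  by simp
qed

lemma pd_cv:
 assumes "Lint k" "test_fun et"
 shows "pd i (cv k et) = cv k (pd i et)"
 by (rule ext, subst pd_eq[OF cv_has_derivative[OF assms]]) (simp add: axis_def if_distrib cong: if_cong)

lemma test_fun_cv:
 assumes k: "ball_kernel k" and et: "test_fun et"
 shows "test_fun (cv k et)"
proof -
 have ki: "Lint k" using k by (simp add: ball_kernel_def)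
 have diff: "cv k et differentiable_on UNIV" if "test_fun et" for et
  using cv_has_derivative[OF ki that] by (auto simp: differentiable_on_def differentiable_def)
 have "Ck m (cv k et)" if "test_fun et" for m et
  using that
 proof (induction m arbitrary: et)
  case 0
  thus ?case by (simp add: differentiable_imp_continuous_on diff)
 next
  case (Suc m)
  thus ?case by (simp add: diff pd_cv[OF ki] test_fun_pd)
 qed
 hence "smooth (cv k et)" using et by (simp add: smooth_def)
 moreover obtain R where "\<forall>x. norm x > R --> et x = 0" using test_fun_support[OF et] by blast
 hence "\<forall>x. norm x > R + 1 --> cv k et x = 0" using cv_zero_outside[OF k, of R et] by blast
 ultimately show ?thesis by (simp add: test_fun_iff bounded_supportI)
qed

lemma cv_sum:
 assumes "Lint k" "!!i. i \<in> A ==> test_fun (et i)"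
 shows "cv k (%x. \<Sum>i\<in>A. et i x) x = (\<Sum>i\<in>A. cv k (et i) x)"
 unfolding cv_def using assms by (simp add: sum_distrib_left cv_test_integrable)

lemma lap_cv:
 assumes k: "ball_kernel k" and et: "test_fun et"
 shows "lap (cv k et) = cv k (lap et)"
proof
 fix x
 have ki: "Lint k" using k by (simp add: ball_kernel_def)
 have "cv k (lap et) x = (\<Sum>i\<in>UNIV. cv k (pd i (pd i et)) x)"
  unfolding lap_def using cv_sum[OF ki, of UNIV "%i. pd i (pd i et)"] et by (simp add: test_fun_pd)
 thus "lap (cv k et) x = cv k (lap et) x"
  using et by (simp add: lap_def pd_cv[OF ki] test_fun_pd)
qed

section \<open>A compactly supported parametrix of the Laplacian\<close>

text \<open>Normalisation of the bump \<open>2 * flat 2\<close>: \<open>flat 2\<close> is the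
  derivative of \<open>flat 0\<close>, and the 2 comes from the gradient of the squared
  norm.\<close>

definition bump_mass :: "'n::finite itself => real" where
 "bump_mass _ = LI (%y::real^'n. 2 * flat 2 (1 - (norm y)\<^sup>2))"

definition rho :: "real^'n::finite => real" where
 "rho x = (1 / bump_mass TYPE('n)) * (2 * flat 2 (1 - (norm x)\<^sup>2))"

definition Psi :: "real^'n::finite => real" where
 "Psi x = (1 / bump_mass TYPE('n)) * flat 0 (1 - (norm x)\<^sup>2)"

text \<open>Since \<open>\<nabla>Psi = - x rho\<close>, the dilates \<open>rho\<^sub>t = t\<^sup>-\<^sup>N rho(\<cdot>/t)\<close> satisfy
 \<open>\<partial>\<^sub>t rho\<^sub>t = t \<Delta>Psi\<^sub>t\<close>; integrating over \<open>t\<close> in \<open>(0,1]\<close> gives \<open>\<Delta>Ker = rho - \<delta>\<close>.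
 At \<open>z = 0\<close> the integral below diverges and \<open>Ker 0\<close> is the junk value 0.\<close>

definition Ker :: "real^'n::finite => real" where
 "Ker z = LI (%t. indicator {0<..1} t * (t / t ^ CARD('n)) * Psi ((1 / t) *\<^sub>R z))"

lemma norm_power2_vec: "(norm x)\<^sup>2 = (\<Sum>i\<in>UNIV. x $ i * x $ i)" for x :: "real^'n::finite"
 by (simp add: power2_norm_eq_inner inner_vec_def)

lemma smooth_one_minus_norm2: "smooth (%x::real^'n::finite. 1 - (norm x)\<^sup>2)"
 unfolding norm_power2_vec by (intro smooth_diff smooth_const smooth_sum smooth_mult smooth_coord)

lemma pd_one_minus_norm2: "pd i (%x::real^'n::finite. 1 - (norm x)\<^sup>2) = (%x. - 2 * x $ i)"
proof
 fix x :: "real^'n"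
 have "((%x::real^'n. 1 - (norm x)\<^sup>2) has_derivative (%h. - (2 * (x \<bullet> h)))) (at x)"
  unfolding power2_norm_eq_inner by (auto intro!: derivative_eq_intros simp: inner_commute)
 from pd_eq[OF this, of i] show "pd i (%x::real^'n. 1 - (norm x)\<^sup>2) x = - 2 * x $ i"
  by (simp add: inner_axis)
qed

lemma flat_ball_zero: "norm x >= 1 ==> flat m (1 - (norm x)\<^sup>2) = 0"
 using power_mono[of 1 "norm x" 2] by (simp add: flat_def)

lemma test_fun_flat_ball: "test_fun (%x::real^'n::finite. flat m (1 - (norm x)\<^sup>2))"
 unfolding test_fun_iff
 by (intro conjI smooth_flat_compose smooth_one_minus_norm2 bounded_supportI[of 1]) (auto simp: flat_ball_zero)

lemma bump_mass_pos: "bump_mass TYPE('n::finite) > 0"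
proof -
 define b where "b y = 2 * flat 2 (1 - (norm y)\<^sup>2)" for y :: "real^'n"
 have t: "test_fun b" unfolding b_def by (intro test_fun_cmult test_fun_flat_ball)
 have nn: "AE y in lborel. 0 <= b y" by (simp add: b_def flat_nonneg)
 have "bump_mass TYPE('n) >= 0" unfolding bump_mass_def b_def[symmetric] by (intro integral_nonneg_AE nn)
 moreover have "bump_mass TYPE('n) \<noteq> 0"
 proof
  assume "bump_mass TYPE('n) = 0"
  hence "AE y in lborel. b y = 0"
   using integral_nonneg_eq_0_iff_AE[OF test_fun_integrable[OF t] nn] by (simp add: bump_mass_def b_def)
  hence "b 0 = 0" by (rule AE_zero_continuous[OF test_fun_continuous[OF t]])
  thus False by (simp add: b_def flat_def)
 qed
 ultimately show ?thesis by simp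
qed

lemma test_fun_rho: "test_fun rho"
 unfolding rho_def by (intro test_fun_cmult test_fun_flat_ball)

lemma test_fun_Psi: "test_fun Psi"
 unfolding Psi_def by (intro test_fun_cmult test_fun_flat_ball)

lemma rho_measurable [measurable]: "rho \<in> bmeas" by (rule test_fun_measurable[OF test_fun_rho])
lemma Psi_measurable [measurable]: "Psi \<in> bmeas" by (rule test_fun_measurable[OF test_fun_Psi])

lemma rho_nonneg: "0 <= rho (x :: real^'n::finite)"
 using bump_mass_pos[where 'n='n] by (simp add: rho_def flat_nonneg)
lemma Psi_nonneg: "0 <= Psi (x :: real^'n::finite)"
 using bump_mass_pos[where 'n='n] by (simp add: Psi_def flat_nonneg)
lemma rho_zero: "norm x >= 1 ==> rho x = 0" by (simp add: rho_def flat_ball_zero)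
lemma Psi_zero: "norm x >= 1 ==> Psi x = 0" by (simp add: Psi_def flat_ball_zero)

lemma integral_rho: "LI (%x::real^'n::finite. rho x) = 1"
 using bump_mass_pos[where 'n='n] by (simp add: rho_def bump_mass_def)

lemma pd_Psi: "pd i Psi = (%x::real^'n::finite. - x $ i * rho x)"
proof -
 have d: "(%x::real^'n. 1 - (norm x)\<^sup>2) differentiable_on UNIV" by (intro smooth_differentiable smooth_one_minus_norm2)
 have "pd i (%x::real^'n. flat 0 (1 - (norm x)\<^sup>2)) = (%x. flat 2 (1 - (norm x)\<^sup>2) * (- 2 * x $ i))"
 proof -
  have "(flat 0 has_real_derivative flat 2 s) (at s)" for s
   using flat_has_derivative[of 0 s] by (simp only: add_0 of_nat_0 mult_zero_left diff_zero)
  from pd_compose(1)[OF d this, of i] show ?thesis by (simp add: pd_one_minus_norm2)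
 qed
 thus ?thesis
  unfolding Psi_def using pd_cmult[OF test_fun_differentiable[OF test_fun_flat_ball], of i "1 / bump_mass TYPE('n)" 0]
  by (simp add: rho_def fun_eq_iff)
qed

lemma ball_kernel_rho: "ball_kernel rho"
 unfolding ball_kernel_def using test_fun_integrable[OF test_fun_rho]
 by (auto simp: rho_zero) (simp add: rho_def)

lemma integrable_bounded_pair:
 fixes g :: "real \<times> (real^'n::finite) => real"
 assumes [measurable]: "g \<in> borel_measurable (lborel \<Otimes>\<^sub>M lborel)"
  and B: "!!t y. \<bar>g (t, y)\<bar> <= B" and 0: "!!t y. t \<notin> {0..1} \<or> norm y > 1 ==> g (t, y) = 0"
 shows "integrable (lborel \<Otimes>\<^sub>M lborel) g"
proof (rule integrable_bnd)
 have "emeasure lborel ({0..1::real} \<times> cball (0::real^'n) 1) < \<infinity>"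
  by (intro emeasure_bounded_finite bounded_Times) auto
 hence "integrable (lborel \<Otimes>\<^sub>M lborel) (indicator ({0..1::real} \<times> cball (0::real^'n) 1) :: _ => real)"
  by (intro integrable_real_indicator) (auto simp: lborel_prod)
 thus "integrable (lborel \<Otimes>\<^sub>M lborel) (%p. B * (indicator ({0..1::real} \<times> cball (0::real^'n) 1) p :: real))"
  by simp
 have "\<bar>g p\<bar> <= \<bar>B * indicator ({0..1::real} \<times> cball (0::real^'n) 1) p\<bar>" for p
  using B[of "fst p" "snd p"] 0[of "fst p" "snd p"] by (cases p) (auto simp: indicator_def)
 thus "AE p in lborel \<Otimes>\<^sub>M lborel. norm (g p) <= norm (B * (indicator ({0..1::real} \<times> cball (0::real^'n) 1) p :: real))"
  by simp
qed measurable

text \<open>The fundamental theorem along the segment from \<open>x\<close> to \<open>x - y\<close>,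
  averaged with weight \<open>rho y\<close>, produces the factors \<open>- y $ i * rho y\<close>,
  which are the partial derivatives of \<open>Psi\<close>. An integration by parts in
  \<open>y\<close> then moves the derivative to \<open>et\<close> and brings out one factor
  \<open>t\<close>.\<close>

lemma rho_average_identity:
 fixes et :: "real^'n::finite => real"
 assumes et: "test_fun et"
 shows "cv rho et x - et x = LI (%t. indicator {0..1} t * (t * LI (%y. Psi y * lap et (x - t *\<^sub>R y))))"
proof -
 note [measurable] = test_fun_measurable[OF et] test_fun_measurable[OF test_fun_pd[OF et]]
 have rho_int: "Lint (rho :: real^'n => real)" by (rule test_fun_integrable[OF test_fun_rho])
 have FTC: "LI (%t. (- (\<Sum>i\<in>UNIV. pd i et (x - t *\<^sub>R y) * y $ i)) * indicator {0..1} t) = et (x - y) - et x" for y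
 proof -
  have D: "((%t. et (x - t *\<^sub>R y)) has_real_derivative - (\<Sum>i\<in>UNIV. pd i et (x - t *\<^sub>R y) * y $ i)) (at t)" for t
  proof -
   have "((%t. x - t *\<^sub>R y) has_derivative (%h. - (h *\<^sub>R y))) (at t)" by (auto intro!: derivative_eq_intros)
   from has_derivative_compose[OF this has_derivative_pd_on[OF test_fun_differentiable[OF et]]]
   have "((%t. et (x - t *\<^sub>R y)) has_derivative (%h. \<Sum>i\<in>UNIV. pd i et (x - t *\<^sub>R y) * (- (h *\<^sub>R y)) $ i)) (at t)" .
   moreover have "(%h. \<Sum>i\<in>UNIV. pd i et (x - t *\<^sub>R y) * (- (h *\<^sub>R y)) $ i) = (*) (- (\<Sum>i\<in>UNIV. pd i et (x - t *\<^sub>R y) * y $ i))"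
    by (auto simp: sum_distrib_left sum_negf algebra_simps)
   ultimately show ?thesis by (simp add: has_field_derivative_def)
  qed
  have C: "isCont (%t. - (\<Sum>i\<in>UNIV. pd i et (x - t *\<^sub>R y) * y $ i)) t" for t
  proof -
   have "continuous_on UNIV (%t. - (\<Sum>i\<in>UNIV. pd i et (x - t *\<^sub>R y) * y $ i))"
    by (intro continuous_intros continuous_on_compose2[OF test_fun_continuous[OF test_fun_pd[OF et]]]) auto
   thus ?thesis by (simp add: continuous_on_eq_continuous_at)
  qed
  have "LI (%t. (- (\<Sum>i\<in>UNIV. pd i et (x - t *\<^sub>R y) * y $ i)) * indicator {0..1} t) = et (x - 1 *\<^sub>R y) - et (x - 0 *\<^sub>R y)"
   by (rule integral_FTC_Icc_real[OF _ D C]) simp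
  thus ?thesis by simp
 qed
 have "\<exists>b>0. \<forall>x. \<bar>pd i et x\<bar> <= b" for i by (intro test_fun_bounded test_fun_pd et)
 then obtain b where b: "!!i. b i > 0" "!!i x. \<bar>pd i et x\<bar> <= b i" by metis
 have "\<exists>b>0. \<forall>x::real^'n. \<bar>pd i Psi x\<bar> <= b" for i by (intro test_fun_bounded test_fun_pd test_fun_Psi)
 then obtain c where c: "!!i. c i > 0" "!!i. !!x::real^'n. \<bar>pd i Psi x\<bar> <= c i" by metis
 note [measurable] = test_fun_measurable[OF test_fun_pd[OF test_fun_Psi]]
 define g where "g t y = indicator {0..1} t * (\<Sum>i\<in>UNIV. pd i Psi y * pd i et (x - t *\<^sub>R y))" for t :: real and y
 have gi: "integrable (lborel \<Otimes>\<^sub>M lborel) (%(t, y). g t y)"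
 proof (rule integrable_bounded_pair)
  show "(%(t, y). g t y) \<in> borel_measurable (lborel \<Otimes>\<^sub>M lborel)" unfolding g_def by measurable
  fix t :: real and y :: "real^'n"
  have "\<bar>\<Sum>i\<in>UNIV. pd i Psi y * pd i et (x - t *\<^sub>R y)\<bar> <= (\<Sum>i\<in>UNIV. \<bar>pd i Psi y * pd i et (x - t *\<^sub>R y)\<bar>)" by (rule sum_abs)
  also have "\<dots> <= (\<Sum>i\<in>UNIV. c i * b i)" unfolding abs_mult by (intro sum_mono mult_mono b(2) c(2) less_imp_le[OF c(1)] abs_ge_zero)
  finally show "\<bar>case (t, y) of (t, y) => g t y\<bar> <= (\<Sum>i\<in>UNIV. c i * b i)"
   by (auto simp: g_def indicator_def intro!: sum_nonneg mult_nonneg_nonneg less_imp_le[OF b(1)] less_imp_le[OF c(1)])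
  show "(case (t, y) of (t, y) => g t y) = 0" if "t \<notin> {0..1} \<or> norm y > 1"
   using that
  proof
   assume "norm y > 1"
   hence "rho y = 0" by (intro rho_zero) simp
   thus ?thesis by (simp add: g_def pd_Psi)
  qed (simp add: g_def)
 qed
 have "cv rho et x - et x = LI (%y. rho y * et (x - y) - rho y * et x)"
  using cv_test_integrable[OF rho_int et, of x] rho_int by (simp add: cv_def integral_rho)
 also have "\<dots> = LI (%y. LI (%t. g t y))"
 proof (rule Bochner_Integration.integral_cong[OF refl])
  fix y
  have "rho y * et (x - y) - rho y * et x = LI (%t. rho y * ((- (\<Sum>i\<in>UNIV. pd i et (x - t *\<^sub>R y) * y $ i)) * indicator {0..1} t))"
   by (simp only: integral_mult_right_zero FTC right_diff_distrib)
  also have "\<dots> = LI (%t. g t y)"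
   by (intro Bochner_Integration.integral_cong refl)
    (simp add: g_def pd_Psi sum_distrib_left sum_distrib_right sum_negf algebra_simps)
  finally show "rho y * et (x - y) - rho y * et x = LI (%t. g t y)" .
 qed
 also have "\<dots> = LI (%t. LI (%y. g t y))"
  by (rule lborel_pair.Fubini_integral[OF gi])
 also have "\<dots> = LI (%t. indicator {0..1} t * (t * LI (%y. Psi y * lap et (x - t *\<^sub>R y))))"
 proof (rule Bochner_Integration.integral_cong[OF refl])
  fix t :: real
  have s: "smooth (%y. pd i et (x + (- t) *\<^sub>R y))" for i by (intro smooth_affine smooth_pd test_fun_smooth et)
  have i1: "Lint (%y. pd i Psi y * pd i et (x - t *\<^sub>R y))" for i
   using test_fun_integrable[OF test_fun_mult[OF test_fun_pd[OF test_fun_Psi] s]] by simp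
  have i2: "Lint (%y. Psi y * pd i (pd i et) (x - t *\<^sub>R y))" for i
   using test_fun_integrable[OF test_fun_mult[OF test_fun_Psi smooth_affine[OF smooth_pd[OF smooth_pd[OF test_fun_smooth[OF et]]], of i i x "- t"]]] by simp
  have ibp: "LI (%y. pd i Psi y * pd i et (x - t *\<^sub>R y)) = t * LI (%y. Psi y * pd i (pd i et) (x - t *\<^sub>R y))" for i
  proof -
   have "LI (%y. pd i Psi y * pd i et (x + (- t) *\<^sub>R y)) = - LI (%y. Psi y * pd i (%y. pd i et (x + (- t) *\<^sub>R y)) y)"
    by (rule integration_by_parts[OF test_fun_Psi s])
   also have "pd i (%y. pd i et (x + (- t) *\<^sub>R y)) = (%y. - t * pd i (pd i et) (x + (- t) *\<^sub>R y))"
    by (intro pd_affine test_fun_differentiable test_fun_pd et)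
   finally show ?thesis by (simp add: mult.left_commute[of _ t])
  qed
  have "LI (%y. g t y) = indicator {0..1} t * (\<Sum>i\<in>UNIV. LI (%y. pd i Psi y * pd i et (x - t *\<^sub>R y)))"
   unfolding g_def using i1 by simp
  also have "\<dots> = indicator {0..1} t * (t * LI (%y. Psi y * lap et (x - t *\<^sub>R y)))"
   unfolding lap_def ibp sum_distrib_left[symmetric] using i2 by (simp add: sum_distrib_left)
  finally show "LI (%y. g t y) = indicator {0..1} t * (t * LI (%y. Psi y * lap et (x - t *\<^sub>R y)))" .
 qed
 finally show ?thesis .
qed

lemma Ker_pair_measurable [measurable]:
 "(%(t, z). indicator {0<..1} t * (t / t ^ CARD('n)) * Psi ((1 / t) *\<^sub>R z) :: real) \<in> borel_measurable (borel \<Otimes>\<^sub>M (borel :: (real^'n::finite) measure))"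
 by measurable

lemma Ker_measurable [measurable]: "Ker \<in> bmeas"
proof -
 have "(%z::real^'n. LI (%t. indicator {0<..1} t * (t / t ^ CARD('n)) * Psi ((1 / t) *\<^sub>R z))) \<in> bmeas"
  by measurable
 thus ?thesis by (simp add: Ker_def[abs_def])
qed

lemma Psi_dilate_integral:
 fixes \<zeta> :: "real^'n::finite => real"
 assumes [measurable]: "\<zeta> \<in> bmeas" and t: "t > 0"
 shows "LI (%z. t / t ^ CARD('n) * Psi ((1 / t) *\<^sub>R z) * \<zeta> (x - z)) = t * LI (%y. Psi y * \<zeta> (x - t *\<^sub>R y))"
proof -
 have "LI (%z. t / t ^ CARD('n) * Psi ((1 / t) *\<^sub>R z) * \<zeta> (x - z))
  = \<bar>t\<bar> ^ DIM(real^'n) * LI (%y. t / t ^ CARD('n) * Psi ((1 / t) *\<^sub>R (0 + t *\<^sub>R y)) * \<zeta> (x - (0 + t *\<^sub>R y)))"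
  using t by (intro integral_lborel_affine) auto
 also have "\<dots> = t ^ CARD('n) * (t / t ^ CARD('n) * LI (%y. Psi y * \<zeta> (x - t *\<^sub>R y)))"
  using t by (simp add: mult.assoc)
 also have "\<dots> = t * LI (%y. Psi y * \<zeta> (x - t *\<^sub>R y))" using t by simp
 finally show ?thesis .
qed

lemma Psi_dilate_integrable:
 fixes \<zeta> :: "real^'n::finite => real"
 assumes [measurable]: "\<zeta> \<in> bmeas" and B: "!!x. \<bar>\<zeta> x\<bar> <= B" and t: "t > 0"
 shows "Lint (%z. t / t ^ CARD('n) * Psi ((1 / t) *\<^sub>R z) * \<zeta> (x - z))"
proof (rule integrable_bnd)
 have "Lint (%z::real^'n. Psi (0 + (1 / t) *\<^sub>R z))"
  using t by (intro integrable_lborel_affine test_fun_integrable test_fun_Psi) auto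
 thus "Lint (%z::real^'n. B * (t / t ^ CARD('n)) * Psi ((1 / t) *\<^sub>R z))" by simp
 show "AE z in lborel. norm (t / t ^ CARD('n) * Psi ((1 / t) *\<^sub>R z) * \<zeta> (x - z)) <= norm (B * (t / t ^ CARD('n)) * Psi ((1 / t) *\<^sub>R z))"
 proof (intro always_eventually allI)
  fix z :: "real^'n"
  have "\<bar>t / t ^ CARD('n) * Psi ((1 / t) *\<^sub>R z)\<bar> * \<bar>\<zeta> (x - z)\<bar> <= \<bar>t / t ^ CARD('n) * Psi ((1 / t) *\<^sub>R z)\<bar> * B"
   by (intro mult_left_mono B) auto
  moreover have "0 <= B" using B[of 0] by linarith
  ultimately show "norm (t / t ^ CARD('n) * Psi ((1 / t) *\<^sub>R z) * \<zeta> (x - z)) <= norm (B * (t / t ^ CARD('n)) * Psi ((1 / t) *\<^sub>R z))"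
   by (simp add: abs_mult mult.commute mult.left_commute)
 qed
qed measurable

text \<open>After the substitution \<open>z = t y\<close> the slice at \<open>t\<close> has mass at
  most \<open>t\<close> times a constant, so the singularity at the origin does no harm to
  integrability.\<close>

lemma Ker_pair_integrable:
 fixes \<zeta> :: "real^'n::finite => real"
 assumes [measurable]: "\<zeta> \<in> bmeas" and B: "!!x. \<bar>\<zeta> x\<bar> <= B"
 shows "integrable (lborel \<Otimes>\<^sub>M lborel) (%(t, z). indicator {0<..1} t * (t / t ^ CARD('n)) * Psi ((1 / t) *\<^sub>R z) * \<zeta> (x - z))"
proof (rule lborel_pair.Fubini_integrable)
 define F where "F t = LI (%z. norm (case (t, z) of (t, z) => indicator {0<..1} t * (t / t ^ CARD('n)) * Psi ((1 / t) *\<^sub>R z) * \<zeta> (x - z)))" for t :: real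
 define C where "C = B * LI (%y::real^'n. Psi y)"
 have F: "\<bar>F t\<bar> <= C * indicator {0<..1} t" for t
 proof (cases "t \<in> {0<..1}")
  case True
  hence t: "t > 0" "t <= 1" by auto
  have "F t = LI (%z. t / t ^ CARD('n) * Psi ((1 / t) *\<^sub>R z) * \<bar>\<zeta> (x - z)\<bar>)"
   unfolding F_def using True by (simp add: abs_mult Psi_nonneg)
  also have "\<dots> = t * LI (%y. Psi y * \<bar>\<zeta> (x - t *\<^sub>R y)\<bar>)"
   by (rule Psi_dilate_integral[of "%x. \<bar>\<zeta> x\<bar>"]) (use t in auto)
  finally have eq: "F t = t * LI (%y. Psi y * \<bar>\<zeta> (x - t *\<^sub>R y)\<bar>)" .
  have "LI (%y. Psi y * \<bar>\<zeta> (x - t *\<^sub>R y)\<bar>) <= LI (%y::real^'n. Psi y * B)"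
  proof (rule integral_mono_AE)
   show i: "Lint (%y::real^'n. Psi y * B)"
    by (intro integrable_mult_left test_fun_integrable test_fun_Psi)
   show "Lint (%y. Psi y * \<bar>\<zeta> (x - t *\<^sub>R y)\<bar>)"
    by (rule integrable_bnd[OF i])
     (auto intro!: mult_mono B order_trans[OF B abs_ge_self] AE_I2 simp: Psi_nonneg abs_mult)
   show "AE y in lborel. Psi y * \<bar>\<zeta> (x - t *\<^sub>R y)\<bar> <= Psi y * B"
    by (auto intro!: mult_left_mono B Psi_nonneg)
  qed
  hence "LI (%y. Psi y * \<bar>\<zeta> (x - t *\<^sub>R y)\<bar>) <= C" by (simp add: C_def mult.commute)
  moreover have nn: "0 <= LI (%y. Psi y * \<bar>\<zeta> (x - t *\<^sub>R y)\<bar>)" by (intro integral_nonneg_AE) (auto simp: Psi_nonneg)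
  ultimately have "t * LI (%y. Psi y * \<bar>\<zeta> (x - t *\<^sub>R y)\<bar>) <= 1 * C" using t by (intro mult_mono) auto
  moreover have "0 <= t * LI (%y. Psi y * \<bar>\<zeta> (x - t *\<^sub>R y)\<bar>)" using t nn by simp
  ultimately show ?thesis using True eq by simp
 qed (auto simp: F_def)
 have "Lint (%t. C * (indicator {0<..1::real} t :: real))"
  by (intro integrable_mult_right integrable_real_indicator) auto
 moreover have "F \<in> borel_measurable lborel" unfolding F_def by measurable
 moreover have "AE t in lborel. norm (F t) <= norm (C * (indicator {0<..1} t :: real))"
  using F by (intro always_eventually allI) (metis abs_ge_self order_trans real_norm_def)
 ultimately show "Lint (%t. LI (%z. norm (case (t, z) of (t, z) => indicator {0<..1} t * (t / t ^ CARD('n)) * Psi ((1 / t) *\<^sub>R z) * \<zeta> (x - z))))"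
  unfolding F_def[symmetric] by (rule integrable_bnd)
 show "AE t in lborel. Lint (%z. case (t, z) of (t, z) => indicator {0<..1} t * (t / t ^ CARD('n)) * Psi ((1 / t) *\<^sub>R z) * \<zeta> (x - z))"
 proof (intro always_eventually allI)
  fix t :: real
  show "Lint (%z. case (t, z) of (t, z) => indicator {0<..1} t * (t / t ^ CARD('n)) * Psi ((1 / t) *\<^sub>R z) * \<zeta> (x - z))"
   using Psi_dilate_integrable[of \<zeta> B t x] B by (cases "t \<in> {0<..1}") auto
 qed
qed measurable

lemma cv_Ker_bounded:
 fixes \<zeta> :: "real^'n::finite => real"
 assumes [measurable]: "\<zeta> \<in> bmeas" and B: "!!x. \<bar>\<zeta> x\<bar> <= B"
 shows "cv Ker \<zeta> x = LI (%t. indicator {0<..1} t * (t * LI (%y. Psi y * \<zeta> (x - t *\<^sub>R y))))"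
  and "Lint (%t. indicator {0<..1} t * (t * LI (%y. Psi y * \<zeta> (x - t *\<^sub>R y))))"
  and "Lint (%z. Ker z * \<zeta> (x - z))"
proof -
 note I = Ker_pair_integrable[OF assms, of x]
 have in_z: "LI (%z. indicator {0<..1} t * (t / t ^ CARD('n)) * Psi ((1 / t) *\<^sub>R z) * \<zeta> (x - z))
  = indicator {0<..1} t * (t * LI (%y. Psi y * \<zeta> (x - t *\<^sub>R y)))" for t
  using Psi_dilate_integral[of \<zeta> t x] by (cases "t \<in> {0<..1}") auto
 have in_t: "LI (%t. indicator {0<..1} t * (t / t ^ CARD('n)) * Psi ((1 / t) *\<^sub>R z) * \<zeta> (x - z)) = Ker z * \<zeta> (x - z)" for z
  by (simp only: Ker_def integral_mult_left_zero)
 show "cv Ker \<zeta> x = LI (%t. indicator {0<..1} t * (t * LI (%y. Psi y * \<zeta> (x - t *\<^sub>R y))))"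
  using lborel_pair.Fubini_integral[OF I] unfolding in_z in_t cv_def .
 show "Lint (%t. indicator {0<..1} t * (t * LI (%y. Psi y * \<zeta> (x - t *\<^sub>R y))))"
  using lborel_pair.integrable_fst[OF I] unfolding in_z .
 show "Lint (%z. Ker z * \<zeta> (x - z))"
  using lborel_pair.integrable_snd[OF I] unfolding in_t .
qed

lemma Ker_nonneg: "0 <= Ker z"
 unfolding Ker_def by (intro integral_nonneg_AE) (auto simp: Psi_nonneg indicator_def)

lemma Ker_integrable: "Lint (Ker :: real^'n::finite => real)"
 using cv_Ker_bounded(3)[of "%x. 1" 1] by simp

lemma Ker_zero: assumes "norm z > 1" shows "Ker z = 0"
proof -
 have "indicator {0<..1} t * (t / t ^ CARD('a)) * Psi ((1 / t) *\<^sub>R z) = 0" for t :: real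
 proof (cases "t \<in> {0<..1}")
  case True
  hence "norm ((1 / t) *\<^sub>R z) >= 1" using assms by (simp add: field_simps)
  thus ?thesis by (simp add: Psi_zero)
 qed simp
 hence "(%t. indicator {0<..1} t * (t / t ^ CARD('a)) * Psi ((1 / t) *\<^sub>R z)) = (%t. 0)" by (intro ext)
 thus ?thesis by (simp add: Ker_def)
qed

lemma ball_kernel_Ker: "ball_kernel Ker"
 unfolding ball_kernel_def by (auto simp: Ker_integrable Ker_zero) (simp add: Ker_def Psi_def)

lemma cv_Ker_lap:
 assumes et: "test_fun et"
 shows "cv Ker (lap et) x = cv rho et x - et x"
proof -
 have t: "test_fun (lap et)" by (rule test_fun_lap[OF et])
 obtain B where B: "!!x. \<bar>lap et x\<bar> <= B" using test_fun_bounded[OF t] by blast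
 have "cv Ker (lap et) x = LI (%t. indicator {0<..1} t * (t * LI (%y. Psi y * lap et (x - t *\<^sub>R y))))"
  by (rule cv_Ker_bounded(1)[OF test_fun_measurable[OF t] B])
 also have "\<dots> = LI (%t. indicator {0..1} t * (t * LI (%y. Psi y * lap et (x - t *\<^sub>R y))))"
  by (rule Bochner_Integration.integral_cong[OF refl]) (auto simp: indicator_def)
 also have "\<dots> = cv rho et x - et x" by (rule rho_average_identity[OF et, symmetric])
 finally show ?thesis .
qed

text \<open>Duality: the equation is tested with \<open>cv Ker et\<close>, whose Laplacian is
  \<open>cv rho et - et\<close>. Both kernels are even, so the convolutions can be moved onto
  \<open>u\<close> and \<open>v\<close>, and the difference of the two sides annihilates every test
  function.\<close>

lemma parametrix_representation:
 fixes u v :: "real^'n::finite => real"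
 assumes u: "loc_int u" and v: "loc_int v"
  and w: "!!ph. test_fun ph ==> LI (%x. u x * lap ph x) = LI (%x. v x * ph x)"
 shows "AE x in lborel. u x = cv rho u x - cv Ker v x"
proof -
 define z where "z x = (u x + (-1) * cv rho u x) + 1 * cv Ker v x" for x
 have l: "loc_int z" unfolding z_def by (intro loc_int_add_cmult loc_int_cv u v ball_kernel_rho ball_kernel_Ker)
 have "AE x in lborel. z x = 0"
 proof (rule fundamental_lemma[OF l])
  fix et :: "real^'n => real" assume et: "test_fun et"
  obtain R where R: "!!x. norm x > R ==> et x = 0" using test_fun_support[OF et] by blast
  obtain B where B: "!!x. \<bar>et x\<bar> <= B" using test_fun_bounded[OF et] by blast
  note m = test_fun_measurable[OF et]
  note s1 = cv_swap[OF ball_kernel_rho u m B R]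
  note s2 = cv_swap[OF ball_kernel_Ker v m B R]
  have tK: "test_fun (cv Ker et)" and tr: "test_fun (cv rho et)"
   by (intro test_fun_cv ball_kernel_Ker ball_kernel_rho et)+
  have "LI (%x. v x * cv Ker et x) = LI (%x. u x * lap (cv Ker et) x)" using w[OF tK] by simp
  also have "lap (cv Ker et) = (%x. cv rho et x - et x)"
   using lap_cv[OF ball_kernel_Ker et] cv_Ker_lap[OF et] by auto
  also have "LI (%x. u x * (cv rho et x - et x)) = LI (%x. u x * cv rho et x) - LI (%x. u x * et x)"
   using loc_int_mult_test[OF u tr] loc_int_mult_test[OF u et] by (simp add: right_diff_distrib)
  finally have eq: "LI (%x. v x * cv Ker et x) = LI (%x. u x * cv rho et x) - LI (%x. u x * et x)" .
  have "LI (%x. z x * et x) = LI (%x. u x * et x - cv rho u x * et x + cv Ker v x * et x)"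
   by (simp add: z_def algebra_simps)
  also have "\<dots> = LI (%x. u x * et x) - LI (%x. cv rho u x * et x) + LI (%x. cv Ker v x * et x)"
   using s1(1) s2(1) loc_int_mult_test[OF u et] by simp
  also have "\<dots> = 0" using s1(2) s2(2) eq by simp
  finally show "LI (%x. z x * et x) = 0" .
 qed
 thus ?thesis by eventually_elim (simp add: z_def)
qed

section \<open>Integrability of the parametrix and Young's inequality\<close>

text \<open>Away from the origin the power is dominated by a sum over dyadic balls. The ball of
  radius \<open>(1/2)^k\<close> has measure proportional to \<open>2^(- k N)\<close>, so the
  integrals form a geometric series with ratio \<open>q = 2 powr (s - N) < 1\<close>.\<close>

lemma integrable_norm_powr_ball:
 assumes s: "0 <= s" "s < real CARD('n::finite)"
 shows "Lint (%z::real^'n. indicator (ball 0 1) z * norm z powr (- s))"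
proof (rule integrableI_nonneg)
 define V where "V = measure lborel (ball (0::real^'n) 1)"
 define q where "q = 2 powr (s - real CARD('n))"
 have q: "0 < q" "q < 1" using s by (auto simp: q_def powr_less_one)
 have le: "ennreal (indicator (ball 0 1) z * norm z powr (- s))
   <= (\<Sum>k. ennreal (2 powr (real (Suc k) * s)) * indicator (ball 0 ((1/2)^k)) z)" if z: "z \<noteq> 0" for z :: "real^'n"
 proof (cases "norm z < 1")
  case True
  have "\<exists>n. (1/2)^n < norm z" using z by (intro real_arch_pow_inv) auto
  hence ex: "\<exists>n. (1/2)^n <= norm z" by (auto intro: less_imp_le)
  \<comment> \<open>The least such \<open>n\<close> places \<open>z\<close> in the ball of radius
    \<open>(1/2)^(n-1)\<close>; this is why the weights carry \<open>Suc k\<close>.\<close>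
  define n where "n = (LEAST n. (1/2)^n <= norm z)"
  have n: "(1/2)^n <= norm z" unfolding n_def using ex by (rule LeastI_ex)
  have "n \<noteq> 0" using n True by (intro notI) simp
  then obtain k where k: "n = Suc k" by (cases n) auto
  have "\<not> (1/2)^k <= norm z" using not_less_Least[of k "%n. (1/2)^n <= norm z"] k by (auto simp: n_def)
  hence in_ball: "z \<in> ball 0 ((1/2)^k)" by simp
  have "norm z powr (- s) <= ((1/2)^n) powr (- s)"
   using n s by (intro powr_mono2') auto
  also have "((1/2::real)^n) powr (- s) = 2 powr (real (Suc k) * s)"
  proof -
   have "(1/2::real)^n = 2 powr (- real n)" by (simp add: powr_minus powr_realpow power_one_over inverse_eq_divide)
   hence "((1/2::real)^n) powr (- s) = 2 powr (real n * s)" by (simp add: powr_powr)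
   thus ?thesis by (simp add: k)
  qed
  finally have "indicator (ball 0 1) z * norm z powr (- s) <= 2 powr (real (Suc k) * s)" using True by simp
  hence "ennreal (indicator (ball 0 1) z * norm z powr (- s)) <= ennreal (2 powr (real (Suc k) * s)) * indicator (ball 0 ((1/2)^k)) z"
   using in_ball by (simp add: ennreal_leI)
  also have "\<dots> <= (\<Sum>k. ennreal (2 powr (real (Suc k) * s)) * indicator (ball 0 ((1/2)^k)) z)"
  proof -
   have "f k <= (\<Sum>k. f k)" for f :: "nat => ennreal" using sum_le_suminf[of f "{k}"] by simp
   thus ?thesis .
  qed
  finally show ?thesis .
 qed simp
 have "(\<integral>\<^sup>+z. ennreal (indicator (ball 0 1) z * norm z powr (- s)) \<partial>(lborel :: (real^'n) measure))
  <= (\<integral>\<^sup>+z. (\<Sum>k. ennreal (2 powr (real (Suc k) * s)) * indicator (ball 0 ((1/2)^k)) z) \<partial>(lborel :: (real^'n) measure))"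
 proof (rule nn_integral_mono_AE)
  have "AE z in (lborel :: (real^'n) measure). z \<noteq> 0" by (rule AE_lborel_singleton)
  thus "AE z in (lborel :: (real^'n) measure). ennreal (indicator (ball 0 1) z * norm z powr (- s))
   <= (\<Sum>k. ennreal (2 powr (real (Suc k) * s)) * indicator (ball 0 ((1/2)^k)) z)"
   by eventually_elim (rule le)
 qed
 also have "\<dots> = (\<Sum>k. ennreal (2 powr (real (Suc k) * s)) * emeasure lborel (ball (0::real^'n) ((1/2)^k)))"
 proof -
  have "(\<integral>\<^sup>+z. (\<Sum>k. ennreal (2 powr (real (Suc k) * s)) * indicator (ball 0 ((1/2)^k)) z) \<partial>(lborel :: (real^'n) measure))
   = (\<Sum>k. \<integral>\<^sup>+z. ennreal (2 powr (real (Suc k) * s)) * indicator (ball 0 ((1/2)^k)) z \<partial>(lborel :: (real^'n) measure))"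
   by (intro nn_integral_suminf borel_measurable_times_ennreal borel_measurable_const borel_measurable_indicator) (simp add: borel_open)
  also have "\<dots> = (\<Sum>k. ennreal (2 powr (real (Suc k) * s)) * emeasure lborel (ball (0::real^'n) ((1/2)^k)))"
   by (intro arg_cong[where f = suminf] ext nn_integral_cmult_indicator) simp
  finally show ?thesis .
 qed
 also have "\<dots> = (\<Sum>k. ennreal (2 powr s * V * q ^ k))"
 proof (intro arg_cong[where f = suminf] ext)
  fix k
  have em: "emeasure lborel (ball (0::real^'n) ((1/2)^k)) = ennreal (((1/2)^k) ^ CARD('n) * V)"
  proof -
   have "emeasure lborel (ball (0::real^'n) ((1/2)^k)) = ennreal (measure lborel (ball (0::real^'n) ((1/2)^k)))"
    using emeasure_lborel_ball_finite[of "0::real^'n" "(1/2)^k"] by (intro emeasure_eq_ennreal_measure) auto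
   also have "measure lborel (ball (0::real^'n) ((1/2)^k)) = ((1/2)^k) ^ CARD('n) * V"
    using content_ball_conv_unit_ball[of "(1/2)^k" "0::real^'n"] by (simp add: V_def)
   finally show ?thesis .
  qed
  have qk: "q ^ k = 2 powr ((s - real CARD('n)) * real k)"
   using q powr_realpow[of q k] by (simp add: q_def powr_powr)
  have hk: "((1/2::real)^k) ^ CARD('n) = 2 powr (- real (k * CARD('n)))"
   using powr_realpow[of 2 "k * CARD('n)"]
   by (simp only: powr_minus power_mult[symmetric] power_one_over inverse_eq_divide)
  have "2 powr (real (Suc k) * s) * (2 powr (- real (k * CARD('n))) * V) = 2 powr (real (Suc k) * s + - real (k * CARD('n))) * V"
   by (simp only: powr_add mult.assoc)
  also have "real (Suc k) * s + - real (k * CARD('n)) = s + (s - real CARD('n)) * real k" by (simp add: algebra_simps)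
  also have "2 powr (s + (s - real CARD('n)) * real k) * V = 2 powr s * V * 2 powr ((s - real CARD('n)) * real k)"
   by (simp only: powr_add mult.assoc mult.commute[of V])
  finally have eq: "2 powr (real (Suc k) * s) * (((1/2)^k) ^ CARD('n) * V) = 2 powr s * V * q ^ k" unfolding qk hk .
  have nn: "0 <= ((1/2)^k) ^ CARD('n) * V" by (simp add: V_def)
  show "ennreal (2 powr (real (Suc k) * s)) * emeasure lborel (ball (0::real^'n) ((1/2)^k)) = ennreal (2 powr s * V * q ^ k)"
   unfolding em ennreal_mult[OF powr_ge_zero nn, symmetric] eq ..
 qed
 also have "\<dots> = ennreal (\<Sum>k. 2 powr s * V * q ^ k)"
 proof (rule suminf_ennreal2)
  show "summable (%k. 2 powr s * V * q ^ k)" using q by (intro summable_mult summable_geometric) auto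
  show "0 <= 2 powr s * V * q ^ k" for k using q by (simp add: V_def)
 qed
 also have "\<dots> < \<infinity>" by simp
 finally show "(\<integral>\<^sup>+z. ennreal (indicator (ball 0 1) z * norm z powr (- s)) \<partial>(lborel :: (real^'n) measure)) < \<infinity>" .
 show "(%z::real^'n. indicator (ball 0 1) z * norm z powr (- s)) \<in> borel_measurable lborel"
  by (intro borel_measurable_times borel_measurable_indicator) auto
qed simp

text \<open>The integrand vanishes unless \<open>t\<close> exceeds \<open>norm z\<close>, so the
  integral is at most a constant times that of \<open>t^(1-N)\<close> from \<open>norm z\<close> to
  1. This gives the singularity \<open>2 - N\<close> of the fundamental solution.\<close>

lemma Ker_le:
 assumes N: "CARD('n::finite) >= 3"
 shows "\<exists>C>0. \<forall>z::real^'n. z \<noteq> 0 --> Ker z <= C * (indicator (ball 0 1) z * norm z powr (- real (CARD('n) - 2)))"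
proof -
 obtain M where M: "M > 0" "!!y::real^'n. \<bar>Psi y\<bar> <= M" using test_fun_bounded[OF test_fun_Psi] by blast
 \<comment> \<open>With \<open>N = m + 3\<close> the integrand is \<open>inverse t ^ (m + 2)\<close>
   and its primitive has exponent \<open>m + 1 = N - 2 > 0\<close>.\<close>
 define m where "m = CARD('n) - 3"
 have Nm: "CARD('n) = m + 3" using N by (simp add: m_def)
 have "Ker z <= M * (indicator (ball 0 1) z * norm z powr (- real (CARD('n) - 2)))" if z: "z \<noteq> 0" for z :: "real^'n"
 proof (cases "norm z < 1")
  case False
  have "Ker z = 0"
  proof -
   have "indicator {0<..1} t * (t / t ^ CARD('n)) * Psi ((1 / t) *\<^sub>R z) = 0" for t :: real
   proof (cases "t \<in> {0<..1}")
    case True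
    hence "norm ((1 / t) *\<^sub>R z) >= 1" using False by (simp add: field_simps)
    thus ?thesis by (simp add: Psi_zero)
   qed simp
   hence "(%t. indicator {0<..1} t * (t / t ^ CARD('n)) * Psi ((1 / t) *\<^sub>R z)) = (%t. 0)" by (intro ext)
   thus ?thesis by (simp add: Ker_def)
  qed
  thus ?thesis using False by simp
 next
  case True
  define a where "a = norm z"
  have a: "0 < a" "a < 1" using z True by (auto simp: a_def)
  have D: "((%t. - (1 / real (m + 1)) * inverse t ^ (m + 1)) has_real_derivative inverse t ^ (m + 2)) (at t)" if "a <= t" "t <= 1" for t
  proof -
   have t: "t \<noteq> 0" using that a by auto
   show ?thesis
    by (rule DERIV_cong[OF DERIV_cmult[OF DERIV_power[OF DERIV_inverse[OF t]]]]) (simp add: power_add power2_eq_square del: of_nat_add of_nat_Suc)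
  qed
  have C: "isCont (%t. inverse t ^ (m + 2)) t" if "a <= t" "t <= 1" for t
   using that a by (auto intro!: continuous_intros)
  have FTC: "has_bochner_integral lborel (%t. inverse t ^ (m + 2) * indicator {a..1} t)
   (- (1 / real (m + 1)) * inverse 1 ^ (m + 1) - - (1 / real (m + 1)) * inverse a ^ (m + 1))"
   by (rule has_bochner_integral_FTC_Icc_real[OF _ D C]) (use a in auto)
  have "Ker z <= LI (%t. M * (inverse t ^ (m + 2) * indicator {a..1} t))"
   unfolding Ker_def
  proof (rule integral_mono_AE')
   show "Lint (%t. M * (inverse t ^ (m + 2) * indicator {a..1} t))"
    using FTC by (auto simp: has_bochner_integral_iff)
   show "AE t in lborel. indicator {0<..1} t * (t / t ^ CARD('n)) * Psi ((1 / t) *\<^sub>R z) <= M * (inverse t ^ (m + 2) * indicator {a..1} t)"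
   proof (intro always_eventually allI)
    fix t :: real
    consider "t \<notin> {0<..1}" | "t \<in> {0<..1}" "t < a" | "t \<in> {a..1}" "t > 0" using a by force
    thus "indicator {0<..1} t * (t / t ^ CARD('n)) * Psi ((1 / t) *\<^sub>R z) <= M * (inverse t ^ (m + 2) * indicator {a..1} t)"
    proof cases
     case 1
     thus ?thesis using a by (auto simp: indicator_def)
    next
     case 2
     hence "norm ((1 / t) *\<^sub>R z) >= 1" by (simp add: field_simps a_def)
     thus ?thesis using 2 by (simp add: Psi_zero)
    next
     case 3
     have "t / t ^ CARD('n) = inverse t ^ (m + 2)" unfolding Nm using 3 by (simp add: field_simps power_add eval_nat_numeral)
     moreover have "inverse t ^ (m + 2) * Psi ((1 / t) *\<^sub>R z) <= inverse t ^ (m + 2) * M"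
      using 3 M(2)[of "(1 / t) *\<^sub>R z"] by (intro mult_left_mono) auto
     ultimately show ?thesis using 3 by (simp add: mult.commute)
    qed
   qed
   show "AE t in lborel. 0 <= M * (inverse t ^ (m + 2) * indicator {a..1} t)"
    using M a by (auto simp: indicator_def intro!: AE_I2)
  qed
  also have "\<dots> = M * (1 / real (m + 1) * (inverse a ^ (m + 1) - 1))"
  proof -
   have "LI (%t. inverse t ^ (m + 2) * indicator {a..1} t) = 1 / real (m + 1) * (inverse a ^ (m + 1) - 1)"
    using has_bochner_integral_integral_eq[OF FTC] by (simp add: right_diff_distrib)
   thus ?thesis by (simp only: integral_mult_right_zero)
  qed
  also have "\<dots> <= M * (inverse a ^ (m + 1))"
  proof (intro mult_left_mono)
   have i1: "1 <= inverse a ^ (m + 1)" using a by (intro one_le_power) (simp add: one_le_inverse_iff)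
   have "1 / real (m + 1) * (inverse a ^ (m + 1) - 1) <= 1 * (inverse a ^ (m + 1) - 1)"
    using i1 by (intro mult_right_mono) auto
   thus "1 / real (m + 1) * (inverse a ^ (m + 1) - 1) <= inverse a ^ (m + 1)" by simp
  qed (use M in auto)
  also have "inverse a ^ (m + 1) = a powr (- real (CARD('n) - 2))"
  proof -
   have "real (CARD('n) - 2) = real (m + 1)" unfolding Nm by simp
   moreover have "a powr (- real (m + 1)) = inverse a ^ (m + 1)"
    using a powr_realpow[of a "m + 1"] by (simp only: powr_minus power_inverse)
   ultimately show ?thesis by simp
  qed
  finally show ?thesis using True by (simp add: a_def)
 qed
 thus ?thesis using M by blast
qed

lemma Ker_powr_integrable:
 assumes N: "CARD('n::finite) >= 3" and r: "1 <= r" "r * real (CARD('n) - 2) < real CARD('n)"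
 shows "Lint (%z::real^'n. Ker z powr r)"
proof -
 obtain C where C: "C > 0" "!!z::real^'n. z \<noteq> 0 ==> Ker z <= C * (indicator (ball 0 1) z * norm z powr (- real (CARD('n) - 2)))"
  using Ker_le[OF N] by blast
 have i: "Lint (%z::real^'n. C powr r * (indicator (ball 0 1) z * norm z powr (- (r * real (CARD('n) - 2)))))"
  using r by (intro integrable_mult_right integrable_norm_powr_ball) auto
 show ?thesis
 proof (rule integrable_bnd[OF i])
  have "AE z in (lborel :: (real^'n) measure). z \<noteq> 0" by (rule AE_lborel_singleton)
  thus "AE z in (lborel :: (real^'n) measure). norm (Ker z powr r) <= norm (C powr r * (indicator (ball 0 1) z * norm z powr (- (r * real (CARD('n) - 2)))))"
  proof eventually_elim
   case (elim z)
   have "Ker z powr r <= (C * (indicator (ball 0 1) z * norm z powr (- real (CARD('n) - 2)))) powr r"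
    using C(2)[OF elim] r by (intro powr_mono2 Ker_nonneg) auto
   also have "\<dots> = C powr r * (indicator (ball 0 1) z * norm z powr (- (r * real (CARD('n) - 2))))"
    using C(1) r by (cases "z \<in> ball 0 1") (auto simp: powr_mult powr_powr mult.commute)
   finally show ?case by simp
  qed
 qed measurable
qed

section \<open>Young's inequality for convolutions\<close>

lemma weighted_AM_GM3:
 fixes a b c \<alpha> bt \<gamma> :: real
 assumes "0 < a" "0 < b" "0 < c" "0 <= \<alpha>" "0 <= bt" "0 <= \<gamma>" "\<alpha> + bt + \<gamma> = 1"
 shows "a powr \<alpha> * b powr bt * c powr \<gamma> <= \<alpha> * a + bt * b + \<gamma> * c"
proof -
 define M where "M = \<alpha> * a + bt * b + \<gamma> * c"
 have M: "M > 0"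
 proof -
  have "\<alpha> > 0 \<or> bt > 0 \<or> \<gamma> > 0" using assms by linarith
  thus ?thesis unfolding M_def using assms
   by (smt (verit) mult_nonneg_nonneg mult_pos_pos)
 qed
 \<comment> \<open>Tangent line of \<open>ln\<close> at the weighted mean \<open>M\<close>.\<close>
 have t: "ln x <= x / M - 1 + ln M" if "x > 0" for x
  using ln_le_minus_one[of "x / M"] that M by (simp add: ln_div)
 have "\<alpha> * ln a + bt * ln b + \<gamma> * ln c <= \<alpha> * (a / M - 1 + ln M) + bt * (b / M - 1 + ln M) + \<gamma> * (c / M - 1 + ln M)"
  using assms by (intro add_mono mult_left_mono t) auto
 also have "\<dots> = (\<alpha> * a + bt * b + \<gamma> * c) / M + (\<alpha> + bt + \<gamma>) * (ln M - 1)" by (simp add: algebra_simps add_divide_distrib)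
 also have "\<dots> = ln M" using assms M by (simp add: M_def)
 finally have "exp (\<alpha> * ln a + bt * ln b + \<gamma> * ln c) <= M" using M by (metis exp_le_cancel_iff exp_ln)
 thus ?thesis using assms by (simp add: powr_def exp_add M_def)
qed

lemma convolution_L1:
 fixes k h :: "real^'n::finite => real"
 assumes k: "Lint k" and h: "Lint h"
 shows "AE x in lborel. Lint (%z. k z * h (x - z))"
  and "Lint (cv k h)" and "LI (%x. cv k h x) = LI (%x. k x) * LI (%x. h x)"
proof -
 have [measurable]: "k \<in> bmeas" "h \<in> bmeas" using k h by auto
 have tr: "Lint (%x. h (x - z))" "LI (%x. h (x - z)) = LI (%x. h x)"
   "LI (%x. \<bar>h (x - z)\<bar>) = LI (%x. \<bar>h x\<bar>)" for z
  using integrable_lborel_translate[OF h, of "-z"] integral_lborel_translate[of h "-z"] integral_lborel_translate[of "%x. \<bar>h x\<bar>" "-z"] by auto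
 have I: "integrable (lborel \<Otimes>\<^sub>M lborel) (%(z, x). k z * h (x - z))"
 proof (rule lborel_pair.Fubini_integrable)
  have "Lint (%z. \<bar>k z\<bar> * LI (%x. \<bar>h x\<bar>))" using k by simp
  thus "Lint (%z. LI (%x. norm (case (z, x) of (z, x) => k z * h (x - z))))"
   by (simp add: abs_mult tr)
 qed (use tr in auto)
 show "AE x in lborel. Lint (%z. k z * h (x - z))" by (rule lborel_pair.AE_integrable_snd[OF I])
 show "Lint (cv k h)" using lborel_pair.integrable_snd[OF I] by (simp add: cv_def[abs_def])
 show "LI (%x. cv k h x) = LI (%x. k x) * LI (%x. h x)"
  using lborel_pair.Fubini_integral[OF I] by (simp add: cv_def tr)
qed

text \<open>In place of the three-factor Hoelder inequality: weighted AM-GM with weights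
  \<open>1/q\<close>, \<open>1 - 1/s\<close>, \<open>1 - 1/r\<close>, applied to the joint integrand
  multiplied by a free scale \<open>c\<close>. The scale is optimised after integration.\<close>

lemma Young_pointwise:
 fixes a b :: "'a => real"
 assumes [measurable]: "a \<in> borel_measurable M" "b \<in> borel_measurable M"
  and nn: "!!z. 0 <= a z" "!!z. 0 <= b z"
  and q: "q > 1" and r: "r >= 1" and s: "s >= 1" and e: "1 / r + 1 / s = 1 + 1 / q"
  and ia: "integrable M (%z. a z powr r)" and ib: "integrable M (%z. b z powr s)"
  and iab: "integrable M (%z. a z powr r * b z powr s)"
 shows "integrable M (%z. a z * b z)"
  and "(\<integral>z. a z * b z \<partial>M) powr q <= (\<integral>z. a z powr r * b z powr s \<partial>M) * ((\<integral>z. a z powr r \<partial>M) + (\<integral>z. b z powr s \<partial>M)) powr (q - 1)"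
proof -
 define I where "I = (\<integral>z. a z powr r * b z powr s \<partial>M)"
 define S where "S = (\<integral>z. a z powr r \<partial>M) + (\<integral>z. b z powr s \<partial>M)"
 define \<alpha> where "\<alpha> = 1 / q"
 define bt where "bt = 1 - 1 / s"
 define \<gamma> where "\<gamma> = 1 - 1 / r"
 have w: "0 < \<alpha>" "\<alpha> < 1" "0 <= bt" "0 <= \<gamma>" "\<alpha> + bt + \<gamma> = 1" using q r s e by (auto simp: \<alpha>_def bt_def \<gamma>_def)
 have exps: "r * \<alpha> + r * bt = 1" "s * \<alpha> + s * \<gamma> = 1"
 proof -
  have "r * \<alpha> + r * bt = r * (1 + 1 / q - 1 / s)" by (simp add: \<alpha>_def bt_def algebra_simps)
  also have "1 + 1 / q - 1 / s = 1 / r" using e by simp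
  finally show "r * \<alpha> + r * bt = 1" using r by simp
  have "s * \<alpha> + s * \<gamma> = s * (1 + 1 / q - 1 / r)" by (simp add: \<alpha>_def \<gamma>_def algebra_simps)
  also have "1 + 1 / q - 1 / r = 1 / s" using e by simp
  finally show "s * \<alpha> + s * \<gamma> = 1" using s by simp
 qed
 have pt: "a z * b z <= c powr (- \<alpha>) * (\<alpha> * c * (a z powr r * b z powr s) + bt * (a z powr r) + \<gamma> * (b z powr s))" if c: "c > 0" for c z
 proof (cases "a z = 0 \<or> b z = 0")
  case True
  have "0 <= c powr (- \<alpha>) * (\<alpha> * c * (a z powr r * b z powr s) + bt * (a z powr r) + \<gamma> * (b z powr s))"
   using c w by (intro mult_nonneg_nonneg add_nonneg_nonneg) auto
  thus ?thesis using True by auto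
 next
  case False
  hence p: "a z > 0" "b z > 0" using nn[of z] by auto
  define A where "A = a z powr r"
  define B where "B = b z powr s"
  have AB: "A > 0" "B > 0" using p by (auto simp: A_def B_def)
  have "A powr \<alpha> * A powr bt = a z" using p exps(1) by (simp add: A_def powr_powr powr_add[symmetric])
  moreover have "B powr \<alpha> * B powr \<gamma> = b z" using p exps(2) by (simp add: B_def powr_powr powr_add[symmetric])
  ultimately have "a z * b z = (A powr \<alpha> * A powr bt) * (B powr \<alpha> * B powr \<gamma>)" by simp
  also have "\<dots> = c powr (- \<alpha>) * ((c * (A * B)) powr \<alpha> * A powr bt * B powr \<gamma>)"
   using c AB by (simp add: powr_mult powr_minus field_simps)
  also have "\<dots> <= c powr (- \<alpha>) * (\<alpha> * (c * (A * B)) + bt * A + \<gamma> * B)"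
   using c AB w by (intro mult_left_mono weighted_AM_GM3) auto
  finally show ?thesis by (simp add: A_def B_def mult.assoc)
 qed
 have ibound: "integrable M (%z. c powr (- \<alpha>) * (\<alpha> * c * (a z powr r * b z powr s) + bt * (a z powr r) + \<gamma> * (b z powr s)))" for c
  using ia ib iab by (intro integrable_mult_right Bochner_Integration.integrable_add) auto
 show int: "integrable M (%z. a z * b z)"
  by (rule integrable_bnd[OF ibound[of 1]]) (use pt[of 1] nn in \<open>auto intro!: AE_I2 order_trans[OF _ abs_ge_self]\<close>)
 have S0: "0 <= S" unfolding S_def by (intro add_nonneg_nonneg integral_nonneg_AE) auto
 have I0: "0 <= I" unfolding I_def by (intro integral_nonneg_AE) auto
 have le: "(\<integral>z. a z * b z \<partial>M) <= c powr (- \<alpha>) * (\<alpha> * c * I + (1 - \<alpha>) * S)" if c: "c > 0" for c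
 proof -
  have "(\<integral>z. a z * b z \<partial>M) <= (\<integral>z. c powr (- \<alpha>) * (\<alpha> * c * (a z powr r * b z powr s) + bt * (a z powr r) + \<gamma> * (b z powr s)) \<partial>M)"
   by (intro integral_mono int ibound pt c)
  also have "\<dots> = c powr (- \<alpha>) * (\<alpha> * c * I + bt * (\<integral>z. a z powr r \<partial>M) + \<gamma> * (\<integral>z. b z powr s \<partial>M))"
   using ia ib iab by (simp add: I_def)
  also have "\<dots> <= c powr (- \<alpha>) * (\<alpha> * c * I + (1 - \<alpha>) * S)"
  proof (intro mult_left_mono)
   have "bt * (\<integral>z. a z powr r \<partial>M) <= (1 - \<alpha>) * (\<integral>z. a z powr r \<partial>M)" "\<gamma> * (\<integral>z. b z powr s \<partial>M) <= (1 - \<alpha>) * (\<integral>z. b z powr s \<partial>M)"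
    using w by (intro mult_right_mono integral_nonneg_AE; auto)+
   thus "\<alpha> * c * I + bt * (\<integral>z. a z powr r \<partial>M) + \<gamma> * (\<integral>z. b z powr s \<partial>M) <= \<alpha> * c * I + (1 - \<alpha>) * S"
    by (simp add: S_def distrib_left)
  qed simp
  finally show ?thesis .
 qed
 have nnab: "0 <= (\<integral>z. a z * b z \<partial>M)" using nn by (intro integral_nonneg_AE) auto
 show "(\<integral>z. a z * b z \<partial>M) powr q <= (\<integral>z. a z powr r * b z powr s \<partial>M) * ((\<integral>z. a z powr r \<partial>M) + (\<integral>z. b z powr s \<partial>M)) powr (q - 1)"
  unfolding I_def[symmetric] S_def[symmetric]
 proof (cases "I = 0 \<or> S = 0")
  case True
  have "(\<integral>z. a z * b z \<partial>M) = 0"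
  proof -
   have "AE z in M. a z * b z = 0"
   proof (cases "I = 0")
    case True
    hence "AE z in M. a z powr r * b z powr s = 0"
     using integral_nonneg_eq_0_iff_AE[OF iab] by (simp add: I_def)
    thus ?thesis by eventually_elim auto
   next
    case False
    hence "S = 0" using True by simp
    hence "(\<integral>z. a z powr r \<partial>M) = 0"
     unfolding S_def by (smt (verit, best) integral_nonneg_AE AE_I2 powr_ge_zero)
    hence "AE z in M. a z powr r = 0" using integral_nonneg_eq_0_iff_AE[OF ia] by simp
    thus ?thesis by eventually_elim auto
   qed
   thus ?thesis by (rule integral_eq_zero_AE)
  qed
  thus "(\<integral>z. a z * b z \<partial>M) powr q <= I * S powr (q - 1)" using I0 by simp
 next
  case False
  \<comment> \<open>At the scale \<open>c = S / I\<close> both terms of \<open>le\<close> become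
    multiples of \<open>S\<close> with total weight 1.\<close>
  hence p: "I > 0" "S > 0" using I0 S0 by auto
  have "(\<integral>z. a z * b z \<partial>M) <= (S / I) powr (- \<alpha>) * (\<alpha> * (S / I) * I + (1 - \<alpha>) * S)" using p by (intro le) auto
  also have "\<dots> = (S / I) powr (- \<alpha>) * S" using p by (simp add: algebra_simps)
  finally have "(\<integral>z. a z * b z \<partial>M) powr q <= ((S / I) powr (- \<alpha>) * S) powr q"
   using q nnab by (intro powr_mono2) auto
  also have "\<dots> = I * S powr (q - 1)"
  proof -
   have "((S / I) powr (- \<alpha>)) powr q = I / S"
   proof -
    have "- \<alpha> * q = - 1" using q by (simp add: \<alpha>_def)
    thus ?thesis using p powr_minus[of "S / I" 1] by (simp only: powr_powr) simp
   qed
   moreover have "S powr q = S * S powr (q - 1)" using p powr_add[of S 1 "q - 1"] by simp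
   ultimately show ?thesis using p by (simp add: powr_mult)
  qed
  finally show "(\<integral>z. a z * b z \<partial>M) powr q <= I * S powr (q - 1)" .
 qed
qed

text \<open>The pointwise bound is integrated by \<open>convolution_L1\<close>, applied to the
  powers of \<open>k\<close> and \<open>h\<close>. The factor \<open>(A + B) powr (q - 1)\<close> is
  not homogeneous, but any finite bound in terms of \<open>A\<close> and \<open>B\<close> is enough;
  homogeneity is restored in \<open>Sobolev\<close>.\<close>

lemma Young_convolution:
 fixes k h :: "real^'n::finite => real"
 assumes [measurable]: "k \<in> bmeas" "h \<in> bmeas"
  and nn: "!!z. 0 <= k z" "!!z. 0 <= h z"
  and q: "q > 1" and r: "r >= 1" and s: "s >= 1" and e: "1 / r + 1 / s = 1 + 1 / q"
  and ik: "Lint (%z. k z powr r)" and ih: "Lint (%z. h z powr s)"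
 defines "A \<equiv> LI (%z. k z powr r)" and "B \<equiv> LI (%z. h z powr s)"
 shows "Lint (%x. cv k h x powr q)" "LI (%x. cv k h x powr q) <= A * B * (A + B) powr (q - 1)"
proof -
 note L = convolution_L1[OF ik ih]
 have tr: "Lint (%z. h (x - z) powr s)" "LI (%z. h (x - z) powr s) = B" for x
  using integrable_lborel_affine[OF ih, of "-1" x] integral_lborel_affine[of "%z. h z powr s" "-1" x]
  by (auto simp: B_def)
 have le: "AE x in lborel. cv k h x powr q <= cv (%z. k z powr r) (%z. h z powr s) x * (A + B) powr (q - 1)"
  using L(1)
 proof eventually_elim
  case (elim x)
  show ?case
   using Young_pointwise(2)[of k lborel "%z. h (x - z)", OF _ _ nn(1) nn(2) q r s e ik tr(1) elim]
   unfolding tr(2) A_def[symmetric] cv_def by simp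
 qed
 have i: "Lint (%x. cv (%z. k z powr r) (%z. h z powr s) x * (A + B) powr (q - 1))"
  using L(2) by simp
 show int: "Lint (%x. cv k h x powr q)"
  by (rule integrable_bnd[OF i]) (use le in \<open>auto elim!: eventually_mono order_trans\<close>)
 have "LI (%x. cv k h x powr q) <= LI (%x. cv (%z. k z powr r) (%z. h z powr s) x * (A + B) powr (q - 1))"
  by (rule integral_mono_AE[OF int i le])
 also have "\<dots> = A * B * (A + B) powr (q - 1)" using L(3) by (simp add: A_def B_def)
 finally show "LI (%x. cv k h x powr q) <= A * B * (A + B) powr (q - 1)" .
qed

text \<open>Cauchy-Schwarz with respect to the weight \<open>\<bar>k\<bar>\<close>; the discriminant
  lemma replaces a change of measure.\<close>

lemma convolution_sq:
 fixes k h :: "real^'n::finite => real"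
 assumes k: "Lint k" and h: "sq_int lborel h"
 shows "AE x in lborel. Lint (%z. k z * h (x - z))"
  and "sq_int lborel (cv k h)" and "LI (%x. (cv k h x)^2) <= LI (%x. \<bar>k x\<bar>)^2 * sqn h"
proof -
 have [measurable]: "k \<in> bmeas" "h \<in> bmeas" using k h by (auto simp: sq_int_def)
 define A where "A = LI (%x. \<bar>k x\<bar>)"
 have A0: "A >= 0" by (simp add: A_def)
 have ka: "Lint (%x. \<bar>k x\<bar>)" using k by simp
 note L = convolution_L1[OF ka sq_int_integrable[OF h]]
 have key: "AE x in lborel. Lint (%z. k z * h (x - z)) & (cv k h x)^2 <= A * cv (%x. \<bar>k x\<bar>) (%x. (h x)^2) x"
  using L(1)
 proof eventually_elim
  case (elim x)
  have bnd: "\<bar>k z * h (x - z)\<bar> <= \<bar>k z\<bar> * (h (x - z))^2 + \<bar>k z\<bar>" for z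
  proof -
   have "\<bar>h (x - z)\<bar> <= (h (x - z))^2 + 1"
    using zero_le_power2[of "\<bar>h (x - z)\<bar> - 1"] zero_le_power2[of "h (x - z)"] by (simp add: power2_diff)
   hence "\<bar>k z\<bar> * \<bar>h (x - z)\<bar> <= \<bar>k z\<bar> * ((h (x - z))^2 + 1)" by (rule mult_left_mono) simp
   thus ?thesis by (simp add: abs_mult algebra_simps)
  qed
  have i: "Lint (%z. \<bar>k z\<bar> * (h (x - z))^2 + \<bar>k z\<bar>)" using elim ka by simp
  have ikh: "Lint (%z. k z * h (x - z))"
   by (rule integrable_bnd[OF i]) (use bnd in \<open>auto intro!: AE_I2 order_trans[OF _ abs_ge_self]\<close>)
  hence ikh': "Lint (%z. \<bar>k z\<bar> * \<bar>h (x - z)\<bar>)" using integrable_abs[of lborel "%z. k z * h (x - z)"] by (simp add: abs_mult)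
  have "LI (%z. \<bar>k z\<bar> * \<bar>h (x - z)\<bar>)^2 <= LI (%z. \<bar>k z\<bar> * (h (x - z))^2) * A"
  proof (rule nonneg_quadratic_discrim)
   fix t :: real
   have "0 <= LI (%z. \<bar>k z\<bar> * (\<bar>h (x - z)\<bar> + t)^2)" by simp
   also have "\<dots> = LI (%z. \<bar>k z\<bar> * (h (x - z))^2 + 2 * t * (\<bar>k z\<bar> * \<bar>h (x - z)\<bar>) + t^2 * \<bar>k z\<bar>)"
    by (intro Bochner_Integration.integral_cong refl) (simp add: power2_sum algebra_simps)
   also have "\<dots> = LI (%z. \<bar>k z\<bar> * (h (x - z))^2) + 2 * t * LI (%z. \<bar>k z\<bar> * \<bar>h (x - z)\<bar>) + t^2 * A"
    using elim ikh' ka by (simp add: A_def)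
   finally show "0 <= LI (%z. \<bar>k z\<bar> * (h (x - z))^2) + 2 * t * LI (%z. \<bar>k z\<bar> * \<bar>h (x - z)\<bar>) + t^2 * A" .
  qed (rule A0)
  moreover have "(cv k h x)^2 <= LI (%z. \<bar>k z\<bar> * \<bar>h (x - z)\<bar>)^2"
  proof -
   have "\<bar>cv k h x\<bar> <= LI (%z. \<bar>k z\<bar> * \<bar>h (x - z)\<bar>)"
    unfolding cv_def using integral_abs_bound[of lborel "%z. k z * h (x - z)"] by (simp add: abs_mult)
   thus ?thesis by (metis abs_ge_zero power2_abs power_mono)
  qed
  ultimately show ?case using ikh by (simp add: cv_def mult.commute)
 qed
 thus "AE x in lborel. Lint (%z. k z * h (x - z))" by eventually_elim simp
 have key2: "AE x in lborel. (cv k h x)^2 <= A * cv (%x. \<bar>k x\<bar>) (%x. (h x)^2) x"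
  using key by eventually_elim simp
 have i: "Lint (%x. A * cv (%x. \<bar>k x\<bar>) (%x. (h x)^2) x)" using L(2) by simp
 have int: "Lint (%x. (cv k h x)^2)"
  by (rule integrable_bnd[OF i])
   (use key2 in \<open>auto elim!: eventually_mono intro: order_trans[OF _ abs_ge_self]\<close>)
 thus "sq_int lborel (cv k h)" by (simp add: sq_int_def)
 have "LI (%x. (cv k h x)^2) <= LI (%x. A * cv (%x. \<bar>k x\<bar>) (%x. (h x)^2) x)"
  by (rule integral_mono_AE[OF int i key2])
 also have "\<dots> = A^2 * sqn h" using L(3) by (simp add: A_def power2_eq_square)
 finally show "LI (%x. (cv k h x)^2) <= LI (%x. \<bar>k x\<bar>)^2 * sqn h" by (simp add: A_def)
qed

section \<open>Functions with square-integrable Laplacian\<close>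

text \<open>The weak Laplacian is carried as a second argument, so that linear combinations,
  translations and limits act on pairs and nothing has to be chosen. It is determined almost
  everywhere by \<open>u\<close>, see \<open>Wsp_unique\<close>, and membership implies
  \<open>H2 u\<close>, see \<open>Wsp_imp_H2\<close>.\<close>

definition Wsp :: "(real^'n::finite => real) => (real^'n => real) => bool" where
 "Wsp u v \<longleftrightarrow> sq_int lborel u & sq_int lborel v &
  (\<forall>ph. test_fun ph --> LI (%x. u x * lap ph x) = LI (%x. v x * ph x))"

lemma WspD:
 assumes "Wsp u v"
 shows "sq_int lborel u" "sq_int lborel v" "u \<in> bmeas" "v \<in> bmeas"
  "!!ph. test_fun ph ==> LI (%x. u x * lap ph x) = LI (%x. v x * ph x)"
 using assms by (auto simp: Wsp_def sq_int_def)

lemma Wsp_add_cmult: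
 assumes "Wsp u v" "Wsp u' v'"
 shows "Wsp (%x. u x + c * u' x) (%x. v x + c * v' x)"
 unfolding Wsp_def
proof (intro conjI allI impI)
 fix ph :: "real^'a => real" assume ph: "test_fun ph"
 note l = test_fun_sq_int[OF test_fun_lap[OF ph]] and f = test_fun_sq_int[OF ph]
 show "LI (%x. (u x + c * u' x) * lap ph x) = LI (%x. (v x + c * v' x) * ph x)"
  unfolding integral_add_cmult_right[OF WspD(1)[OF assms(1)] WspD(1)[OF assms(2)] l]
   integral_add_cmult_right[OF WspD(2)[OF assms(1)] WspD(2)[OF assms(2)] f]
  using WspD(5)[OF assms(1) ph] WspD(5)[OF assms(2) ph] by simp
qed (auto intro!: sq_int_add_cmult WspD[OF assms(1)] WspD[OF assms(2)])

lemma Wsp_zero: "Wsp (%x. 0) (%x. 0)"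
 by (simp add: Wsp_def sq_int_zero)

lemma Wsp_cmult: "Wsp u v ==> Wsp (%x. c * u x) (%x. c * v x)"
 using Wsp_add_cmult[OF Wsp_zero, of u v c] by simp

lemma Wsp_diff: "Wsp u v ==> Wsp u' v' ==> Wsp (%x. u x - u' x) (%x. v x - v' x)"
 using Wsp_add_cmult[of u v u' v' "-1"] by simp

lemma Wsp_representation:
 assumes "Wsp u v" shows "AE x in lborel. u x = cv rho u x - cv Ker v x"
 using assms by (intro parametrix_representation sq_int_loc_int WspD(5)[OF assms]) (auto simp: Wsp_def)

lemma sq_int_affine:
 fixes u :: "real^'n::finite => real"
 assumes "sq_int lborel u" "c \<noteq> 0" shows "sq_int lborel (%x. u (b + c *\<^sub>R x))"
proof -
 have [measurable]: "u \<in> bmeas" using sq_int_measurable[OF assms(1)] by simp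
 show ?thesis using integrable_lborel_affine[OF sq_int_integrable[OF assms(1)] assms(2), of b] by (simp add: sq_int_def)
qed

lemma Wsp_affine:
 fixes u v :: "real^'n::finite => real"
 assumes W: "Wsp u v" and c: "c \<noteq> 0"
 shows "Wsp (%x. u (b + c *\<^sub>R x)) (%x. c\<^sup>2 * v (b + c *\<^sub>R x))"
 unfolding Wsp_def
proof (intro conjI allI impI sq_int_cmult sq_int_affine WspD[OF W] c)
 note [measurable] = WspD(3,4)[OF W]
 fix ph :: "real^'n => real" assume ph: "test_fun ph"
 note [measurable] = test_fun_measurable[OF ph] test_fun_measurable[OF test_fun_lap[OF ph]]
 define ps where "ps x = ph ((- (1 / c)) *\<^sub>R b + (1 / c) *\<^sub>R x)" for x
 have ps: "test_fun ps" unfolding ps_def using c by (intro test_fun_affine ph) auto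
 have inv: "(- (1 / c)) *\<^sub>R b + (1 / c) *\<^sub>R (b + c *\<^sub>R x) = x" for x using c by (simp add: algebra_simps)
 have ps1: "ps (b + c *\<^sub>R x) = ph x" for x unfolding ps_def inv ..
 have ps2: "c\<^sup>2 * lap ps (b + c *\<^sub>R x) = lap ph x" for x
  unfolding ps_def lap_affine[OF test_fun_smooth[OF ph]] inv using c by (simp add: power_one_over)
 note [measurable] = test_fun_measurable[OF ps] test_fun_measurable[OF test_fun_lap[OF ps]]
 have 1: "LI (%x. u x * lap ps x) = \<bar>c\<bar> ^ DIM(real^'n) * LI (%x. u (b + c *\<^sub>R x) * lap ps (b + c *\<^sub>R x))"
  by (rule integral_lborel_affine[OF _ c]) measurable
 have 2: "LI (%x. v x * ps x) = \<bar>c\<bar> ^ DIM(real^'n) * LI (%x. v (b + c *\<^sub>R x) * ps (b + c *\<^sub>R x))"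
  by (rule integral_lborel_affine[OF _ c]) measurable
 have 3: "LI (%x. u (b + c *\<^sub>R x) * lap ps (b + c *\<^sub>R x)) = LI (%x. v (b + c *\<^sub>R x) * ph x)"
  using 1 2 WspD(5)[OF W ps] c by (simp add: ps1)
 have "LI (%x. u (b + c *\<^sub>R x) * lap ph x) = c\<^sup>2 * LI (%x. u (b + c *\<^sub>R x) * lap ps (b + c *\<^sub>R x))"
  unfolding ps2[symmetric] by (simp add: mult.left_commute)
 also have "\<dots> = LI (%x. c\<^sup>2 * v (b + c *\<^sub>R x) * ph x)" unfolding 3 by (simp add: mult.assoc)
 finally show "LI (%x. u (b + c *\<^sub>R x) * lap ph x) = LI (%x. c\<^sup>2 * v (b + c *\<^sub>R x) * ph x)" .
qed

section \<open>The subcritical Sobolev inequality\<close>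

lemma bounded_ball_powr_integrable:
 fixes k :: "real^'n::finite => real"
 assumes "test_fun k" "0 < r" shows "Lint (%z. \<bar>k z\<bar> powr r)"
proof -
 obtain R where R: "\<forall>x. norm x > R --> k x = 0" using test_fun_support[OF assms(1)] by blast
 have "Lint (%x. indicator (cball 0 R) x *\<^sub>R (\<bar>k x\<bar> powr r))"
  using test_fun_continuous[OF assms(1)] assms(2)
  by (intro borel_integrable_compact continuous_on_powr') (auto intro!: continuous_intros continuous_on_subset[OF test_fun_continuous[OF assms(1)]])
 moreover have "(%x. indicator (cball 0 R) x *\<^sub>R (\<bar>k x\<bar> powr r)) = (%x. \<bar>k x\<bar> powr r)"
  using R assms(2) by (auto simp: fun_eq_iff indicator_def not_le)
 ultimately show ?thesis by simp
qed

lemma powr_add_le: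
 fixes a b q :: real
 assumes "0 <= a" "0 <= b" "0 < q" shows "(a + b) powr q <= 2 powr q * (a powr q + b powr q)"
proof -
 have "(a + b) powr q <= (2 * max a b) powr q" using assms by (intro powr_mono2) auto
 also have "\<dots> = 2 powr q * (max a b) powr q" using assms by (simp add: powr_mult)
 also have "(max a b) powr q <= a powr q + b powr q" by (simp add: max_def)
 finally show ?thesis by simp
qed

lemma abs_cv_le: "\<bar>cv k h x\<bar> <= cv (%z. \<bar>k z\<bar>) (%z. \<bar>h z\<bar>) x"
 unfolding cv_def using integral_abs_bound[of lborel "%z. k z * h (x - z)"] by (simp add: abs_mult)

lemma cv_nonneg: "(!!z. 0 <= k z) ==> (!!z. 0 <= h z) ==> 0 <= cv k h x"
 unfolding cv_def by (intro integral_nonneg_AE) auto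

text \<open>Young's inequality is applied to both terms of the parametrix representation
  \<open>u = rho * u - Ker * v\<close>, with data normalised to norm at most 1.\<close>

lemma Sobolev_bounded:
 assumes N: "CARD('n::finite) >= 5" and q: "2 <= q" "q < 2 * real CARD('n) / (real CARD('n) - 4)"
 shows "\<exists>C\<ge>0. \<forall>(u :: real^'n => real) v. Wsp u v --> sqn u + sqn v <= 1 -->
  Lint (%x. \<bar>u x\<bar> powr q) & LI (%x. \<bar>u x\<bar> powr q) <= C"
proof -
 \<comment> \<open>The exponent dictated by Young's inequality for an L2 factor. The condition
   \<open>r * (N - 2) < N\<close>, under which \<open>Ker powr r\<close> is integrable, is the
   strict subcriticality of \<open>q\<close>.\<close>
 define r where "r = 1 / (1/2 + 1/q)"
 have e: "1 / r + 1 / 2 = 1 + 1 / q" using q by (simp add: r_def)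
 have "1/2 + 1/q <= 1" using q by (simp add: field_simps)
 moreover have "0 < 1/2 + 1/q" using q by (simp add: add_pos_pos)
 ultimately have r: "r >= 1" by (simp add: r_def)
 have rN: "r * real (CARD('n) - 2) < real CARD('n)"
 proof -
  have "q * (real CARD('n) - 4) < 2 * real CARD('n)" using q N by (simp add: field_simps)
  moreover have "1/2 + 1/q = (q + 2) / (2 * q)" using q by (simp add: field_simps)
  hence "r = 2 * q / (q + 2)" by (simp add: r_def)
  moreover have "real (CARD('n) - 2) = real CARD('n) - 2" using N by (simp add: of_nat_diff)
  moreover have "2 * q * (real CARD('n) - 2) < real CARD('n) * (q + 2)"
   using \<open>q * (real CARD('n) - 4) < 2 * real CARD('n)\<close> by (simp add: algebra_simps)
  ultimately show ?thesis using q by (simp add: pos_divide_less_eq)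
 qed
 have iK: "Lint (%z::real^'n. \<bar>Ker z\<bar> powr r)" using Ker_powr_integrable[OF _ r rN] N by (simp add: Ker_nonneg)
 have iR: "Lint (%z::real^'n. \<bar>rho z\<bar> powr r)" using r by (intro bounded_ball_powr_integrable test_fun_rho) auto
 define A where "A = LI (%z::real^'n. \<bar>Ker z\<bar> powr r)"
 define A' where "A' = LI (%z::real^'n. \<bar>rho z\<bar> powr r)"
 have A0: "A >= 0" "A' >= 0" by (simp_all add: A_def A'_def)
 define C where "C = 2 powr q * (A' * (A' + 1) powr (q - 1) + A * (A + 1) powr (q - 1))"
 have "Lint (%x. \<bar>u x\<bar> powr q) & LI (%x. \<bar>u x\<bar> powr q) <= C"
  if W: "Wsp u v" and b: "sqn u + sqn v <= 1" for u v :: "real^'n => real"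
 proof -
  note [measurable] = WspD(3,4)[OF W]
  have sq: "\<bar>a\<bar> powr 2 = a^2" for a :: real by (cases "a = 0") (auto simp: powr_numeral)
  have young: "Lint (%x. cv (%z. \<bar>k z\<bar>) (%z. \<bar>h z\<bar>) x powr q) &
   LI (%x. cv (%z. \<bar>k z\<bar>) (%z. \<bar>h z\<bar>) x powr q) <= LI (%z. \<bar>k z\<bar> powr r) * (LI (%z. \<bar>k z\<bar> powr r) + 1) powr (q - 1)"
   if [measurable]: "k \<in> bmeas" and ik: "Lint (%z. \<bar>k z\<bar> powr r)" and h: "sq_int lborel h" and h1: "sqn h <= 1" for k h :: "real^'n => real"
  proof -
   have [measurable]: "h \<in> bmeas" using sq_int_measurable[OF h] by simp
   have ih: "Lint (%z. \<bar>h z\<bar> powr 2)" using sq_int_integrable[OF h] by (simp add: sq)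
   define a where "a = LI (%z. \<bar>k z\<bar> powr r)"
   define d where "d = LI (%z. \<bar>h z\<bar> powr 2)"
   have ad: "0 <= a" "0 <= d" "d <= 1" using h1 by (auto simp: a_def d_def sq)
   have Y: "Lint (%x. cv (%z. \<bar>k z\<bar>) (%z. \<bar>h z\<bar>) x powr q)"
    "LI (%x. cv (%z. \<bar>k z\<bar>) (%z. \<bar>h z\<bar>) x powr q) <= a * d * (a + d) powr (q - 1)"
    unfolding a_def d_def by (rule Young_convolution[of "%z. \<bar>k z\<bar>" "%z. \<bar>h z\<bar>", OF _ _ _ _ _ r _ e ik ih]; use q in auto)+
   have "a * d * (a + d) powr (q - 1) <= (a * 1) * (a + 1) powr (q - 1)"
    using ad q by (intro mult_mono mult_left_mono powr_mono2) auto
   thus ?thesis using Y by (simp add: a_def)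
  qed
  have u1: "sqn u <= 1" and v1: "sqn v <= 1"
  proof -
   have "0 <= sqn u" "0 <= sqn v" by simp_all
   thus "sqn u <= 1" "sqn v <= 1" using b by linarith+
  qed
  have y1: "Lint (%x. cv (%z. \<bar>rho z\<bar>) (%z. \<bar>u z\<bar>) x powr q)"
   "LI (%x. cv (%z. \<bar>rho z\<bar>) (%z. \<bar>u z\<bar>) x powr q) <= A' * (A' + 1) powr (q - 1)"
   using young[OF rho_measurable iR WspD(1)[OF W] u1] by (auto simp: A'_def)
  have y2: "Lint (%x. cv (%z. \<bar>Ker z\<bar>) (%z. \<bar>v z\<bar>) x powr q)"
   "LI (%x. cv (%z. \<bar>Ker z\<bar>) (%z. \<bar>v z\<bar>) x powr q) <= A * (A + 1) powr (q - 1)"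
   using young[OF Ker_measurable iK WspD(2)[OF W] v1] by (auto simp: A_def)
  have i: "Lint (%x. 2 powr q * (cv (%z. \<bar>rho z\<bar>) (%z. \<bar>u z\<bar>) x powr q + cv (%z. \<bar>Ker z\<bar>) (%z. \<bar>v z\<bar>) x powr q))"
   using y1 y2 by simp
  have le: "AE x in lborel. \<bar>u x\<bar> powr q <= 2 powr q * (cv (%z. \<bar>rho z\<bar>) (%z. \<bar>u z\<bar>) x powr q + cv (%z. \<bar>Ker z\<bar>) (%z. \<bar>v z\<bar>) x powr q)"
   using Wsp_representation[OF W]
  proof eventually_elim
   case (elim x)
   have "\<bar>u x\<bar> <= cv (%z. \<bar>rho z\<bar>) (%z. \<bar>u z\<bar>) x + cv (%z. \<bar>Ker z\<bar>) (%z. \<bar>v z\<bar>) x"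
    unfolding elim using abs_cv_le[of rho u x] abs_cv_le[of Ker v x] by linarith
   hence "\<bar>u x\<bar> powr q <= (cv (%z. \<bar>rho z\<bar>) (%z. \<bar>u z\<bar>) x + cv (%z. \<bar>Ker z\<bar>) (%z. \<bar>v z\<bar>) x) powr q"
    using q by (intro powr_mono2) auto
   also have "\<dots> <= 2 powr q * (cv (%z. \<bar>rho z\<bar>) (%z. \<bar>u z\<bar>) x powr q + cv (%z. \<bar>Ker z\<bar>) (%z. \<bar>v z\<bar>) x powr q)"
    using q by (intro powr_add_le cv_nonneg) auto
   finally show ?case .
  qed
  have int: "Lint (%x. \<bar>u x\<bar> powr q)"
   by (rule integrable_bnd[OF i]) (use le in \<open>auto elim!: eventually_mono intro: order_trans[OF _ abs_ge_self]\<close>)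
  have "LI (%x. \<bar>u x\<bar> powr q) <= LI (%x. 2 powr q * (cv (%z. \<bar>rho z\<bar>) (%z. \<bar>u z\<bar>) x powr q + cv (%z. \<bar>Ker z\<bar>) (%z. \<bar>v z\<bar>) x powr q))"
   by (rule integral_mono_AE[OF int i le])
  also have "\<dots> <= C" unfolding C_def using y1 y2 by simp
  finally show ?thesis using int by simp
 qed
 moreover have "C >= 0" unfolding C_def using A0 by (intro mult_nonneg_nonneg add_nonneg_nonneg) auto
 ultimately show ?thesis by blast
qed

text \<open>Scaling by \<open>1 / sqrt E\<close> reduces to the normalised case; the case
  \<open>E = 0\<close>, where this fails, is \<open>u = 0\<close> almost everywhere.\<close>

lemma Sobolev:
 assumes N: "CARD('n::finite) >= 5" and q: "2 <= q" "q < 2 * real CARD('n) / (real CARD('n) - 4)"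
 shows "\<exists>C\<ge>0. \<forall>(u :: real^'n => real) v. Wsp u v -->
  Lint (%x. \<bar>u x\<bar> powr q) & LI (%x. \<bar>u x\<bar> powr q) <= C * (sqn u + sqn v) powr (q / 2)"
proof -
 obtain C where C: "C >= 0" "!!(u :: real^'n => real) v. Wsp u v ==> sqn u + sqn v <= 1 ==>
  Lint (%x. \<bar>u x\<bar> powr q) & LI (%x. \<bar>u x\<bar> powr q) <= C"
  using Sobolev_bounded[OF N q] by blast
 have "Lint (%x. \<bar>u x\<bar> powr q) & LI (%x. \<bar>u x\<bar> powr q) <= C * (sqn u + sqn v) powr (q / 2)"
  if W: "Wsp u v" for u v :: "real^'n => real"
 proof -
  define E where "E = sqn u + sqn v"
  have nn: "0 <= sqn u" "0 <= sqn v" by simp_all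
  show ?thesis
  proof (cases "E = 0")
   case True
   hence "sqn u = 0" using nn unfolding E_def by linarith
   hence "AE x in lborel. (u x)^2 = 0" using integral_nonneg_eq_0_iff_AE[OF sq_int_integrable[OF WspD(1)[OF W]]] by simp
   hence ae: "AE x in lborel. \<bar>u x\<bar> powr q = 0" by eventually_elim simp
   note [measurable] = WspD(3)[OF W]
   have "Lint (%x. \<bar>u x\<bar> powr q)" by (subst integrable_cong_AE[where g = "%x. 0"]) (use ae in auto)
   moreover have "LI (%x. \<bar>u x\<bar> powr q) = 0" by (rule integral_eq_zero_AE[OF ae])
   ultimately show ?thesis using C(1) by simp
  next
   case False
   hence E: "E > 0" using nn unfolding E_def by linarith
   define c where "c = 1 / sqrt E"
   have c: "c > 0" "c^2 = 1 / E" using E by (auto simp: c_def power_divide)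
   have W': "Wsp (%x. c * u x) (%x. c * v x)" by (rule Wsp_cmult[OF W])
   have "LI (%x. (c * u x)^2) + LI (%x. (c * v x)^2) = c^2 * E"
    by (simp add: power_mult_distrib E_def distrib_left)
   also have "\<dots> = 1" using c E by simp
   finally have *: "Lint (%x. \<bar>c * u x\<bar> powr q)" "LI (%x. \<bar>c * u x\<bar> powr q) <= C"
    using C(2)[OF W'] by auto
   have eq: "(%x. \<bar>c * u x\<bar> powr q) = (%x. c powr q * \<bar>u x\<bar> powr q)" using c by (auto simp: abs_mult powr_mult)
   have 1: "Lint (%x. \<bar>u x\<bar> powr q)" using *(1) c unfolding eq by simp
   have "c powr q * LI (%x. \<bar>u x\<bar> powr q) <= C" using *(2) unfolding eq by simp
   moreover have "c powr q * E powr (q / 2) = 1"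
   proof -
    have "sqrt E powr q = E powr (q / 2)" using E by (simp add: powr_half_sqrt[symmetric] powr_powr)
    thus ?thesis using E by (simp add: c_def powr_divide)
   qed
   ultimately have "LI (%x. \<bar>u x\<bar> powr q) <= C * E powr (q / 2)"
   proof -
    assume a: "c powr q * LI (%x. \<bar>u x\<bar> powr q) <= C" and b: "c powr q * E powr (q / 2) = 1"
    have "LI (%x. \<bar>u x\<bar> powr q) = (c powr q * LI (%x. \<bar>u x\<bar> powr q)) * E powr (q / 2)"
     using b by (simp add: mult.commute mult.left_commute)
    also have "\<dots> <= C * E powr (q / 2)" by (intro mult_right_mono a) simp
    finally show ?thesis .
   qed
   thus ?thesis using 1 by (simp add: E_def)
  qed
 qed
 thus ?thesis using C(1) by blast
qed

section \<open>Local compactness through the parametrix\<close>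

lemma positive_weight:
 "\<exists>om :: real^'n::finite => real. om \<in> bmeas & (\<forall>x. 0 < om x) & Lint om & sq_int lborel om"
proof -
 obtain h :: "real^'n => ennreal" where h [measurable]: "h \<in> borel_measurable lborel" and fin: "integral\<^sup>N lborel h \<noteq> \<infinity>"
  and pos: "\<forall>x\<in>space lborel. 0 < h x & h x < \<infinity>"
  using sigma_finite_measure.Ex_finite_integrable_function[OF sigma_finite_lborel] by blast
 define om where "om x = min 1 (enn2real (h x))" for x
 have [measurable]: "om \<in> bmeas" unfolding om_def using h by measurable
 have p: "0 < om x" for x using pos by (simp add: om_def enn2real_positive_iff)
 have i: "Lint om"
 proof (rule integrableI_nonneg)
  have "(\<integral>\<^sup>+x. ennreal (om x) \<partial>lborel) <= integral\<^sup>N lborel h"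
  proof (rule nn_integral_mono)
   fix x
   have "ennreal (om x) <= ennreal (enn2real (h x))" by (intro ennreal_leI) (simp add: om_def)
   also have "\<dots> = h x" using pos by simp
   finally show "ennreal (om x) <= h x" .
  qed
  thus "(\<integral>\<^sup>+x. ennreal (om x) \<partial>lborel) < \<infinity>" using fin by (auto simp: less_top top_unique)
 qed (use p in \<open>auto intro: less_imp_le\<close>)
 have "Lint (%x. (om x)^2)"
 proof (rule integrable_bnd[OF i])
  have "(om x)^2 <= om x" for x
   using p[of x] mult_left_le[of "om x" "om x"] by (auto simp: power2_eq_square om_def min_def mult_left_le)
  thus "AE x in lborel. norm ((om x)\<^sup>2) <= norm (om x)" using p by (auto intro!: AE_I2 order_trans[OF _ abs_ge_self])
 qed measurable
 thus ?thesis using p i by (intro exI[of _ om]) (auto simp: sq_int_def)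
qed

lemma sq_int_reflect_translate:
 fixes k :: "real^'n::finite => real"
 assumes "sq_int lborel k" shows "sq_int lborel (%w. k (x - w))" "LI (%w. (k (x - w))^2) = sqn k"
proof -
 have [measurable]: "k \<in> bmeas" using sq_int_measurable[OF assms] by simp
 show "sq_int lborel (%w. k (x - w))" using sq_int_affine[OF assms, of "-1" x] by simp
 show "LI (%w. (k (x - w))^2) = sqn k"
  using integral_lborel_affine[of "%w. (k w)^2" "-1" x] by simp
qed

lemma cv_reflect:
 fixes k h :: "real^'n::finite => real"
 assumes [measurable]: "k \<in> bmeas" "h \<in> bmeas"
 shows "cv k h x = LI (%w. h w * k (x - w))"
 unfolding cv_def using integral_lborel_affine[of "%z. k z * h (x - z)" "-1" x] by (simp add: mult.commute)

text \<open>The kernel is split at height \<open>M\<close>. Its bounded part is square-integrable,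
  so there weak convergence gives pointwise convergence under a uniform bound; the rest has small L1
  norm and contributes little uniformly in \<open>n\<close>. The positive integrable weight
  \<open>om\<close> measures local convergence on the whole space by one integral.\<close>

lemma cv_weak_limit:
 fixes k :: "real^'n::finite => real" and e :: "nat => real^'n => real"
 assumes k: "Lint k" and e: "!!n. sq_int lborel (e n)" and bd: "!!n. sqn (e n) <= C"
  and weak: "!!h. sq_int lborel h ==> (%n. LI (%x. e n x * h x)) -->> 0"
  and w [measurable]: "om \<in> bmeas" and w0: "!!x. 0 < om x" and wi: "Lint om" and ws: "sq_int lborel om"
 shows "(%n. LI (%x. om x * \<bar>cv k (e n) x\<bar>)) -->> 0"
proof (rule LIMSEQ_I)
 fix \<epsilon> :: real assume \<epsilon>: "\<epsilon> > 0"
 have [measurable]: "k \<in> bmeas" "e n \<in> bmeas" for n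
  using k sq_int_measurable[OF e] by auto
 have C0: "C >= 0" using bd[of 0] by (smt (verit) integral_nonneg_AE AE_I2 zero_le_power2)
 define D where "D = sqrt (LI (%x. (om x)^2)) * sqrt C"
 define kM where "kM M z = (if \<bar>k z\<bar> <= real M then k z else 0)" for M :: nat and z
 have [measurable]: "kM M \<in> bmeas" for M unfolding kM_def by measurable
 have "(%M. LI (%z. \<bar>k z - kM M z\<bar>)) -->> LI (%z::real^'n. 0)"
 proof (rule integral_dominated_convergence[where w = "%z. \<bar>k z\<bar>"])
  show "AE z in lborel. (%M. \<bar>k z - kM M z\<bar>) -->> 0"
  proof (rule AE_I2, rule tendsto_eventually)
   fix z
   obtain M0 :: nat where "\<bar>k z\<bar> <= real M0" using real_arch_simple by blast
   hence "\<bar>k z - kM M z\<bar> = 0" if "M >= M0" for M using that by (auto simp: kM_def)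
   thus "\<forall>\<^sub>F M in sequentially. \<bar>k z - kM M z\<bar> = 0" by (auto simp: eventually_sequentially)
  qed
 qed (use k in \<open>auto simp: kM_def\<close>)
 hence "(%M. LI (%z. \<bar>k z - kM M z\<bar>) * D) -->> 0 * D" by (intro tendsto_mult tendsto_const) simp
 hence "\<forall>\<^sub>F M in sequentially. LI (%z. \<bar>k z - kM M z\<bar>) * D < \<epsilon> / 2"
  using \<epsilon> by (intro order_tendstoD(2)[where y = "0 * D"]) auto
 then obtain M where M: "LI (%z. \<bar>k z - kM M z\<bar>) * D < \<epsilon> / 2" by (auto simp: eventually_sequentially)
 define k1 where "k1 = kM M"
 define k2 where "k2 z = k z - kM M z" for z
 have [measurable]: "k1 \<in> bmeas" "k2 \<in> bmeas" unfolding k1_def k2_def by measurable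
 have k1i: "Lint k1" unfolding k1_def
  by (rule integrable_bnd[OF k]) (auto simp: kM_def)
 have k2i: "Lint k2" unfolding k2_def using k k1i by (simp add: k1_def)
 have k1s: "sq_int lborel k1"
 proof -
  have "Lint (%z. (k1 z)^2)"
  proof (rule integrable_bnd)
   show "Lint (%z. real M * k z)" using k by simp
   have "(k1 z)^2 <= real M * \<bar>k z\<bar>" for z
   proof (cases "\<bar>k z\<bar> <= real M")
    case True
    have "(k1 z)^2 = \<bar>k z\<bar> * \<bar>k z\<bar>" using True by (simp add: k1_def kM_def power2_eq_square)
    also have "\<dots> <= real M * \<bar>k z\<bar>" using True by (intro mult_right_mono) auto
    finally show ?thesis .
   qed (simp add: k1_def kM_def)
   thus "AE z in lborel. norm ((k1 z)\<^sup>2) <= norm (real M * k z)" by (auto simp: abs_mult)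
  qed measurable
  thus ?thesis by (simp add: sq_int_def)
 qed
 define B where "B = sqrt C * sqrt (sqn k1)"
 have k1_bound: "\<bar>cv k1 (e n) x\<bar> <= B" for n x
 proof -
  have "\<bar>cv k1 (e n) x\<bar> <= sqrt (sqn (e n)) * sqrt (LI (%w. (k1 (x - w))^2))"
   using integral_Cauchy_Schwarz_sqrt[OF e[of n] sq_int_reflect_translate(1)[OF k1s, of x]] by (simp add: cv_reflect)
  also have "\<dots> <= B" unfolding B_def sq_int_reflect_translate(2)[OF k1s] using bd[of n] by (intro mult_right_mono) auto
  finally show ?thesis .
 qed
 have lim1: "(%n. LI (%x. om x * \<bar>cv k1 (e n) x\<bar>)) -->> LI (%z::real^'n. 0)"
 proof (rule integral_dominated_convergence[where w = "%x. om x * B"])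
  show "AE x in lborel. (%n. om x * \<bar>cv k1 (e n) x\<bar>) -->> 0"
  proof (intro always_eventually allI tendsto_mult_right_zero tendsto_rabs_zero)
   fix x
   show "(%n. cv k1 (e n) x) -->> 0"
    using weak[OF sq_int_reflect_translate(1)[OF k1s, of x]] by (simp add: cv_reflect)
  qed
  show "AE x in lborel. norm (om x * \<bar>cv k1 (e n) x\<bar>) <= om x * B" for n
   using k1_bound[of n] less_imp_le[OF w0] by (auto simp: abs_mult intro!: AE_I2 mult_left_mono)
 qed (use wi in auto)
 hence "\<forall>\<^sub>F n in sequentially. LI (%x. om x * \<bar>cv k1 (e n) x\<bar>) < \<epsilon> / 2"
  using \<epsilon> by (intro order_tendstoD(2)[OF lim1]) auto
 then obtain n0 where n0: "!!n. n >= n0 ==> LI (%x. om x * \<bar>cv k1 (e n) x\<bar>) < \<epsilon> / 2" by (auto simp: eventually_sequentially)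
 show "\<exists>no. \<forall>n\<ge>no. norm (LI (%x. om x * \<bar>cv k (e n) x\<bar>) - 0) < \<epsilon>"
 proof (intro exI allI impI)
  fix n assume n: "n >= n0"
  note s1 = convolution_sq[OF k1i e[of n]] and s2 = convolution_sq[OF k2i e[of n]] and s0 = convolution_sq[OF k e[of n]]
  have abs_sq: "sq_int lborel (%x. \<bar>g x\<bar>)" if "sq_int lborel g" for g :: "real^'n => real" using that by (auto simp: sq_int_def)
  have i: "Lint (%x. om x * \<bar>cv k (e n) x\<bar>)" "Lint (%x. om x * \<bar>cv k1 (e n) x\<bar>)" "Lint (%x. om x * \<bar>cv k2 (e n) x\<bar>)"
   by (intro sq_int_mult ws abs_sq s0 s1 s2)+
  have "AE x in lborel. cv k (e n) x = cv k1 (e n) x + cv k2 (e n) x"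
   using s1(1) s2(1)
  proof eventually_elim
   case (elim x)
   have "cv k1 (e n) x + cv k2 (e n) x = LI (%z. k1 z * e n (x - z) + k2 z * e n (x - z))"
    unfolding cv_def using elim by simp
   also have "\<dots> = cv k (e n) x" unfolding cv_def by (intro Bochner_Integration.integral_cong refl) (simp add: k1_def k2_def algebra_simps)
   finally show ?case by simp
  qed
  hence "LI (%x. om x * \<bar>cv k (e n) x\<bar>) <= LI (%x. om x * \<bar>cv k1 (e n) x\<bar> + om x * \<bar>cv k2 (e n) x\<bar>)"
  proof (intro integral_mono_AE i Bochner_Integration.integrable_add, eventually_elim)
   case (elim x)
   have "om x * \<bar>cv k (e n) x\<bar> <= om x * (\<bar>cv k1 (e n) x\<bar> + \<bar>cv k2 (e n) x\<bar>)"
    unfolding elim using less_imp_le[OF w0] by (intro mult_left_mono) auto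
   thus ?case by (simp add: distrib_left)
  qed
  also have "\<dots> = LI (%x. om x * \<bar>cv k1 (e n) x\<bar>) + LI (%x. om x * \<bar>cv k2 (e n) x\<bar>)" using i by simp
  also have "LI (%x. om x * \<bar>cv k2 (e n) x\<bar>) <= LI (%z. \<bar>k z - kM M z\<bar>) * D"
  proof -
   have "LI (%x. om x * \<bar>cv k2 (e n) x\<bar>) <= sqrt (LI (%x. (om x)^2)) * sqrt (LI (%x. (cv k2 (e n) x)^2))"
    using integral_Cauchy_Schwarz_sqrt[OF ws abs_sq[OF s2(2)]] by simp
   also have "\<dots> <= sqrt (LI (%x. (om x)^2)) * sqrt (LI (%x. \<bar>k2 x\<bar>)^2 * C)"
   proof (intro mult_left_mono real_sqrt_le_mono)
    show "LI (%x. (cv k2 (e n) x)^2) <= LI (%x. \<bar>k2 x\<bar>)^2 * C"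
     using s2(3) bd[of n] by (meson mult_left_mono order_trans zero_le_power2)
   qed simp
   also have "\<dots> = LI (%z. \<bar>k2 z\<bar>) * D" by (simp add: D_def real_sqrt_mult)
   finally show ?thesis by (simp add: k2_def)
  qed
  finally have "LI (%x. om x * \<bar>cv k (e n) x\<bar>) < \<epsilon>" using M n0[OF n] by linarith
  moreover have "0 <= LI (%x. om x * \<bar>cv k (e n) x\<bar>)" using less_imp_le[OF w0] by (intro integral_nonneg_AE) auto
  ultimately show "norm (LI (%x. om x * \<bar>cv k (e n) x\<bar>) - 0) < \<epsilon>" by simp
 qed
qed

text \<open>A substitute for Rellich's theorem: the differences satisfy
  \<open>d = rho * d - Ker * e\<close> with \<open>d\<close> and \<open>e\<close> weakly null, so
  they tend to zero in weighted L1, and a further subsequence converges almost everywhere.\<close>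

lemma Wsp_weak_compactness:
 fixes u v :: "nat => real^'n::finite => real"
 assumes W: "!!n. Wsp (u n) (v n)" and bd: "!!n. sqn (u n) <= C" "!!n. sqn (v n) <= C"
 shows "\<exists>r u0 v0. strict_mono (r :: nat => nat) & Wsp u0 v0 &
  (\<forall>h. sq_int lborel h --> (%n. LI (%x. v (r n) x * h x)) -->> LI (%x. v0 x * h x)) &
  (AE x in lborel. (%n. u (r n) x) -->> u0 x)"
proof -
 obtain r1 u0 where r1: "strict_mono r1" and u0: "sq_int lborel u0"
  and wu: "!!h. sq_int lborel h ==> (%n. LI (%x. u (r1 n) x * h x)) -->> LI (%x. u0 x * h x)"
 proof -
  have "sq_int lborel (u n)" "sqn (u n) <= C" for n by (intro WspD(1)[OF W] bd)+
  from weak_compactness_sq_int[of lborel u C, OF this] show ?thesis by (elim exE conjE) (rule that, assumption, assumption, simp)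
 qed
 obtain r2 v0 where r2: "strict_mono r2" and v0: "sq_int lborel v0"
  and wv: "!!h. sq_int lborel h ==> (%n. LI (%x. v (r1 (r2 n)) x * h x)) -->> LI (%x. v0 x * h x)"
 proof -
  have "sq_int lborel (v (r1 n))" "LI (%x. (v (r1 n) x)^2) <= C" for n by (intro WspD(2)[OF W] bd)+
  from weak_compactness_sq_int[of lborel "%n. v (r1 n)" C, OF this] show ?thesis by (elim exE conjE) (rule that, assumption, assumption, simp)
 qed
 define r where "r n = r1 (r2 n)" for n
 have wu': "(%n. LI (%x. u (r n) x * h x)) -->> LI (%x. u0 x * h x)" if "sq_int lborel h" for h
  using LIMSEQ_subseq_LIMSEQ[OF wu[OF that] r2] by (simp add: o_def r_def)
 have wv': "(%n. LI (%x. v (r n) x * h x)) -->> LI (%x. v0 x * h x)" if "sq_int lborel h" for h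
  using wv[OF that] by (simp add: r_def)
 have W0: "Wsp u0 v0"
  unfolding Wsp_def
 proof (intro conjI u0 v0 allI impI)
  fix ph :: "real^'n => real" assume ph: "test_fun ph"
  have "(%n. LI (%x. u (r n) x * lap ph x)) -->> LI (%x. u0 x * lap ph x)"
   by (intro wu' test_fun_sq_int test_fun_lap ph)
  moreover have "(%n. LI (%x. u (r n) x * lap ph x)) -->> LI (%x. v0 x * ph x)"
   using wv'[OF test_fun_sq_int[OF ph]] WspD(5)[OF W ph] by simp
  ultimately show "LI (%x. u0 x * lap ph x) = LI (%x. v0 x * ph x)" by (rule LIMSEQ_unique)
 qed
 define d where "d n x = u (r n) x - u0 x" for n x
 define e where "e n x = v (r n) x - v0 x" for n x
 have Wd: "Wsp (d n) (e n)" for n unfolding d_def e_def by (intro Wsp_diff W W0)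
 have bdd: "sqn (d n) <= 2 * C + 2 * sqn u0" for n
  using integral_square_triangle[OF WspD(1)[OF W[of "r n"]] sq_int_cmult[OF u0, of "-1"]] bd(1)[of "r n"] by (simp add: d_def)
 have bde: "sqn (e n) <= 2 * C + 2 * sqn v0" for n
  using integral_square_triangle[OF WspD(2)[OF W[of "r n"]] sq_int_cmult[OF v0, of "-1"]] bd(2)[of "r n"] by (simp add: e_def)
 have wd: "(%n. LI (%x. d n x * h x)) -->> 0" if h: "sq_int lborel h" for h
 proof -
  have "LI (%x. d n x * h x) = LI (%x. u (r n) x * h x) - LI (%x. u0 x * h x)" for n
   unfolding d_def using integral_add_cmult_right[OF WspD(1)[OF W[of "r n"]] u0 h, of "-1"] by simp
  thus ?thesis using wu'[OF h] by (simp add: LIM_zero)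
 qed
 have we: "(%n. LI (%x. e n x * h x)) -->> 0" if h: "sq_int lborel h" for h
 proof -
  have "LI (%x. e n x * h x) = LI (%x. v (r n) x * h x) - LI (%x. v0 x * h x)" for n
   unfolding e_def using integral_add_cmult_right[OF WspD(2)[OF W[of "r n"]] v0 h, of "-1"] by simp
  thus ?thesis using wv'[OF h] by (simp add: LIM_zero)
 qed
 obtain om :: "real^'n => real" where w [measurable]: "om \<in> bmeas" and w0: "!!x. 0 < om x" and wi: "Lint om" and ws: "sq_int lborel om"
  using positive_weight by blast
 have rho_i: "Lint (rho :: real^'n => real)" by (intro test_fun_integrable test_fun_rho)
 have l1: "(%n. LI (%x. om x * \<bar>cv rho (d n) x\<bar>)) -->> 0"
  by (rule cv_weak_limit[OF rho_i WspD(1)[OF Wd] bdd wd w w0 wi ws])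
 have l2: "(%n. LI (%x. om x * \<bar>cv Ker (e n) x\<bar>)) -->> 0"
  by (rule cv_weak_limit[OF Ker_integrable WspD(2)[OF Wd] bde we w w0 wi ws])
 have abs_sq: "sq_int lborel (%x. \<bar>g x\<bar>)" if "sq_int lborel g" for g :: "real^'n => real" using that by (auto simp: sq_int_def)
 have il: "Lint (%x. om x * \<bar>d n x\<bar>)" for n by (intro sq_int_mult ws abs_sq WspD(1)[OF Wd])
 have ile: "LI (%x. om x * \<bar>d n x\<bar>) <= LI (%x. om x * \<bar>cv rho (d n) x\<bar>) + LI (%x. om x * \<bar>cv Ker (e n) x\<bar>)" for n
 proof -
  have i: "Lint (%x. om x * \<bar>cv rho (d n) x\<bar>)" "Lint (%x. om x * \<bar>cv Ker (e n) x\<bar>)"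
   by (intro sq_int_mult ws abs_sq convolution_sq(2) rho_i Ker_integrable WspD[OF Wd])+
  have "LI (%x. om x * \<bar>d n x\<bar>) <= LI (%x. om x * \<bar>cv rho (d n) x\<bar> + om x * \<bar>cv Ker (e n) x\<bar>)"
  proof (intro integral_mono_AE il Bochner_Integration.integrable_add i)
   show "AE x in lborel. om x * \<bar>d n x\<bar> <= om x * \<bar>cv rho (d n) x\<bar> + om x * \<bar>cv Ker (e n) x\<bar>"
    using Wsp_representation[OF Wd[of n]]
   proof eventually_elim
    case (elim x)
    have "om x * \<bar>d n x\<bar> <= om x * (\<bar>cv rho (d n) x\<bar> + \<bar>cv Ker (e n) x\<bar>)"
     by (intro mult_left_mono less_imp_le[OF w0]) (subst elim, simp)
    thus ?case by (simp add: distrib_left)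
   qed
  qed
  thus ?thesis using i by simp
 qed
 have "(%n. LI (%x. norm (om x * d n x))) -->> 0"
 proof (rule tendsto_sandwich[OF _ _ tendsto_const])
  show "\<forall>\<^sub>F n in sequentially. 0 <= LI (%x. norm (om x * d n x))" by simp
  show "\<forall>\<^sub>F n in sequentially. LI (%x. norm (om x * d n x)) <= LI (%x. om x * \<bar>cv rho (d n) x\<bar>) + LI (%x. om x * \<bar>cv Ker (e n) x\<bar>)"
   using ile less_imp_le[OF w0] by (auto simp: abs_mult)
  show "(%n. LI (%x. om x * \<bar>cv rho (d n) x\<bar>) + LI (%x. om x * \<bar>cv Ker (e n) x\<bar>)) -->> 0"
   using tendsto_add[OF l1 l2] by simp
 qed
 moreover have "Lint (%x. om x * d n x)" for n by (intro sq_int_mult ws WspD(1)[OF Wd])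
 ultimately obtain r3 where r3: "strict_mono r3" and ae: "AE x in lborel. (%n. om x * d (r3 n) x) -->> 0"
  using tendsto_L1_AE_subseq[of lborel "%n x. om x * d n x"] by blast
 have "AE x in lborel. (%n. u (r (r3 n)) x) -->> u0 x"
  using ae
 proof eventually_elim
  case (elim x)
  have "(%n. (1 / om x) * (om x * d (r3 n) x)) -->> (1 / om x) * 0" by (intro tendsto_intros elim)
  hence "(%n. d (r3 n) x) -->> 0" using w0[of x] by (simp add: less_imp_neq[symmetric])
  thus ?case by (simp add: d_def LIM_zero_iff)
 qed
 moreover have "(%n. LI (%x. v (r (r3 n)) x * h x)) -->> LI (%x. v0 x * h x)" if "sq_int lborel h" for h
  using LIMSEQ_subseq_LIMSEQ[OF wv'[OF that] r3] by (simp add: o_def)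
 moreover have "strict_mono (%n. r (r3 n))" using r1 r2 r3 by (simp add: strict_mono_def r_def)
 ultimately show ?thesis using W0 by (intro exI[of _ "%n. r (r3 n)"] exI[of _ u0] exI[of _ v0]) auto
qed

section \<open>Second order Sobolev regularity\<close>

lemma cv_pd_swap:
 assumes k: "test_fun k" and ph: "test_fun ph"
 shows "cv k (pd i ph) = cv (pd i k) ph"
proof
 fix x
 have s: "smooth (%z. ph (x + (-1) *\<^sub>R z))" by (intro smooth_affine test_fun_smooth ph)
 have "pd i (%z. ph (x + (-1) *\<^sub>R z)) = (%z. (-1) * pd i ph (x + (-1) *\<^sub>R z))"
  by (intro pd_affine test_fun_differentiable ph)
 thus "cv k (pd i ph) x = cv (pd i k) ph x"
  using integration_by_parts[OF k s, of i] by (simp add: cv_def)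
qed

lemma sqrt_integral_cv_le:
 fixes k ph :: "real^'n::finite => real"
 assumes k: "Lint k" and ph: "sq_int lborel ph"
 shows "sqrt (LI (%x. (cv k ph x)^2)) <= LI (%x. \<bar>k x\<bar>) * sqrt (sqn ph)"
proof -
 have "sqrt (LI (%x. (cv k ph x)^2)) <= sqrt (LI (%x. \<bar>k x\<bar>)^2 * sqn ph)"
  by (intro real_sqrt_le_mono convolution_sq(3) k ph)
 thus ?thesis by (simp add: real_sqrt_mult)
qed

lemma sqrt_integral_lap_cv_Ker_le:
 assumes ph: "test_fun (ph :: real^'n::finite => real)"
 shows "sqrt (LI (%x. (lap (cv Ker ph) x)^2)) <= 2 * sqrt (sqn ph)"
proof -
 have ri: "Lint (rho :: real^'n => real)" by (intro test_fun_integrable test_fun_rho)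
 note f = test_fun_sq_int[OF ph]
 have "LI (%x::real^'n. \<bar>rho x\<bar>) = 1" using integral_rho by (simp add: rho_nonneg)
 hence le: "LI (%x. (cv rho ph x)^2) <= sqn ph"
  using convolution_sq(3)[OF ri f] by simp
 have eq: "lap (cv Ker ph) = (%x. cv rho ph x + (-1) * ph x)"
  using lap_cv[OF ball_kernel_Ker ph] cv_Ker_lap[OF ph] by auto
 have "LI (%x. (lap (cv Ker ph) x)^2) <= 2 * LI (%x. (cv rho ph x)^2) + 2 * sqn ph"
  unfolding eq using integral_square_triangle[OF convolution_sq(2)[OF ri f] sq_int_cmult[OF f, of "-1"]] by simp
 also have "\<dots> <= 4 * sqn ph" using le by simp
 finally have "sqrt (LI (%x. (lap (cv Ker ph) x)^2)) <= sqrt (4 * sqn ph)" by (rule real_sqrt_le_mono)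
 thus ?thesis by (simp add: real_sqrt_mult)
qed

lemma Wsp_test_identity:
 assumes W: "Wsp u v" and ps: "test_fun ps"
 shows "LI (%x. u x * ps x) = LI (%x. u x * cv rho ps x) - LI (%x. v x * cv Ker ps x)"
proof -
 have t: "test_fun (cv Ker ps)" "test_fun (cv rho ps)" by (intro test_fun_cv ball_kernel_Ker ball_kernel_rho ps)+
 have "LI (%x. v x * cv Ker ps x) = LI (%x. u x * lap (cv Ker ps) x)" using WspD(5)[OF W t(1)] by simp
 also have "lap (cv Ker ps) = (%x. cv rho ps x - ps x)" using lap_cv[OF ball_kernel_Ker ps] cv_Ker_lap[OF ps] by auto
 also have "LI (%x. u x * (cv rho ps x - ps x)) = LI (%x. u x * cv rho ps x) - LI (%x. u x * ps x)"
  using sq_int_mult[OF WspD(1)[OF W] test_fun_sq_int[OF t(2)]] sq_int_mult[OF WspD(1)[OF W] test_fun_sq_int[OF ps]]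
  by (simp add: right_diff_distrib)
 finally show ?thesis by simp
qed

text \<open>In the tested form of the representation the derivative falls on the smooth
  \<open>rho\<close> in one term and on \<open>cv Ker ph\<close> in the other. The Laplacian of
  \<open>cv Ker ph\<close> is controlled by \<open>ph\<close>, and for test functions it controls
  all first and second derivatives. The variable \<open>D\<close> treats both orders at
  once.\<close>

lemma Wsp_derivative_functional_bound:
 fixes u v :: "real^'n::finite => real"
 assumes W: "Wsp u v" and D: "D = pd i \<or> D = (%ph. pd i (pd j ph))"
 shows "\<exists>C. \<forall>ph. test_fun ph --> \<bar>LI (%x. u x * D ph x)\<bar> <= C * sqrt (sqn ph)"
proof -
 have Ki: "Lint (Ker :: real^'n => real)" by (rule Ker_integrable)
 have tD: "test_fun (D ph)" if "test_fun ph" for ph using D that by (auto simp: test_fun_pd)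
 have tr: "test_fun (D rho)" by (intro tD test_fun_rho)
 have rD: "cv rho (D ph) = cv (D rho) ph" if "test_fun ph" for ph
  using D that pd_commute[OF test_fun_rho, of i j] by (auto simp: cv_pd_swap test_fun_rho test_fun_pd)
 have KD: "cv Ker (D ph) = D (cv Ker ph)" if "test_fun ph" for ph
  using D that by (auto simp: pd_cv[OF Ki] test_fun_pd)
 define a where "a = LI (%x::real^'n. \<bar>Ker x\<bar>)"
 have a0: "a >= 0" by (simp add: a_def)
 have KB: "sqrt (LI (%x. (D (cv Ker ph) x)^2)) <= (2 * a + 2) * sqrt (sqn ph)" if ph: "test_fun ph" for ph
 proof -
  define n where "n = sqrt (sqn ph)"
  have n0: "n >= 0" by (simp add: n_def)
  have t: "test_fun (cv Ker ph)" by (intro test_fun_cv ball_kernel_Ker ph)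
  have l: "sqrt (LI (%x. (lap (cv Ker ph) x)^2)) <= 2 * n" unfolding n_def by (rule sqrt_integral_lap_cv_Ker_le[OF ph])
  have c: "sqrt (LI (%x. (cv Ker ph x)^2)) <= a * n" unfolding n_def a_def by (rule sqrt_integral_cv_le[OF Ki test_fun_sq_int[OF ph]])
  from D show ?thesis unfolding n_def[symmetric]
  proof
   assume D: "D = pd i"
   have "LI (%x. (D (cv Ker ph) x)^2) <= sqrt (LI (%x. (cv Ker ph x)^2)) * sqrt (LI (%x. (lap (cv Ker ph) x)^2))"
    unfolding D by (rule integral_gradient_le[OF t])
   also have "\<dots> <= (a * n) * (2 * n)" by (intro mult_mono l c) (use a0 n0 in auto)
   also have "\<dots> <= ((2 * a + 2) * n)^2"
   proof -
    have "2 * a <= (2 * a + 2)^2" using a0 by (simp add: power2_eq_square algebra_simps)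
    hence "2 * a * n^2 <= (2 * a + 2)^2 * n^2" by (intro mult_right_mono) auto
    thus ?thesis by (simp add: power_mult_distrib power2_eq_square algebra_simps)
   qed
   finally have "sqrt (LI (%x. (D (cv Ker ph) x)^2)) <= sqrt (((2 * a + 2) * n)^2)" by (rule real_sqrt_le_mono)
   thus "sqrt (LI (%x. (D (cv Ker ph) x)^2)) <= (2 * a + 2) * n" using a0 n0 by simp
  next
   assume D: "D = (%ph. pd i (pd j ph))"
   have "sqrt (LI (%x. (D (cv Ker ph) x)^2)) <= sqrt (LI (%x. (lap (cv Ker ph) x)^2))"
    unfolding D by (intro real_sqrt_le_mono integral_second_derivatives_le t)
   also have "\<dots> <= 2 * n" by (rule l)
   also have "\<dots> <= (2 * a + 2) * n" using a0 n0 by (intro mult_right_mono) auto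
   finally show "sqrt (LI (%x. (D (cv Ker ph) x)^2)) <= (2 * a + 2) * n" .
  qed
 qed
 define b where "b = LI (%x. \<bar>D rho x\<bar>)"
 define nu where "nu = sqrt (sqn u)"
 define nv where "nv = sqrt (sqn v)"
 have nn: "nu >= 0" "nv >= 0" by (simp_all add: nu_def nv_def)
 have "\<bar>LI (%x. u x * D ph x)\<bar> <= (nu * b + nv * (2 * a + 2)) * sqrt (sqn ph)" if ph: "test_fun ph" for ph
 proof -
  define n where "n = sqrt (sqn ph)"
  have s1: "sq_int lborel (cv (D rho) ph)" by (intro convolution_sq test_fun_integrable tr test_fun_sq_int ph)
  have s2: "sq_int lborel (D (cv Ker ph))" by (intro test_fun_sq_int tD test_fun_cv ball_kernel_Ker ph)
  have "\<bar>LI (%x. u x * cv (D rho) ph x)\<bar> <= nu * sqrt (LI (%x. (cv (D rho) ph x)^2))"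
   unfolding nu_def by (rule integral_Cauchy_Schwarz_sqrt[OF WspD(1)[OF W] s1])
  also have "\<dots> <= nu * (b * n)" unfolding b_def n_def
   by (intro mult_left_mono sqrt_integral_cv_le test_fun_integrable tr test_fun_sq_int ph nn)
  finally have 1: "\<bar>LI (%x. u x * cv (D rho) ph x)\<bar> <= nu * (b * n)" .
  have "\<bar>LI (%x. v x * D (cv Ker ph) x)\<bar> <= nv * sqrt (LI (%x. (D (cv Ker ph) x)^2))"
   unfolding nv_def by (rule integral_Cauchy_Schwarz_sqrt[OF WspD(2)[OF W] s2])
  also have "\<dots> <= nv * ((2 * a + 2) * n)" unfolding n_def by (intro mult_left_mono KB ph nn)
  finally have 2: "\<bar>LI (%x. v x * D (cv Ker ph) x)\<bar> <= nv * ((2 * a + 2) * n)" .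
  have "LI (%x. u x * D ph x) = LI (%x. u x * cv (D rho) ph x) - LI (%x. v x * D (cv Ker ph) x)"
   using Wsp_test_identity[OF W tD[OF ph]] rD[OF ph] KD[OF ph] by simp
  thus ?thesis using 1 2 unfolding n_def[symmetric] by (simp add: algebra_simps)
 qed
 thus ?thesis by blast
qed

text \<open>Riesz representation on the linear space of test functions, which is not closed; the
  functional is bounded there in the L2 norm.\<close>

lemma Wsp_weak_derivative:
 fixes u v :: "real^'n::finite => real"
 assumes W: "Wsp u v" and D: "D = pd i \<or> D = (%ph. pd i (pd j ph))"
 shows "\<exists>f. sq_int lborel f & (\<forall>ph. test_fun ph --> LI (%x. u x * D ph x) = LI (%x. f x * ph x))"
proof -
 obtain C where C: "!!ph. test_fun ph ==> \<bar>LI (%x. u x * D ph x)\<bar> <= C * sqrt (sqn ph)"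
  using Wsp_derivative_functional_bound[OF W D] by blast
 have tD: "test_fun (D ph)" if "test_fun ph" for ph using D that by (auto simp: test_fun_pd)
 have lin: "D (%x. g x + c * h x) = (%x. D g x + c * D h x)" if "test_fun g" "test_fun h" for g h c
 proof -
  have p: "pd i (%x. g x + c * h x) = (%x. pd i g x + c * pd i h x)" if "test_fun g" "test_fun h" for g h i
   using test_fun_differentiable[OF that(1)] test_fun_differentiable[OF that(2)] test_fun_differentiable[OF test_fun_cmult[OF that(2), of c]]
   by (simp add: pd_add pd_cmult)
  thus ?thesis using D that by (auto simp: test_fun_pd)
 qed
 have "\<exists>f s. sq_int lborel f & (\<forall>g\<in>Collect test_fun. LI (%x. u x * D g x) = LI (%x. f x * g x)) &
  (\<forall>n::nat. s n \<in> Collect test_fun) & (%n. LI (%x. (s n x - f x)^2)) -->> 0"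
 proof (rule Riesz_representation)
  show "Collect test_fun \<noteq> ({} :: (real^'n => real) set)" using test_fun_zero by auto
  fix g h :: "real^'n => real" and c assume gh: "g \<in> Collect test_fun" "h \<in> Collect test_fun"
  thus "(%x. g x + c * h x) \<in> Collect test_fun" by (auto intro!: test_fun_add test_fun_cmult)
  have "sq_int lborel (D g)" "sq_int lborel (D h)" using gh by (auto intro!: test_fun_sq_int tD)
  thus "LI (%x. u x * D (%x. g x + c * h x) x) = LI (%x. u x * D g x) + c * LI (%x. u x * D h x)"
   using lin[of g h c] gh integral_add_cmult_right[of lborel "D g" "D h" u c] WspD(1)[OF W] by (simp add: mult.commute)
 next
  fix g :: "real^'n => real" assume "g \<in> Collect test_fun"
  hence g: "test_fun g" by simp
  show "sq_int lborel g" by (rule test_fun_sq_int[OF g])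
  show "\<bar>LI (%x. u x * D g x)\<bar> <= C * sqrt (LI (%x. (g x)\<^sup>2))" by (rule C[OF g])
 qed
 then obtain f where "sq_int lborel f" "\<forall>g\<in>Collect test_fun. LI (%x. u x * D g x) = LI (%x. f x * g x)"
  by (elim exE conjE) (rule that)
 thus ?thesis by (intro exI[of _ f]) simp
qed

section \<open>From Borel functions to the completed measure\<close>

lemma lebesgue_integral_borel:
 fixes g :: "real^'n::finite => real"
 assumes "g \<in> bmeas" shows "(LINT x|lebesgue. g x) = LI (%x. g x)"
 using assms by (intro integral_completion) simp

lemma sq_int_imp_L2: "sq_int lborel g ==> L2 g"
 unfolding L2_def
proof
 assume g: "sq_int lborel g"
 note m [measurable] = sq_int_measurable[OF g]
 show "g \<in> borel_measurable lebesgue" by (rule measurable_completion[OF m])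
 show "integrable lebesgue (%x. (g x)^2)"
  by (rule integrable_completion[THEN iffD2]) (use sq_int_integrable[OF g] in measurable)
qed

text \<open>The Riesz densities lack the minus sign of integration by parts: the first derivatives
  are \<open>- F i\<close>, while for the second ones the two signs cancel.\<close>

lemma Wsp_imp_H2:
 fixes u v :: "real^'n::finite => real"
 assumes W: "Wsp u v" shows "H2 u"
proof -
 have "\<exists>f. sq_int lborel f & (\<forall>ph. test_fun ph --> LI (%x. u x * pd i ph x) = LI (%x. f x * ph x))" for i
  using Wsp_weak_derivative[OF W, of "pd i" i i] by simp
 then obtain F where F: "!!i. sq_int lborel (F i)" "!!i ph. test_fun ph ==> LI (%x. u x * pd i ph x) = LI (%x. F i x * ph x)"
  by metis
 have "\<exists>f. sq_int lborel f & (\<forall>ph. test_fun ph --> LI (%x. u x * pd i (pd j ph) x) = LI (%x. f x * ph x))" for i j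
  using Wsp_weak_derivative[OF W, of "%ph. pd i (pd j ph)" i j] by simp
 then obtain G where G: "!!i j. sq_int lborel (G i j)" "!!i j ph. test_fun ph ==> LI (%x. u x * pd i (pd j ph) x) = LI (%x. G i j x * ph x)"
  by metis
 have [measurable]: "u \<in> bmeas" "F i \<in> bmeas" "G i j \<in> bmeas" for i j
  using WspD(3)[OF W] sq_int_measurable[OF F(1)] sq_int_measurable[OF G(1)] by auto
 have "L2 (%x. - F i x)" for i using sq_int_imp_L2[OF sq_int_cmult[OF F(1)[of i], of "-1"]] by simp
 moreover have "weak_pd i u (%x. - F i x)" for i
  unfolding weak_pd_def
 proof (intro allI impI)
  fix ph :: "real^'n => real" assume ph: "test_fun ph"
  note [measurable] = test_fun_measurable[OF ph] test_fun_measurable[OF test_fun_pd[OF ph]]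
  show "(LINT x|lebesgue. u x * pd i ph x) = - (LINT x|lebesgue. - F i x * ph x)"
   using F(2)[OF ph, of i] by (simp add: lebesgue_integral_borel)
 qed
 moreover have "weak_pd j (%x. - F i x) (G i j)" for i j
  unfolding weak_pd_def
 proof (intro allI impI)
  fix ph :: "real^'n => real" assume ph: "test_fun ph"
  note [measurable] = test_fun_measurable[OF ph] test_fun_measurable[OF test_fun_pd[OF ph]]
  show "(LINT x|lebesgue. - F i x * pd j ph x) = - (LINT x|lebesgue. G i j x * ph x)"
   using F(2)[OF test_fun_pd[OF ph, of j], of i] G(2)[OF ph, of i j] by (simp add: lebesgue_integral_borel)
 qed
 ultimately show ?thesis
  unfolding H2_def using sq_int_imp_L2[OF WspD(1)[OF W]] sq_int_imp_L2[OF G(1)]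
  by (intro conjI exI[of _ "%i x. - F i x"] exI[of _ G]) auto
qed

lemma L2_borel_representative:
 fixes g :: "real^'n::finite => real"
 assumes "L2 g" shows "\<exists>g'. sq_int lborel g' & (AE x in lebesgue. g x = g' x)"
proof -
 obtain g' where g': "g' \<in> borel_measurable lborel" "AE x in lborel. g x = g' x"
  using completion_ex_borel_measurable_real[of g lborel] assms by (auto simp: L2_def)
 have ae: "AE x in lebesgue. g x = g' x" by (rule AE_completion[OF g'(2)])
 have [measurable]: "g \<in> borel_measurable lebesgue" using assms by (simp add: L2_def)
 have [measurable]: "g' \<in> borel_measurable lebesgue" by (rule measurable_completion[OF g'(1)])
 have "integrable lebesgue (%x. (g x)^2)" using assms by (simp add: L2_def)
 hence "integrable lebesgue (%x. (g' x)^2)"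
  by (rule integrable_cong_AE_imp) (use ae in \<open>auto elim!: eventually_mono\<close>)
 hence "sq_int lborel g'" using g'(1) integrable_completion[of "%x. (g' x)^2" lborel] by (simp add: sq_int_def)
 thus ?thesis using ae by blast
qed

lemma lebesgue_integral_cong_borel:
 fixes g g' :: "real^'n::finite => real"
 assumes g: "g \<in> borel_measurable lebesgue" and g': "g' \<in> bmeas" and ae: "AE x in lebesgue. g x = g' x"
 shows "(LINT x|lebesgue. g x) = LI (%x. g' x)"
proof -
 have "g' \<in> borel_measurable lebesgue" using g' by (intro measurable_completion) simp
 hence "(LINT x|lebesgue. g x) = (LINT x|lebesgue. g' x)" by (intro integral_cong_AE g ae)
 thus ?thesis using lebesgue_integral_borel[OF g'] by simp
qed

lemma borel_imp_lebesgue: "g \<in> bmeas ==> g \<in> borel_measurable lebesgue" for g :: "real^'n::finite => real"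
 by (intro measurable_completion) simp

lemma weak_lap_imp_Wsp:
 fixes ph w :: "real^'n::finite => real"
 assumes "L2 ph" "weak_lap ph w"
 shows "\<exists>ph' w'. Wsp ph' w' & (AE x in lebesgue. ph x = ph' x) & (AE x in lebesgue. w x = w' x)"
proof -
 obtain ph' where p: "sq_int lborel ph'" "AE x in lebesgue. ph x = ph' x" using L2_borel_representative[OF assms(1)] by blast
 have w: "L2 w" using assms(2) by (simp add: weak_lap_def)
 obtain w' where q: "sq_int lborel w'" "AE x in lebesgue. w x = w' x" using L2_borel_representative[OF w] by blast
 have [measurable]: "ph \<in> borel_measurable lebesgue" "w \<in> borel_measurable lebesgue" using assms(1) w by (auto simp: L2_def)
 have [measurable]: "ph' \<in> bmeas" "w' \<in> bmeas" using sq_int_measurable[OF p(1)] sq_int_measurable[OF q(1)] by auto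
 have "LI (%x. ph' x * lap et x) = LI (%x. w' x * et x)" if et: "test_fun et" for et
 proof -
  note m = test_fun_measurable[OF et] test_fun_measurable[OF test_fun_lap[OF et]]
  note [measurable] = m borel_imp_lebesgue[OF m(1)] borel_imp_lebesgue[OF m(2)]
  have "(LINT x|lebesgue. ph x * lap et x) = LI (%x. ph' x * lap et x)"
   by (rule lebesgue_integral_cong_borel) (use p(2) in \<open>auto elim!: eventually_mono\<close>)
  moreover have "(LINT x|lebesgue. w x * et x) = LI (%x. w' x * et x)"
   by (rule lebesgue_integral_cong_borel) (use q(2) in \<open>auto elim!: eventually_mono\<close>)
  ultimately show ?thesis using assms(2) et by (simp add: weak_lap_def)
 qed
 thus ?thesis using p q by (auto simp: Wsp_def)
qed

text \<open>Needed because \<open>weak_solution\<close> quantifies over every admissible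
  \<open>Lu\<close>: all of them agree almost everywhere with the constructed
  \<open>v\<close>.\<close>

lemma Wsp_unique:
 fixes u v v' :: "real^'n::finite => real"
 assumes "Wsp u v" "Wsp u' v'" "AE x in lborel. u x = u' x"
 shows "AE x in lborel. v x = v' x"
proof -
 have W: "Wsp (%x. u x - u' x) (%x. v x - v' x)" by (intro Wsp_diff assms)
 have "AE x in lborel. v x - v' x = 0"
 proof (rule fundamental_lemma[OF sq_int_loc_int[OF WspD(2)[OF W]]])
  fix et :: "real^'n => real" assume et: "test_fun et"
  have "LI (%x. (u x - u' x) * lap et x) = 0"
   by (rule integral_eq_zero_AE) (use assms(3) in \<open>auto elim!: eventually_mono\<close>)
  thus "LI (%x. (v x - v' x) * et x) = 0" using WspD(5)[OF W et] by simp
 qed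
 thus ?thesis by eventually_elim simp
qed

lemma AE_lebesgue_iff_borel:
 fixes g h :: "real^'n::finite => real"
 assumes [measurable]: "g \<in> bmeas" "h \<in> bmeas"
 shows "(AE x in lebesgue. g x = h x) \<longleftrightarrow> (AE x in lborel. g x = h x)"
 by (rule AE_completion_iff)

lemma weak_solutionI:
 fixes u v V :: "real^'n::finite => real"
 assumes W: "Wsp u v" and V: "V \<in> bmeas" "!!x. \<bar>V x\<bar> <= B" and f: "f \<in> bmeas"
  and eq: "!!ph ps. Wsp ph ps ==> eps^4 * LI (%x. v x * ps x) + LI (%x. V x * u x * ph x) = LI (%x. f (u x) * ph x)"
 shows "weak_solution eps V f u"
 unfolding weak_solution_def
proof (intro conjI allI impI)
 show "H2 u" by (rule Wsp_imp_H2[OF W])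
 fix ph Lu Lph :: "real^'n => real" assume H: "H2 ph" "weak_lap u Lu" "weak_lap ph Lph"
 obtain u' v' where 1: "Wsp u' v'" "AE x in lebesgue. u x = u' x" "AE x in lebesgue. Lu x = v' x"
  using weak_lap_imp_Wsp[OF sq_int_imp_L2[OF WspD(1)[OF W]] H(2)] by blast
 have "L2 ph" using H(1) by (simp add: H2_def)
 then obtain ph' ps' where 2: "Wsp ph' ps'" "AE x in lebesgue. ph x = ph' x" "AE x in lebesgue. Lph x = ps' x"
  using weak_lap_imp_Wsp[OF _ H(3)] by blast
 note b = WspD(3,4)[OF W] WspD(3,4)[OF 1(1)] WspD(3,4)[OF 2(1)] V(1)
 note [measurable] = f b b[THEN borel_imp_lebesgue]
 have [measurable]: "ph \<in> borel_measurable lebesgue" "Lu \<in> borel_measurable lebesgue" "Lph \<in> borel_measurable lebesgue"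
  using \<open>L2 ph\<close> H(2,3) by (auto simp: weak_lap_def L2_def)
 have "AE x in lborel. v x = v' x"
  using AE_lebesgue_iff_borel[OF WspD(3)[OF W] WspD(3)[OF 1(1)]] 1(2) by (intro Wsp_unique[OF W 1(1)]) simp
 hence "AE x in lebesgue. v x = v' x" by (rule AE_completion)
 hence Luv: "AE x in lebesgue. Lu x = v x" using 1(3) by eventually_elim simp
 have sV: "sq_int lborel (%x. V x * u x)"
  by (rule sq_int_bound[OF WspD(1)[OF W], of _ B]) (use V in \<open>auto simp: abs_mult intro!: mult_right_mono AE_I2\<close>)
 have "(LINT x|lebesgue. eps^4 * Lu x * Lph x + V x * u x * ph x) = LI (%x. eps^4 * (v x * ps' x) + V x * u x * ph' x)"
 proof (rule lebesgue_integral_cong_borel)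
  show "AE x in lebesgue. eps^4 * Lu x * Lph x + V x * u x * ph x = eps^4 * (v x * ps' x) + V x * u x * ph' x"
   using Luv 2(2,3) by eventually_elim simp
 qed measurable
 also have "\<dots> = eps^4 * LI (%x. v x * ps' x) + LI (%x. V x * u x * ph' x)"
  using sq_int_mult[OF WspD(2)[OF W] WspD(2)[OF 2(1)]] sq_int_mult[OF sV WspD(1)[OF 2(1)]] by simp
 also have "\<dots> = LI (%x. f (u x) * ph' x)" by (rule eq[OF 2(1)])
 also have "\<dots> = (LINT x|lebesgue. f (u x) * ph x)"
 proof (rule lebesgue_integral_cong_borel[symmetric])
  show "AE x in lebesgue. f (u x) * ph x = f (u x) * ph' x" using 2(2) by eventually_elim simp
  show "(%x. f (u x) * ph x) \<in> borel_measurable lebesgue"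
   using borel_imp_lebesgue[of "%x. f (u x)"] by simp
 qed measurable
 finally show "(LINT x|lebesgue. eps^4 * Lu x * Lph x + V x * u x * ph x) = (LINT x|lebesgue. f (u x) * ph x)" .
qed

section \<open>Uniform bounds for solutions\<close>

lemma integral_indicator_cball:
 "Lint (%x::real^'n::finite. indicator (cball y R) x :: real)"
 "LI (%x. indicator (cball (y::real^'n) R) x) = (LI (%x. indicator (cball (0::real^'n) R) x) :: real)"
proof -
 show "Lint (%x::real^'n. indicator (cball y R) x :: real)"
  by (intro integrable_real_indicator emeasure_bounded_finite) auto
 have [measurable]: "(indicator (cball y R) :: real^'n => real) \<in> bmeas"
  by (intro borel_measurable_indicator) simp
 have "(%x::real^'n. indicator (cball y R) (x + y) :: real) = indicator (cball 0 R)"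
  by (auto simp: indicator_def dist_norm fun_eq_iff)
 thus "LI (%x. indicator (cball (y::real^'n) R) x) = (LI (%x. indicator (cball (0::real^'n) R) x) :: real)"
  using integral_lborel_translate[of "indicator (cball y R)" y] by simp
qed

lemma cv_cong_AE:
 fixes k v v' :: "real^'n::finite => real"
 assumes [measurable]: "k \<in> bmeas" "v \<in> bmeas" "v' \<in> bmeas"
  and ae: "AE x in lborel. v x = v' x"
 shows "cv k v x = cv k v' x"
 unfolding cv_reflect[OF assms(1,2)] cv_reflect[OF assms(1,3)]
 by (rule integral_cong_AE) (use ae in \<open>auto elim!: eventually_mono\<close>)

text \<open>Both integrands are supported on two unit balls, whose measure does not depend on the
  centres, and the Lipschitz constant of \<open>k\<close> bounds them there.\<close>

lemma test_fun_difference_sq: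
 assumes k: "test_fun (k :: real^'n::finite => real)" and 1: "!!x. norm x > 1 ==> k x = 0"
 shows "\<exists>A>0. \<forall>a b. LI (%w. (k (a - w) - k (b - w))^2) <= (A * norm (a - b))^2"
  and "\<exists>A>0. \<forall>e. LI (%w. \<bar>k w - k (w + e)\<bar>) <= A * norm e"
proof -
 obtain L where L: "L > 0" "!!x y. \<bar>k x - k y\<bar> <= L * norm (x - y)" using test_fun_Lipschitz[OF k] by blast
 note [measurable] = test_fun_measurable[OF k]
 define m where "m = (LI (%x. indicator (cball (0::real^'n) 1) x) :: real)"
 have m0: "m >= 0" by (simp add: m_def)
 have mi: "Lint (indicator (cball y 1) :: real^'n => real)" "LI (%x. indicator (cball (y::real^'n) 1) x) = m" for y
  using integral_indicator_cball[of y 1] by (auto simp: m_def)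
 have z: "k (a - w) = 0" if "w \<notin> cball a 1" for a w using that by (intro 1) (auto simp: dist_norm)
 have le: "LI (%w. (k (a - w) - k (b - w))^2) <= (sqrt (2 * m + 1) * L * norm (a - b))^2" for a b
 proof -
  have "LI (%w. (k (a - w) - k (b - w))^2) <= LI (%w. (L * norm (a - b))^2 * (indicator (cball a 1) w + indicator (cball b 1) w))"
  proof (rule integral_mono_AE')
   show "Lint (%w. (L * norm (a - b))^2 * (indicator (cball a 1) w + indicator (cball b 1) w))"
    using mi by (intro integrable_mult_right Bochner_Integration.integrable_add) auto
   show "AE w in lborel. (k (a - w) - k (b - w))^2 <= (L * norm (a - b))^2 * (indicator (cball a 1) w + indicator (cball b 1) w)"
   proof (rule AE_I2)
    fix w
    have "\<bar>k (a - w) - k (b - w)\<bar> <= L * norm (a - b)" using L(2)[of "a - w" "b - w"] by simp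
    hence sq: "(k (a - w) - k (b - w))^2 <= (L * norm (a - b))^2" by (metis abs_ge_zero power2_abs power_mono)
    show "(k (a - w) - k (b - w))^2 <= (L * norm (a - b))^2 * (indicator (cball a 1) w + indicator (cball b 1) w)"
    proof (cases "w \<in> cball a 1 \<or> w \<in> cball b 1")
     case True
     hence "(1::real) <= indicator (cball a 1) w + indicator (cball b 1) w" by (auto simp: indicator_def)
     hence "(L * norm (a - b))^2 * 1 <= (L * norm (a - b))^2 * (indicator (cball a 1) w + indicator (cball b 1) w)" by (intro mult_left_mono) auto
     thus ?thesis using sq by simp
    next
     case False
     thus ?thesis by (simp add: z)
    qed
   qed
  qed auto
  also have "\<dots> = (L * norm (a - b))^2 * (2 * m)" using mi by simp
  also have "\<dots> <= (L * norm (a - b))^2 * (2 * m + 1)" by (intro mult_left_mono) auto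
  also have "\<dots> = (sqrt (2 * m + 1) * L * norm (a - b))^2" using m0 by (simp add: power_mult_distrib)
  finally show ?thesis .
 qed
 show "\<exists>A>0. \<forall>a b. LI (%w. (k (a - w) - k (b - w))^2) <= (A * norm (a - b))^2"
  using le L(1) m0 by (intro exI[of _ "sqrt (2 * m + 1) * L"]) auto
 have z': "k (w + e) = 0" if "w \<notin> cball (- e) 1" for e w using that by (intro 1) (auto simp: dist_norm norm_minus_commute add.commute)
 have zz: "k w = 0" if "w \<notin> cball 0 1" for w using that by (intro 1) auto
 have le: "LI (%w. \<bar>k w - k (w + e)\<bar>) <= ((2 * m + 1) * L) * norm e" for e
 proof -
  have "LI (%w. \<bar>k w - k (w + e)\<bar>) <= LI (%w. L * norm e * (indicator (cball 0 1) w + indicator (cball (- e) 1) w))"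
  proof (rule integral_mono_AE')
   show "Lint (%w::real^'n. L * norm e * (indicator (cball 0 1) w + indicator (cball (- e) 1) w))"
    using mi by (intro integrable_mult_right Bochner_Integration.integrable_add) auto
   show "AE w in lborel. \<bar>k w - k (w + e)\<bar> <= L * norm e * (indicator (cball 0 1) w + indicator (cball (- e) 1) w)"
   proof (rule AE_I2)
    fix w
    show "\<bar>k w - k (w + e)\<bar> <= L * norm e * (indicator (cball 0 1) w + indicator (cball (- e) 1) w)"
    proof (cases "w \<in> cball 0 1 \<or> w \<in> cball (- e) 1")
     case True
     hence "(1::real) <= indicator (cball 0 1) w + indicator (cball (- e) 1) w" by (auto simp: indicator_def)
     hence "L * norm e * 1 <= L * norm e * (indicator (cball 0 1) w + indicator (cball (- e) 1) w)" using L by (intro mult_left_mono) auto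
     thus ?thesis using L(2)[of w "w + e"] by simp
    next
     case False
     thus ?thesis by (simp add: z' zz)
    qed
   qed
   show "AE w in lborel. 0 <= L * norm e * (indicator (cball 0 1) w + indicator (cball (- e) 1) w)" using L by auto
  qed
  also have "\<dots> = L * norm e * (2 * m)" using mi by simp
  also have "\<dots> <= L * norm e * (2 * m + 1)" using L by (intro mult_left_mono) auto
  finally show ?thesis by (simp add: mult_ac)
 qed
 show "\<exists>A>0. \<forall>e. LI (%w. \<bar>k w - k (w + e)\<bar>) <= A * norm e"
  using le L(1) m0 by (intro exI[of _ "(2 * m + 1) * L"]) auto
qed

lemma cv_rho_bounds:
 "\<exists>A>0. \<forall>(u :: real^'n::finite => real). sq_int lborel u -->
  (\<forall>x. \<bar>cv rho u x\<bar> <= A * sqrt (sqn u)) &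
  (\<forall>x y. \<bar>cv rho u x - cv rho u y\<bar> <= A * sqrt (sqn u) * norm (x - y))"
proof -
 have rs: "sq_int lborel (rho :: real^'n => real)" by (intro test_fun_sq_int test_fun_rho)
 obtain A1 where A1: "A1 > 0" "!!a b::real^'n. LI (%w. (rho (a - w) - rho (b - w))^2) <= (A1 * norm (a - b))^2"
 proof -
  have "rho x = 0" if "norm x > 1" for x :: "real^'n" using rho_zero[of x] that by simp
  from test_fun_difference_sq(1)[OF test_fun_rho this] show ?thesis using that by blast
 qed
 define A0 where "A0 = sqrt (LI (%w::real^'n. (rho w)^2))"
 have A0: "A0 >= 0" by (simp add: A0_def)
 have "\<bar>cv rho u x\<bar> <= (A0 + A1) * sqrt (sqn u)"
  "\<bar>cv rho u x - cv rho u y\<bar> <= (A0 + A1) * sqrt (sqn u) * norm (x - y)" if u: "sq_int lborel u" for u and x y :: "real^'n"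
 proof -
  have um [measurable]: "u \<in> bmeas" using sq_int_measurable[OF u] by simp
  define n where "n = sqrt (sqn u)"
  have n: "n >= 0" by (simp add: n_def)
  note s = sq_int_reflect_translate[OF rs]
  have "\<bar>cv rho u x\<bar> <= n * A0"
   using integral_Cauchy_Schwarz_sqrt[OF u s(1)[of x]] unfolding s(2) cv_reflect[OF rho_measurable um] n_def A0_def .
  also have "\<dots> <= n * (A0 + A1)" using n A1 by (intro mult_left_mono) auto
  finally show "\<bar>cv rho u x\<bar> <= (A0 + A1) * sqrt (sqn u)" by (simp add: n_def mult.commute)
  have "cv rho u x - cv rho u y = LI (%w. u w * (rho (x - w) - rho (y - w)))"
   unfolding cv_reflect[OF rho_measurable um] using sq_int_mult[OF u s(1)[of x]] sq_int_mult[OF u s(1)[of y]]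
   by (simp add: right_diff_distrib)
  hence "\<bar>cv rho u x - cv rho u y\<bar> <= n * sqrt (LI (%w. (rho (x - w) - rho (y - w))^2))"
   using integral_Cauchy_Schwarz_sqrt[OF u sq_int_diff[OF s(1)[of x] s(1)[of y]]] unfolding n_def by simp
  also have "\<dots> <= n * sqrt ((A1 * norm (x - y))^2)" using n by (intro mult_left_mono real_sqrt_le_mono A1)
  also have "\<dots> = n * (A1 * norm (x - y))" using A1 by simp
  also have "\<dots> <= n * ((A0 + A1) * norm (x - y))" using n A0 by (intro mult_left_mono mult_right_mono) auto
  finally show "\<bar>cv rho u x - cv rho u y\<bar> <= (A0 + A1) * sqrt (sqn u) * norm (x - y)" by (simp add: n_def mult_ac)
 qed
 thus ?thesis using A0 A1(1) by (intro exI[of _ "A0 + A1"]) auto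
qed

text \<open>A Lipschitz bound that avoids the gradient of \<open>Ker\<close>: in the slice at scale
  \<open>t\<close>, moving from \<open>x\<close> to \<open>y\<close> amounts to translating
  \<open>Psi\<close> by \<open>(y - x) / t\<close>, and the loss of \<open>1 / t\<close> is paid by
  the factor \<open>t\<close> of the slice.\<close>

lemma cv_Ker_bounds:
 "\<exists>A>0. \<forall>(v :: real^'n::finite => real) B. v \<in> bmeas --> (\<forall>x. \<bar>v x\<bar> <= B) -->
  (\<forall>x. \<bar>cv Ker v x\<bar> <= A * B) & (\<forall>x y. \<bar>cv Ker v x - cv Ker v y\<bar> <= A * B * norm (x - y))"
proof -
 obtain A1 where A1: "A1 > 0" "!!e::real^'n. LI (%w. \<bar>Psi w - Psi (w + e)\<bar>) <= A1 * norm e"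
 proof -
  have "Psi x = 0" if "norm x > 1" for x :: "real^'n" using Psi_zero[of x] that by simp
  from test_fun_difference_sq(2)[OF test_fun_Psi this] show ?thesis using that by blast
 qed
 define A0 where "A0 = LI (%z::real^'n. Ker z)"
 have A0: "A0 >= 0" unfolding A0_def by (intro integral_nonneg_AE) (simp add: Ker_nonneg)
 have pi: "Lint (Psi :: real^'n => real)" by (intro test_fun_integrable test_fun_Psi)
 have "\<bar>cv Ker v x\<bar> <= (A0 + A1) * B" "\<bar>cv Ker v x - cv Ker v y\<bar> <= (A0 + A1) * B * norm (x - y)"
  if m [measurable]: "v \<in> bmeas" and B: "!!x. \<bar>v x\<bar> <= B" for v B and x y :: "real^'n"
 proof -
  have B0: "B >= 0" using B[of 0] by linarith
  have "\<bar>cv Ker v x\<bar> <= LI (%z::real^'n. Ker z * B)"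
   unfolding cv_def
  proof (rule order_trans[OF integral_abs_bound integral_mono_AE])
   show "Lint (%z. \<bar>Ker z * v (x - z)\<bar>)" by (intro integrable_abs cv_Ker_bounded(3)[OF m B])
   show "AE z in lborel. \<bar>Ker z * v (x - z)\<bar> <= Ker z * B" by (rule AE_I2) (auto simp: abs_mult Ker_nonneg intro!: mult_left_mono B)
  qed (use Ker_integrable in auto)
  also have "\<dots> = A0 * B" by (simp add: A0_def)
  also have "\<dots> <= (A0 + A1) * B" using B0 A1 by (intro mult_right_mono) auto
  finally show "\<bar>cv Ker v x\<bar> <= (A0 + A1) * B" .
  define J where "J x t = indicator {0<..1} t * (t * LI (%y. Psi y * v (x - t *\<^sub>R y)))" for x and t :: real
  have Ji: "Lint (J x)" and Jc: "cv Ker v x = LI (%t. J x t)" for x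
   using cv_Ker_bounded[OF m B, of x] by (auto simp: J_def[abs_def])
  have psi_int: "Lint (%y. p y * v (x - t *\<^sub>R y))" if "Lint p" for p :: "real^'n => real" and x t
  proof (rule integrable_bnd)
   show "Lint (%y. B * p y)" using that by simp
   show "AE y in lborel. norm (p y * v (x - t *\<^sub>R y)) <= norm (B * p y)"
    using B B0 by (intro AE_I2) (auto simp: abs_mult mult.commute[of B] intro!: mult_left_mono)
  qed (use that in measurable)
  have Jd: "\<bar>J x t - J y t\<bar> <= indicator {0..1} t * (A1 * B * norm (x - y))" for t
  proof (cases "t \<in> {0<..1}")
   case True
   hence t: "t > 0" by simp
   define e where "e = (1 / t) *\<^sub>R (y - x)"
   have pe: "Lint (%w. Psi (w + e))" by (intro integrable_lborel_translate pi)
   have "LI (%w. Psi w * v (y - t *\<^sub>R w)) = LI (%w. Psi (w + e) * v (y - t *\<^sub>R (w + e)))"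
    by (rule integral_lborel_translate[symmetric]) measurable
   also have "\<dots> = LI (%w. Psi (w + e) * v (x - t *\<^sub>R w))"
   proof -
    have "y - t *\<^sub>R (w + e) = x - t *\<^sub>R w" for w using t by (simp add: e_def algebra_simps)
    thus ?thesis by simp
   qed
   finally have sh: "LI (%w. Psi w * v (y - t *\<^sub>R w)) = LI (%w. Psi (w + e) * v (x - t *\<^sub>R w))" .
   have "\<bar>LI (%w. Psi w * v (x - t *\<^sub>R w)) - LI (%w. Psi w * v (y - t *\<^sub>R w))\<bar> = \<bar>LI (%w. (Psi w - Psi (w + e)) * v (x - t *\<^sub>R w))\<bar>"
    unfolding sh using psi_int[OF pi, of x t] psi_int[OF pe, of x t] by (simp add: left_diff_distrib)
   also have "\<dots> <= LI (%w. \<bar>Psi w - Psi (w + e)\<bar> * B)"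
   proof (rule order_trans[OF integral_abs_bound integral_mono_AE])
    have pd: "Lint (%w. Psi w - Psi (w + e))" using pi pe by simp
    show "Lint (%w. \<bar>(Psi w - Psi (w + e)) * v (x - t *\<^sub>R w)\<bar>)" by (intro integrable_abs psi_int pd)
    show "Lint (%w. \<bar>Psi w - Psi (w + e)\<bar> * B)" using pd by simp
    show "AE w in lborel. \<bar>(Psi w - Psi (w + e)) * v (x - t *\<^sub>R w)\<bar> <= \<bar>Psi w - Psi (w + e)\<bar> * B"
     by (rule AE_I2) (auto simp: abs_mult intro!: mult_left_mono B)
   qed
   also have "\<dots> <= (A1 * norm e) * B" using A1(2)[of e] B0 by (simp add: mult_right_mono)
   finally have d: "\<bar>LI (%w. Psi w * v (x - t *\<^sub>R w)) - LI (%w. Psi w * v (y - t *\<^sub>R w))\<bar> <= A1 * norm e * B" .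
   have "\<bar>J x t - J y t\<bar> = t * \<bar>LI (%w. Psi w * v (x - t *\<^sub>R w)) - LI (%w. Psi w * v (y - t *\<^sub>R w))\<bar>"
    using True t by (simp add: J_def right_diff_distrib[symmetric] abs_mult)
   also have "\<dots> <= t * (A1 * norm e * B)" using t by (intro mult_left_mono d) auto
   also have "\<dots> = A1 * B * norm (x - y)" using t by (simp add: e_def norm_minus_commute)
   finally show ?thesis using True by simp
  qed (use A1 B0 in \<open>auto simp: J_def indicator_def\<close>)
  have i01: "Lint (%t. indicator {0..1::real} t * (A1 * B * norm (x - y)))" by (intro integrable_mult_left integrable_real_indicator) auto
  have "\<bar>cv Ker v x - cv Ker v y\<bar> = \<bar>LI (%t. J x t - J y t)\<bar>" using Ji Jc by simp
  also have "\<dots> <= LI (%t. \<bar>J x t - J y t\<bar>)" by (rule integral_abs_bound)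
  also have "\<dots> <= LI (%t. indicator {0..1::real} t * (A1 * B * norm (x - y)))"
  proof (rule integral_mono)
   show "Lint (%t. \<bar>J x t - J y t\<bar>)" by (intro integrable_abs Bochner_Integration.integrable_diff Ji)
   show "Lint (%t. indicator {0..1::real} t * (A1 * B * norm (x - y)))" by (rule i01)
  qed (rule Jd)
  also have "\<dots> = A1 * B * norm (x - y)" by simp
  also have "\<dots> <= (A0 + A1) * B * norm (x - y)" using A0 B0 by (intro mult_right_mono) auto
  finally show "\<bar>cv Ker v x - cv Ker v y\<bar> <= (A0 + A1) * B * norm (x - y)" .
 qed
 thus ?thesis using A0 A1(1) by (intro exI[of _ "A0 + A1"]) auto
qed

text \<open>Young's inequality on balls; as \<open>Ker\<close> lives on the unit ball, each
  application costs one unit of radius. With \<open>1 / r = 1 + 1 / t - 1 / s\<close> the hypothesis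
  \<open>1 / s - 2 / N < 1 / t\<close> is exactly the integrability condition
  \<open>r * (N - 2) < N\<close>.\<close>

lemma Ker_local_step:
 assumes N: "CARD('n::finite) >= 3" and s: "s >= 1" and t: "t > 1" "1 / t <= 1 / s" "1 / s - 2 / real CARD('n) < 1 / t"
  and M: "M >= 0" and c0: "c0 >= 0"
 shows "\<exists>M'\<ge>0. \<forall>(a :: real^'n => real) b y. a \<in> bmeas --> b \<in> bmeas -->
  (AE x in lborel. \<bar>a x\<bar> <= c0 + cv Ker (%x. \<bar>b x\<bar>) x) -->
  Lint (%x. indicator (cball y (R + 1)) x * \<bar>b x\<bar> powr s) -->
  LI (%x. indicator (cball y (R + 1)) x * \<bar>b x\<bar> powr s) <= M -->
  Lint (%x. indicator (cball y R) x * \<bar>a x\<bar> powr t) &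
  LI (%x. indicator (cball y R) x * \<bar>a x\<bar> powr t) <= M'"
proof -
 define D where "D = 1 + 1 / t - 1 / s"
 define r where "r = 1 / D"
 have d: "D > 1 - 2 / real CARD('n)" "D <= 1" using t by (auto simp: D_def)
 have N0: "1 - 2 / real CARD('n) > 0" using N by (simp add: field_simps)
 have D0: "D > 0" using d N0 by linarith
 have r: "r >= 1" using d D0 by (simp add: r_def)
 have e: "1 / r + 1 / s = 1 + 1 / t" by (simp add: r_def D_def)
 have rN: "r * real (CARD('n) - 2) < real CARD('n)"
 proof -
  have "real (CARD('n) - 2) = (1 - 2 / real CARD('n)) * real CARD('n)" using N by (simp add: field_simps of_nat_diff)
  moreover have "r * (1 - 2 / real CARD('n)) < 1" using d D0 by (simp add: r_def pos_divide_less_eq)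
  ultimately show ?thesis using N by (simp add: mult.assoc[symmetric])
 qed
 have iK: "Lint (%z::real^'n. Ker z powr r)" by (rule Ker_powr_integrable[OF N r rN])
 define A where "A = LI (%z::real^'n. Ker z powr r)"
 have A0: "A >= 0" by (simp add: A_def)
 define m where "m = (LI (%x. indicator (cball (0::real^'n) R) x) :: real)"
 have m0: "m >= 0" by (simp add: m_def)
 define M' where "M' = 2 powr t * (c0 powr t * m + A * M * (A + M) powr (t - 1))"
 have M0: "M' >= 0" using m0 A0 M by (simp add: M'_def)
 have "Lint (%x. indicator (cball y R) x * \<bar>a x\<bar> powr t) & LI (%x. indicator (cball y R) x * \<bar>a x\<bar> powr t) <= M'"
  if am [measurable]: "a \<in> bmeas" and bm [measurable]: "b \<in> bmeas"
   and ae: "AE x in lborel. \<bar>a x\<bar> <= c0 + cv Ker (%x. \<bar>b x\<bar>) x"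
   and bi: "Lint (%x. indicator (cball y (R + 1)) x * \<bar>b x\<bar> powr s)"
   and bM: "LI (%x. indicator (cball y (R + 1)) x * \<bar>b x\<bar> powr s) <= M" for a b and y :: "real^'n"
 proof -
  define h where "h x = indicator (cball y (R + 1)) x * \<bar>b x\<bar>" for x
  have [measurable]: "(indicator (cball y R) :: real^'n => real) \<in> bmeas" "(indicator (cball y (R + 1)) :: real^'n => real) \<in> bmeas"
   by (intro borel_measurable_indicator; simp)+
  have [measurable]: "h \<in> bmeas" unfolding h_def by measurable
  have h0: "0 <= h x" for x by (simp add: h_def)
  have hs: "h x powr s = indicator (cball y (R + 1)) x * \<bar>b x\<bar> powr s" for x
   using s by (cases "x \<in> cball y (R + 1)") (auto simp: h_def)
  have hi: "Lint (%x. h x powr s)" using bi by (simp only: hs)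
  define H where "H = LI (%x. h x powr s)"
  have H: "0 <= H" "H <= M" using bM by (auto simp: H_def hs)
  have Y: "Lint (%x. cv Ker h x powr t)" "LI (%x. cv Ker h x powr t) <= A * H * (A + H) powr (t - 1)"
   unfolding A_def H_def by (rule Young_convolution[OF Ker_measurable _ Ker_nonneg h0 t(1) r s e iK hi]; simp)+
  have "A * H * (A + H) powr (t - 1) <= A * M * (A + M) powr (t - 1)" using A0 H t M
   by (intro mult_mono mult_left_mono powr_mono2) auto
  hence Y2: "LI (%x. cv Ker h x powr t) <= A * M * (A + M) powr (t - 1)" using Y(2) by linarith
  have loc: "cv Ker (%x. \<bar>b x\<bar>) x = cv Ker h x" if "x \<in> cball y R" for x
  proof -
   have "Ker z * \<bar>b (x - z)\<bar> = Ker z * h (x - z)" for z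
   proof (cases "norm z > 1")
    case False
    have "dist y (x - z) <= dist y x + norm z"
     using dist_triangle[of y "x - z" x] by (simp add: dist_norm)
    hence "x - z \<in> cball y (R + 1)" using that False by auto
    thus ?thesis by (simp add: h_def)
   qed (simp add: Ker_zero)
   thus ?thesis unfolding cv_def by (intro Bochner_Integration.integral_cong refl)
  qed
  have i: "Lint (%x. 2 powr t * (c0 powr t * indicator (cball y R) x + cv Ker h x powr t))"
   using Y(1) integral_indicator_cball(1)[of y R] by simp
  have le: "AE x in lborel. indicator (cball y R) x * \<bar>a x\<bar> powr t <= 2 powr t * (c0 powr t * indicator (cball y R) x + cv Ker h x powr t)"
   using ae
  proof eventually_elim
   case (elim x)
   show ?case
   proof (cases "x \<in> cball y R")
    case True
    have "\<bar>a x\<bar> powr t <= (c0 + cv Ker h x) powr t" using elim loc[OF True] t by (intro powr_mono2) auto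
    also have "\<dots> <= 2 powr t * (c0 powr t + cv Ker h x powr t)"
     using t c0 by (intro powr_add_le cv_nonneg Ker_nonneg h0) auto
    finally show ?thesis using True by simp
   qed simp
  qed
  have int: "Lint (%x. indicator (cball y R) x * \<bar>a x\<bar> powr t)"
   by (rule integrable_bnd[OF i]) (use le in \<open>auto elim!: eventually_mono intro: order_trans[OF _ abs_ge_self]\<close>)
  have "LI (%x. indicator (cball y R) x * \<bar>a x\<bar> powr t) <= LI (%x. 2 powr t * (c0 powr t * indicator (cball y R) x + cv Ker h x powr t))"
   by (rule integral_mono_AE[OF int i le])
  also have "\<dots> = 2 powr t * (c0 powr t * m + LI (%x. cv Ker h x powr t))"
   using Y(1) integral_indicator_cball[of y R] by (simp add: m_def)
  also have "\<dots> <= M'" unfolding M'_def using Y2 by (intro mult_left_mono add_left_mono) auto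
  finally show ?thesis using int by simp
 qed
 thus ?thesis using M0 by blast
qed

text \<open>The endpoint of the bootstrap. For the exponent \<open>r\<close> conjugate to
  \<open>s\<close>, the condition \<open>1 / s < 2 / N\<close> makes \<open>Ker powr r\<close>
  integrable. The elementary inequality for conjugate exponents replaces Hoelder, hence the sum
  \<open>A + M\<close>.\<close>

lemma Ker_local_sup:
 assumes N: "CARD('n::finite) >= 3" and s: "s > 1" "1 / s < 2 / real CARD('n)"
 shows "\<exists>A\<ge>0. \<forall>(b :: real^'n => real) x M. b \<in> bmeas -->
  Lint (%w. indicator (cball x 1) w * \<bar>b w\<bar> powr s) -->
  LI (%w. indicator (cball x 1) w * \<bar>b w\<bar> powr s) <= M --> cv Ker (%x. \<bar>b x\<bar>) x <= A + M"
proof -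
 define D where "D = 1 - 1 / s"
 define r where "r = 1 / D"
 have N0: "1 - 2 / real CARD('n) > 0" using N by (simp add: field_simps)
 have d: "D > 0" "D < 1" "1 - 2 / real CARD('n) < D" using s by (auto simp: D_def)
 note D0 = d(1)
 have r: "r > 1" using d by (simp add: r_def)
 have e: "1 / r + 1 / s = 1" by (simp add: r_def D_def)
 have rN: "r * real (CARD('n) - 2) < real CARD('n)"
 proof -
  have "real (CARD('n) - 2) = (1 - 2 / real CARD('n)) * real CARD('n)" using N by (simp add: field_simps of_nat_diff)
  moreover have "r * (1 - 2 / real CARD('n)) < 1" using d D0 by (simp add: r_def pos_divide_less_eq)
  ultimately show ?thesis using N by (simp add: mult.assoc[symmetric])
 qed
 have iK: "Lint (%z::real^'n. Ker z powr r)" using r by (intro Ker_powr_integrable[OF N _ rN]) simp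
 define A where "A = LI (%z::real^'n. Ker z powr r)"
 have A0: "A >= 0" by (simp add: A_def)
 have "cv Ker (%x. \<bar>b x\<bar>) x <= A + M"
  if bm [measurable]: "b \<in> bmeas" and bi: "Lint (%w. indicator (cball x 1) w * \<bar>b w\<bar> powr s)"
   and bM: "LI (%w. indicator (cball x 1) w * \<bar>b w\<bar> powr s) <= M" for b and x :: "real^'n" and M
 proof -
  have [measurable]: "(indicator (cball x 1) :: real^'n => real) \<in> bmeas" by (intro borel_measurable_indicator) simp
  define G where "G z = indicator (cball x 1) (x - z) * \<bar>b (x - z)\<bar> powr s" for z
  have Gi: "Lint G" using integrable_lborel_affine[OF bi, of "-1" x] by (simp add: G_def[abs_def])
  have GM: "LI (%z. G z) <= M"
   using integral_lborel_affine[of "%w. indicator (cball x 1) w * \<bar>b w\<bar> powr s" "-1" x] bM by (simp add: G_def)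
  have "cv Ker (%x. \<bar>b x\<bar>) x <= LI (%z. Ker z powr r + G z)"
   unfolding cv_def
  proof (rule integral_mono_AE')
   show "Lint (%z. Ker z powr r + G z)" using iK Gi by simp
   show "AE z in lborel. Ker z * \<bar>b (x - z)\<bar> <= Ker z powr r + G z"
   proof (rule AE_I2)
    fix z
    show "Ker z * \<bar>b (x - z)\<bar> <= Ker z powr r + G z"
    proof (cases "norm z > 1")
     case True
     thus ?thesis by (simp add: Ker_zero G_def)
    next
     case False
     hence in1: "x - z \<in> cball x 1" by (simp add: dist_norm)
     have "Ker z * \<bar>b (x - z)\<bar> <= Ker z powr r / r + \<bar>b (x - z)\<bar> powr s / s"
      using r s e by (intro Youngs_inequality Ker_nonneg) auto
     also have "\<dots> <= Ker z powr r / 1 + \<bar>b (x - z)\<bar> powr s / 1"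
      using r s by (intro add_mono divide_left_mono) auto
     finally show ?thesis using in1 by (simp add: G_def)
    qed
   qed
   show "AE z in lborel. 0 <= Ker z powr r + G z" by (rule AE_I2) (simp add: G_def)
  qed
  also have "\<dots> = A + LI (%z. G z)" using iK Gi by (simp add: A_def)
  finally show ?thesis using GM by linarith
 qed
 thus ?thesis using A0 by blast
qed

text \<open>The fourth-order equation split into two Poisson equations in the weak sense, with
  Laplacian \<open>v\<close> for \<open>u\<close> and \<open>h\<close> for \<open>v\<close>.
  Coefficients occur only through the growth constant \<open>C0\<close>, so the resulting bounds are
  uniform in them.\<close>

definition reg_data :: "real => real => real => (real^'n::finite => real) => (real^'n => real) => (real^'n => real) => bool" where
 "reg_data p C C0 u v h \<longleftrightarrow> Wsp u v & sqn u + sqn v <= C & loc_int h &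
  (\<forall>ph. test_fun ph --> LI (%x. v x * lap ph x) = LI (%x. h x * ph x)) &
  (\<forall>x. \<bar>h x\<bar> <= C0 * (1 + \<bar>u x\<bar> powr p))"

text \<open>\<open>sel\<close> picks out \<open>u\<close>, \<open>v\<close> or \<open>h\<close>, so
  that one step lemma serves both equations. The bound is uniform in the centre \<open>y\<close>;
  the radius is arbitrary, since every step uses up part of it.\<close>

definition loc_bd :: "real => real => real => real => ((real^'n::finite => real) => (real^'n => real) => (real^'n => real) => real^'n => real) => bool" where
 "loc_bd p C C0 q sel \<longleftrightarrow> (\<forall>R. \<exists>M\<ge>0. \<forall>u v h y. reg_data p C C0 u v h -->
  Lint (%x. indicator (cball y R) x * \<bar>sel u v h x\<bar> powr q) &
  LI (%x. indicator (cball y R) x * \<bar>sel u v h x\<bar> powr q) <= M)"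

lemma reg_dataD:
 assumes "reg_data p C C0 u v h"
 shows "Wsp u v" "loc_int h" "u \<in> bmeas" "v \<in> bmeas" "h \<in> bmeas"
  "sqn u <= C" "sqn v <= C" "!!x. \<bar>h x\<bar> <= C0 * (1 + \<bar>u x\<bar> powr p)"
  "AE x in lborel. u x = cv rho u x - cv Ker v x" "AE x in lborel. v x = cv rho v x - cv Ker h x"
proof -
 note a = assms[unfolded reg_data_def]
 have nn: "0 <= sqn u" "0 <= sqn v" by simp_all
 show W: "Wsp u v" and l: "loc_int h" using a by auto
 show "u \<in> bmeas" "v \<in> bmeas" "h \<in> bmeas"
  using WspD(3,4)[OF W] loc_int_measurable[OF l] by auto
 show "sqn u <= C" "sqn v <= C" using a nn by linarith+
 show "\<bar>h x\<bar> <= C0 * (1 + \<bar>u x\<bar> powr p)" for x using a by blast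
 show "AE x in lborel. u x = cv rho u x - cv Ker v x" by (rule Wsp_representation[OF W])
 show "AE x in lborel. v x = cv rho v x - cv Ker h x"
  using a by (intro parametrix_representation sq_int_loc_int WspD[OF W] l) auto
qed

lemma reg_data_bounds:
 assumes C: "C >= 0"
 shows "\<exists>c0\<ge>0. \<forall>(u :: real^'n::finite => real) v h. reg_data p C C0 u v h -->
  (\<forall>x. \<bar>cv rho u x\<bar> <= c0) & (\<forall>x. \<bar>cv rho v x\<bar> <= c0) & (\<forall>x y. \<bar>cv rho u x - cv rho u y\<bar> <= c0 * norm (x - y)) &
  (AE x in lborel. \<bar>u x\<bar> <= c0 + cv Ker (%x. \<bar>v x\<bar>) x) & (AE x in lborel. \<bar>v x\<bar> <= c0 + cv Ker (%x. \<bar>h x\<bar>) x)"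
proof -
 obtain A where A: "A > 0" "!!(u :: real^'n => real) x. sq_int lborel u ==> \<bar>cv rho u x\<bar> <= A * sqrt (sqn u)"
  "!!(u :: real^'n => real) x y. sq_int lborel u ==> \<bar>cv rho u x - cv rho u y\<bar> <= A * sqrt (sqn u) * norm (x - y)"
  using cv_rho_bounds by metis
 define c0 where "c0 = A * sqrt C"
 have c0: "c0 >= 0" using A(1) C by (simp add: c0_def)
 have "(\<forall>x. \<bar>cv rho u x\<bar> <= c0) & (\<forall>x. \<bar>cv rho v x\<bar> <= c0) & (\<forall>x y. \<bar>cv rho u x - cv rho u y\<bar> <= c0 * norm (x - y)) &
  (AE x in lborel. \<bar>u x\<bar> <= c0 + cv Ker (%x. \<bar>v x\<bar>) x) & (AE x in lborel. \<bar>v x\<bar> <= c0 + cv Ker (%x. \<bar>h x\<bar>) x)"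
  if P: "reg_data p C C0 u v h" for u v h :: "real^'n => real"
 proof -
  note D = reg_dataD[OF P]
  have su: "A * sqrt (sqn u) <= c0" and sv: "A * sqrt (sqn v) <= c0"
   unfolding c0_def using A(1) D(6,7) by (intro mult_left_mono real_sqrt_le_mono; simp)+
  have 1: "\<bar>cv rho u x\<bar> <= c0" for x using A(2)[OF WspD(1)[OF D(1)], of x] su by linarith
  have 2: "\<bar>cv rho v x\<bar> <= c0" for x using A(2)[OF WspD(2)[OF D(1)], of x] sv by linarith
  have 3: "\<bar>cv rho u x - cv rho u y\<bar> <= c0 * norm (x - y)" for x y
   using A(3)[OF WspD(1)[OF D(1)], of x y] mult_right_mono[OF su norm_ge_zero[of "x - y"]] by linarith
  have K: "\<bar>cv Ker w x\<bar> <= cv Ker (%x. \<bar>w x\<bar>) x" for w and x :: "real^'n"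
   using abs_cv_le[of Ker w x] by (simp add: Ker_nonneg)
  have 4: "AE x in lborel. \<bar>u x\<bar> <= c0 + cv Ker (%x. \<bar>v x\<bar>) x"
   using D(9)
  proof eventually_elim
   case (elim x)
   show ?case using 1[of x] K[of v x] by (subst elim) linarith
  qed
  have 5: "AE x in lborel. \<bar>v x\<bar> <= c0 + cv Ker (%x. \<bar>h x\<bar>) x"
   using D(10)
  proof eventually_elim
   case (elim x)
   show ?case using 2[of x] K[of h x] by (subst elim) linarith
  qed
  show ?thesis using 1 2 3 4 5 by blast
 qed
 thus ?thesis using c0 by blast
qed

lemma loc_bd_rhs:
 assumes q: "q > 0" and p: "p > 0" and C0: "C0 >= 0" and b: "loc_bd p C C0 q (%u v h. u :: real^'n::finite => real)"
 shows "loc_bd p C C0 (q / p) (%u v h. h :: real^'n => real)"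
 unfolding loc_bd_def
proof
 fix R
 obtain M where M: "M >= 0" "!!(u :: real^'n => real) v h y. reg_data p C C0 u v h ==>
  Lint (%x. indicator (cball y R) x * \<bar>u x\<bar> powr q) & LI (%x. indicator (cball y R) x * \<bar>u x\<bar> powr q) <= M"
  using b[unfolded loc_bd_def, THEN spec, of R] by (elim exE conjE) (rule that, assumption, blast)
 define s where "s = q / p"
 have s: "s > 0" "p * s = q" using p q by (auto simp: s_def)
 define m where "m = (LI (%x. indicator (cball (0::real^'n) R) x) :: real)"
 have m0: "m >= 0" by (simp add: m_def)
 define k where "k = C0 powr s * 2 powr s"
 have "Lint (%x. indicator (cball y R) x * \<bar>h x\<bar> powr s) & LI (%x. indicator (cball y R) x * \<bar>h x\<bar> powr s) <= k * (m + M)"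
  if P: "reg_data p C C0 u v h" for u v h and y :: "real^'n"
 proof -
  note D = reg_dataD[OF P]
  note [measurable] = D(3,5)
  have [measurable]: "(indicator (cball y R) :: real^'n => real) \<in> bmeas" by (intro borel_measurable_indicator) simp
  note Mu = M(2)[OF P, of y]
  have i: "Lint (%x. k * (indicator (cball y R) x + indicator (cball y R) x * \<bar>u x\<bar> powr q))"
   using Mu integral_indicator_cball(1)[of y R] by (intro integrable_mult_right Bochner_Integration.integrable_add) auto
  have le: "indicator (cball y R) x * \<bar>h x\<bar> powr s <= k * (indicator (cball y R) x + indicator (cball y R) x * \<bar>u x\<bar> powr q)" for x
  proof (cases "x \<in> cball y R")
   case True
   have "\<bar>h x\<bar> powr s <= (C0 * (1 + \<bar>u x\<bar> powr p)) powr s" using D(8)[of x] s by (intro powr_mono2) auto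
   also have "\<dots> = C0 powr s * (1 + \<bar>u x\<bar> powr p) powr s" using C0 by (simp add: powr_mult)
   also have "\<dots> <= C0 powr s * (2 powr s * (1 powr s + (\<bar>u x\<bar> powr p) powr s))" using s by (intro mult_left_mono powr_add_le) auto
   also have "\<dots> = k * (1 + \<bar>u x\<bar> powr q)" using s by (simp add: k_def powr_powr)
   finally show ?thesis using True by simp
  qed simp
  have int: "Lint (%x. indicator (cball y R) x * \<bar>h x\<bar> powr s)"
   by (rule integrable_bnd[OF i]) (use le in \<open>auto intro!: AE_I2 order_trans[OF _ abs_ge_self]\<close>)
  have "LI (%x. indicator (cball y R) x * \<bar>h x\<bar> powr s) <= LI (%x. k * (indicator (cball y R) x + indicator (cball y R) x * \<bar>u x\<bar> powr q))"
   by (rule integral_mono_AE[OF int i]) (use le in auto)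
  also have "\<dots> = k * (m + LI (%x. indicator (cball y R) x * \<bar>u x\<bar> powr q))"
   using Mu integral_indicator_cball[of y R] by (simp add: m_def)
  also have "\<dots> <= k * (m + M)" using Mu by (intro mult_left_mono add_left_mono) (auto simp: k_def)
  finally show ?thesis using int by simp
 qed
 moreover have "k * (m + M) >= 0" using m0 M(1) by (simp add: k_def)
 ultimately show "\<exists>M\<ge>0. \<forall>(u :: real^'n => real) v h y. reg_data p C C0 u v h -->
  Lint (%x. indicator (cball y R) x * \<bar>h x\<bar> powr (q / p)) &
  LI (%x. indicator (cball y R) x * \<bar>h x\<bar> powr (q / p)) <= M"
  unfolding s_def by blast
qed

lemma loc_bd_step:
 fixes sel sel' :: "(real^'n::finite => real) => (real^'n => real) => (real^'n => real) => real^'n => real"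
 assumes N: "CARD('n) >= 3" and c0: "c0 >= 0"
  and m: "!!u v h. reg_data p C C0 u v h ==> sel u v h \<in> bmeas & sel' u v h \<in> bmeas"
  and le: "!!u v h. reg_data p C C0 u v h ==> AE x in lborel. \<bar>sel' u v h x\<bar> <= c0 + cv Ker (%x. \<bar>sel u v h x\<bar>) x"
  and s: "s >= 1" and t: "t > 1" "1 / t <= 1 / s" "1 / s - 2 / real CARD('n) < 1 / t"
  and b: "loc_bd p C C0 s sel"
 shows "loc_bd p C C0 t sel'"
 unfolding loc_bd_def
proof
 fix R
 obtain M where M: "M >= 0" "!!u v h y. reg_data p C C0 u v h ==>
  Lint (%x. indicator (cball y (R + 1)) x * \<bar>sel u v h x\<bar> powr s) & LI (%x. indicator (cball y (R + 1)) x * \<bar>sel u v h x\<bar> powr s) <= M"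
  using b[unfolded loc_bd_def, THEN spec, of "R + 1"] by (elim exE conjE) (rule that, assumption, blast)
 obtain M' where M': "M' >= 0" "!!(a :: real^'n => real) b y. a \<in> bmeas ==> b \<in> bmeas ==>
  (AE x in lborel. \<bar>a x\<bar> <= c0 + cv Ker (%x. \<bar>b x\<bar>) x) ==>
  Lint (%x. indicator (cball y (R + 1)) x * \<bar>b x\<bar> powr s) ==>
  LI (%x. indicator (cball y (R + 1)) x * \<bar>b x\<bar> powr s) <= M ==>
  Lint (%x. indicator (cball y R) x * \<bar>a x\<bar> powr t) &
  LI (%x. indicator (cball y R) x * \<bar>a x\<bar> powr t) <= M'"
  using Ker_local_step[OF N s t M(1) c0, of R] by (elim exE conjE) (rule that, assumption, simp)
 show "\<exists>M\<ge>0. \<forall>u v h y. reg_data p C C0 u v h -->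
  Lint (%x. indicator (cball y R) x * \<bar>sel' u v h x\<bar> powr t) &
  LI (%x. indicator (cball y R) x * \<bar>sel' u v h x\<bar> powr t) <= M"
 proof (rule exI[of _ M'], intro conjI allI impI M')
  fix u v h :: "real^'n => real" and y assume P: "reg_data p C C0 u v h"
  note r = M'(2)[of "sel' u v h" "sel u v h" y] m[OF P] le[OF P] M(2)[OF P, of y]
  show "Lint (%x. indicator (cball y R) x * \<bar>sel' u v h x\<bar> powr t)" using r by blast
  show "LI (%x. indicator (cball y R) x * \<bar>sel' u v h x\<bar> powr t) <= M'" using r by blast
 qed
qed

text \<open>The bootstrap improves the exponent \<open>1/q\<close> of local integrability of \<open>u\<close> to
 \<open>p/q - 4/N\<close> up to an arbitrarily small loss, a gain bounded below because of subcriticality;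
 it stops as soon as \<open>p/q < 2/N\<close>, when \<open>v\<close> is already bounded.\<close>

lemma bootstrap_exponent:
 assumes N: "CARD('n::finite) >= 5" and p: "1 < p" "p < 2 * real CARD('n) / (real CARD('n) - 4) - 1"
  and C: "C >= 0" and C0: "C0 >= 0"
 shows "\<exists>bt>0. p * bt < 2 / real CARD('n) & bt < 1 / p & loc_bd p C C0 (1 / bt) (%u v h. u :: real^'n => real)"
proof -
 define n where "n = real CARD('n)"
 have n5: "n >= 5" using N by (simp add: n_def)
 obtain c0 where c0: "c0 >= 0" "!!(u :: real^'n => real) v h. reg_data p C C0 u v h ==> AE x in lborel. \<bar>u x\<bar> <= c0 + cv Ker (%x. \<bar>v x\<bar>) x"
  "!!(u :: real^'n => real) v h. reg_data p C C0 u v h ==> AE x in lborel. \<bar>v x\<bar> <= c0 + cv Ker (%x. \<bar>h x\<bar>) x"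
  using reg_data_bounds[OF C, of p C0] by (elim exE conjE) (rule that, assumption, blast, blast)
 have pn: "(p - 1) * (n - 4) < 8"
 proof -
  have "p + 1 < 2 * n / (n - 4)" using p by (simp add: n_def)
  hence "(p + 1) * (n - 4) < 2 * n" using n5 by (simp add: field_simps)
  thus ?thesis by (simp add: algebra_simps)
 qed
 \<comment> \<open>\<open>1 / lo\<close> is the critical exponent \<open>2 N / (N - 4)\<close>;
   subcriticality of \<open>p\<close>, in the form \<open>pn\<close>, enters in
   \<open>lo1\<close>.\<close>
 define lo where "lo = 1/2 - 2/n"
 have lo_pos: "0 < lo" using n5 by (simp add: lo_def field_simps)
 have lo1: "lo < 4 / (n * (p - 1))"
 proof -
  have "lo = (n - 4) / (2 * n)" using n5 by (simp add: lo_def field_simps)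
  moreover have "(n - 4) * (n * (p - 1)) < 4 * (2 * n)"
  proof -
   have "n * ((p - 1) * (n - 4)) < n * 8" using pn n5 by (intro mult_strict_left_mono) auto
   thus ?thesis by (simp add: mult_ac)
  qed
  ultimately show ?thesis using n5 p by (simp add: divide_less_eq less_divide_eq mult_ac)
 qed
 have lo2: "lo < 1 / p"
 proof -
  have "p * (n - 4) < 2 * n"
  proof -
   have "p * (n - 4) < 8 + (n - 4)" using pn by (simp add: algebra_simps)
   also have "\<dots> <= 2 * n" using n5 by simp
   finally show ?thesis .
  qed
  moreover have "lo = (n - 4) / (2 * n)" using n5 by (simp add: lo_def field_simps)
  ultimately show ?thesis using n5 p by (simp add: divide_less_eq less_divide_eq mult_ac)
 qed
 have lo3: "lo < 1/2" using n5 by (simp add: lo_def)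
 \<comment> \<open>The starting value \<open>bt0\<close> lies above \<open>lo\<close>, hence in the
   Sobolev range. The upper bounds make each step a gain, keep the exponent of \<open>h\<close>
   above 1, and keep the exponent of \<open>u\<close> at least 2.\<close>
 have "lo < min (4 / (n * (p - 1))) (min (1 / p) (1/2))" using lo1 lo2 lo3 by simp
 then obtain bt0 where b0: "lo < bt0" "bt0 < min (4 / (n * (p - 1))) (min (1 / p) (1/2))" using dense by blast
 hence b0': "bt0 < 4 / (n * (p - 1))" "bt0 < 1 / p" "bt0 < 1/2" "bt0 > 0" using lo_pos by auto
 define d where "d = 4 / n - (p - 1) * bt0"
 have d: "d > 0"
 proof -
  have "(p - 1) * bt0 < (p - 1) * (4 / (n * (p - 1)))" using p b0' by (intro mult_strict_left_mono) auto
  also have "\<dots> = 4 / n" using p n5 by (simp only: times_divide_eq_right mult.commute[of n] mult_divide_mult_cancel_left)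
  finally show ?thesis by (simp add: d_def)
 qed
 \<comment> \<open>The loss in each of the two kernel steps. Together they cost at most
   \<open>d / 2\<close> of the gain \<open>d\<close>; the bound \<open>1 / n\<close> keeps each step
   from losing integrability.\<close>
 define et where "et = min (d / 4) (1 / n)"
 have et: "0 < et" "et <= d / 4" "et <= 1 / n" using d n5 by (auto simp: et_def)
 have start: "loc_bd p C C0 (1 / bt0) (%u v h. u :: real^'n => real)"
  unfolding loc_bd_def
 proof
  fix R
  have q2: "2 <= 1 / bt0" using b0' by (simp add: field_simps)
  have "1 / bt0 < 1 / lo" using b0 lo_pos b0' by (simp add: field_simps)
  also have "1 / lo = 2 * n / (n - 4)" using n5 by (simp add: lo_def field_simps)
  finally have q3: "1 / bt0 < 2 * real CARD('n) / (real CARD('n) - 4)" by (simp add: n_def)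
  obtain S where S: "S >= 0" "!!(u :: real^'n => real) v. Wsp u v ==> Lint (%x. \<bar>u x\<bar> powr (1 / bt0)) &
    LI (%x. \<bar>u x\<bar> powr (1 / bt0)) <= S * (sqn u + sqn v) powr (1 / bt0 / 2)"
   using Sobolev[OF N q2 q3] by blast
  show "\<exists>M\<ge>0. \<forall>(u :: real^'n => real) v h y. reg_data p C C0 u v h -->
  Lint (%x. indicator (cball y R) x * \<bar>u x\<bar> powr (1 / bt0)) &
  LI (%x. indicator (cball y R) x * \<bar>u x\<bar> powr (1 / bt0)) <= M"
  proof (intro exI[of _ "S * C powr (1 / bt0 / 2)"] conjI allI impI)
   fix u v h :: "real^'n => real" and y assume P: "reg_data p C C0 u v h"
   note D = reg_dataD[OF P]
   note [measurable] = D(3)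
   have [measurable]: "(indicator (cball y R) :: real^'n => real) \<in> bmeas" by (intro borel_measurable_indicator) simp
   note Su = S(2)[OF D(1)]
   show i: "Lint (%x. indicator (cball y R) x * \<bar>u x\<bar> powr (1 / bt0))"
    by (rule integrable_bnd[of lborel "%x. \<bar>u x\<bar> powr (1 / bt0)"]) (use Su in \<open>auto simp: indicator_def\<close>)
   have "LI (%x. indicator (cball y R) x * \<bar>u x\<bar> powr (1 / bt0)) <= LI (%x. \<bar>u x\<bar> powr (1 / bt0))"
    by (rule integral_mono_AE[OF i]) (use Su in \<open>auto simp: indicator_def\<close>)
   also have "\<dots> <= S * (sqn u + sqn v) powr (1 / bt0 / 2)" using Su by blast
   also have "\<dots> <= S * C powr (1 / bt0 / 2)"
    using P b0' S(1) unfolding reg_data_def by (intro mult_left_mono powr_mono2) auto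
   finally show "LI (%x. indicator (cball y R) x * \<bar>u x\<bar> powr (1 / bt0)) <= S * C powr (1 / bt0 / 2)" .
  qed (use S in auto)
 qed
 have step: "\<exists>bt'>0. bt' <= bt0 & loc_bd p C C0 (1 / bt') (%u v h. u :: real^'n => real) & (p * bt' < 2 / n \<or> bt' <= bt - d / 2)"
  if b: "0 < bt" "bt <= bt0" and lb: "loc_bd p C C0 (1 / bt) (%u v h. u :: real^'n => real)" and pb: "p * bt >= 2 / n" for bt
 proof -
  have pb1: "p * bt < 1"
  proof -
   have "p * bt <= p * bt0" using b p by (intro mult_left_mono) auto
   also have "\<dots> < p * (1 / p)" using b0' p by (intro mult_strict_left_mono) auto
   finally show ?thesis using p by simp
  qed
  have h1: "loc_bd p C C0 (1 / (p * bt)) (%u v h. h :: real^'n => real)"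
   using loc_bd_rhs[OF _ _ C0 lb] b p by (simp add: mult.commute)
  have i2: "0 < 1 / n" "2 / n = 2 * (1 / n)" using n5 by auto
  define \<tau> where "\<tau> = p * bt - 2 / n + et"
  have \<tau>: "0 < \<tau>" "\<tau> < p * bt" "\<tau> < 1" using pb et i2 pb1 unfolding \<tau>_def by linarith+
  have v1: "loc_bd p C C0 (1 / \<tau>) (%u v h. v :: real^'n => real)"
  proof (rule loc_bd_step[OF _ c0(1) _ c0(3) _ _ _ _ h1])
   show "1 <= 1 / (p * bt)" using pb1 b p by (simp add: field_simps)
   show "1 < 1 / \<tau>" using \<tau> by simp
   show "1 / (1 / \<tau>) <= 1 / (1 / (p * bt))" using \<tau> by simp
   show "1 / (1 / (p * bt)) - 2 / real CARD('n) < 1 / (1 / \<tau>)" using et by (simp add: \<tau>_def n_def)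
  qed (use N reg_dataD in auto)
  \<comment> \<open>The first entry is the regular gain. The second keeps \<open>bt'\<close>
    positive if the gain overshoots; then \<open>p * bt' <= 1 / n\<close>, which already meets the
    target.\<close>
  define bt' where "bt' = max (\<tau> - 2 / n + et) (min (\<tau> / 2) (1 / (p * n)))"
  have pn0: "0 < 1 / (p * n)" using p n5 by simp
  have "0 < min (\<tau> / 2) (1 / (p * n))" using \<tau>(1) pn0 by (simp only: min_less_iff_conj) simp
  hence b1: "0 < bt'" unfolding bt'_def by linarith
  have "\<tau> - 2 / n + et <= \<tau>" using et i2 by linarith
  hence b2: "bt' <= \<tau>" using \<tau> by (auto simp: bt'_def)
  have b3: "\<tau> - 2 / n < bt'" using et by (auto simp: bt'_def)
  have u1: "loc_bd p C C0 (1 / bt') (%u v h. u :: real^'n => real)"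
  proof (rule loc_bd_step[OF _ c0(1) _ c0(2) _ _ _ _ v1])
   show "1 <= 1 / \<tau>" using \<tau> by simp
   show "1 < 1 / bt'" using b1 b2 \<tau> by simp
   show "1 / (1 / bt') <= 1 / (1 / \<tau>)" using b2 by simp
   show "1 / (1 / \<tau>) - 2 / real CARD('n) < 1 / (1 / bt')" using b3 by (simp add: n_def)
  qed (use N reg_dataD in auto)
  have dec: "\<tau> - 2 / n + et <= bt - d / 2"
  proof -
   have "(p - 1) * bt <= (p - 1) * bt0" using p b by (intro mult_left_mono) auto
   hence "p * bt - 4 / n <= bt - d" by (simp add: d_def algebra_simps)
   thus ?thesis using et by (simp add: \<tau>_def)
  qed
  have small: "p * bt' < 2 / n \<or> bt' <= bt - d / 2"
  proof (cases "bt' = \<tau> - 2 / n + et")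
   case False
   hence "bt' <= 1 / (p * n)" by (auto simp: bt'_def max_def min_def split: if_splits)
   hence "p * bt' <= p * (1 / (p * n))" using p by (intro mult_left_mono) auto
   also have "\<dots> = 1 / n" using p by simp
   also have "\<dots> < 2 / n" using n5 by (simp add: field_simps)
   finally show ?thesis by simp
  qed (use dec in simp)
  show ?thesis
  proof (cases "bt' <= bt0")
   case True
   thus ?thesis using b1 u1 small by blast
  next
   \<comment> \<open>Since \<open>bt' > bt0 >= bt\<close>, only the alternative
     \<open>p * bt' < 2 / n\<close> is left, and then \<open>bt0\<close> itself meets the
     target.\<close>
   case False
   hence "\<not> bt' <= bt - d / 2" using b d by simp
   hence "p * bt' < 2 / n" using small by blast
   hence "p * bt0 < 2 / n" using False p by (smt (verit) mult_left_mono)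
   thus ?thesis using b0' start by blast
  qed
 qed
 have iter: "\<exists>bt>0. bt <= bt0 & loc_bd p C C0 (1 / bt) (%u v h. u :: real^'n => real) & (p * bt < 2 / n \<or> bt <= bt0 - real k * (d / 2))" for k
 proof (induction k)
  case 0
  show ?case using start b0' by (intro exI[of _ bt0]) auto
 next
  case (Suc k)
  then obtain bt where b: "bt > 0" "bt <= bt0" "loc_bd p C C0 (1 / bt) (%u v h. u :: real^'n => real)" "p * bt < 2 / n \<or> bt <= bt0 - real k * (d / 2)" by blast
  show ?case
  proof (cases "p * bt < 2 / n")
   case True
   thus ?thesis using b by blast
  next
   case False
   hence le: "bt <= bt0 - real k * (d / 2)" and ge: "p * bt >= 2 / n" using b by auto
   obtain bt' where b': "bt' > 0" "bt' <= bt0" "loc_bd p C C0 (1 / bt') (%u v h. u :: real^'n => real)" "p * bt' < 2 / n \<or> bt' <= bt - d / 2"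
    using step[OF b(1,2,3) ge] by blast
   have "real (Suc k) * (d / 2) = real k * (d / 2) + d / 2" by (simp add: distrib_right)
   hence "p * bt' < 2 / n \<or> bt' <= bt0 - real (Suc k) * (d / 2)" using b'(4) le by linarith
   thus ?thesis using b' by blast
  qed
 qed
 obtain k :: nat where k: "bt0 / (d / 2) < real k" using reals_Archimedean2 by blast
 hence "bt0 - real k * (d / 2) < 0" using d by (simp add: field_simps)
 then obtain bt where "bt > 0" "bt <= bt0" "loc_bd p C C0 (1 / bt) (%u v h. u :: real^'n => real)" "p * bt < 2 / n"
  using iter[of k] by force
 thus ?thesis using b0' by (intro exI[of _ bt]) (auto simp: n_def)
qed

text \<open>The bootstrap puts \<open>h\<close> locally into an exponent above \<open>N / 2\<close>,
  so \<open>v\<close> is bounded; one more application of \<open>Ker\<close> makes \<open>u\<close>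
  Lipschitz. The function \<open>u'\<close> is the continuous representative given by the parametrix
  formula.\<close>

lemma uniform_regularity:
 assumes N: "CARD('n::finite) >= 5" and p: "1 < p" "p < 2 * real CARD('n) / (real CARD('n) - 4) - 1"
  and C: "C >= 0" and C0: "C0 >= 0"
 shows "\<exists>B>0. \<forall>(u :: real^'n => real) v h. reg_data p C C0 u v h -->
  (\<exists>u'. (AE x in lborel. u x = u' x) & (\<forall>x. \<bar>u' x\<bar> <= B) & (\<forall>x y. \<bar>u' x - u' y\<bar> <= B * norm (x - y)))"
proof -
 obtain bt where bt: "bt > 0" "p * bt < 2 / real CARD('n)" "bt < 1 / p" "loc_bd p C C0 (1 / bt) (%u v h. u :: real^'n => real)"
  using bootstrap_exponent[OF N p C C0] by blast
 define s where "s = 1 / (p * bt)"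
 have pb: "p * bt < 1" using bt p by (simp add: field_simps)
 have s: "s > 1" "1 / s < 2 / real CARD('n)" using pb bt p by (auto simp: s_def)
 have hb: "loc_bd p C C0 s (%u v h. h :: real^'n => real)"
  using loc_bd_rhs[OF _ _ C0 bt(4)] bt p by (simp add: s_def mult.commute)
 obtain M where M: "M >= 0" "!!(u :: real^'n => real) v h y. reg_data p C C0 u v h ==>
  Lint (%x. indicator (cball y 1) x * \<bar>h x\<bar> powr s) & LI (%x. indicator (cball y 1) x * \<bar>h x\<bar> powr s) <= M"
  using hb[unfolded loc_bd_def, THEN spec, of 1] by (elim exE conjE) (rule that, assumption, blast)
 obtain A where A: "A >= 0" "!!(b :: real^'n => real) x M. b \<in> bmeas ==>
  Lint (%w. indicator (cball x 1) w * \<bar>b w\<bar> powr s) ==>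
  LI (%w. indicator (cball x 1) w * \<bar>b w\<bar> powr s) <= M ==> cv Ker (%x. \<bar>b x\<bar>) x <= A + M"
 proof -
  have "CARD('n) >= 3" using N by simp
  from Ker_local_sup[OF this s] show ?thesis by (elim exE conjE) (rule that, assumption, blast)
 qed
 obtain c0 where c0: "c0 >= 0" "!!(u :: real^'n => real) v h. reg_data p C C0 u v h ==>
  (\<forall>x. \<bar>cv rho u x\<bar> <= c0) & (\<forall>x y. \<bar>cv rho u x - cv rho u y\<bar> <= c0 * norm (x - y)) & (AE x in lborel. \<bar>v x\<bar> <= c0 + cv Ker (%x. \<bar>h x\<bar>) x)"
  using reg_data_bounds[OF C, of p C0] by (elim exE conjE) (rule that, assumption, blast)
 obtain K where K: "K > 0" "!!(v :: real^'n => real) B. v \<in> bmeas ==> (\<forall>x. \<bar>v x\<bar> <= B) ==>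
  (\<forall>x. \<bar>cv Ker v x\<bar> <= K * B) & (\<forall>x y. \<bar>cv Ker v x - cv Ker v y\<bar> <= K * B * norm (x - y))"
  using cv_Ker_bounds by (elim exE conjE) (rule that, assumption, blast)
 define b where "b = c0 + (A + M)"
 have b0: "b >= 0" using c0 A(1) M(1) by (simp add: b_def)
 define B where "B = c0 + K * b + 1"
 have B0: "B > 0" using c0(1) K(1) b0 by (simp add: B_def add_nonneg_pos)
 have "\<exists>u'. (AE x in lborel. u x = u' x) & (\<forall>x. \<bar>u' x\<bar> <= B) & (\<forall>x y. \<bar>u' x - u' y\<bar> <= B * norm (x - y))"
  if P: "reg_data p C C0 u v h" for u v h :: "real^'n => real"
 proof -
  note D = reg_dataD[OF P]
  note [measurable] = D(3,4,5)
  \<comment> \<open>The bound on \<open>v\<close> holds only almost everywhere. Clipping makes it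
    hold everywhere and leaves the convolution with \<open>Ker\<close> unchanged.\<close>
  define v' where "v' x = max (- b) (min b (v x))" for x
  have [measurable]: "v' \<in> bmeas" unfolding v'_def by measurable
  have v'b: "\<forall>x. \<bar>v' x\<bar> <= b" using b0 by (auto simp: v'_def)
  have cb: "cv Ker (%x. \<bar>h x\<bar>) x <= A + M" for x using A(2)[OF D(5)] M(2)[OF P, of x] by blast
  have "AE x in lborel. \<bar>v x\<bar> <= c0 + cv Ker (%x. \<bar>h x\<bar>) x" using c0(2)[OF P] by blast
  hence "AE x in lborel. v x = v' x"
  proof eventually_elim
   case (elim x)
   hence "\<bar>v x\<bar> <= b" using cb[of x] by (simp add: b_def)
   thus ?case by (auto simp: v'_def)
  qed
  hence cvv: "cv Ker v x = cv Ker v' x" for x by (intro cv_cong_AE) auto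
  define u' where "u' x = cv rho u x - cv Ker v' x" for x
  have Kb: "\<bar>cv Ker v' x\<bar> <= K * b" "\<bar>cv Ker v' x - cv Ker v' y\<bar> <= K * b * norm (x - y)" for x y using K(2)[OF _ v'b] by auto
  have rb: "\<bar>cv rho u x\<bar> <= c0" "\<bar>cv rho u x - cv rho u y\<bar> <= c0 * norm (x - y)" for x y using c0(2)[OF P] by auto
  have "AE x in lborel. u x = u' x" using D(9) by eventually_elim (simp add: u'_def cvv)
  moreover have "\<bar>u' x\<bar> <= B" for x using Kb(1)[of x] rb(1)[of x] by (simp add: u'_def B_def)
  moreover have "\<bar>u' x - u' y\<bar> <= B * norm (x - y)" for x y
  proof -
   have "\<bar>u' x - u' y\<bar> <= (c0 + K * b) * norm (x - y)" using Kb(2)[of x y] rb(2)[of x y] by (simp add: u'_def distrib_right)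
   also have "\<dots> <= B * norm (x - y)" by (intro mult_right_mono) (auto simp: B_def)
   finally show ?thesis .
  qed
  ultimately show ?thesis by blast
 qed
 thus ?thesis using B0 by blast
qed

section \<open>The penalised functional and its Nehari set\<close>

definition prim :: "(real => real) => real => real" where
 "prim g s = (LBINT t=0..s. g t)"

lemma prim_has_derivative:
 assumes "continuous_on UNIV g"
 shows "(prim g has_real_derivative g s) (at s)"
proof -
 define a where "a = - \<bar>s\<bar> - 1"
 define b where "b = \<bar>s\<bar> + 1"
 have "((%u. LBINT y=0..u. g y) has_vector_derivative g s) (at s within {a..b})"
  using interval_integral_FTC2[of a 0 b g s] continuous_on_subset[OF assms, of "{a..b}"] by (simp add: a_def b_def zero_ereal_def)
 moreover have "at s within {a..b} = at s" by (intro at_within_interior) (auto simp: a_def b_def)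
 ultimately show ?thesis by (simp add: prim_def[abs_def] has_real_derivative_iff_has_vector_derivative)
qed

lemma prim_0 [simp]: "prim g 0 = 0" by (simp add: prim_def zero_ereal_def[symmetric])

lemma prim_mean_value:
 assumes "continuous_on UNIV g"
 shows "\<exists>\<xi>. \<bar>\<xi>\<bar> <= max \<bar>x\<bar> \<bar>y\<bar> & prim g x - prim g y = (x - y) * g \<xi> & \<bar>\<xi> - y\<bar> <= \<bar>x - y\<bar>"
proof -
 consider "x < y" | "x = y" | "y < x" by linarith
 thus ?thesis
 proof cases
  case 1
  obtain \<xi> where "x < \<xi>" "\<xi> < y" "prim g y - prim g x = (y - x) * g \<xi>"
   using MVT2[OF 1, of "prim g" g] prim_has_derivative[OF assms] by blast
  thus ?thesis by (intro exI[of _ \<xi>]) (auto simp: algebra_simps)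
 next
  case 3
  obtain \<xi> where "y < \<xi>" "\<xi> < x" "prim g x - prim g y = (x - y) * g \<xi>"
   using MVT2[OF 3, of "prim g" g] prim_has_derivative[OF assms] by blast
  thus ?thesis by (intro exI[of _ \<xi>]) auto
 qed auto
qed

lemma prim_continuous:
 assumes "continuous_on UNIV g" shows "continuous_on UNIV (prim g)"
 using prim_has_derivative[OF assms] DERIV_isCont continuous_at_imp_continuous_on by blast

text \<open>The hypothesis \<open>m\<close> says that \<open>g s / s\<close> is monotone along rays.
  It makes \<open>prim g (t * s) - t\<twosuperior> / 2 * (s * g s)\<close>, as a function of
  \<open>t >= 0\<close>, smallest at \<open>t = 1\<close>. After integration this is the maximality
  of a Nehari point on its ray.\<close>

lemma prim_scaling:
 assumes c: "continuous_on UNIV g" and m: "!!s t. 0 <= t ==> t <= 1 ==> s * g (t * s) <= t * (s * g s)" and t: "0 <= t"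
 shows "prim g s + (t\<^sup>2 - 1) / 2 * (s * g s) <= prim g (t * s)"
proof -
 define ph where "ph t = prim g (t * s) - t\<^sup>2 / 2 * (s * g s)" for t
 have d: "(ph has_real_derivative (s * g (t * s) - t * (s * g s))) (at t)" for t
 proof -
  have "((%t. t * s) has_real_derivative s) (at t)" by (auto intro!: derivative_eq_intros)
  from DERIV_chain2[OF prim_has_derivative[OF c] this]
  have "((%t. prim g (t * s)) has_real_derivative g (t * s) * s) (at t)" .
  thus ?thesis unfolding ph_def by (auto intro!: derivative_eq_intros)
 qed
 have "ph 1 <= ph t"
 proof (cases "t <= 1")
  case True
  show ?thesis by (rule DERIV_nonpos_imp_nonincreasing[OF True]) (use d m t in fastforce)
 next
  case False
  have "0 <= s * g (x * s) - x * (s * g s)" if "1 <= x" for x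
  proof -
   have "(x * s) * g (1 / x * (x * s)) <= 1 / x * ((x * s) * g (x * s))" using that by (intro m) auto
   hence "x * (s * g s) <= s * g (x * s)" using that by (simp add: mult.assoc)
   thus ?thesis by simp
  qed
  thus ?thesis using False d by (intro DERIV_nonneg_imp_nondecreasing[of 1 t ph]) fastforce+
 qed
 thus ?thesis by (simp add: ph_def field_simps)
qed

text \<open>\<open>gt\<close> is the penalised nonlinearity. Monotonicity of the quotients by
  \<open>s\<close> is stated without division; it is strict for \<open>f\<close> alone, since
  \<open>gt\<close> will be linear for large arguments. The two upper bounds on
  \<open>\<kappa>\<close> serve the two estimates in \<open>Nh_energy\<close>. The dummy
  \<open>ty\<close> fixes the dimension.\<close>

locale penal =
 fixes f gt :: "real => real" and V0 V1 cA p \<mu> \<nu> \<kappa> :: real and ty :: "'n::finite itself"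
 assumes N: "CARD('n) >= 5" and p: "1 < p" "p < 2 * real CARD('n) / (real CARD('n) - 4) - 1"
  and V0: "0 < V0" "V0 <= V1" and cA: "0 < cA"
  and cont: "continuous_on UNIV f" "continuous_on UNIV gt"
  and growth: "!!s. \<bar>f s\<bar> <= cA * (\<bar>s\<bar> + \<bar>s\<bar> powr p)" "!!s. \<bar>gt s\<bar> <= cA * (\<bar>s\<bar> + \<bar>s\<bar> powr p)"
  and small: "!!e. e > 0 ==> \<exists>C\<ge>0. \<forall>s. s * f s <= e * s\<^sup>2 + C * \<bar>s\<bar> powr (p + 1)"
  and sign: "!!s. s \<noteq> 0 ==> 0 < s * f s" "!!s. 0 <= s * gt s"
  and mono: "!!s t. 0 <= t ==> t <= 1 ==> s * f (t * s) <= t * (s * f s)"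
   "!!s t. 0 <= t ==> t <= 1 ==> s * gt (t * s) <= t * (s * gt s)"
  and strict: "!!s t. 0 < t ==> t < 1 ==> s \<noteq> 0 ==> s * f (t * s) < t * (s * f s)"
  and superlinear: "!!K. \<exists>T>0. \<forall>s. \<bar>s\<bar> >= T --> K * s\<^sup>2 <= s * f s"
  and AR: "2 < \<mu>" "!!s. \<mu> * prim f s <= s * f s" and nu: "\<nu> = 1 / 2 - 1 / \<mu>"
  and pen: "!!s. s * gt s <= \<kappa> * s\<^sup>2" "!!s. s * gt s <= s * f s" and kappa: "0 < \<kappa>" "\<kappa> <= V0 / 2" "\<kappa> <= \<nu> * V0"
begin

lemma nu_pos: "0 < \<nu>" "\<nu> < 1/2" using AR(1) by (auto simp: nu field_simps)

lemma f_0 [simp]: "f 0 = 0" "gt 0 = 0" using growth(1)[of 0] growth(2)[of 0] by auto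

lemma borel_f [measurable]: "f \<in> bmeas" "gt \<in> bmeas"
 "prim f \<in> bmeas" "prim gt \<in> bmeas"
 using cont prim_continuous by (auto intro: borel_measurable_continuous_onI)

lemma sf_nonneg: "0 <= s * f s" using sign(1)[of s] by (cases "s = 0") auto

lemma prim_bound:
 assumes "g = f \<or> g = gt"
 shows "\<bar>prim g x - prim g y\<bar> <= cA * (max \<bar>x\<bar> \<bar>y\<bar> + max \<bar>x\<bar> \<bar>y\<bar> powr p) * \<bar>x - y\<bar>"
proof -
 have c: "continuous_on UNIV g" using assms cont by auto
 obtain \<xi> where \<xi>: "\<bar>\<xi>\<bar> <= max \<bar>x\<bar> \<bar>y\<bar>" "prim g x - prim g y = (x - y) * g \<xi>" using prim_mean_value[OF c] by blast
 have "\<bar>g \<xi>\<bar> <= cA * (\<bar>\<xi>\<bar> + \<bar>\<xi>\<bar> powr p)" using assms growth by auto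
 also have "\<dots> <= cA * (max \<bar>x\<bar> \<bar>y\<bar> + max \<bar>x\<bar> \<bar>y\<bar> powr p)"
  using \<xi>(1) cA p by (intro mult_left_mono add_mono powr_mono2) auto
 finally have "\<bar>g \<xi>\<bar> * \<bar>x - y\<bar> <= cA * (max \<bar>x\<bar> \<bar>y\<bar> + max \<bar>x\<bar> \<bar>y\<bar> powr p) * \<bar>x - y\<bar>" by (rule mult_right_mono) simp
 thus ?thesis unfolding \<xi>(2) abs_mult by (simp only: mult.commute)
qed

lemma powr_mult_self: "0 <= (x::real) ==> x powr p * x = x powr (p + 1)"
 using p by (cases "x = 0") (auto simp: powr_add)

lemma prim_bound0:
 assumes "g = f \<or> g = gt" shows "\<bar>prim g x\<bar> <= cA * (x\<^sup>2 + \<bar>x\<bar> powr (p + 1))"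
 using prim_bound[OF assms, of x 0] powr_mult_self[of "\<bar>x\<bar>"] by (simp add: max_absorb1 power2_eq_square distrib_right mult.assoc)

lemma prim_nonneg:
 assumes "g = f \<or> g = gt" shows "0 <= prim g s" "2 * prim g s <= s * g s"
proof -
 have c: "continuous_on UNIV g" using assms cont by auto
 have m: "s * g (t * s) <= t * (s * g s)" if "0 <= t" "t <= 1" for s t using assms mono that by auto
 have sg: "0 <= s * g s" for s using assms sign sf_nonneg by auto
 show "2 * prim g s <= s * g s" using prim_scaling[OF c m, of 0 s] by simp
 obtain \<xi> where x: "\<bar>\<xi>\<bar> <= max \<bar>s\<bar> \<bar>0\<bar>" "prim g s - prim g 0 = (s - 0) * g \<xi>" using prim_mean_value[OF c] by blast
 have "0 <= prim g s" if "s > 0"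
 proof (rule DERIV_nonneg_imp_nondecreasing[of 0 s "prim g", simplified])
  fix x assume "0 <= x" "x <= s"
  have "0 <= g x" using sg[of x] \<open>0 <= x\<close> assms f_0 by (cases "x = 0") (auto simp: zero_le_mult_iff)
  thus "\<exists>y. (prim g has_real_derivative y) (at x) & 0 <= y" using prim_has_derivative[OF c] by blast
 qed (use that in simp)
 moreover have "0 <= prim g s" if "s < 0"
 proof (rule DERIV_nonpos_imp_nonincreasing[of s 0 "prim g", simplified])
  fix x assume "s <= x" "x <= 0"
  have "g x <= 0" using sg[of x] \<open>x <= 0\<close> assms f_0 by (cases "x = 0") (auto simp: zero_le_mult_iff)
  thus "\<exists>y. (prim g has_real_derivative y) (at x) & y <= 0" using prim_has_derivative[OF c] by blast
 qed (use that in simp)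
 ultimately show "0 <= prim g s" by (cases "s = 0") (auto simp: neq_iff)
qed

lemma prim_gt_le: "prim gt s <= \<kappa> / 2 * s\<^sup>2" using prim_nonneg(2)[of gt s] pen(1)[of s] by simp

lemma prim_gt_le_f: "prim gt s <= prim f s"
proof -
 have D: "((%s. prim f s - prim gt s) has_real_derivative (f s - gt s)) (at s)" for s
  by (intro DERIV_diff prim_has_derivative cont)
 consider "s > 0" | "s = 0" | "s < 0" by linarith
 thus ?thesis
 proof cases
  case 1
  have "f x - gt x >= 0" if "0 <= x" for x using pen(2)[of x] that by (cases "x = 0") (auto simp: mult_le_cancel_left)
  hence "prim f 0 - prim gt 0 <= prim f s - prim gt s" using D 1
   by (intro DERIV_nonneg_imp_nondecreasing[of 0 s "%s. prim f s - prim gt s"]) fastforce+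
  thus ?thesis by simp
 next
  case 3
  have "f x - gt x <= 0" if "x <= 0" for x using pen(2)[of x] that by (cases "x = 0") (auto simp: mult_le_cancel_left)
  hence "prim f 0 - prim gt 0 <= prim f s - prim gt s" using D 3
   by (intro DERIV_nonpos_imp_nonincreasing[of s 0 "%s. prim f s - prim gt s"]) fastforce+
  thus ?thesis by simp
 qed simp
qed

definition gg :: "(real^'n => real) => (real^'n => real) => real^'n => real" where
 "gg th u x = th x * f (u x) + (1 - th x) * gt (u x)"

definition GG :: "(real^'n => real) => (real^'n => real) => real^'n => real" where
 "GG th u x = th x * prim f (u x) + (1 - th x) * prim gt (u x)"

definition adm :: "(real^'n => real) => (real^'n => real) => bool" where
 "adm W th \<longleftrightarrow> W \<in> bmeas & th \<in> bmeas & (\<forall>x. V0 <= W x & W x <= V1 & 0 <= th x & th x <= 1)"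

text \<open>\<open>v\<close> stands for the Laplacian of \<open>u\<close>; in the rescaled variable
  no power of the small parameter is left in front of it.\<close>

definition Qf :: "(real^'n => real) => (real^'n => real) => (real^'n => real) => real" where
 "Qf W u v = sqn v + LI (%x. W x * (u x)^2)"

definition Jf :: "(real^'n => real) => (real^'n => real) => (real^'n => real) => (real^'n => real) => real" where
 "Jf W th u v = Qf W u v / 2 - LI (%x. GG th u x)"

text \<open>Positivity of the form excludes the zero function, for which the identity is
  trivial.\<close>

definition Nh :: "(real^'n => real) => (real^'n => real) => (real^'n => real) => (real^'n => real) => bool" where
 "Nh W th u v \<longleftrightarrow> Wsp u v & 0 < Qf W u v & Qf W u v = LI (%x. gg th u x * u x)"

text \<open>A common domain for dominated convergence in \<open>gg\<close> and \<open>GG\<close>,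
  larger than \<open>Wsp\<close>: it is closed under absolute values, so sums such as
  \<open>\<bar>u\<bar> + \<bar>h\<bar>\<close> can serve as majorants.\<close>

definition Lpp :: "(real^'n => real) => bool" where
 "Lpp w \<longleftrightarrow> sq_int lborel w & Lint (%x. \<bar>w x\<bar> powr (p + 1))"

lemma admD:
 assumes "adm W th"
 shows "W \<in> bmeas" "th \<in> bmeas" "V0 <= W x" "W x <= V1" "0 <= th x" "th x <= 1" "\<bar>W x\<bar> <= V1"
proof -
 show *: "W \<in> bmeas" "th \<in> bmeas" "V0 <= W x" "W x <= V1" "0 <= th x" "th x <= 1" using assms by (auto simp: adm_def)
 show "\<bar>W x\<bar> <= V1" using *(3,4) V0 by linarith
qed

lemma LppD: "Lpp w ==> w \<in> bmeas" "Lpp w ==> sq_int lborel w" "Lpp w ==> Lint (%x. \<bar>w x\<bar> powr (p + 1))"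
 by (auto simp: Lpp_def sq_int_def)

lemma Wsp_Lpp: "Wsp u v ==> Lpp u"
 unfolding Lpp_def using Sobolev[OF N, of "p + 1"] p WspD(1) by fastforce

lemma Lpp_abs: "Lpp w ==> Lpp (%x. \<bar>w x\<bar>)"
 by (auto simp: Lpp_def sq_int_def)

lemma Lpp_cmult: "Lpp w ==> Lpp (%x. c * w x)"
 unfolding Lpp_def by (auto intro: sq_int_cmult simp: abs_mult powr_mult)

lemma Lpp_add:
 assumes "Lpp w" "Lpp w'" shows "Lpp (%x. w x + w' x)"
 unfolding Lpp_def
proof
 note [measurable] = LppD(1)[OF assms(1)] LppD(1)[OF assms(2)]
 show "sq_int lborel (%x. w x + w' x)" using assms by (auto simp: Lpp_def intro: sq_int_add)
 have i: "Lint (%x. 2 powr (p + 1) * (\<bar>w x\<bar> powr (p + 1) + \<bar>w' x\<bar> powr (p + 1)))"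
  using assms by (simp add: Lpp_def)
 show "Lint (%x. \<bar>w x + w' x\<bar> powr (p + 1))"
 proof (rule integrable_bnd[OF i])
  show "AE x in lborel. norm (\<bar>w x + w' x\<bar> powr (p + 1)) <= norm (2 powr (p + 1) * (\<bar>w x\<bar> powr (p + 1) + \<bar>w' x\<bar> powr (p + 1)))"
  proof (rule AE_I2)
   fix x
   have "\<bar>w x + w' x\<bar> powr (p + 1) <= (\<bar>w x\<bar> + \<bar>w' x\<bar>) powr (p + 1)" using p by (intro powr_mono2) auto
   also have "\<dots> <= 2 powr (p + 1) * (\<bar>w x\<bar> powr (p + 1) + \<bar>w' x\<bar> powr (p + 1))" using p by (intro powr_add_le) auto
   finally show "norm (\<bar>w x + w' x\<bar> powr (p + 1)) <= norm (2 powr (p + 1) * (\<bar>w x\<bar> powr (p + 1) + \<bar>w' x\<bar> powr (p + 1)))" by simp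
  qed
 qed measurable
qed

lemma Lpp_dominating:
 assumes "Lpp w" shows "Lint (%x. cA * (\<bar>w x\<bar> + \<bar>w x\<bar> powr p) * \<bar>w x\<bar>)"
proof -
 have "(%x. cA * (\<bar>w x\<bar> + \<bar>w x\<bar> powr p) * \<bar>w x\<bar>) = (%x. cA * ((w x)^2 + \<bar>w x\<bar> powr (p + 1)))"
  by (auto simp: powr_mult_self[symmetric] power2_eq_square distrib_right)
 thus ?thesis using assms by (simp add: Lpp_def sq_int_def)
qed

lemma gg_measurable [measurable (raw)]:
 "th \<in> bmeas ==> u \<in> bmeas ==> gg th u \<in> bmeas"
 "th \<in> bmeas ==> u \<in> bmeas ==> GG th u \<in> bmeas"
proof -
 assume [measurable]: "th \<in> bmeas" "u \<in> bmeas"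
 have [measurable]: "(%x. k (u x)) \<in> bmeas" if "k \<in> bmeas" for k :: "real => real"
  using that by measurable
 note this[OF borel_f(1), measurable] this[OF borel_f(2), measurable] this[OF borel_f(3), measurable] this[OF borel_f(4), measurable]
 show "gg th u \<in> bmeas" "GG th u \<in> bmeas" unfolding gg_def[abs_def] GG_def[abs_def] by measurable
qed

lemma convex_abs_le:
 assumes "0 <= t" "t <= (1::real)" "\<bar>x\<bar> <= B" "\<bar>y\<bar> <= B" shows "\<bar>t * x + (1 - t) * y\<bar> <= B"
proof -
 have "\<bar>t * x + (1 - t) * y\<bar> <= t * \<bar>x\<bar> + (1 - t) * \<bar>y\<bar>" using assms by (simp add: abs_mult order_trans[OF abs_triangle_ineq])
 also have "\<dots> <= t * B + (1 - t) * B" using assms by (intro add_mono mult_left_mono) auto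
 finally show ?thesis by (simp add: algebra_simps)
qed

lemma gg_bound:
 assumes "0 <= th x" "th x <= 1" "\<bar>u x\<bar> <= w"
 shows "\<bar>gg th u x\<bar> <= cA * (w + w powr p)"
proof -
 have "cA * (\<bar>u x\<bar> + \<bar>u x\<bar> powr p) <= cA * (w + w powr p)" using cA p assms by (intro mult_left_mono add_mono powr_mono2) auto
 thus ?thesis unfolding gg_def using growth(1)[of "u x"] growth(2)[of "u x"] assms by (intro convex_abs_le) auto
qed

lemma GG_bound:
 assumes "0 <= th x" "th x <= 1" "\<bar>u x\<bar> <= w"
 shows "\<bar>GG th u x\<bar> <= cA * (w + w powr p) * w"
proof -
 have "cA * (\<bar>u x\<bar> + \<bar>u x\<bar> powr p) * \<bar>u x\<bar> <= cA * (w + w powr p) * w" using cA p assms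
  by (intro mult_mono mult_left_mono add_mono powr_mono2) auto
 moreover have "\<bar>prim g (u x)\<bar> <= cA * (\<bar>u x\<bar> + \<bar>u x\<bar> powr p) * \<bar>u x\<bar>" if "g = f \<or> g = gt" for g
  using prim_bound[OF that, of "u x" 0] by (simp add: max_absorb1)
 ultimately show ?thesis unfolding GG_def using assms by (intro convex_abs_le) (auto intro: order_trans)
qed

lemma gg_integrable:
 assumes th: "th \<in> bmeas" "!!x. 0 <= th x" "!!x. th x <= 1" and u: "Lpp u" and h: "Lpp h"
 shows "Lint (%x. gg th u x * h x)"
proof -
 note [measurable] = th(1) LppD(1)[OF u] LppD(1)[OF h]
 have L: "Lpp (%x. \<bar>u x\<bar> + \<bar>h x\<bar>)" by (intro Lpp_add Lpp_abs u h)
 show ?thesis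
 proof (rule integrable_bnd[OF Lpp_dominating[OF L]])
  show "AE x in lborel. norm (gg th u x * h x) <= norm (cA * (\<bar>\<bar>u x\<bar> + \<bar>h x\<bar>\<bar> + \<bar>\<bar>u x\<bar> + \<bar>h x\<bar>\<bar> powr p) * \<bar>\<bar>u x\<bar> + \<bar>h x\<bar>\<bar>)"
  proof (rule AE_I2)
   fix x
   have "\<bar>gg th u x\<bar> * \<bar>h x\<bar> <= cA * ((\<bar>u x\<bar> + \<bar>h x\<bar>) + (\<bar>u x\<bar> + \<bar>h x\<bar>) powr p) * (\<bar>u x\<bar> + \<bar>h x\<bar>)"
    using cA th by (intro mult_mono gg_bound) auto
   thus "norm (gg th u x * h x) <= norm (cA * (\<bar>\<bar>u x\<bar> + \<bar>h x\<bar>\<bar> + \<bar>\<bar>u x\<bar> + \<bar>h x\<bar>\<bar> powr p) * \<bar>\<bar>u x\<bar> + \<bar>h x\<bar>\<bar>)"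
    using cA by (simp add: abs_mult abs_of_pos)
  qed
 qed measurable
qed

lemma GG_integrable:
 assumes th: "th \<in> bmeas" "!!x. 0 <= th x" "!!x. th x <= 1" and u: "Lpp u"
 shows "Lint (GG th u)"
proof -
 note [measurable] = th(1) LppD(1)[OF u]
 show ?thesis
  by (rule integrable_bnd[OF Lpp_dominating[OF u]])
   (use GG_bound[OF th(2,3) order_refl] in \<open>auto intro!: AE_I2 order_trans[OF _ abs_ge_self]\<close>)
qed

lemma gg_tendsto: "a -->> th x ==> b -->> u x ==> (%n. a n * f (b n) + (1 - a n) * gt (b n)) -->> gg th u x"
 unfolding gg_def using cont by (intro tendsto_intros) (auto intro: continuous_on_tendsto_compose)

lemma GG_tendsto: "a -->> th x ==> b -->> u x ==> (%n. a n * prim f (b n) + (1 - a n) * prim gt (b n)) -->> GG th u x"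
 unfolding GG_def using prim_continuous[OF cont(1)] prim_continuous[OF cont(2)] by (intro tendsto_intros) (auto intro: continuous_on_tendsto_compose)

lemma gg_dominated:
 assumes th: "!!n. th n \<in> bmeas" "!!n x. 0 <= th n x" "!!n x. th n x <= 1" "th0 \<in> bmeas"
  and u: "!!n. u n \<in> bmeas" "u0 \<in> bmeas" and h: "!!n. h n \<in> bmeas" "h0 \<in> bmeas"
  and w: "Lpp w" and le: "!!n x. \<bar>u n x\<bar> <= \<bar>w x\<bar>" "!!n x. \<bar>h n x\<bar> <= \<bar>w x\<bar>"
  and lim: "!!x. (%n. th n x) -->> th0 x" "!!x. (%n. u n x) -->> u0 x" "!!x. (%n. h n x) -->> h0 x"
 shows "(%n. LI (%x. gg (th n) (u n) x * h n x)) -->> LI (%x. gg th0 u0 x * h0 x)"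
  "(%n. LI (%x. GG (th n) (u n) x)) -->> LI (%x. GG th0 u0 x)"
proof -
 note [measurable] = th(1,4) u h LppD(1)[OF w]
 show "(%n. LI (%x. gg (th n) (u n) x * h n x)) -->> LI (%x. gg th0 u0 x * h0 x)"
 proof (rule integral_dominated_convergence[OF _ _ Lpp_dominating[OF w]])
  show "AE x in lborel. (%n. gg (th n) (u n) x * h n x) -->> gg th0 u0 x * h0 x"
   using gg_tendsto[OF lim(1,2)] by (intro AE_I2 tendsto_mult lim(3)) (simp add: gg_def)
  show "AE x in lborel. norm (gg (th n) (u n) x * h n x) <= cA * (\<bar>w x\<bar> + \<bar>w x\<bar> powr p) * \<bar>w x\<bar>" for n
   using cA by (intro AE_I2) (auto simp: abs_mult intro!: mult_mono gg_bound th le)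
 qed measurable
 show "(%n. LI (%x. GG (th n) (u n) x)) -->> LI (%x. GG th0 u0 x)"
 proof (rule integral_dominated_convergence[OF _ _ Lpp_dominating[OF w]])
  show "AE x in lborel. (%n. GG (th n) (u n) x) -->> GG th0 u0 x"
   using GG_tendsto[OF lim(1,2)] by (intro AE_I2) (simp add: GG_def)
  show "AE x in lborel. norm (GG (th n) (u n) x) <= cA * (\<bar>w x\<bar> + \<bar>w x\<bar> powr p) * \<bar>w x\<bar>" for n
   by (intro AE_I2) (auto intro!: GG_bound th le)
 qed measurable
qed

lemma W_integrable:
 assumes a: "adm W th" and u: "sq_int lborel u" and h: "sq_int lborel h"
 shows "Lint (%x. W x * (u x * h x))" "Lint (%x. W x * (u x)^2)"
proof -
 have "sq_int lborel (%x. W x * u x)" if "sq_int lborel u" for u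
  by (rule sq_int_bound[OF that, of _ V1])
   (use admD[OF a] sq_int_measurable[OF that] in \<open>auto simp: abs_mult intro!: AE_I2 mult_right_mono\<close>)
 from sq_int_mult[OF this[OF u] h] sq_int_mult[OF this[OF u] u]
 show "Lint (%x. W x * (u x * h x))" "Lint (%x. W x * (u x)^2)"
  by (auto simp: mult.assoc power2_eq_square)
qed

definition Bf :: "(real^'n => real) => (real^'n => real) => (real^'n => real) => (real^'n => real) => (real^'n => real) => real" where
 "Bf W u v h k = LI (%x. v x * k x) + LI (%x. W x * (u x * h x))"

lemma Qf_expand:
 assumes a: "adm W th" and u: "Wsp u v" and h: "Wsp h k"
 shows "Qf W (%x. u x + c * h x) (%x. v x + c * k x) = Qf W u v + 2 * c * Bf W u v h k + c^2 * Qf W h k"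
proof -
 note uu = WspD(1)[OF u] and hh = WspD(1)[OF h]
 have "(%x. W x * (u x + c * h x)^2) = (%x. W x * (u x)^2 + 2 * c * (W x * (u x * h x)) + c^2 * (W x * (h x)^2))"
  by (auto simp: power2_eq_square algebra_simps)
 hence "LI (%x. W x * (u x + c * h x)^2) = LI (%x. W x * (u x)^2) + 2 * c * LI (%x. W x * (u x * h x)) + c^2 * LI (%x. W x * (h x)^2)"
  using W_integrable[OF a uu hh] W_integrable(2)[OF a hh hh] by simp
 thus ?thesis using sq_int_expand[OF WspD(2)[OF u] WspD(2)[OF h], of c] by (simp add: Qf_def Bf_def algebra_simps)
qed

lemma Qf_scale: "Qf W (%x. c * u x) (%x. c * v x) = c^2 * Qf W u v"
 by (simp add: Qf_def power_mult_distrib distrib_left mult.left_commute[of _ "c^2"])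

lemma Qf_lower:
 assumes a: "adm W th" and u: "Wsp u v"
 shows "V0 * sqn u <= Qf W u v" "sqn v <= Qf W u v"
  "V0 * sqn u + sqn v <= Qf W u v"
proof -
 have "LI (%x. V0 * (u x)^2) <= LI (%x. W x * (u x)^2)"
  using W_integrable(2)[OF a WspD(1)[OF u] WspD(1)[OF u]] sq_int_integrable[OF WspD(1)[OF u]] admD(3)[OF a]
  by (intro integral_mono) (auto intro: mult_right_mono)
 hence *: "V0 * sqn u <= LI (%x. W x * (u x)^2)" by simp
 have nn: "0 <= sqn u" "0 <= sqn v" by simp_all
 hence "0 <= V0 * sqn u" using V0 by simp
 with * nn show "V0 * sqn u <= Qf W u v" "sqn v <= Qf W u v"
  "V0 * sqn u + sqn v <= Qf W u v" unfolding Qf_def by linarith+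
qed

lemma gg_int:
 assumes "adm W th" "Wsp u v" "Wsp h k"
 shows "Lint (%x. gg th u x * h x)" "Lint (GG th u)"
 using admD[OF assms(1)] assms by (auto intro!: gg_integrable GG_integrable Wsp_Lpp)

text \<open>Integrated form of \<open>prim_scaling\<close>. It holds off the Nehari set too, where
  the defect of the Nehari identity enters linearly; \<open>level_upper\<close> uses it for
  functions that are only nearly on the set.\<close>

lemma Jf_scale_le:
 assumes a: "adm W th" and W: "Wsp u v" and t: "0 <= t"
 shows "Jf W th (%x. t * u x) (%x. t * v x) <= Jf W th u v + (t\<^sup>2 - 1) / 2 * (Qf W u v - LI (%x. gg th u x * u x))"
proof -
 note i = gg_int[OF a W W] gg_int(2)[OF a Wsp_cmult[OF W, of t] W]
 have "LI (%x. GG th u x + (t\<^sup>2 - 1) / 2 * (gg th u x * u x)) <= LI (%x. GG th (%x. t * u x) x)"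
 proof (rule integral_mono)
  fix x
  note s = prim_scaling[OF cont(1) mono(1) t, of "u x"] prim_scaling[OF cont(2) mono(2) t, of "u x"]
  have "th x * (prim f (u x) + (t\<^sup>2 - 1) / 2 * (u x * f (u x))) + (1 - th x) * (prim gt (u x) + (t\<^sup>2 - 1) / 2 * (u x * gt (u x)))
   <= th x * prim f (t * u x) + (1 - th x) * prim gt (t * u x)"
   using admD[OF a] s by (intro add_mono mult_left_mono) auto
  moreover have "GG th u x + (t\<^sup>2 - 1) / 2 * (gg th u x * u x) = th x * (prim f (u x) + (t\<^sup>2 - 1) / 2 * (u x * f (u x))) + (1 - th x) * (prim gt (u x) + (t\<^sup>2 - 1) / 2 * (u x * gt (u x)))"
   unfolding GG_def gg_def by (simp add: distrib_left distrib_right mult_ac)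
  ultimately show "GG th u x + (t\<^sup>2 - 1) / 2 * (gg th u x * u x) <= GG th (%x. t * u x) x"
   by (simp add: GG_def)
 qed (use i in auto)
 hence "LI (%x. GG th u x) + (t\<^sup>2 - 1) / 2 * LI (%x. gg th u x * u x) <= LI (%x. GG th (%x. t * u x) x)"
  using i by simp
 thus ?thesis unfolding Jf_def Qf_scale by (simp add: field_simps)
qed

lemma Jf_scaling:
 assumes a: "adm W th" and u: "Nh W th u v" and t: "0 <= t"
 shows "Jf W th (%x. t * u x) (%x. t * v x) <= Jf W th u v"
 using Jf_scale_le[OF a _ t, of u v] u by (simp add: Nh_def)

text \<open>Coercivity: where \<open>f\<close> acts, the superquadraticity \<open>AR\<close> is
  used; where \<open>gt\<close> acts, its quadratic bound with
  \<open>\<kappa> <= \<nu> * V0\<close>. For the last claim \<open>\<kappa> <= V0 / 2\<close> lets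
  half of the form absorb the penalised part, so the \<open>th\<close>-part of \<open>f\<close> must
  carry the other half.\<close>

lemma Nh_energy:
 assumes a: "adm W th" and u: "Nh W th u v"
 shows "Jf W th u v = LI (%x. gg th u x * u x / 2 - GG th u x)" "\<nu> / 2 * Qf W u v <= Jf W th u v"
  "Qf W u v / 2 <= LI (%x. th x * (u x * f (u x)))"
proof -
 have W: "Wsp u v" using u by (simp add: Nh_def)
 note [measurable] = admD(1,2)[OF a] WspD(3)[OF W]
 note i = gg_int[OF a W W]
 have Q: "Qf W u v = LI (%x. gg th u x * u x)" using u by (simp add: Nh_def)
 show "Jf W th u v = LI (%x. gg th u x * u x / 2 - GG th u x)" unfolding Jf_def using i by (simp add: Q)
 note u2 = sq_int_integrable[OF WspD(1)[OF W]]
 have "LI (%x. GG th u x) <= LI (%x. 1 / \<mu> * (gg th u x * u x) + \<nu> / 2 * V0 * (u x)^2)"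
 proof (rule integral_mono)
  fix x
  have 1: "prim f (u x) <= 1 / \<mu> * (u x * f (u x)) + \<nu> / 2 * V0 * (u x)^2"
  proof -
   have "prim f (u x) <= 1 / \<mu> * (u x * f (u x))" using AR(1) AR(2)[of "u x"] by (simp add: field_simps)
   moreover have "0 <= \<nu> / 2 * V0 * (u x)^2" using nu_pos V0 by simp
   ultimately show ?thesis by linarith
  qed
  have 2: "prim gt (u x) <= 1 / \<mu> * (u x * gt (u x)) + \<nu> / 2 * V0 * (u x)^2"
  proof -
   have "\<kappa> / 2 * (u x)^2 <= \<nu> / 2 * V0 * (u x)^2" using kappa by (intro mult_right_mono) auto
   moreover have "0 <= 1 / \<mu> * (u x * gt (u x))" using AR(1) by (intro mult_nonneg_nonneg[OF _ sign(2)]) auto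
   ultimately show ?thesis using prim_gt_le[of "u x"] by linarith
  qed
  have "GG th u x <= th x * (1 / \<mu> * (u x * f (u x)) + \<nu> / 2 * V0 * (u x)^2) + (1 - th x) * (1 / \<mu> * (u x * gt (u x)) + \<nu> / 2 * V0 * (u x)^2)"
   unfolding GG_def using admD[OF a] 1 2 by (intro add_mono mult_left_mono) auto
  also have "\<dots> = 1 / \<mu> * (gg th u x * u x) + \<nu> / 2 * V0 * (u x)^2"
   unfolding gg_def by (simp add: algebra_simps add_divide_distrib diff_divide_distrib)
  finally show "GG th u x <= 1 / \<mu> * (gg th u x * u x) + \<nu> / 2 * V0 * (u x)^2" .
 qed (use i u2 in auto)
 also have "\<dots> = 1 / \<mu> * Qf W u v + \<nu> / 2 * (V0 * sqn u)"
  using i u2 by (simp add: Q)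
 also have "\<dots> <= 1 / \<mu> * Qf W u v + \<nu> / 2 * Qf W u v"
  using Qf_lower(1)[OF a W] nu_pos by (intro add_left_mono mult_left_mono) auto
 finally have "Jf W th u v >= Qf W u v / 2 - (1 / \<mu> * Qf W u v + \<nu> / 2 * Qf W u v)" unfolding Jf_def by linarith
 moreover have "Qf W u v / 2 - (1 / \<mu> * Qf W u v + \<nu> / 2 * Qf W u v) = \<nu> / 2 * Qf W u v"
  unfolding nu by (simp add: algebra_simps add_divide_distrib diff_divide_distrib)
 ultimately show "\<nu> / 2 * Qf W u v <= Jf W th u v" by linarith
 have uf: "Lint (%x. th x * (u x * f (u x)))"
 proof (rule integrable_bnd[OF gg_integrable[of "%x. 1", OF _ _ _ Wsp_Lpp[OF W] Wsp_Lpp[OF W]]])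
  show "AE x in lborel. norm (th x * (u x * f (u x))) <= norm (gg (%x. 1) u x * u x)"
  proof (rule AE_I2)
   fix x
   have "\<bar>th x\<bar> * \<bar>u x * f (u x)\<bar> <= 1 * \<bar>u x * f (u x)\<bar>" using admD[OF a] by (intro mult_right_mono) auto
   thus "norm (th x * (u x * f (u x))) <= norm (gg (%x. 1) u x * u x)" by (simp add: gg_def abs_mult mult.commute)
  qed
 qed auto
 have "Qf W u v <= LI (%x. th x * (u x * f (u x)) + V0 / 2 * (u x)^2)"
  unfolding Q
 proof (rule integral_mono)
  fix x
  have "(1 - th x) * (u x * gt (u x)) <= 1 * (V0 / 2 * (u x)^2)"
  proof (rule mult_mono)
   have "\<kappa> * (u x)^2 <= V0 / 2 * (u x)^2" using kappa by (intro mult_right_mono) auto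
   thus "u x * gt (u x) <= V0 / 2 * (u x)^2" using pen(1)[of "u x"] by linarith
  qed (use admD[OF a] sign(2) in auto)
  thus "gg th u x * u x <= th x * (u x * f (u x)) + V0 / 2 * (u x)^2" by (simp add: gg_def algebra_simps)
 qed (use i uf u2 in auto)
 also have "\<dots> = LI (%x. th x * (u x * f (u x))) + (V0 * sqn u) / 2" using uf u2 by simp
 finally show "Qf W u v / 2 <= LI (%x. th x * (u x * f (u x)))" using Qf_lower(1)[OF a W] by linarith
qed

text \<open>The half of \<open>Qf\<close> carried by \<open>f\<close> is, up to an absorbed
  quadratic part, of order \<open>p + 1 > 2\<close> by Sobolev, which is impossible for small
  \<open>Qf\<close>. The constant does not depend on \<open>W\<close> or \<open>th\<close>.\<close>

lemma Nh_lower: "\<exists>\<delta>>0. \<forall>W th u v. adm W th --> Nh W th u v --> \<delta> <= Qf W u v"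
proof -
 obtain C where C: "C >= 0" "!!s. s * f s <= (V0 / 4) * s\<^sup>2 + C * \<bar>s\<bar> powr (p + 1)" using small[of "V0 / 4"] V0 by auto
 obtain S where S: "S >= 0" "!!(u :: real^'n => real) v. Wsp u v ==>
  Lint (%x. \<bar>u x\<bar> powr (p + 1)) & LI (%x. \<bar>u x\<bar> powr (p + 1)) <= S * (sqn u + sqn v) powr ((p + 1) / 2)"
  using Sobolev[OF N, of "p + 1"] p by auto
 define k where "k = 1 / V0 + 1"
 have k: "k > 0" using V0 by (simp add: k_def add_pos_pos)
 define D where "D = C * S * k powr ((p + 1) / 2) + 1"
 have D: "D > 0" using C S by (simp add: D_def add_nonneg_pos)
 \<comment> \<open>The solution \<open>q\<close> of
   \<open>1 / 4 = D * q powr ((p - 1) / 2)\<close>.\<close>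
 define \<delta> where "\<delta> = (1 / (4 * D)) powr (2 / (p - 1))"
 have "\<delta> <= Qf W u v" if a: "adm W th" and u: "Nh W th u v" for W th u v
 proof -
  have W: "Wsp u v" and Q0: "Qf W u v > 0" using u by (auto simp: Nh_def)
  define q where "q = Qf W u v"
  note Su = S(2)[OF W]
  note u2 = sq_int_integrable[OF WspD(1)[OF W]]
  have "q / 2 <= LI (%x. th x * (u x * f (u x)))" unfolding q_def by (rule Nh_energy(3)[OF a u])
  also have "\<dots> <= LI (%x. (V0 / 4) * (u x)\<^sup>2 + C * \<bar>u x\<bar> powr (p + 1))"
  proof (rule integral_mono_AE')
   show "AE x in lborel. th x * (u x * f (u x)) <= (V0 / 4) * (u x)\<^sup>2 + C * \<bar>u x\<bar> powr (p + 1)"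
   proof (rule AE_I2)
    fix x
    have "th x * (u x * f (u x)) <= 1 * (u x * f (u x))" using admD[OF a] sf_nonneg by (intro mult_right_mono) auto
    thus "th x * (u x * f (u x)) <= (V0 / 4) * (u x)\<^sup>2 + C * \<bar>u x\<bar> powr (p + 1)" using C(2)[of "u x"] by simp
   qed
   show "AE x in lborel. 0 <= (V0 / 4) * (u x)\<^sup>2 + C * \<bar>u x\<bar> powr (p + 1)" using V0 C by simp
  qed (use u2 Su in auto)
  also have "\<dots> = (V0 * sqn u) / 4 + C * LI (%x. \<bar>u x\<bar> powr (p + 1))" using u2 Su by simp
  also have "\<dots> <= q / 4 + C * (S * (k * q) powr ((p + 1) / 2))"
  proof (intro add_mono mult_left_mono)
   show "(V0 * sqn u) / 4 <= q / 4" using Qf_lower(1)[OF a W] by (simp add: q_def)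
   have "sqn u <= q / V0" using Qf_lower(1)[OF a W] V0 by (simp add: q_def field_simps)
   hence "sqn u + sqn v <= k * q" using Qf_lower(2)[OF a W] by (simp add: k_def q_def distrib_right)
   hence "(sqn u + sqn v) powr ((p + 1) / 2) <= (k * q) powr ((p + 1) / 2)"
    using p by (intro powr_mono2) auto
   hence "S * (sqn u + sqn v) powr ((p + 1) / 2) <= S * (k * q) powr ((p + 1) / 2)" using S by (intro mult_left_mono) auto
   thus "LI (%x. \<bar>u x\<bar> powr (p + 1)) <= S * (k * q) powr ((p + 1) / 2)" using Su by linarith
  qed (use C in auto)
  also have "C * (S * (k * q) powr ((p + 1) / 2)) = C * S * k powr ((p + 1) / 2) * q powr ((p + 1) / 2)"
   using k Q0 by (simp add: powr_mult q_def)
  also have "\<dots> <= D * q powr ((p + 1) / 2)" by (intro mult_right_mono) (auto simp: D_def)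
  finally have "q / 4 <= D * q powr ((p + 1) / 2)" by simp
  also have "q powr ((p + 1) / 2) = q * q powr ((p - 1) / 2)"
  proof -
   have "(p + 1) / 2 = 1 + (p - 1) / 2" by (simp add: field_simps)
   thus ?thesis using Q0 by (simp only: powr_add q_def) simp
  qed
  finally have "q * (1 / 4) <= q * (D * q powr ((p - 1) / 2))" by (simp add: mult_ac)
  hence "1 / 4 <= D * q powr ((p - 1) / 2)" using Q0 by (simp add: q_def)
  hence "1 / (4 * D) <= q powr ((p - 1) / 2)" using D by (simp add: field_simps)
  hence "(1 / (4 * D)) powr (2 / (p - 1)) <= (q powr ((p - 1) / 2)) powr (2 / (p - 1))" using p D by (intro powr_mono2) auto
  also have "\<dots> = q"
  proof -
   have "(p - 1) / 2 * (2 / (p - 1)) = 1" using p by simp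
   thus ?thesis unfolding powr_powr using Q0 by (simp only: q_def) simp
  qed
  finally show ?thesis by (simp add: \<delta>_def q_def)
 qed
 moreover have "\<delta> > 0" using D by (simp add: \<delta>_def)
 ultimately show ?thesis by blast
qed

end

section \<open>Existence of a critical minimiser\<close>

lemma LI_pull: "LI (%x. a x * (t * b x)) = t * LI (%x. a x * b x)"
proof -
 have "(%x. a x * (t * b x)) = (%x. t * (a x * b x))" by (simp add: fun_eq_iff)
 thus ?thesis by simp
qed

text \<open>Dominated convergence with a remainder: up to functions \<open>b n\<close> of uniformly
  small integral, a fixed integrable \<open>g\<close> dominates. It replaces uniform
  integrability.\<close>

lemma integral_tendsto_0_dominated:
 fixes d :: "nat => 'a => real"
 assumes d [measurable]: "!!n. d n \<in> borel_measurable M" and nn: "!!n x. 0 <= d n x" and lim: "AE x in M. (%n. d n x) -->> 0"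
  and dom: "!!e. e > 0 ==> \<exists>g b. integrable M g & (\<forall>x. 0 <= g x) &
   (\<forall>n. integrable M (b n) & (\<forall>x. 0 <= b n x & d n x <= g x + b n x) & (\<integral>x. b n x \<partial>M) <= e)"
 shows "!!n. integrable M (d n)" "(%n. \<integral>x. d n x \<partial>M) -->> 0"
proof -
 show i: "integrable M (d n)" for n
 proof -
  obtain g b where gb: "integrable M g" "\<forall>n. integrable M (b n) & (\<forall>x. 0 <= b n x & d n x <= g x + b n x) & (\<integral>x. b n x \<partial>M) <= 1"
   using dom[OF zero_less_one] by blast
  hence "integrable M (%x. g x + b n x)" by simp
  thus ?thesis by (rule integrable_bnd) (use gb nn in \<open>auto intro!: AE_I2 order_trans[OF _ abs_ge_self]\<close>)
 qed
 show "(%n. \<integral>x. d n x \<partial>M) -->> 0"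
 proof (rule LIMSEQ_I)
  fix e :: real assume e: "e > 0"
  obtain g b where gb: "integrable M g" "\<forall>x. 0 <= g x" "\<forall>n. integrable M (b n) & (\<forall>x. 0 <= b n x & d n x <= g x + b n x) & (\<integral>x. b n x \<partial>M) <= e / 2"
   using dom[OF half_gt_zero[OF e]] by blast
  have [measurable]: "g \<in> borel_measurable M" using gb by auto
  have mi: "integrable M (%x. min (d n x) (g x))" for n
   by (rule integrable_bnd[OF gb(1)]) (use gb nn in \<open>auto intro!: AE_I2\<close>)
  have "(%n. \<integral>x. min (d n x) (g x) \<partial>M) -->> (\<integral>x. 0 \<partial>M)"
  proof (rule integral_dominated_convergence[OF _ _ gb(1)])
   show "AE x in M. (%n. min (d n x) (g x)) -->> 0"
    using lim
   proof eventually_elim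
    case (elim x)
    from tendsto_min[OF this tendsto_const[of "g x"]] show ?case using gb(2) by (simp add: min_absorb1)
   qed
   show "AE x in M. norm (min (d n x) (g x)) <= g x" for n using gb nn by (auto intro!: AE_I2)
  qed auto
  hence "\<forall>\<^sub>F n in sequentially. (\<integral>x. min (d n x) (g x) \<partial>M) < e / 2" using e by (intro order_tendstoD) auto
  then obtain n0 where n0: "!!n. n >= n0 ==> (\<integral>x. min (d n x) (g x) \<partial>M) < e / 2" by (auto simp: eventually_sequentially)
  have "norm ((\<integral>x. d n x \<partial>M) - 0) < e" if "n >= n0" for n
  proof -
   have "(\<integral>x. d n x \<partial>M) <= (\<integral>x. min (d n x) (g x) + b n x \<partial>M)"
   proof (rule integral_mono[OF i])
    show "d n x <= min (d n x) (g x) + b n x" for x using gb(3) by (simp add: min_def)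
   qed (use mi gb in auto)
   also have "\<dots> = (\<integral>x. min (d n x) (g x) \<partial>M) + (\<integral>x. b n x \<partial>M)" using mi gb by simp
   also have "\<dots> < e" using n0[OF that] gb(3)[rule_format, of n] by linarith
   finally show ?thesis using nn by (simp add: Bochner_Integration.integral_nonneg abs_of_nonneg)
  qed
  thus "\<exists>no. \<forall>n\<ge>no. norm ((\<integral>x. d n x \<partial>M) - 0) < e" by blast
 qed
qed

text \<open>The integrable weight \<open>th\<close> acts like a finite measure. Growth of lower
  order than \<open>q\<close> then turns a uniform bound on the \<open>q\<close>-th powers and
  convergence almost everywhere into convergence of the integrals.\<close>

lemma subcritical_convergence:
 fixes u :: "nat => 'a => real"
 assumes th: "integrable M th" "!!x. 0 <= th x" "!!x. th x <= 1"
  and ps: "continuous_on UNIV ps" "!!e. e > 0 ==> \<exists>C\<ge>0. \<forall>s. \<bar>ps s\<bar> <= e * \<bar>s\<bar> powr q + C" and q: "q > 0"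
  and u [measurable]: "!!n. u n \<in> borel_measurable M" and uq: "!!n. integrable M (%x. \<bar>u n x\<bar> powr q)" "!!n. (\<integral>x. \<bar>u n x\<bar> powr q \<partial>M) <= C"
  and u0 [measurable]: "u0 \<in> borel_measurable M" and lim: "AE x in M. (%n. u n x) -->> u0 x"
 shows "!!n. integrable M (%x. th x * ps (u n x))" "integrable M (%x. th x * ps (u0 x))"
  "(%n. \<integral>x. th x * ps (u n x) \<partial>M) -->> (\<integral>x. th x * ps (u0 x) \<partial>M)"
proof -
 have [measurable]: "ps \<in> bmeas" using ps(1) by (rule borel_measurable_continuous_onI)
 have [measurable]: "th \<in> borel_measurable M" using th by auto
 have psl: "(%n. ps (u n x)) -->> ps (u0 x)" if "(%n. u n x) -->> u0 x" for x
  using continuous_on_tendsto_compose[OF ps(1) that] by simp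
 have l: "AE x in M. (%n. \<bar>u n x\<bar> powr q) -->> \<bar>u0 x\<bar> powr q"
  using lim by eventually_elim (use q in \<open>auto intro!: tendsto_powr' tendsto_rabs\<close>)
 note F = integral_Fatou[OF uq(1) _ l _ uq(2) tendsto_const]
 have u0q: "integrable M (%x. \<bar>u0 x\<bar> powr q)" "(\<integral>x. \<bar>u0 x\<bar> powr q \<partial>M) <= C" by (rule F; auto)+
 have C: "C >= 0" by (rule order_trans[OF _ u0q(2)]) simp
 have I: "integrable M (%x. th x * ps (w x))" if w: "w \<in> borel_measurable M" "integrable M (%x. \<bar>w x\<bar> powr q)" for w
 proof -
  obtain D where D: "D >= 0" "!!s. \<bar>ps s\<bar> <= 1 * \<bar>s\<bar> powr q + D" using ps(2)[of 1] by auto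
  note [measurable] = w(1)
  show ?thesis
  proof (rule integrable_bnd[of _ "%x. \<bar>w x\<bar> powr q + D * th x"])
   show "AE x in M. norm (th x * ps (w x)) <= norm (\<bar>w x\<bar> powr q + D * th x)"
   proof (rule AE_I2)
    fix x
    have "th x * \<bar>ps (w x)\<bar> <= th x * (\<bar>w x\<bar> powr q + D)" using D(2)[of "w x"] th(2) by (intro mult_left_mono) auto
    moreover have "th x * \<bar>w x\<bar> powr q <= 1 * \<bar>w x\<bar> powr q" using th by (intro mult_right_mono) auto
    ultimately show "norm (th x * ps (w x)) <= norm (\<bar>w x\<bar> powr q + D * th x)" using th(2) D(1) by (simp add: abs_mult algebra_simps)
   qed
  qed (use w th in auto)
 qed
 show I1: "integrable M (%x. th x * ps (u n x))" for n by (rule I[OF u uq(1)])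
 show I2: "integrable M (%x. th x * ps (u0 x))" by (rule I[OF u0 u0q(1)])
 define d where "d n x = th x * \<bar>ps (u n x) - ps (u0 x)\<bar>" for n x
 have d: "(%n. \<integral>x. d n x \<partial>M) -->> 0" "integrable M (d n)" for n
 proof -
  have 1: "d n \<in> borel_measurable M" for n unfolding d_def[abs_def] by measurable
  have 2: "0 <= d n x" for n x using th(2) by (simp add: d_def)
  have 3: "AE x in M. (%n. d n x) -->> 0" using lim
  proof eventually_elim
   case (elim x)
   have "(%n. th x * \<bar>ps (u n x) - ps (u0 x)\<bar>) -->> th x * \<bar>ps (u0 x) - ps (u0 x)\<bar>" by (intro tendsto_intros psl elim)
   thus ?case by (simp add: d_def)
  qed
  have 4: "\<exists>g b. integrable M g & (\<forall>x. 0 <= g x) & (\<forall>n. integrable M (b n) & (\<forall>x. 0 <= b n x & d n x <= g x + b n x) & (\<integral>x. b n x \<partial>M) <= e)"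
   if e: "e > 0" for e
  proof -
   define e' where "e' = e / (2 * C + 1)"
   have e': "e' > 0" "e' * (2 * C) <= e" using e C by (auto simp: e'_def field_simps)
   obtain D where D: "D >= 0" "!!s. \<bar>ps s\<bar> <= e' * \<bar>s\<bar> powr q + D" using ps(2)[OF e'(1)] by auto
   show ?thesis
   proof (intro exI conjI allI)
    show "integrable M (%x. 2 * D * th x)" using th by simp
    show "0 <= 2 * D * th x" for x using D th by simp
    show "integrable M (%x. e' * (\<bar>u n x\<bar> powr q + \<bar>u0 x\<bar> powr q))" for n using uq u0q by simp
    show "0 <= e' * (\<bar>u n x\<bar> powr q + \<bar>u0 x\<bar> powr q)" for n x using e' by simp
    have "(\<integral>x. e' * (\<bar>u n x\<bar> powr q + \<bar>u0 x\<bar> powr q) \<partial>M) <= e' * (C + C)" for n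
     using uq[of n] u0q e' by (simp add: mult_left_mono add_mono)
    moreover have "e' * (C + C) <= e" using e'(2) unfolding mult_2 .
    ultimately show "(\<integral>x. e' * (\<bar>u n x\<bar> powr q + \<bar>u0 x\<bar> powr q) \<partial>M) <= e" for n by (rule order_trans)
    show "d n x <= 2 * D * th x + e' * (\<bar>u n x\<bar> powr q + \<bar>u0 x\<bar> powr q)" for n x
    proof -
     have "d n x <= th x * (2 * D + e' * (\<bar>u n x\<bar> powr q + \<bar>u0 x\<bar> powr q))" unfolding d_def
      using D(2)[of "u n x"] D(2)[of "u0 x"] by (intro mult_left_mono th) (simp add: distrib_left)
     also have "\<dots> <= 2 * D * th x + 1 * (e' * (\<bar>u n x\<bar> powr q + \<bar>u0 x\<bar> powr q))"
      unfolding distrib_left using e' th by (intro add_mono mult_right_mono) auto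
     finally show ?thesis by simp
    qed
   qed
  qed
  show "(%n. \<integral>x. d n x \<partial>M) -->> 0" "integrable M (d n)" by (rule integral_tendsto_0_dominated[OF 1 2 3 4]; assumption)+
 qed
 have "(%n. (\<integral>x. th x * ps (u n x) \<partial>M) - (\<integral>x. th x * ps (u0 x) \<partial>M)) -->> 0"
 proof (rule Lim_null_comparison[OF _ d(1)], rule always_eventually, rule allI)
  fix n
  have "norm (\<integral>x. th x * ps (u n x) - th x * ps (u0 x) \<partial>M) <= (\<integral>x. norm (th x * ps (u n x) - th x * ps (u0 x)) \<partial>M)" by (rule integral_norm_bound)
  also have "\<dots> = (\<integral>x. d n x \<partial>M)" using th(2) by (simp add: d_def[abs_def] abs_mult right_diff_distrib[symmetric])
  finally have "norm (\<integral>x. th x * ps (u n x) - th x * ps (u0 x) \<partial>M) <= (\<integral>x. d n x \<partial>M)" .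
  thus "norm ((\<integral>x. th x * ps (u n x) \<partial>M) - (\<integral>x. th x * ps (u0 x) \<partial>M)) <= (\<integral>x. d n x \<partial>M)" using I1 I2 by simp
 qed
 thus "(%n. \<integral>x. th x * ps (u n x) \<partial>M) -->> (\<integral>x. th x * ps (u0 x) \<partial>M)" by (rule LIM_zero_cancel)
qed

lemma square_le_powr: "2 <= (r::real) ==> s\<^sup>2 <= 1 + \<bar>s\<bar> powr r"
proof (cases "\<bar>s\<bar> <= 1")
 case True
 hence "s\<^sup>2 <= 1" by (simp add: abs_square_le_1)
 thus ?thesis by (smt (verit) powr_ge_zero)
next
 case False
 assume "2 <= r"
 have "s\<^sup>2 = \<bar>s\<bar> powr 2" using False by (simp add: powr_numeral)
 also have "\<dots> <= \<bar>s\<bar> powr r" using False \<open>2 <= r\<close> by (intro powr_mono) auto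
 finally show ?thesis by simp
qed

lemma subcritical_bound:
 assumes ps: "!!s. \<bar>ps s\<bar> <= K * (s\<^sup>2 + \<bar>s\<bar> powr r)" and K: "K >= 0" and r: "2 <= r" "r < (q::real)" and e: "e > 0"
 shows "\<exists>C\<ge>0. \<forall>s. \<bar>ps s\<bar> <= e * \<bar>s\<bar> powr q + C"
proof -
 have "((%x::real. x powr (r - q)) \<longlongrightarrow> 0) at_top" using r by (intro tendsto_neg_powr filterlim_ident) auto
 hence ev: "\<forall>\<^sub>F x in at_top. x powr (r - q) < e / (3 * K + 1)" using e K by (intro order_tendstoD) auto
 obtain M :: real where M: "M >= 1" "M powr (r - q) < e / (3 * K + 1)"
  using eventually_conj[OF ev eventually_ge_at_top[of 1]] by (auto simp: eventually_at_top_linorder)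
 have b: "\<bar>ps s\<bar> <= K * (1 + 2 * \<bar>s\<bar> powr r)" for s
  by (rule order_trans[OF ps]) (use square_le_powr[OF r(1), of s] K in \<open>intro mult_left_mono, auto\<close>)
 have "\<bar>ps s\<bar> <= e * \<bar>s\<bar> powr q + K * (1 + 2 * M powr r)" for s
 proof (cases "\<bar>s\<bar> <= M")
  case True
  have "K * (1 + 2 * \<bar>s\<bar> powr r) <= K * (1 + 2 * M powr r)" using True K r by (intro mult_left_mono add_mono powr_mono2) auto
  moreover have "0 <= e * \<bar>s\<bar> powr q" using e by simp
  ultimately show ?thesis using b[of s] by linarith
 next
  case False
  have "1 <= \<bar>s\<bar> powr r" using False M r by (intro ge_one_powr_ge_zero) auto
  hence "K * (1 + 2 * \<bar>s\<bar> powr r) <= K * (3 * \<bar>s\<bar> powr r)" using K by (intro mult_left_mono) auto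
  also have "\<dots> = (3 * K) * (\<bar>s\<bar> powr (r - q) * \<bar>s\<bar> powr q)" using False M by (simp add: powr_add[symmetric])
  also have "\<dots> <= (3 * K) * (M powr (r - q) * \<bar>s\<bar> powr q)" using False M K r by (intro mult_left_mono mult_right_mono powr_mono2') auto
  also have "\<dots> <= e * \<bar>s\<bar> powr q"
  proof -
   have "(3 * K) * M powr (r - q) <= (3 * K) * (e / (3 * K + 1))" using M K by (intro mult_left_mono) auto
   also have "\<dots> <= e" using K e by (simp add: field_simps)
   finally have "(3 * K) * M powr (r - q) * \<bar>s\<bar> powr q <= e * \<bar>s\<bar> powr q" by (rule mult_right_mono) simp
   thus ?thesis by (simp add: mult.assoc)
  qed
  finally show ?thesis using b[of s] K by (smt (verit) mult_nonneg_nonneg powr_ge_zero)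
 qed
 moreover have "0 <= K * (1 + 2 * M powr r)" using K by (simp add: add_nonneg_nonneg)
 ultimately show ?thesis by blast
qed

text \<open>A difference quotient with both endpoints moving; the mean value point stays between
  them and hence tends to \<open>a\<close>.\<close>

lemma prim_quotient_tendsto:
 assumes g: "continuous_on UNIV g" and x: "x -->> a" and y: "y -->> a" and h: "(%n. (x n - y n) / si n) -->> h"
 shows "(%n. (prim g (x n) - prim g (y n)) / si n) -->> h * g a"
proof -
 have "\<forall>n. \<exists>\<xi>. prim g (x n) - prim g (y n) = (x n - y n) * g \<xi> & \<bar>\<xi> - y n\<bar> <= \<bar>x n - y n\<bar>"
  using prim_mean_value[OF g] by blast
 then obtain \<xi> where \<xi>: "!!n. prim g (x n) - prim g (y n) = (x n - y n) * g (\<xi> n)" "!!n. \<bar>\<xi> n - y n\<bar> <= \<bar>x n - y n\<bar>" by metis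
 have "(%n. \<xi> n - y n) -->> 0"
  by (rule Lim_null_comparison[of _ "%n. \<bar>x n - y n\<bar>"]) (use \<xi>(2) tendsto_rabs[OF tendsto_diff[OF x y]] in auto)
 from tendsto_add[OF this y] have "\<xi> -->> a" by simp
 from tendsto_mult[OF h continuous_on_tendsto_compose[OF g this]] show ?thesis by (simp add: \<xi>(1))
qed

context penal
begin

text \<open>Strictness is available only through \<open>f\<close>, that is, where \<open>th\<close>
  and \<open>u\<close> are both nonzero; the \<open>gt\<close> part contributes with the weak
  sign.\<close>

lemma gg_strict:
 assumes a: "adm W th" and u: "Wsp u v" and nz: "\<not> (AE x in lborel. th x * u x = 0)" and t: "0 < t" "t < 1"
 shows "LI (%x. gg th (%x. t * u x) x * u x) < t * LI (%x. gg th u x * u x)"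
proof -
 note i = gg_int(1)[OF a u u] gg_int(1)[OF a Wsp_cmult[OF u, of t] u]
 define D where "D x = t * (gg th u x * u x) - gg th (%x. t * u x) x * u x" for x
 have D: "th x * (t * (u x * f (u x)) - u x * f (t * u x)) <= D x" for x
 proof -
  have "0 <= (1 - th x) * (t * (u x * gt (u x)) - u x * gt (t * u x))" using admD(6)[OF a, of x] mono(2)[of t "u x"] t by (intro mult_nonneg_nonneg) auto
  moreover have "D x = th x * (t * (u x * f (u x)) - u x * f (t * u x)) + (1 - th x) * (t * (u x * gt (u x)) - u x * gt (t * u x))"
   by (simp add: D_def gg_def algebra_simps)
  ultimately show ?thesis by linarith
 qed
 have D0: "0 <= D x" for x
 proof -
  have "0 <= th x * (t * (u x * f (u x)) - u x * f (t * u x))" using admD(5)[OF a, of x] mono(1)[of t "u x"] t by (intro mult_nonneg_nonneg) auto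
  thus ?thesis using D[of x] by linarith
 qed
 have Di: "Lint D" unfolding D_def[abs_def] using i by simp
 have "LI D \<noteq> 0"
 proof
  assume "LI D = 0"
  hence "AE x in lborel. D x = 0" using integral_nonneg_eq_0_iff_AE[OF Di] D0 by simp
  hence "AE x in lborel. th x * u x = 0"
  proof eventually_elim
   case (elim x)
   have False if "th x \<noteq> 0" "u x \<noteq> 0"
   proof -
    have "0 < th x * (t * (u x * f (u x)) - u x * f (t * u x))" using admD(5)[OF a, of x] that strict[OF t that(2)] by (intro mult_pos_pos) auto
    thus False using D[of x] elim by linarith
   qed
   thus ?case by auto
  qed
  thus False using nz by simp
 qed
 moreover have "0 <= LI D" using D0 by simp
 moreover have "LI D = t * LI (%x. gg th u x * u x) - LI (%x. gg th (%x. t * u x) x * u x)" unfolding D_def[abs_def] using i by simp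
 ultimately show ?thesis by linarith
qed

lemma gg_strict_gt:
 assumes a: "adm W th" and u: "Wsp u v" and nz: "\<not> (AE x in lborel. th x * u x = 0)" and t: "1 < t"
 shows "t * LI (%x. gg th u x * u x) < LI (%x. gg th (%x. t * u x) x * u x)"
proof -
 have "\<not> (AE x in lborel. th x * (t * u x) = 0)" using nz t by simp
 from gg_strict[OF a Wsp_cmult[OF u] this, of "1 / t"] t
 have "LI (%x. gg th u x * (t * u x)) < 1 / t * LI (%x. gg th (%x. t * u x) x * (t * u x))" by simp
 thus ?thesis unfolding LI_pull using t by simp
qed

lemma Nh_nonzero:
 assumes a: "adm W th" and u: "Nh W th u v"
 shows "\<not> (AE x in lborel. th x * u x = 0)"
proof
 assume "AE x in lborel. th x * u x = 0"
 hence "AE x in lborel. th x * (u x * f (u x)) = 0" by eventually_elim auto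
 hence "LI (%x. th x * (u x * f (u x))) = 0" by (rule integral_eq_zero_AE)
 thus False using Nh_energy(3)[OF a u] u by (simp add: Nh_def)
qed

lemma ray_continuous:
 assumes a: "adm W th" and u: "Wsp u v"
 shows "continuous_on UNIV (%t. LI (%x. gg th (%x. t * u x) x * u x))"
 unfolding continuous_on_sequentially
proof (intro allI ballI impI, elim conjE)
 fix s :: "nat => real" and t assume s: "s -->> t"
 obtain K where K: "K > 0" "!!n. \<bar>s n\<bar> <= K" using convergent_imp_Bseq[of s] s unfolding convergent_def Bseq_def by auto
 note [measurable] = WspD(3)[OF u]
 have "(%n. LI (%x. gg th (%x. s n * u x) x * u x)) -->> LI (%x. gg th (%x. t * u x) x * u x)"
 proof (rule gg_dominated(1)[where w="%x. (K + 1) * u x"])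
  show "Lpp (%x. (K + 1) * u x)" by (intro Lpp_cmult Wsp_Lpp[OF u])
  show "\<bar>s n * u x\<bar> <= \<bar>(K + 1) * u x\<bar>" for n x using K(1) K(2)[of n] by (auto simp: abs_mult intro!: mult_right_mono)
  show "\<bar>u x\<bar> <= \<bar>(K + 1) * u x\<bar>" for x using K(1) mult_right_mono[of 1 "K + 1" "\<bar>u x\<bar>"] by (simp add: abs_mult)
 qed (use admD[OF a] s in \<open>auto intro!: tendsto_intros\<close>)
 thus "((%t. LI (%x. gg th (%x. t * u x) x * u x)) \<circ> s) -->> LI (%x. gg th (%x. t * u x) x * u x)" by (simp add: o_def)
qed

text \<open>After division by \<open>t\<close>, the Nehari identity for \<open>t u\<close> is the
  equation \<open>LI gg (t u) u = t * Qf\<close>, so a sign change on the ray suffices.\<close>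

lemma ray_root:
 assumes a: "adm W th" and u: "Wsp u v" and Q: "0 < Qf W u v" and b: "0 < b" "b <= c"
  and le: "LI (%x. gg th (%x. b * u x) x * u x) <= b * Qf W u v" "c * Qf W u v <= LI (%x. gg th (%x. c * u x) x * u x)"
 shows "\<exists>t. b <= t & t <= c & Nh W th (%x. t * u x) (%x. t * v x)"
proof -
 have "\<exists>t. b <= t & t <= c & LI (%x. gg th (%x. t * u x) x * u x) - t * Qf W u v = 0"
  using le b by (intro IVT') (auto intro!: continuous_intros continuous_on_subset[OF ray_continuous[OF a u]])
 then obtain t where t: "b <= t" "t <= c" "LI (%x. gg th (%x. t * u x) x * u x) = t * Qf W u v" by auto
 have "Nh W th (%x. t * u x) (%x. t * v x)"
  unfolding Nh_def Qf_scale LI_pull using Wsp_cmult[OF u] Q t b by (simp add: power2_eq_square)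
 thus ?thesis using t by blast
qed

text \<open>Near zero the form wins, because the nonlinearity is small to higher order or has slope
  at most \<open>V0 / 2\<close>; far out \<open>f\<close> wins by superlinearity, but only on the
  set where \<open>th * u\<close> does not vanish.\<close>

lemma Nh_projection:
 assumes a: "adm W th" and u: "Wsp u v" and nz: "\<not> (AE x in lborel. th x * u x = 0)"
 shows "\<exists>t>0. Nh W th (%x. t * u x) (%x. t * v x)"
proof -
 note [measurable] = admD(1,2)[OF a] WspD(3)[OF u]
 note u2 = sq_int_integrable[OF WspD(1)[OF u]] and up = LppD(3)[OF Wsp_Lpp[OF u]]
 define Q where "Q = Qf W u v"
 define \<Phi> where "\<Phi> t = LI (%x. gg th (%x. t * u x) x * u x)" for t
 have \<Phi>t: "t * \<Phi> t = LI (%x. gg th (%x. t * u x) x * (t * u x))" for t by (simp add: \<Phi>_def LI_pull)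
 have ui: "Lint (%x. th x * (u x)^2)"
  by (rule integrable_bnd[OF u2]) (use admD[OF a] in \<open>auto intro!: AE_I2 mult_left_le_one_le\<close>)
 define I where "I = LI (%x. th x * (u x)^2)"
 have I: "I > 0"
 proof -
  have "0 <= I" unfolding I_def using admD[OF a] by (intro Bochner_Integration.integral_nonneg) auto
  moreover have "I \<noteq> 0"
  proof
   assume "I = 0"
   hence "AE x in lborel. th x * (u x)^2 = 0" unfolding I_def using integral_nonneg_eq_0_iff_AE[OF ui] admD[OF a] by simp
   hence "AE x in lborel. th x * u x = 0" by eventually_elim auto
   thus False using nz by simp
  qed
  ultimately show ?thesis by simp
 qed
 have "I <= sqn u" unfolding I_def using ui u2 admD[OF a] by (intro integral_mono) (auto intro: mult_left_le_one_le)
 hence Q: "Q > 0" using Qf_lower(1)[OF a u] I V0(1) unfolding Q_def by (smt (verit) mult_pos_pos)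
 obtain b where b: "0 < b" "b <= 1" "\<Phi> b <= b * Q"
 proof -
  obtain C where C: "C >= 0" "!!s. s * f s <= V0 / 2 * s\<^sup>2 + C * \<bar>s\<bar> powr (p + 1)" using small[of "V0 / 2"] V0 by auto
  have g: "s * gt s <= V0 / 2 * s\<^sup>2 + C * \<bar>s\<bar> powr (p + 1)" for s
   using pen(1)[of s] mult_right_mono[OF kappa(2), of "s\<^sup>2"] C(1) by (smt (verit) mult_nonneg_nonneg powr_ge_zero zero_le_power2)
  define A where "A = C * LI (%x. \<bar>u x\<bar> powr (p + 1))"
  have A: "A >= 0" using C by (simp add: A_def)
  \<comment> \<open>Chosen so that \<open>b powr (p - 1) * A <= Q / 2\<close>; the
    \<open>+ 1\<close> covers \<open>A = 0\<close>.\<close>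
  define b where "b = min 1 ((Q / (2 * (A + 1))) powr (1 / (p - 1)))"
  have b: "0 < b" "b <= 1" using Q A by (auto simp: b_def)
  have "b powr (p - 1) <= ((Q / (2 * (A + 1))) powr (1 / (p - 1))) powr (p - 1)" using p b by (intro powr_mono2) (auto simp: b_def)
  also have "\<dots> = Q / (2 * (A + 1))" using p Q A by (simp add: powr_powr)
  finally have "b powr (p - 1) * A <= Q / (2 * (A + 1)) * A" using A by (rule mult_right_mono)
  also have "\<dots> <= Q / 2" using A Q by (simp add: field_simps)
  finally have bA: "b powr (p - 1) * A <= Q / 2" .
  have "b * \<Phi> b <= LI (%x. V0 / 2 * (b * u x)^2 + C * \<bar>b * u x\<bar> powr (p + 1))" unfolding \<Phi>t
  proof (rule integral_mono[OF gg_int(1)[OF a Wsp_cmult[OF u] Wsp_cmult[OF u]]])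
   show "Lint (%x. V0 / 2 * (b * u x)^2 + C * \<bar>b * u x\<bar> powr (p + 1))" using u2 up by (simp add: power_mult_distrib abs_mult powr_mult)
   fix x
   have "th x * (b * u x * f (b * u x)) + (1 - th x) * (b * u x * gt (b * u x)) <= th x * (V0 / 2 * (b * u x)^2 + C * \<bar>b * u x\<bar> powr (p + 1)) + (1 - th x) * (V0 / 2 * (b * u x)^2 + C * \<bar>b * u x\<bar> powr (p + 1))"
    using admD[OF a] C(2) g by (intro add_mono mult_left_mono) auto
   also have "\<dots> = V0 / 2 * (b * u x)^2 + C * \<bar>b * u x\<bar> powr (p + 1)" unfolding distrib_right[symmetric] by simp
   finally show "gg th (%x. b * u x) x * (b * u x) <= V0 / 2 * (b * u x)^2 + C * \<bar>b * u x\<bar> powr (p + 1)"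
    unfolding gg_def distrib_right by (simp only: mult_ac)
  qed
  also have "\<dots> = b^2 * (V0 * sqn u) / 2 + b powr (p + 1) * A"
   using u2 up b by (simp add: power_mult_distrib abs_mult powr_mult A_def)
  also have "\<dots> <= b^2 * Q / 2 + b powr (p + 1) * A" using Qf_lower(1)[OF a u] by (intro add_right_mono divide_right_mono mult_left_mono) (auto simp: Q_def)
  also have "b powr (p + 1) * A = b^2 * (b powr (p - 1) * A)"
  proof -
   have "b powr (p + 1) = b powr 2 * b powr (p - 1)" by (simp add: powr_add[symmetric] add.commute)
   thus ?thesis using b by (simp add: powr_numeral)
  qed
  also have "b^2 * Q / 2 + b^2 * (b powr (p - 1) * A) <= b^2 * Q / 2 + b^2 * (Q / 2)" using bA by (intro add_left_mono mult_left_mono) auto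
  finally have "b * \<Phi> b <= b * (b * Q)" by (simp add: power2_eq_square mult_ac)
  hence "\<Phi> b <= b * Q" using b by simp
  thus ?thesis using that b by blast
 qed
 obtain c where c: "1 <= c" "c * Q <= \<Phi> c"
 proof -
  \<comment> \<open>More than half of \<open>I\<close> lies where
    \<open>\<bar>c * u x\<bar> >= T\<close> for large \<open>c\<close>, so this slope yields at
    least \<open>K * c^2 * I / 2 = c^2 * Q\<close>.\<close>
  define K where "K = 2 * Q / I"
  have K: "K > 0" using Q I by (simp add: K_def)
  obtain T where T: "T > 0" "!!s. \<bar>s\<bar> >= T ==> K * s\<^sup>2 <= s * f s" using superlinear[of K] by auto
  define m where "m n x = (if T <= \<bar>real (Suc n) * u x\<bar> then th x * (u x)^2 else 0)" for n x
  have [measurable]: "m n \<in> bmeas" for n unfolding m_def[abs_def] by measurable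
  have mb: "0 <= m n x" "m n x <= th x * (u x)^2" for n x using admD(5)[OF a, of x] by (auto simp: m_def)
  have mi: "Lint (m n)" for n
   by (rule integrable_bnd[OF ui]) (use mb in \<open>auto intro!: AE_I2 order_trans[OF _ abs_ge_self]\<close>)
  have "(%n. LI (m n)) -->> I" unfolding I_def
  proof (rule integral_dominated_convergence[OF _ _ ui])
   show "AE x in lborel. (%n. m n x) -->> th x * (u x)^2"
   proof (rule AE_I2)
    fix x
    show "(%n. m n x) -->> th x * (u x)^2"
    proof (cases "u x = 0")
     case False
     obtain n0 where n0: "T / \<bar>u x\<bar> < real n0" using reals_Archimedean2 by blast
     have "m n x = th x * (u x)^2" if "n >= n0" for n
     proof -
      have "T / \<bar>u x\<bar> <= real (Suc n)" using n0 that by linarith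
      hence "T <= \<bar>real (Suc n) * u x\<bar>" using False by (simp add: abs_mult pos_divide_le_eq)
      thus ?thesis by (simp add: m_def)
     qed
     hence "\<forall>\<^sub>F n in sequentially. m n x = th x * (u x)^2" by (auto simp: eventually_sequentially)
     thus ?thesis by (rule tendsto_eventually)
    qed (auto simp: m_def)
   qed
   show "AE x in lborel. norm (m n x) <= th x * (u x)^2" for n using mb by (auto intro!: AE_I2)
  qed auto
  hence "\<forall>\<^sub>F n in sequentially. LI (m n) > I / 2" using I by (intro order_tendstoD) auto
  then obtain n where n: "LI (m n) > I / 2" by (auto simp: eventually_sequentially)
  define c where "c = real (Suc n)"
  have c: "c >= 1" by (simp add: c_def)
  have "LI (%x. K * c^2 * m n x) <= c * \<Phi> c" unfolding \<Phi>t
  proof (rule integral_mono[OF _ gg_int(1)[OF a Wsp_cmult[OF u] Wsp_cmult[OF u]]])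
   show "Lint (%x. K * c\<^sup>2 * m n x)" using mi by simp
   fix x
   have "K * c^2 * m n x <= th x * (c * u x * f (c * u x))"
   proof (cases "T <= \<bar>c * u x\<bar>")
    case True
    have "th x * (K * (c * u x)^2) <= th x * (c * u x * f (c * u x))" using T(2)[OF True] admD(5)[OF a] by (intro mult_left_mono) auto
    thus ?thesis using True by (simp add: m_def c_def power_mult_distrib mult_ac)
   next
    case False thus ?thesis using sf_nonneg[of "c * u x"] admD(5)[OF a, of x] mult_nonneg_nonneg by (auto simp: m_def c_def)
   qed
   moreover have "0 <= (1 - th x) * (c * u x * gt (c * u x))" using admD(6)[OF a, of x] by (intro mult_nonneg_nonneg sign) auto
   moreover have "gg th (%x. c * u x) x * (c * u x) = th x * (c * u x * f (c * u x)) + (1 - th x) * (c * u x * gt (c * u x))"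
    unfolding gg_def by algebra
   ultimately show "K * c^2 * m n x <= gg th (%x. c * u x) x * (c * u x)" by linarith
  qed
  moreover have "K * c^2 * (I / 2) <= LI (%x. K * c^2 * m n x)" using n K by (simp add: mult_left_mono)
  moreover have "K * c^2 * (I / 2) = c * (c * Q)" using I by (simp add: K_def power2_eq_square)
  ultimately have "c * (c * Q) <= c * \<Phi> c" by linarith
  thus ?thesis using that c by simp
 qed
 from ray_root[OF a u _ b(1), of c] Q b c obtain t where "b <= t" "Nh W th (%x. t * u x) (%x. t * v x)" unfolding Q_def \<Phi>_def by auto
 thus ?thesis using b by (intro exI[of _ t]) auto
qed

text \<open>Stability of the projection without an implicit function theorem: the strict
  inequalities at \<open>1 - et\<close> and \<open>1 + et\<close> hold for the limit and hence for
  almost all \<open>n\<close>, and the intermediate value theorem finds a factor between.\<close>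

lemma Nh_near:
 assumes a: "!!n. adm (W n) (th n)" and a0: "adm W0 th0" and u0: "Nh W0 th0 u0 v0" and u: "!!n. Wsp (u n) (v n)"
  and w: "Lpp w" "!!n x. \<bar>u n x\<bar> <= \<bar>w x\<bar>" and lim: "!!x. (%n. th n x) -->> th0 x" "!!x. (%n. u n x) -->> u0 x"
  and Q: "(%n. Qf (W n) (u n) (v n)) -->> Qf W0 u0 v0" and et: "0 < et" "et < 1"
 shows "\<forall>\<^sub>F n in sequentially. \<exists>t. 1 - et <= t & t <= 1 + et & Nh (W n) (th n) (%x. t * u n x) (%x. t * v n x)"
proof -
 have U: "Wsp u0 v0" and Q0: "Qf W0 u0 v0 > 0" "Qf W0 u0 v0 = LI (%x. gg th0 u0 x * u0 x)" using u0 by (auto simp: Nh_def)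
 note nz = Nh_nonzero[OF a0 u0]
 have \<Phi>: "(%n. LI (%x. gg (th n) (%x. t * u n x) x * u n x)) -->> LI (%x. gg th0 (%x. t * u0 x) x * u0 x)" for t
 proof (rule gg_dominated(1)[where w="%x. (\<bar>t\<bar> + 1) * w x"])
  show "Lpp (%x. (\<bar>t\<bar> + 1) * w x)" by (intro Lpp_cmult w)
  show "\<bar>t * u n x\<bar> <= \<bar>(\<bar>t\<bar> + 1) * w x\<bar>" "\<bar>u n x\<bar> <= \<bar>(\<bar>t\<bar> + 1) * w x\<bar>" for n x
   using mult_mono[of "\<bar>t\<bar>" "\<bar>t\<bar> + 1" "\<bar>u n x\<bar>" "\<bar>w x\<bar>"] mult_mono[of 1 "\<bar>t\<bar> + 1" "\<bar>u n x\<bar>" "\<bar>w x\<bar>"] w(2)[of n x] by (auto simp: abs_mult)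
  show "(%x. t * u n x) \<in> bmeas" "u n \<in> bmeas" for n using WspD(3)[OF u[of n]] by auto
  show "(%x. t * u0 x) \<in> bmeas" "u0 \<in> bmeas" using WspD(3)[OF U] by auto
 qed (use admD[OF a] admD[OF a0] lim in \<open>auto intro!: tendsto_intros\<close>)
 have "(%n. (1 - et) * Qf (W n) (u n) (v n) - LI (%x. gg (th n) (%x. (1 - et) * u n x) x * u n x)) -->> (1 - et) * Qf W0 u0 v0 - LI (%x. gg th0 (%x. (1 - et) * u0 x) x * u0 x)"
  by (intro tendsto_intros \<Phi> Q)
 moreover have "0 < (1 - et) * Qf W0 u0 v0 - LI (%x. gg th0 (%x. (1 - et) * u0 x) x * u0 x)" using gg_strict[OF a0 U nz, of "1 - et"] et Q0 by simp
 ultimately have 1: "\<forall>\<^sub>F n in sequentially. 0 < (1 - et) * Qf (W n) (u n) (v n) - LI (%x. gg (th n) (%x. (1 - et) * u n x) x * u n x)" by (rule order_tendstoD)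
 have "(%n. LI (%x. gg (th n) (%x. (1 + et) * u n x) x * u n x) - (1 + et) * Qf (W n) (u n) (v n)) -->> LI (%x. gg th0 (%x. (1 + et) * u0 x) x * u0 x) - (1 + et) * Qf W0 u0 v0"
  by (intro tendsto_intros \<Phi> Q)
 moreover have "0 < LI (%x. gg th0 (%x. (1 + et) * u0 x) x * u0 x) - (1 + et) * Qf W0 u0 v0" using gg_strict_gt[OF a0 U nz, of "1 + et"] et Q0 by simp
 ultimately have 2: "\<forall>\<^sub>F n in sequentially. 0 < LI (%x. gg (th n) (%x. (1 + et) * u n x) x * u n x) - (1 + et) * Qf (W n) (u n) (v n)" by (rule order_tendstoD)
 have 3: "\<forall>\<^sub>F n in sequentially. 0 < Qf (W n) (u n) (v n)" by (rule order_tendstoD(1)[OF Q Q0(1)])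
 show ?thesis using 1 2 3 by eventually_elim (rule ray_root[OF a u], use et in auto)
qed

text \<open>The energy is not differentiated along the Nehari set. The perturbation
  \<open>u + si h\<close> is scaled by a factor \<open>t\<close> back onto the set, its energy is
  compared with that of \<open>t u\<close>, and the resulting difference quotient passes to the
  limit as \<open>si\<close> tends to 0 and \<open>t\<close> to 1.\<close>

lemma minimiser_critical_ge:
 assumes a: "adm W th" and u: "Nh W th u v" and mn: "!!z z'. Nh W th z z' ==> Jf W th u v <= Jf W th z z'" and h: "Wsp h k"
 shows "LI (%x. gg th u x * h x) <= Bf W u v h k"
proof -
 have U: "Wsp u v" using u by (simp add: Nh_def)
 note [measurable] = admD(1,2)[OF a] WspD(3)[OF U] WspD(3)[OF h]
 \<comment> \<open>The tolerance \<open>1 / (m + 2)\<close> is below 1, as \<open>Nh_near\<close>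
   demands; \<open>n >= m\<close> forces the step sizes to zero.\<close>
 have "\<exists>n\<ge>m. \<exists>t. 1 - 1 / (real m + 2) <= t & t <= 1 + 1 / (real m + 2) &
  Nh W th (%x. t * (u x + 1 / real (Suc n) * h x)) (%x. t * (v x + 1 / real (Suc n) * k x))" for m
 proof -
  have "\<forall>\<^sub>F n in sequentially. \<exists>t. 1 - 1 / (real m + 2) <= t & t <= 1 + 1 / (real m + 2) &
  Nh W th (%x. t * (u x + 1 / real (Suc n) * h x)) (%x. t * (v x + 1 / real (Suc n) * k x))"
  proof (rule Nh_near[OF a a u Wsp_add_cmult[OF U h], of "%x. \<bar>u x\<bar> + \<bar>h x\<bar>"])
   show "Lpp (%x. \<bar>u x\<bar> + \<bar>h x\<bar>)" by (intro Lpp_add Lpp_abs Wsp_Lpp[OF U] Wsp_Lpp[OF h])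
   show "\<bar>u x + 1 / real (Suc n) * h x\<bar> <= \<bar>\<bar>u x\<bar> + \<bar>h x\<bar>\<bar>" for n x
    using mult_right_mono[of "1 / real (Suc n)" 1 "\<bar>h x\<bar>"] abs_triangle_ineq[of "u x" "1 / real (Suc n) * h x"] by (simp add: abs_mult)
   have l: "(%n. 1 / real (Suc n)) -->> 0" using LIMSEQ_inverse_real_of_nat by (simp add: inverse_eq_divide)
   have "(%n. u x + 1 / real (Suc n) * h x) -->> u x + 0 * h x" for x by (intro tendsto_intros l)
   thus "(%n. u x + 1 / real (Suc n) * h x) -->> u x" for x by simp
   have "(%n. Qf W u v + 2 * (1 / real (Suc n)) * Bf W u v h k + (1 / real (Suc n))^2 * Qf W h k) -->> Qf W u v + 2 * 0 * Bf W u v h k + 0^2 * Qf W h k"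
    by (intro tendsto_intros l)
   thus "(%n. Qf W (%x. u x + 1 / real (Suc n) * h x) (%x. v x + 1 / real (Suc n) * k x)) -->> Qf W u v"
    by (simp only: Qf_expand[OF a U h]) simp
  qed auto
  from eventually_conj[OF this eventually_ge_at_top[of m]] show ?thesis by (auto simp: eventually_sequentially)
 qed
 hence "\<forall>m. \<exists>n t. m <= n & 1 - 1 / (real m + 2) <= t & t <= 1 + 1 / (real m + 2) &
  Nh W th (%x. t * (u x + 1 / real (Suc n) * h x)) (%x. t * (v x + 1 / real (Suc n) * k x))" by blast
 then obtain n where "\<forall>m. \<exists>t. m <= n m & 1 - 1 / (real m + 2) <= t & t <= 1 + 1 / (real m + 2) &
  Nh W th (%x. t * (u x + 1 / real (Suc (n m)) * h x)) (%x. t * (v x + 1 / real (Suc (n m)) * k x))" by (rule choice[THEN exE])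
 then obtain t where nt: "\<forall>m. m <= n m & 1 - 1 / (real m + 2) <= t m & t m <= 1 + 1 / (real m + 2) &
  Nh W th (%x. t m * (u x + 1 / real (Suc (n m)) * h x)) (%x. t m * (v x + 1 / real (Suc (n m)) * k x))" by (rule choice[THEN exE])
 then have n: "!!m. n m >= m" and t: "!!m. 1 - 1 / (real m + 2) <= t m" "!!m. t m <= 1 + 1 / (real m + 2)"
  and Nt: "!!m. Nh W th (%x. t m * (u x + 1 / real (Suc (n m)) * h x)) (%x. t m * (v x + 1 / real (Suc (n m)) * k x))" by blast+
 define si where "si m = 1 / real (Suc (n m))" for m
 have si: "si m > 0" "si m <= 1" for m by (auto simp: si_def)
 have t1: "0 <= t m" "t m <= 2" for m using t[of m] by (smt (verit) divide_le_eq_1 of_nat_0_le_iff)+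
 have l0: "(%m. 1 / (real m + 2)) -->> 0"
  using LIMSEQ_ignore_initial_segment[OF lim_1_over_n, of 2] by (simp add: add.commute)
 have tl: "t -->> 1"
 proof (rule tendsto_sandwich[OF always_eventually always_eventually])
  show "(%m. 1 - 1 / (real m + 2)) -->> 1" using tendsto_diff[OF tendsto_const[of 1] l0] by simp
  show "(%m. 1 + 1 / (real m + 2)) -->> 1" using tendsto_add[OF tendsto_const[of 1] l0] by simp
 qed (use t in auto)
 have sil: "si -->> 0"
 proof (rule tendsto_sandwich[OF always_eventually always_eventually tendsto_const])
  show "(%m. 1 / real (Suc m)) -->> 0" using LIMSEQ_inverse_real_of_nat by (simp add: inverse_eq_divide)
  show "\<forall>m. si m <= 1 / real (Suc m)" using n by (auto simp: si_def intro!: divide_left_mono)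
 qed (use si in \<open>auto intro: less_imp_le\<close>)
 define D where "D m x = (GG th (%x. t m * (u x + si m * h x)) x - GG th (%x. t m * u x) x) / si m" for m x
 have [measurable]: "D m \<in> bmeas" for m unfolding D_def[abs_def] by measurable
 \<comment> \<open>\<open>J (t u) <= J u\<close> since \<open>u\<close> is on the Nehari set, and
   \<open>J u <= J (t (u + si h))\<close> by minimality. With the same \<open>t\<close> on both
   sides, no rate for its convergence to 1 is needed.\<close>
 have le: "LI (D m) <= t m^2 * (Bf W u v h k + si m / 2 * Qf W h k)" for m
 proof -
  note i = gg_int(2)[OF a Wsp_cmult[OF Wsp_add_cmult[OF U h, of "si m"], of "t m"] U] gg_int(2)[OF a Wsp_cmult[OF U, of "t m"] U]
  have "Jf W th (%x. t m * u x) (%x. t m * v x) <= Jf W th (%x. t m * (u x + si m * h x)) (%x. t m * (v x + si m * k x))"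
   using Jf_scaling[OF a u t1(1)[of m]] mn[OF Nt[of m]] by (simp add: si_def)
  hence "LI (GG th (%x. t m * (u x + si m * h x))) - LI (GG th (%x. t m * u x)) <= si m * (t m^2 * (Bf W u v h k + si m / 2 * Qf W h k))"
   unfolding Jf_def Qf_scale Qf_expand[OF a U h] by (simp add: field_simps power2_eq_square)
  hence "LI (D m) * si m <= si m * (t m^2 * (Bf W u v h k + si m / 2 * Qf W h k))" unfolding D_def[abs_def] using i si[of m] by simp
  thus ?thesis using si(1)[of m] by (simp add: mult.commute)
 qed
 define w where "w x = 2 * (\<bar>u x\<bar> + \<bar>h x\<bar>)" for x
 have w: "Lpp w" unfolding w_def by (intro Lpp_cmult Lpp_add Lpp_abs Wsp_Lpp[OF U] Wsp_Lpp[OF h])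
 have xt: "(%m. t m * (u x + si m * h x)) -->> u x" "(%m. t m * u x) -->> u x" "(%m. (t m * (u x + si m * h x) - t m * u x) / si m) -->> h x" for x
 proof -
  have "(%m. t m * (u x + si m * h x)) -->> 1 * (u x + 0 * h x)" "(%m. t m * u x) -->> 1 * u x" "(%m. t m * h x) -->> 1 * h x" by (intro tendsto_intros tl sil)+
  moreover have "(t m * (u x + si m * h x) - t m * u x) / si m = t m * h x" for m using si(1)[of m] by (simp add: field_simps)
  ultimately show "(%m. t m * (u x + si m * h x)) -->> u x" "(%m. t m * u x) -->> u x" "(%m. (t m * (u x + si m * h x) - t m * u x) / si m) -->> h x" by simp_all
 qed
 have "(%m. LI (D m)) -->> LI (%x. gg th u x * h x)"
 proof (rule integral_dominated_convergence[OF _ _ Lpp_dominating[OF w]])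
  show "AE x in lborel. (%m. D m x) -->> gg th u x * h x"
  proof (rule AE_I2)
   fix x
   have "(%m. th x * ((prim f (t m * (u x + si m * h x)) - prim f (t m * u x)) / si m) + (1 - th x) * ((prim gt (t m * (u x + si m * h x)) - prim gt (t m * u x)) / si m))
    -->> th x * (h x * f (u x)) + (1 - th x) * (h x * gt (u x))"
    by (intro tendsto_intros prim_quotient_tendsto cont xt)
   moreover have "D m x = th x * ((prim f (t m * (u x + si m * h x)) - prim f (t m * u x)) / si m) + (1 - th x) * ((prim gt (t m * (u x + si m * h x)) - prim gt (t m * u x)) / si m)" for m
    by (simp add: D_def GG_def add_divide_distrib diff_divide_distrib right_diff_distrib)
   moreover have "gg th u x * h x = th x * (h x * f (u x)) + (1 - th x) * (h x * gt (u x))" unfolding gg_def by algebra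
   ultimately show "(%m. D m x) -->> gg th u x * h x" by simp
  qed
  fix m
  show "AE x in lborel. norm (D m x) <= cA * (\<bar>w x\<bar> + \<bar>w x\<bar> powr p) * \<bar>w x\<bar>"
  proof (rule AE_I2)
   fix x
   define y where "y = t m * u x"
   define z where "z = t m * (u x + si m * h x)"
   have w0: "\<bar>w x\<bar> = w x" by (simp add: w_def)
   have th: "\<bar>t m * u x\<bar> <= 2 * \<bar>u x\<bar>" "\<bar>t m * h x\<bar> <= 2 * \<bar>h x\<bar>" using t1[of m] by (auto simp: abs_mult intro!: mult_right_mono)
   have sth: "\<bar>si m * (t m * h x)\<bar> <= 1 * \<bar>t m * h x\<bar>" unfolding abs_mult[of "si m"] using si[of m] by (intro mult_right_mono) auto
   have z: "z = y + si m * (t m * h x)" by (simp add: z_def y_def algebra_simps)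
   have "\<bar>z\<bar> <= 2 * \<bar>u x\<bar> + 2 * \<bar>h x\<bar>" unfolding z y_def
    by (rule order_trans[OF abs_triangle_ineq add_mono[OF th(1) order_trans[OF sth[unfolded mult_1] th(2)]]])
   moreover have "\<bar>y\<bar> <= 2 * \<bar>u x\<bar> + 2 * \<bar>h x\<bar>" unfolding y_def by (rule order_trans[OF th(1)]) simp
   ultimately have yz: "max \<bar>z\<bar> \<bar>y\<bar> <= w x" by (simp add: w_def)
   have "\<bar>prim g z - prim g y\<bar> / si m <= cA * (w x + w x powr p) * w x" if "g = f \<or> g = gt" for g
   proof -
    have "\<bar>prim g z - prim g y\<bar> <= cA * (max \<bar>z\<bar> \<bar>y\<bar> + max \<bar>z\<bar> \<bar>y\<bar> powr p) * \<bar>z - y\<bar>" by (rule prim_bound[OF that])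
    also have "\<dots> <= cA * (w x + w x powr p) * (si m * w x)"
    proof (intro mult_mono mult_left_mono add_mono powr_mono2 yz)
     show "\<bar>z - y\<bar> <= si m * w x" unfolding z using th si(1)[of m] by (simp add: abs_mult[of "si m"] w_def)
    qed (use cA p yz in \<open>auto simp: w_def\<close>)
    finally show ?thesis using si(1)[of m] by (simp add: pos_divide_le_eq mult_ac)
   qed
   hence b: "\<bar>(prim g z - prim g y) / si m\<bar> <= cA * (w x + w x powr p) * w x" if "g = f \<or> g = gt" for g using that si(1)[of m] by simp
   have "D m x = th x * ((prim f z - prim f y) / si m) + (1 - th x) * ((prim gt z - prim gt y) / si m)"
    by (simp add: D_def GG_def add_divide_distrib diff_divide_distrib right_diff_distrib z_def y_def)
   thus "norm (D m x) <= cA * (\<bar>w x\<bar> + \<bar>w x\<bar> powr p) * \<bar>w x\<bar>" unfolding w0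
    using convex_abs_le[OF admD(5,6)[OF a] b[of f] b[of gt]] by simp
  qed
 qed auto
 moreover have "(%m. t m^2 * (Bf W u v h k + si m / 2 * Qf W h k)) -->> 1^2 * (Bf W u v h k + 0 / 2 * Qf W h k)"
  by (intro tendsto_intros tl sil) auto
 ultimately have "LI (%x. gg th u x * h x) <= 1^2 * (Bf W u v h k + 0 / 2 * Qf W h k)"
  by (rule LIMSEQ_le) (use le in auto)
 thus ?thesis by simp
qed

text \<open>The one-sided inequality for \<open>h\<close> and for \<open>- h\<close>.\<close>

lemma minimiser_critical:
 assumes a: "adm W th" and u: "Nh W th u v" and mn: "!!z z'. Nh W th z z' ==> Jf W th u v <= Jf W th z z'" and h: "Wsp h k"
 shows "Bf W u v h k = LI (%x. gg th u x * h x)"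
proof -
 have "LI (%x. gg th u x * (-1 * h x)) <= Bf W u v (%x. -1 * h x) (%x. -1 * k x)"
  by (rule minimiser_critical_ge[OF a u mn Wsp_cmult[OF h]])
 thus ?thesis using minimiser_critical_ge[OF a u mn h] by (simp add: Bf_def)
qed

lemma Nh_bounded:
 assumes a: "adm W th" and u: "Nh W th u v" and J: "Jf W th u v <= c"
 shows "sqn u + sqn v <= (1 / V0 + 1) * (2 * c / \<nu>)"
proof -
 have U: "Wsp u v" using u by (simp add: Nh_def)
 have Q: "Qf W u v <= 2 * c / \<nu>" using Nh_energy(2)[OF a u] J nu_pos by (simp add: field_simps)
 have "sqn u <= 1 / V0 * Qf W u v" using Qf_lower(1)[OF a U] V0 by (simp add: field_simps)
 hence "sqn u + sqn v <= (1 / V0 + 1) * Qf W u v" using Qf_lower(2)[OF a U] by (simp add: distrib_right)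
 also have "\<dots> <= (1 / V0 + 1) * (2 * c / \<nu>)" using Q V0 by (intro mult_left_mono) auto
 finally show ?thesis .
qed

text \<open>Integrability of \<open>th\<close> confines the superlinear part to a weighted region
  where compactness holds; the remaining, penalised part is dominated by the quadratic form and is
  treated by Fatou.\<close>

lemma minimiser_exists:
 assumes a: "adm W th" and th: "Lint th" and ne: "Nh W th z0 z0'"
 shows "\<exists>u v. Nh W th u v & (\<forall>z z'. Nh W th z z' --> Jf W th u v <= Jf W th z z')"
proof -
 define S where "S = {Jf W th z z' | z z'. Nh W th z z'}"
 define c where "c = Inf S"
 have Sne: "S \<noteq> {}" using ne by (auto simp: S_def)
 have "0 <= s" if "s \<in> S" for s
 proof -
  obtain z z' where z: "s = Jf W th z z'" "Nh W th z z'" using \<open>s \<in> S\<close> by (auto simp: S_def)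
  thus ?thesis using Nh_energy(2)[OF a z(2)] nu_pos by (smt (verit) Nh_def mult_pos_pos half_gt_zero)
 qed
 hence bb: "bdd_below S" by (intro bdd_belowI[of _ 0])
 have cl: "c <= Jf W th z z'" if "Nh W th z z'" for z z' unfolding c_def using that by (intro cInf_lower bb) (auto simp: S_def)
 have "\<exists>z z'. Nh W th z z' & Jf W th z z' < c + 1 / real (Suc n)" for n
 proof -
  have "\<exists>s\<in>S. s < c + 1 / real (Suc n)" by (rule cInf_lessD[OF Sne]) (simp add: c_def)
  thus ?thesis by (auto simp: S_def)
 qed
 then obtain z z' where z: "!!n. Nh W th (z n) (z' n)" "!!n. Jf W th (z n) (z' n) < c + 1 / real (Suc n)" by metis
 have z1: "Wsp (z n) (z' n)" for n using z(1)[of n] by (simp add: Nh_def)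
 define C where "C = (1 / V0 + 1) * (2 * (c + 1) / \<nu>)"
 have zb: "sqn (z n) + LI (%x. (z' n x)^2) <= C" for n unfolding C_def
 proof (rule Nh_bounded[OF a z(1)])
  have "1 / real (Suc n) <= 1" by simp
  thus "Jf W th (z n) (z' n) <= c + 1" using z(2)[of n] by linarith
 qed
 have nn: "0 <= sqn (z n)" "0 <= LI (%x. (z' n x)^2)" for n by simp_all
 have zb': "sqn (z n) <= C" "LI (%x. (z' n x)^2) <= C" for n using zb[of n] nn[of n] by linarith+
 obtain r u v where r: "strict_mono (r :: nat => nat)" and U: "Wsp u v"
  and vw: "\<forall>h. sq_int lborel h --> (%n. LI (%x. z' (r n) x * h x)) -->> LI (%x. v x * h x)"
  and ul: "AE x in lborel. (%n. z (r n) x) -->> u x"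
  using Wsp_weak_compactness[of z z' C, OF z1 zb'] by (elim exE conjE) (rule that, assumption+)
 \<comment> \<open>The midpoint between \<open>p + 1\<close> and the critical exponent: all growth
   of order \<open>p + 1\<close> is strictly below \<open>q\<close>.\<close>
 define q where "q = (p + 1 + 2 * real CARD('n) / (real CARD('n) - 4)) / 2"
 have q: "p + 1 < q" "q < 2 * real CARD('n) / (real CARD('n) - 4)" using p by (auto simp: q_def)
 obtain S' where S': "S' >= 0" "!!(u :: real^'n => real) v. Wsp u v ==>
  Lint (%x. \<bar>u x\<bar> powr q) & LI (%x. \<bar>u x\<bar> powr q) <= S' * (sqn u + sqn v) powr (q / 2)"
  using Sobolev[OF N, of q] p q by auto
 have zq: "Lint (%x. \<bar>z n x\<bar> powr q)" "LI (%x. \<bar>z n x\<bar> powr q) <= S' * C powr (q / 2)" for n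
 proof -
  show "Lint (%x. \<bar>z n x\<bar> powr q)" using S'(2)[OF z1] by blast
  have "S' * (sqn (z n) + LI (%x. (z' n x)^2)) powr (q / 2) <= S' * C powr (q / 2)"
   using S'(1) zb[of n] p q nn[of n] by (intro mult_left_mono powr_mono2) auto
  thus "LI (%x. \<bar>z n x\<bar> powr q) <= S' * C powr (q / 2)" using S'(2)[OF z1[of n]] by linarith
 qed
 have Vit: "Lint (%x. th x * ps (z (r n) x))" "Lint (%x. th x * ps (u x))"
  "(%n. LI (%x. th x * ps (z (r n) x))) -->> LI (%x. th x * ps (u x))"
  if "continuous_on UNIV ps" "!!s. \<bar>ps s\<bar> <= K * (s\<^sup>2 + \<bar>s\<bar> powr (p + 1))" "K >= 0" for ps K n
 proof -
  have "z (r n) \<in> borel_measurable lborel" "u \<in> borel_measurable lborel" for n using WspD(3)[OF z1] WspD(3)[OF U] by auto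
  note V = subcritical_convergence[OF th admD(5,6)[OF a] that(1) subcritical_bound[OF that(2,3) _ q(1)] _ this(1) zq this(2) ul]
  show "Lint (%x. th x * ps (z (r n) x))" "Lint (%x. th x * ps (u x))"
  "(%n. LI (%x. th x * ps (z (r n) x))) -->> LI (%x. th x * ps (u x))" by (rule V; use p q in simp)+
 qed
 \<comment> \<open>\<open>Nh_lower\<close> and \<open>Nh_energy\<close> bound the weighted integral
   of \<open>z * f z\<close> below by \<open>\<delta> / 2\<close>, and this integral passes to the
   limit.\<close>
 have nz: "\<not> (AE x in lborel. th x * u x = 0)"
 proof
  assume "AE x in lborel. th x * u x = 0"
  hence "AE x in lborel. th x * (u x * f (u x)) = 0" by eventually_elim auto
  hence 0: "LI (%x. th x * (u x * f (u x))) = 0" by (rule integral_eq_zero_AE)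
  obtain \<delta> where \<delta>: "\<delta> > 0" "!!u v. Nh W th u v ==> \<delta> <= Qf W u v" using Nh_lower a by blast
  have "\<bar>s * f s\<bar> <= cA * (s\<^sup>2 + \<bar>s\<bar> powr (p + 1))" for s
  proof -
   have "\<bar>s * f s\<bar> <= \<bar>s\<bar> * (cA * (\<bar>s\<bar> + \<bar>s\<bar> powr p))" unfolding abs_mult using growth(1) by (intro mult_left_mono) auto
   also have "\<dots> = cA * (s\<^sup>2 + \<bar>s\<bar> powr (p + 1))" using powr_mult_self[of "\<bar>s\<bar>"] by (simp add: distrib_left power2_eq_square mult_ac)
   finally show ?thesis .
  qed
  hence "(%n. LI (%x. th x * (z (r n) x * f (z (r n) x)))) -->> LI (%x. th x * (u x * f (u x)))"
   using cA cont by (intro Vit(3)[of "%s. s * f s" cA]) (auto intro!: continuous_intros)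
  moreover have "\<delta> / 2 <= LI (%x. th x * (z (r n) x * f (z (r n) x)))" for n
   using \<delta>(2)[OF z(1)[of "r n"]] Nh_energy(3)[OF a z(1)[of "r n"]] by linarith
  ultimately have "\<delta> / 2 <= 0" unfolding 0 by (intro LIMSEQ_le_const) auto
  thus False using \<delta> by simp
 qed
 \<comment> \<open>The limit need not satisfy the Nehari identity, so it is projected. The factor
   \<open>t\<close> is applied to the sequence as well: \<open>Jf_scaling\<close> keeps the energy
   of \<open>t z\<close> below that of \<open>z\<close>.\<close>
 obtain t where t: "t > 0" and Nt: "Nh W th (%x. t * u x) (%x. t * v x)" using Nh_projection[OF a U nz] by blast
 \<comment> \<open>The terms without compactness, as \<open>1 - th\<close> is not integrable. The
   bound on \<open>prim gt\<close> by \<open>\<kappa> / 2\<close> times the square makes their sum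
   nonnegative, which is what Fatou needs.\<close>
 define A where "A n x = t^2 / 2 * (W x * (z (r n) x)^2) - (1 - th x) * prim gt (t * z (r n) x)" for n x
 define A0 where "A0 x = t^2 / 2 * (W x * (u x)^2) - (1 - th x) * prim gt (t * u x)" for x
 define K where "K = cA * (t^2 + t powr (p + 1))"
 have Fb: "\<bar>prim g (t * s)\<bar> <= K * (s\<^sup>2 + \<bar>s\<bar> powr (p + 1))" if "g = f \<or> g = gt" for s g
 proof -
  have "\<bar>prim g (t * s)\<bar> <= cA * (t^2 * s^2 + t powr (p + 1) * \<bar>s\<bar> powr (p + 1))"
   using prim_bound0[OF that, of "t * s"] t by (simp add: power_mult_distrib abs_mult powr_mult)
  also have "\<dots> <= cA * ((t^2 + t powr (p + 1)) * s^2 + (t^2 + t powr (p + 1)) * \<bar>s\<bar> powr (p + 1))"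
   using cA by (intro mult_left_mono add_mono mult_right_mono) auto
  finally show ?thesis by (simp only: K_def distrib_left[of "t^2 + t powr (p + 1)", symmetric] mult.assoc)
 qed
 have K: "K >= 0" using cA by (simp add: K_def)
 note [measurable] = admD(1,2)[OF a] WspD(3)[OF U] borel_f
 have Vp: "Lint (%x. th x * prim f (t * z (r n) x))" "Lint (%x. th x * prim f (t * u x))"
  "(%n. LI (%x. th x * prim f (t * z (r n) x))) -->> LI (%x. th x * prim f (t * u x))" for n
  by (rule Vit[of "%s. prim f (t * s)" K]; use Fb[of f] K prim_continuous[OF cont(1)] in \<open>auto intro!: continuous_on_compose2[of UNIV "prim f"] continuous_intros\<close>)+
 have split: "Jf W th (%x. t * y x) (%x. t * y' x) = t^2 / 2 * LI (%x. (y' x)^2) + LI (%x. t^2 / 2 * (W x * (y x)^2) - (1 - th x) * prim gt (t * y x)) - LI (%x. th x * prim f (t * y x))"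
  "Lint (%x. t^2 / 2 * (W x * (y x)^2) - (1 - th x) * prim gt (t * y x))"
  if y: "Wsp y y'" "Lint (%x. th x * prim f (t * y x))" for y y'
 proof -
  have i: "Lint (%x. th x * prim f (t * y x) + (1 - th x) * prim gt (t * y x))"
   using gg_int(2)[OF a Wsp_cmult[OF y(1), of t] y(1)] by (simp add: GG_def[abs_def])
  have ig: "Lint (%x. (1 - th x) * prim gt (t * y x))" using Bochner_Integration.integrable_diff[OF i y(2)] by simp
  note iw = W_integrable(2)[OF a WspD(1)[OF y(1)] WspD(1)[OF y(1)]]
  show "Lint (%x. t^2 / 2 * (W x * (y x)^2) - (1 - th x) * prim gt (t * y x))" using ig iw by simp
  show "Jf W th (%x. t * y x) (%x. t * y' x) = t^2 / 2 * LI (%x. (y' x)^2) + LI (%x. t^2 / 2 * (W x * (y x)^2) - (1 - th x) * prim gt (t * y x)) - LI (%x. th x * prim f (t * y x))"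
   unfolding Jf_def Qf_scale GG_def[abs_def] Bochner_Integration.integral_add[OF y(2) ig] Bochner_Integration.integral_diff[OF integrable_mult_right[OF iw] ig] by (simp add: Qf_def distrib_left)
 qed
 have "LI A0 <= c - t^2 / 2 * sqn v + LI (%x. th x * prim f (t * u x))"
 proof (rule integral_Fatou(2)[where f=A])
  show "Lint (A n)" for n unfolding A_def[abs_def] by (rule split(2)[OF z1 Vp(1)])
  show "AE x in lborel. 0 <= A n x" for n
  proof (rule AE_I2)
   fix x
   have "(1 - th x) * prim gt (t * z (r n) x) <= 1 * (\<kappa> / 2 * (t * z (r n) x)^2)"
    using admD(5,6)[OF a, of x] prim_gt_le prim_nonneg(1)[of gt] by (intro mult_mono) auto
   also have "\<dots> <= W x / 2 * (t * z (r n) x)^2" using kappa V0 admD(3)[OF a, of x] by (simp add: mult_right_mono)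
   finally show "0 <= A n x" by (simp add: A_def power_mult_distrib mult_ac)
  qed
  show "AE x in lborel. (%n. A n x) -->> A0 x" using ul
  proof eventually_elim
   case (elim x)
   show ?case unfolding A_def A0_def
    by (intro tendsto_intros elim continuous_on_tendsto_compose[OF prim_continuous[OF cont(2)]]) auto
  qed
  show "A0 \<in> borel_measurable lborel" unfolding A0_def[abs_def] by measurable
  show "LI (A n) <= c + 1 / real (Suc (r n)) - t^2 / 2 * (2 * LI (%x. z' (r n) x * v x) - sqn v) + LI (%x. th x * prim f (t * z (r n) x))" for n
  proof -
   \<comment> \<open>Weak lower semicontinuity in linear form: the squared norm of \<open>z'\<close>
     is bounded below by an expression linear in \<open>z'\<close>, whose limit is known.\<close>
   have "0 <= LI (%x. (z' (r n) x + (-1) * v x)^2)" by simp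
   also have "\<dots> = LI (%x. (z' (r n) x)^2) - 2 * LI (%x. z' (r n) x * v x) + sqn v"
    by (simp only: sq_int_expand[OF WspD(2)[OF z1] WspD(2)[OF U]]) simp
   finally have "t^2 / 2 * (2 * LI (%x. z' (r n) x * v x) - sqn v) <= t^2 / 2 * LI (%x. (z' (r n) x)^2)"
    by (intro mult_left_mono) auto
   moreover have "Jf W th (%x. t * z (r n) x) (%x. t * z' (r n) x) <= c + 1 / real (Suc (r n))"
    using Jf_scaling[OF a z(1)[of "r n"], of t] z(2)[of "r n"] t by simp
   ultimately show ?thesis unfolding split(1)[OF z1 Vp(1)] A_def[abs_def] by linarith
  qed
  have vl: "(%n. LI (%x. z' (r n) x * v x)) -->> LI (%x. v x * v x)" using vw WspD(2)[OF U] by blast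
  have rl: "(%n. 1 / real (Suc (r n))) -->> 0"
   using LIMSEQ_subseq_LIMSEQ[OF LIMSEQ_inverse_real_of_nat r] by (simp add: o_def inverse_eq_divide)
  have "(%n. c + 1 / real (Suc (r n)) - t^2 / 2 * (2 * LI (%x. z' (r n) x * v x) - sqn v) + LI (%x. th x * prim f (t * z (r n) x)))
   -->> c + 0 - t^2 / 2 * (2 * LI (%x. v x * v x) - sqn v) + LI (%x. th x * prim f (t * u x))"
   by (intro tendsto_intros vl Vp(3) rl)
  thus "(%n. c + 1 / real (Suc (r n)) - t^2 / 2 * (2 * LI (%x. z' (r n) x * v x) - sqn v) + LI (%x. th x * prim f (t * z (r n) x)))
   -->> c - t^2 / 2 * sqn v + LI (%x. th x * prim f (t * u x))" by (simp add: power2_eq_square)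
 qed
 hence "Jf W th (%x. t * u x) (%x. t * v x) <= c" unfolding split(1)[OF U Vp(2)] A0_def[abs_def] by linarith
 thus ?thesis using Nt cl order_trans by blast
qed

end

section \<open>Concentration of the solutions\<close>

lemma test_fun_Wsp:
 assumes h: "test_fun h" shows "Wsp h (lap h)"
 unfolding Wsp_def
proof (intro conjI allI impI test_fun_sq_int test_fun_lap h)
 fix g :: "real^'a => real" assume g: "test_fun g"
 have e: "LI (%x. h x * pd i (pd i g) x) = LI (%x. pd i (pd i h) x * g x)" for i
  using integration_by_parts[OF test_fun_pd[OF g] test_fun_smooth[OF h], of i i] integration_by_parts[OF test_fun_pd[OF h] test_fun_smooth[OF g], of i i]
  by (simp add: mult.commute)
 have i: "Lint (%x. h x * pd i (pd i g) x)" "Lint (%x. pd i (pd i h) x * g x)" for i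
  by (intro test_fun_integrable test_fun_mult test_fun_pd test_fun_smooth g h)+
 show "LI (%x. h x * lap g x) = LI (%x. lap h x * g x)"
  unfolding lap_def sum_distrib_left sum_distrib_right using i e by simp
qed

text \<open>Bounded in L2 and convergent almost everywhere implies weakly convergent. The version
  with absolute values is needed when bounded coefficients that do not converge are
  inserted.\<close>

lemma L2_bounded_AE_weak:
 fixes w :: "nat => 'a => real"
 assumes w: "!!n. sq_int M (w n)" "!!n. (\<integral>x. (w n x)^2 \<partial>M) <= C" and w0: "w0 \<in> borel_measurable M"
  and lim: "AE x in M. (%n. w n x) -->> w0 x" and h: "sq_int M h"
 shows "sq_int M w0" "(%n. \<integral>x. \<bar>w n x - w0 x\<bar> * \<bar>h x\<bar> \<partial>M) -->> 0" "(%n. \<integral>x. w n x * h x \<partial>M) -->> (\<integral>x. w0 x * h x \<partial>M)"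
proof -
 note [measurable] = sq_int_measurable[OF w(1)] w0 sq_int_measurable[OF h]
 have l2: "AE x in M. (%n. (w n x)^2) -->> (w0 x)^2" using lim by eventually_elim (intro tendsto_power)
 note F = integral_Fatou[OF sq_int_integrable[OF w(1)] _ l2 _ w(2) tendsto_const]
 have i0: "integrable M (%x. (w0 x)^2)" "(\<integral>x. (w0 x)^2 \<partial>M) <= C" by (rule F; simp)+
 show s0: "sq_int M w0" using i0 w0 by (simp add: sq_int_def)
 have C: "C >= 0" by (rule order_trans[OF _ i0(2)]) simp
 have d: "!!n. (%x. \<bar>w n x - w0 x\<bar> * \<bar>h x\<bar>) \<in> borel_measurable M" "!!n x. 0 <= \<bar>w n x - w0 x\<bar> * \<bar>h x\<bar>" by simp_all
 have dl: "AE x in M. (%n. \<bar>w n x - w0 x\<bar> * \<bar>h x\<bar>) -->> 0" using lim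
 proof eventually_elim
  case (elim x)
  have "(%n. \<bar>w n x - w0 x\<bar> * \<bar>h x\<bar>) -->> \<bar>w0 x - w0 x\<bar> * \<bar>h x\<bar>" by (intro tendsto_intros elim)
  thus ?case by simp
 qed
 have dom: "\<exists>g b. integrable M g & (\<forall>x. 0 <= g x) & (\<forall>n. integrable M (b n) & (\<forall>x. 0 <= b n x & \<bar>w n x - w0 x\<bar> * \<bar>h x\<bar> <= g x + b n x) & (\<integral>x. b n x \<partial>M) <= e)" if e: "e > 0" for e
 proof -
  \<comment> \<open>The weight in \<open>y * \<bar>h\<bar> <= k * y^2 + h^2 / (4 * k)\<close>; the
    part with \<open>k\<close> has integral at most \<open>4 * C * k <= e\<close>.\<close>
  define k where "k = e / (4 * C + 1)"
  have k: "k > 0" "k * (4 * C) <= e" using e C by (auto simp: k_def field_simps)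
  show ?thesis
  proof (intro exI conjI allI)
   show "integrable M (%x. (h x)^2 / (4 * k))" using sq_int_integrable[OF h] by simp
   show "0 <= (h x)^2 / (4 * k)" for x using k by simp
   show "integrable M (%x. 2 * k * ((w n x)^2 + (w0 x)^2))" for n using sq_int_integrable[OF w(1)] i0 by simp
   show "0 <= 2 * k * ((w n x)^2 + (w0 x)^2)" for n x using k by simp
   have "(\<integral>x. (w n x)^2 + (w0 x)^2 \<partial>M) <= C + C" for n using sq_int_integrable[OF w(1)[of n]] i0 w(2)[of n] by simp
   hence "2 * k * (\<integral>x. (w n x)^2 + (w0 x)^2 \<partial>M) <= 2 * k * (C + C)" for n using k(1) by (intro mult_left_mono) auto
   moreover have "2 * k * (C + C) <= e" using k(2) by (simp add: mult_ac)
   ultimately show "(\<integral>x. 2 * k * ((w n x)^2 + (w0 x)^2) \<partial>M) <= e" for n unfolding integral_mult_right_zero by (rule order_trans)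
   fix n x
   define y where "y = \<bar>w n x - w0 x\<bar>"
   have "0 <= (2 * k * y - \<bar>h x\<bar>)^2" by simp
   also have "\<dots> = 4 * k * (k * y^2 + (h x)^2 / (4 * k) - y * \<bar>h x\<bar>)" using k by (simp add: power2_eq_square field_simps)
   finally have "y * \<bar>h x\<bar> <= k * y^2 + (h x)^2 / (4 * k)" using k by (simp add: zero_le_mult_iff)
   moreover have "k * y^2 <= k * (2 * ((w n x)^2 + (w0 x)^2))"
    using k sum_squares_ge_zero[of "w n x + w0 x" 0] by (intro mult_left_mono) (auto simp: y_def power2_eq_square algebra_simps)
   ultimately show "\<bar>w n x - w0 x\<bar> * \<bar>h x\<bar> <= (h x)^2 / (4 * k) + 2 * k * ((w n x)^2 + (w0 x)^2)" unfolding y_def by (simp add: mult_ac)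
  qed
 qed
 show 0: "(%n. \<integral>x. \<bar>w n x - w0 x\<bar> * \<bar>h x\<bar> \<partial>M) -->> 0" by (rule integral_tendsto_0_dominated(2)[OF d dl dom])
 have "(%n. (\<integral>x. w n x * h x \<partial>M) - (\<integral>x. w0 x * h x \<partial>M)) -->> 0"
 proof (rule Lim_null_comparison[OF _ 0], rule always_eventually, rule allI)
  fix n
  have "(\<integral>x. w n x * h x \<partial>M) - (\<integral>x. w0 x * h x \<partial>M) = (\<integral>x. (w n x - w0 x) * h x \<partial>M)"
   using sq_int_mult[OF w(1) h] sq_int_mult[OF s0 h] by (simp add: left_diff_distrib)
  thus "norm ((\<integral>x. w n x * h x \<partial>M) - (\<integral>x. w0 x * h x \<partial>M)) <= (\<integral>x. \<bar>w n x - w0 x\<bar> * \<bar>h x\<bar> \<partial>M)"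
   using integral_norm_bound[of M "%x. (w n x - w0 x) * h x"] by (simp add: abs_mult)
 qed
 thus "(%n. \<integral>x. w n x * h x \<partial>M) -->> (\<integral>x. w0 x * h x \<partial>M)" by (rule LIM_zero_cancel)
qed

lemma LI_translate: "F \<in> bmeas ==> LI (%x. F (y + x)) = LI F"
 using integral_lborel_translate[of F y] by (simp add: add.commute)

context penal
begin

definition crit where
 "crit W th u v \<longleftrightarrow> Wsp u v & (\<forall>h k. Wsp h k --> Bf W u v h k = LI (%x. gg th u x * h x))"

lemma adm_const: "V0 <= c ==> c <= V1 ==> 0 <= d ==> d <= 1 ==> adm (%_. c) (%_. d)" by (simp add: adm_def)

lemma gg_linear_bound:
 assumes th: "0 <= th x" "th x <= 1" and u: "\<bar>u x\<bar> <= B"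
 shows "\<bar>gg th u x\<bar> <= cA * (1 + B powr (p - 1)) * \<bar>u x\<bar>"
proof -
 have "\<bar>u x\<bar> powr p = \<bar>u x\<bar> * \<bar>u x\<bar> powr (p - 1)" by (cases "u x = 0") (auto simp: powr_diff)
 also have "\<dots> <= \<bar>u x\<bar> * B powr (p - 1)" using u p by (intro mult_left_mono powr_mono2) auto
 finally have "cA * (\<bar>u x\<bar> + \<bar>u x\<bar> powr p) <= cA * (\<bar>u x\<bar> + \<bar>u x\<bar> * B powr (p - 1))" using cA by (intro mult_left_mono) auto
 thus ?thesis using gg_bound[of th x u, OF th order_refl] by (simp add: algebra_simps)
qed

text \<open>The potentials \<open>W n\<close> are not assumed to converge: boundedness suffices to
  replace \<open>u n\<close> by \<open>u0\<close> next to them, so the limit equation is stated as a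
  limit of integrals. The cutoffs tend to a constant because they vary slowly in the rescaled
  variable.\<close>

lemma crit_limit:
 fixes u v :: "nat => real^'n => real"
 assumes a: "!!n. adm (W n) (th n)" and s: "!!n. crit (W n) (th n) (u n) (v n)" and bd: "!!n. sqn (u n) + sqn (v n) <= C"
  and B: "!!n x. \<bar>u n x\<bar> <= B" "!!n x y. \<bar>u n x - u n y\<bar> <= B * norm (x - y)" and lo: "0 < d" "!!n. d <= \<bar>u n 0\<bar>"
  and th: "!!x. (%n. th n x) -->> \<tau>"
 shows "\<exists>r u0 v0. strict_mono (r :: nat => nat) & Wsp u0 v0 & \<not> (AE x in lborel. u0 x = 0) & (AE x in lborel. (%n. u (r n) x) -->> u0 x) &
  (\<forall>h k. Wsp h k --> (%n. LI (%x. W (r n) x * (u0 x * h x))) -->> LI (%x. gg (%_. \<tau>) u0 x * h x) - LI (%x. v0 x * k x))"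
proof -
 have U: "Wsp (u n) (v n)" for n using s by (simp add: crit_def)
 have nn: "0 <= sqn (u n)" "0 <= sqn (v n)" for n by simp_all
 have bd': "sqn (u n) <= C" "sqn (v n) <= C" for n using bd[of n] nn[of n] by linarith+
 obtain r u0 v0 where r: "strict_mono (r :: nat => nat)" and U0: "Wsp u0 v0"
  and vw: "\<forall>h. sq_int lborel h --> (%n. LI (%x. v (r n) x * h x)) -->> LI (%x. v0 x * h x)"
  and ul: "AE x in lborel. (%n. u (r n) x) -->> u0 x"
  using Wsp_weak_compactness[of u v C, OF U bd'] by (elim exE conjE) (rule that, assumption+)
 have B0: "B >= 0" using B(1)[of 0 0] by linarith
 have nz: "\<not> (AE x in lborel. u0 x = 0)"
 proof
  assume z: "AE x in lborel. u0 x = 0"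
  \<comment> \<open>On the ball of this radius the common Lipschitz bound keeps
    \<open>\<bar>u n\<bar>\<close> above \<open>d / 2\<close>, so the pointwise limit cannot vanish
    there.\<close>
  define t where "t = d / (2 * (B + 1))"
  have t: "t > 0" "B * t <= d / 2" using lo B0 by (auto simp: t_def field_simps)
  have "AE x :: real^'n in lborel. max 0 (t - norm x) = 0" using z ul
  proof eventually_elim
   case (elim x)
   have "d / 2 <= \<bar>u n x\<bar>" if "norm x < t" for n
   proof -
    have "B * norm x <= B * t" using that B0 by (intro mult_left_mono) auto
    thus ?thesis using B(2)[of n x 0] lo(2)[of n] t by simp
   qed
   moreover have "(%n. \<bar>u (r n) x\<bar>) -->> \<bar>0\<bar>" using elim by (intro tendsto_rabs) simp
   ultimately have "norm x < t ==> d / 2 <= \<bar>0\<bar>" by (intro LIMSEQ_le_const) auto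
   thus ?case using lo(1) by fastforce
  qed
  moreover have "continuous_on UNIV (%x :: real^'n. max 0 (t - norm x))" by (intro continuous_intros)
  ultimately have "max 0 (t - norm (0 :: real^'n)) = 0" using AE_zero_continuous by blast
  thus False using t by simp
 qed
 define K where "K = cA * (1 + B powr (p - 1))"
 have K: "K >= 0" using cA by (simp add: K_def)
 define g where "g n = gg (th (r n)) (u (r n))" for n
 note [measurable] = WspD(3)[OF U] WspD(3)[OF U0] admD(1,2)[OF a]
 have \<tau>: "0 <= \<tau>" "\<tau> <= 1" using LIMSEQ_le_const[OF th[of 0], of 0] LIMSEQ_le_const2[OF th[of 0], of 1] admD(5,6)[OF a] by auto
 have gs: "sq_int lborel (g n)" "sqn (g n) <= K^2 * C" for n
 proof -
  have b: "\<bar>g n x\<bar> <= K * \<bar>u (r n) x\<bar>" for x unfolding g_def K_def by (intro gg_linear_bound admD[OF a] B)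
  show s: "sq_int lborel (g n)" by (rule sq_int_bound[OF WspD(1)[OF U]]) (use b in \<open>auto simp: g_def\<close>)
  have "sqn (g n) <= LI (%x. K^2 * (u (r n) x)^2)"
  proof (rule integral_mono[OF sq_int_integrable[OF s]])
   show "(g n x)^2 <= K^2 * (u (r n) x)^2" for x using power_mono[OF b[of x], of 2] by (simp add: power_mult_distrib)
  qed (use sq_int_integrable[OF WspD(1)[OF U]] in simp)
  also have "\<dots> <= K^2 * C" using bd'(1) by (simp add: mult_left_mono)
  finally show "sqn (g n) <= K^2 * C" .
 qed
 have gl: "AE x in lborel. (%n. g n x) -->> gg (%_. \<tau>) u0 x" using ul
 proof eventually_elim
  case (elim x)
  from gg_tendsto[of "%n. th (r n) x" "%_. \<tau>" x "%n. u (r n) x" u0, OF LIMSEQ_subseq_LIMSEQ[OF th[of x] r, unfolded o_def] elim] show ?case by (simp add: g_def gg_def)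
 qed
 have gm: "gg (%_. \<tau>) u0 \<in> borel_measurable lborel" by simp
 have "(%n. LI (%x. W (r n) x * (u0 x * h x))) -->> LI (%x. gg (%_. \<tau>) u0 x * h x) - LI (%x. v0 x * k x)" if hk: "Wsp h k" for h k
 proof -
  note h = WspD(1)[OF hk]
  have "(%n. LI (%x. g n x * h x)) -->> LI (%x. gg (%_. \<tau>) u0 x * h x)" by (rule L2_bounded_AE_weak(3)[OF gs gm gl h])
  moreover have "(%n. LI (%x. v (r n) x * k x)) -->> LI (%x. v0 x * k x)" using vw WspD(2)[OF hk] by blast
  moreover have "(%n. LI (%x. W (r n) x * (u (r n) x * h x)) - LI (%x. W (r n) x * (u0 x * h x))) -->> 0"
  proof (rule Lim_null_comparison)
   have "(%n. LI (%x. \<bar>u (r n) x - u0 x\<bar> * \<bar>h x\<bar>)) -->> 0"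
    by (rule L2_bounded_AE_weak(2)[OF WspD(1)[OF U] bd'(1) _ ul h]) simp
   from tendsto_mult_right_zero[OF this, of V1] show "(%n. V1 * LI (%x. \<bar>u (r n) x - u0 x\<bar> * \<bar>h x\<bar>)) -->> 0" .
   have "norm (LI (%x. W (r n) x * (u (r n) x * h x)) - LI (%x. W (r n) x * (u0 x * h x))) <= V1 * LI (%x. \<bar>u (r n) x - u0 x\<bar> * \<bar>h x\<bar>)" for n
   proof -
    have i: "Lint (%x. \<bar>(u (r n) x - u0 x) * h x\<bar>)" by (intro integrable_abs sq_int_mult[OF WspD(1)[OF Wsp_diff[OF U U0]] h])
    have "LI (%x. W (r n) x * (u (r n) x * h x)) - LI (%x. W (r n) x * (u0 x * h x)) = LI (%x. W (r n) x * ((u (r n) x - u0 x) * h x))"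
     using W_integrable(1)[OF a WspD(1)[OF U] h] W_integrable(1)[OF a WspD(1)[OF U0] h] by (simp add: left_diff_distrib right_diff_distrib)
    also have "norm \<dots> <= LI (%x. V1 * \<bar>(u (r n) x - u0 x) * h x\<bar>)"
    proof (rule order_trans[OF integral_norm_bound integral_mono])
     show "Lint (%x. norm (W (r n) x * ((u (r n) x - u0 x) * h x)))" by (intro integrable_norm W_integrable(1)[OF a WspD(1)[OF Wsp_diff[OF U U0]] h])
     show "norm (W (r n) x * ((u (r n) x - u0 x) * h x)) <= V1 * \<bar>(u (r n) x - u0 x) * h x\<bar>" for x
      unfolding real_norm_def abs_mult[of "W (r n) x"] by (intro mult_right_mono admD(7)[OF a]) simp
    qed (use i in simp)
    finally show ?thesis by (simp add: abs_mult)
   qed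
   thus "\<forall>\<^sub>F n in sequentially. norm (LI (%x. W (r n) x * (u (r n) x * h x)) - LI (%x. W (r n) x * (u0 x * h x))) <= V1 * LI (%x. \<bar>u (r n) x - u0 x\<bar> * \<bar>h x\<bar>)" by simp
  qed
  ultimately have "(%n. LI (%x. g n x * h x) - LI (%x. v (r n) x * k x) - (LI (%x. W (r n) x * (u (r n) x * h x)) - LI (%x. W (r n) x * (u0 x * h x)))) -->>
   LI (%x. gg (%_. \<tau>) u0 x * h x) - LI (%x. v0 x * k x) - 0" by (intro tendsto_diff)
  moreover have "LI (%x. g n x * h x) = LI (%x. v (r n) x * k x) + LI (%x. W (r n) x * (u (r n) x * h x))" for n
   using s[of "r n"] hk by (simp add: crit_def Bf_def g_def)
  ultimately show ?thesis by simp
 qed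
 thus ?thesis using r U0 nz ul by (intro exI[of _ r] exI[of _ u0] exI[of _ v0]) auto
qed

lemma square_integral_pos:
 assumes "sq_int lborel w" "\<not> (AE x in lborel. w x = 0)" shows "0 < sqn w"
proof -
 have "sqn w \<noteq> 0" using integral_nonneg_eq_0_iff_AE[OF sq_int_integrable[OF assms(1)]] assms(2) by simp
 moreover have "0 <= sqn w" by simp
 ultimately show ?thesis by linarith
qed

text \<open>Testing the limit with itself leaves only the penalised nonlinearity, of slope at most
  \<open>V0 / 2\<close>, against a potential of at least \<open>V0\<close>. No limit of
  \<open>W n\<close> is needed, so the centres may run off to infinity.\<close>

lemma crit_vanishing:
 fixes u v :: "nat => real^'n => real"
 assumes a: "!!n. adm (W n) (th n)" and s: "!!n. crit (W n) (th n) (u n) (v n)" and bd: "!!n. sqn (u n) + sqn (v n) <= C"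
  and B: "!!n x. \<bar>u n x\<bar> <= B" "!!n x y. \<bar>u n x - u n y\<bar> <= B * norm (x - y)" and lo: "0 < d" "!!n. d <= \<bar>u n 0\<bar>"
  and th: "!!x. (%n. th n x) -->> 0"
 shows False
proof -
 obtain r u0 v0 where U: "Wsp u0 v0" "\<not> (AE x in lborel. u0 x = 0)"
  and l: "\<forall>h k. Wsp h k --> (%n. LI (%x. W (r n) x * (u0 x * h x))) -->> LI (%x. gg (%_. 0) u0 x * h x) - LI (%x. v0 x * k x)"
  using crit_limit[OF a s bd B lo th] by (elim exE conjE) (rule that, assumption+)
 note u2 = sq_int_integrable[OF WspD(1)[OF U(1)]]
 have "V0 * sqn u0 <= LI (%x. W (r n) x * (u0 x * u0 x))" for n
 proof -
  have "LI (%x. V0 * (u0 x)^2) <= LI (%x. W (r n) x * (u0 x)^2)"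
   by (rule integral_mono) (use u2 W_integrable(2)[OF a WspD(1)[OF U(1)] WspD(1)[OF U(1)]] admD(3)[OF a] in \<open>auto intro: mult_right_mono\<close>)
  thus ?thesis by (simp add: power2_eq_square)
 qed
 hence "V0 * sqn u0 <= LI (%x. gg (%_. 0) u0 x * u0 x) - LI (%x. v0 x * v0 x)" by (intro LIMSEQ_le_const[OF l[rule_format, OF U(1)]]) auto
 also have "\<dots> <= LI (%x. gg (%_. 0) u0 x * u0 x)" by simp
 also have "\<dots> <= LI (%x. V0 / 2 * (u0 x)^2)"
 proof (rule integral_mono)
  show "Lint (%x. gg (%_. 0) u0 x * u0 x)" by (rule gg_int(1)[OF adm_const[of V0 0] U(1) U(1)]) (use V0 in auto)
  fix x
  show "gg (%_. 0) u0 x * u0 x <= V0 / 2 * (u0 x)^2" using pen(1)[of "u0 x"] mult_right_mono[OF kappa(2), of "(u0 x)^2"] by (simp add: gg_def mult.commute)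
 qed (use u2 in simp)
 finally show False using square_integral_pos[OF WspD(1)[OF U(1)] U(2)] V0 by simp
qed

text \<open>On the Nehari set the energy equals the integral of \<open>gg * u / 2 - GG\<close>,
  which is pointwise nonnegative; in this form the level bound survives translation and passes to
  the limit by Fatou.\<close>

lemma crit_concentration:
 fixes u v :: "nat => real^'n => real"
 assumes a: "!!n. adm (W n) (th n)" and s: "!!n. crit (W n) (th n) (u n) (v n)" and bd: "!!n. sqn (u n) + sqn (v n) <= C"
  and B: "!!n x. \<bar>u n x\<bar> <= B" "!!n x y. \<bar>u n x - u n y\<bar> <= B * norm (x - y)" and lo: "0 < d" "!!n. d <= \<bar>u n 0\<bar>"
  and th: "!!x. (%n. th n x) -->> \<tau>" and W: "!!x. (%n. W n x) -->> om"
  and E: "!!e. e > 0 ==> \<forall>\<^sub>F n in sequentially. LI (%x. gg (th n) (u n) x * u n x / 2 - GG (th n) (u n) x) <= L + e"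
 shows "adm (%_. om) (%_. \<tau>) & (\<exists>u0 v0. Nh (%_. om) (%_. \<tau>) u0 v0 & Jf (%_. om) (%_. \<tau>) u0 v0 <= L)"
proof -
 have A: "adm (%_. om) (%_. \<tau>)"
  by (intro adm_const) (use LIMSEQ_le_const[OF th[of 0], of 0] LIMSEQ_le_const2[OF th[of 0], of 1] LIMSEQ_le_const[OF W[of 0], of V0] LIMSEQ_le_const2[OF W[of 0], of V1] admD[OF a] in auto)
 obtain r u0 v0 where r: "strict_mono (r :: nat => nat)" and U: "Wsp u0 v0" and nz: "\<not> (AE x in lborel. u0 x = 0)" and ul: "AE x in lborel. (%n. u (r n) x) -->> u0 x"
  and l: "\<forall>h k. Wsp h k --> (%n. LI (%x. W (r n) x * (u0 x * h x))) -->> LI (%x. gg (%_. \<tau>) u0 x * h x) - LI (%x. v0 x * k x)"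
  using crit_limit[OF a s bd B lo th] by (elim exE conjE) (rule that, assumption+)
 note u2 = sq_int_integrable[OF WspD(1)[OF U]]
 have Us: "Wsp (u n) (v n)" for n using s by (simp add: crit_def)
 note [measurable] = WspD(3)[OF U] admD(1,2)[OF a]
 have "(%n. LI (%x. W (r n) x * (u0 x * u0 x))) -->> LI (%x. om * (u0 x * u0 x))"
 proof (rule integral_dominated_convergence[where w="%x. V1 * (u0 x)^2"])
  show "AE x in lborel. (%n. W (r n) x * (u0 x * u0 x)) -->> om * (u0 x * u0 x)"
   by (intro AE_I2 tendsto_intros LIMSEQ_subseq_LIMSEQ[OF W r, unfolded o_def])
  show "AE x in lborel. norm (W (r n) x * (u0 x * u0 x)) <= V1 * (u0 x)^2" for n
   using admD(7)[OF a] by (intro AE_I2) (auto simp: abs_mult power2_eq_square intro: mult_right_mono)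
 qed (use u2 in auto)
 from LIMSEQ_unique[OF this l[rule_format, OF U]]
 have Q: "Qf (%_. om) u0 v0 = LI (%x. gg (%_. \<tau>) u0 x * u0 x)" by (simp add: Qf_def power2_eq_square)
 have "0 < Qf (%_. om) u0 v0" using Qf_lower(1)[OF A U] square_integral_pos[OF WspD(1)[OF U] nz] V0 by (smt (verit) mult_pos_pos)
 hence Nh: "Nh (%_. om) (%_. \<tau>) u0 v0" using U Q by (simp add: Nh_def)
 have "Jf (%_. om) (%_. \<tau>) u0 v0 <= L + e" if e: "e > 0" for e
 proof -
  obtain n0 where n0: "!!n. n >= n0 ==> LI (%x. gg (th n) (u n) x * u n x / 2 - GG (th n) (u n) x) <= L + e" using E[OF e] by (auto simp: eventually_sequentially)
  have r': "strict_mono (%n. r (n + n0))" using r by (simp add: strict_mono_def)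
  have i: "Lint (%x. gg (th n) (u n) x * u n x / 2 - GG (th n) (u n) x)" for n using gg_int[OF a Us Us] by simp
  have nn: "0 <= gg (th n) (u n) x * u n x / 2 - GG (th n) (u n) x" for n x
  proof -
   have "0 <= th n x * (u n x * f (u n x) / 2 - prim f (u n x)) + (1 - th n x) * (u n x * gt (u n x) / 2 - prim gt (u n x))"
    using prim_nonneg(2)[of f "u n x"] prim_nonneg(2)[of gt "u n x"] admD(5,6)[OF a, of n x] by (intro add_nonneg_nonneg mult_nonneg_nonneg) auto
   thus ?thesis by (simp add: gg_def GG_def algebra_simps add_divide_distrib diff_divide_distrib)
  qed
  have m: "(%x. gg (%_. \<tau>) u0 x * u0 x / 2 - GG (%_. \<tau>) u0 x) \<in> borel_measurable lborel" by simp
  have li: "AE x in lborel. (%n. gg (th (r (n + n0))) (u (r (n + n0))) x * u (r (n + n0)) x / 2 - GG (th (r (n + n0))) (u (r (n + n0))) x) -->> gg (%_. \<tau>) u0 x * u0 x / 2 - GG (%_. \<tau>) u0 x"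
   using ul
  proof eventually_elim
   case (elim x)
   note e = LIMSEQ_ignore_initial_segment[OF elim, of n0] and t = LIMSEQ_subseq_LIMSEQ[OF th[of x] r', unfolded o_def]
   show ?case using gg_tendsto[of _ "%_. \<tau>" x _ u0, OF t e] GG_tendsto[of _ "%_. \<tau>" x _ u0, OF t e] e
    by (intro tendsto_intros) (auto simp: gg_def GG_def)
  qed
  have "LI (%x. gg (%_. \<tau>) u0 x * u0 x / 2 - GG (%_. \<tau>) u0 x) <= L + e"
  proof (rule integral_Fatou(2)[OF i _ li m _ tendsto_const])
   show "LI (%x. gg (th (r (n + n0))) (u (r (n + n0))) x * u (r (n + n0)) x / 2 - GG (th (r (n + n0))) (u (r (n + n0))) x) <= L + e" for n
    using seq_suble[OF r, of "n + n0"] by (intro n0) simp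
  qed (use nn in simp)
  thus ?thesis using Nh_energy(1)[OF A Nh] by simp
 qed
 hence "Jf (%_. om) (%_. \<tau>) u0 v0 <= L" by (rule field_le_epsilon)
 thus ?thesis using A Nh by blast
qed

text \<open>Project \<open>u\<close> to the Nehari set of the reference problem with coefficients
  \<open>V0\<close> and 1. Since \<open>gt\<close> has the smaller primitive, energy at most
  \<open>c\<close> for the problem \<open>(om, \<tau>)\<close> and at least \<open>c\<close> for the
  reference forces \<open>om <= V0\<close>.\<close>

lemma level_compare:
 assumes A: "adm (%_. om) (%_. \<tau>)" and u: "Nh (%_. om) (%_. \<tau>) u v" and J: "Jf (%_. om) (%_. \<tau>) u v <= c"
  and c: "!!z z'. Nh (%_. V0) (%_. 1) z z' ==> c <= Jf (%_. V0) (%_. 1) z z'"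
 shows "om = V0"
proof -
 have A1: "adm (%_. V0) (%_. 1)" by (intro adm_const) (use V0 in auto)
 have U: "Wsp u v" using u by (simp add: Nh_def)
 note u2 = sq_int_integrable[OF WspD(1)[OF U]]
 have nz: "\<not> (AE x in lborel. u x = 0)"
 proof
  assume "AE x in lborel. u x = 0"
  hence "AE x in lborel. \<tau> * u x = 0" by eventually_elim simp
  thus False using Nh_nonzero[OF A u] by simp
 qed
 then obtain t where t: "t > 0" and Nt: "Nh (%_. V0) (%_. 1) (%x. t * u x) (%x. t * v x)" using Nh_projection[OF A1 U] by auto
 note Ut = Wsp_cmult[OF U, of t]
 have "LI (GG (%_. \<tau>) (%x. t * u x)) <= LI (GG (%_. 1) (%x. t * u x))"
 proof (rule integral_mono[OF gg_int(2)[OF A Ut Ut] gg_int(2)[OF A1 Ut Ut]])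
  fix x
  have "(1 - \<tau>) * prim gt (t * u x) <= (1 - \<tau>) * prim f (t * u x)" using prim_gt_le_f A by (intro mult_left_mono) (auto simp: adm_def)
  thus "GG (%_. \<tau>) (%x. t * u x) x <= GG (%_. 1) (%x. t * u x) x" by (simp add: GG_def algebra_simps)
 qed
 moreover have "c <= Jf (%_. V0) (%_. 1) (%x. t * u x) (%x. t * v x)" by (rule c[OF Nt])
 moreover have "Jf (%_. om) (%_. \<tau>) (%x. t * u x) (%x. t * v x) <= c" using Jf_scaling[OF A u, of t] J t by linarith
 ultimately have "Qf (%_. om) (%x. t * u x) (%x. t * v x) <= Qf (%_. V0) (%x. t * u x) (%x. t * v x)" unfolding Jf_def by linarith
 hence "om * sqn u <= V0 * sqn u" unfolding Qf_scale using t by (simp add: Qf_def)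
 hence "om <= V0" using square_integral_pos[OF WspD(1)[OF U] nz] by simp
 thus ?thesis using A by (simp add: adm_def)
qed

lemma Wsp_cong:
 assumes U: "Wsp u v" and ae: "AE x in lborel. u x = u' x" and m: "u' \<in> bmeas"
 shows "Wsp u' v"
proof -
 note [measurable] = WspD(3,4)[OF U] m
 have "sq_int lborel u'" by (rule sq_int_bound[OF WspD(1)[OF U], of _ 1]) (use ae in auto)
 moreover have "LI (%x. u' x * lap g x) = LI (%x. u x * lap g x)" if "test_fun g" for g
 proof -
  note [measurable] = test_fun_measurable[OF test_fun_lap[OF that]]
  show ?thesis by (rule integral_cong_AE) (use ae in auto)
 qed
 ultimately show ?thesis using WspD[OF U] by (simp add: Wsp_def)
qed

lemma penal_cong:
 assumes a: "adm W th" and U: "Wsp u v" and ae: "AE x in lborel. u x = u' x" and m: "u' \<in> bmeas"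
 shows "crit W th u v ==> crit W th u' v" "Nh W th u v ==> Nh W th u' v" "Jf W th u' v = Jf W th u v" "LI (%x. (u' x)^2) = sqn u"
proof -
 note [measurable] = WspD(3,4)[OF U] m admD(1,2)[OF a]
 have g: "LI (%x. gg th u' x * h x) = LI (%x. gg th u x * h x)" if [measurable]: "h \<in> bmeas" for h
  by (rule integral_cong_AE) (use ae in \<open>auto simp: gg_def\<close>)
 have g2: "LI (%x. gg th u' x * u' x) = LI (%x. gg th u x * u x)" by (rule integral_cong_AE) (use ae in \<open>auto simp: gg_def\<close>)
 have G: "LI (GG th u') = LI (GG th u)" by (rule integral_cong_AE) (use ae in \<open>auto simp: GG_def\<close>)
 have w: "LI (%x. W x * (u' x * h x)) = LI (%x. W x * (u x * h x))" if [measurable]: "h \<in> bmeas" for h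
  by (rule integral_cong_AE) (use ae in auto)
 have w2: "LI (%x. W x * (u' x)^2) = LI (%x. W x * (u x)^2)" by (rule integral_cong_AE) (use ae in auto)
 show "LI (%x. (u' x)^2) = sqn u" by (rule integral_cong_AE) (use ae in auto)
 note W = Wsp_cong[OF U ae m]
 show "crit W th u v ==> crit W th u' v" using W by (simp add: crit_def Bf_def g w WspD(3))
 show "Nh W th u v ==> Nh W th u' v" using W by (simp add: Nh_def Qf_def w2 g2)
 show "Jf W th u' v = Jf W th u v" by (simp add: Jf_def Qf_def w2 G)
qed

lemma crit_translate:
 assumes a: "adm W th" and s: "crit W th u v"
 shows "adm (%x. W (y + x)) (%x. th (y + x))" "crit (%x. W (y + x)) (%x. th (y + x)) (%x. u (y + x)) (%x. v (y + x))"
  "LI (%x. (u (y + x))^2) = sqn u" "LI (%x. (v (y + x))^2) = sqn v"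
  "LI (%x. gg (%x. th (y + x)) (%x. u (y + x)) x * u (y + x) / 2 - GG (%x. th (y + x)) (%x. u (y + x)) x) = LI (%x. gg th u x * u x / 2 - GG th u x)"
proof -
 have U: "Wsp u v" using s by (simp add: crit_def)
 note [measurable] = WspD(3,4)[OF U] admD(1,2)[OF a]
 have gy: "gg (%x. th (y + x)) (%x. u (y + x)) x = gg th u (y + x)" "GG (%x. th (y + x)) (%x. u (y + x)) x = GG th u (y + x)" for x by (simp_all add: gg_def GG_def)
 show "adm (%x. W (y + x)) (%x. th (y + x))" using a by (simp add: adm_def)
 show "LI (%x. (u (y + x))^2) = sqn u" "LI (%x. (v (y + x))^2) = sqn v" by (rule LI_translate; measurable)+
 show "LI (%x. gg (%x. th (y + x)) (%x. u (y + x)) x * u (y + x) / 2 - GG (%x. th (y + x)) (%x. u (y + x)) x) = LI (%x. gg th u x * u x / 2 - GG th u x)"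
  unfolding gy by (rule LI_translate[of "%x. gg th u x * u x / 2 - GG th u x"]) measurable
 have "Bf (%x. W (y + x)) (%x. u (y + x)) (%x. v (y + x)) h k = LI (%x. gg th u (y + x) * h x)" if hk: "Wsp h k" for h k
 proof -
  have hk': "Wsp (%x. h (x - y)) (%x. k (x - y))" using Wsp_affine[OF hk, of 1 "-y"] by simp
  note [measurable] = WspD(3,4)[OF hk']
  note e = LI_translate[of "%x. v x * k (x - y)" y] LI_translate[of "%x. W x * (u x * h (x - y))" y] LI_translate[of "%x. gg th u x * h (x - y)" y]
  have "LI (%x. v (y + x) * k x) = LI (%x. v x * k (x - y))" "LI (%x. W (y + x) * (u (y + x) * h x)) = LI (%x. W x * (u x * h (x - y)))"
   "LI (%x. gg th u (y + x) * h x) = LI (%x. gg th u x * h (x - y))" using e by simp_all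
  thus ?thesis using s hk' by (simp add: crit_def Bf_def)
 qed
 thus "crit (%x. W (y + x)) (%x. th (y + x)) (%x. u (y + x)) (%x. v (y + x))"
  using Wsp_affine[OF U, of 1 y] by (simp add: crit_def gy)
qed

text \<open>A critical point has \<open>gg th u - W * u\<close> as the weak Laplacian of
  \<open>v\<close>. Its growth constant \<open>2 * cA + V1\<close> depends on neither
  \<open>W\<close> nor \<open>th\<close>, so one \<open>B\<close> serves all rescaled problems and
  all translates.\<close>

lemma crit_regular:
 assumes C: "C >= 0"
 shows "\<exists>B>0. \<forall>W th u v. adm W th --> crit W th u v --> sqn u + sqn v <= C -->
  (\<exists>u'. (AE x in lborel. u x = u' x) & (\<forall>x. \<bar>u' x\<bar> <= B) & (\<forall>x y. \<bar>u' x - u' y\<bar> <= B * norm (x - y)))"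
proof -
 define C0 where "C0 = 2 * cA + V1"
 have C0: "C0 >= 0" using cA V0 by (simp add: C0_def)
 obtain B where B: "B > 0" "!!(u :: real^'n => real) v h. reg_data p C C0 u v h ==>
  (\<exists>u'. (AE x in lborel. u x = u' x) & (\<forall>x. \<bar>u' x\<bar> <= B) & (\<forall>x y. \<bar>u' x - u' y\<bar> <= B * norm (x - y)))"
  using uniform_regularity[OF N p C C0] by blast
 have "reg_data p C C0 u v (%x. gg th u x + (-1) * (W x * u x))"
  if a: "adm W th" and s: "crit W th u v" and bd: "sqn u + sqn v <= C" for W th u v
  unfolding reg_data_def
 proof (intro conjI allI impI bd)
  show U: "Wsp u v" using s by (simp add: crit_def)
  note [measurable] = WspD(3,4)[OF U] admD(1,2)[OF a]
  have Wu: "sq_int lborel (%x. W x * u x)"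
   by (rule sq_int_bound[OF WspD(1)[OF U], of _ V1]) (use admD[OF a] in \<open>auto simp: abs_mult intro!: AE_I2 mult_right_mono\<close>)
  have ggl: "Lint (%x. gg th u x * h x)" if "Lpp h" for h using admD[OF a] Wsp_Lpp[OF U] that by (intro gg_integrable)
  have "loc_int (gg th u)" unfolding loc_int_def
  proof (intro conjI allI)
   fix R :: real
   have i: "Lint (indicator (cball 0 R) :: real^'n => real)" by (intro integrable_real_indicator emeasure_bounded_finite) auto
   have "(%x. \<bar>indicator (cball 0 R) x :: real\<bar> powr (p + 1)) = (indicator (cball 0 R) :: real^'n => real)" "(%x. (indicator (cball 0 R) x :: real)^2) = (indicator (cball 0 R) :: real^'n => real)"
    by (auto simp: indicator_def fun_eq_iff)
   hence "Lpp (indicator (cball 0 R))" using i by (simp add: Lpp_def sq_int_def borel_measurable_indicator)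
   from ggl[OF this] show "Lint (%x. indicator (cball 0 R) x * gg th u x)" by (simp add: mult.commute)
  qed measurable
  thus "loc_int (%x. gg th u x + (-1) * (W x * u x))" by (rule loc_int_add_cmult[OF _ sq_int_loc_int[OF Wu]])
  fix h :: "real^'n => real" assume h: "test_fun h"
  note hW = test_fun_Wsp[OF h]
  have "LI (%x. v x * lap h x) + LI (%x. W x * (u x * h x)) = LI (%x. gg th u x * h x)" using s hW by (simp add: crit_def Bf_def)
  thus "LI (%x. v x * lap h x) = LI (%x. (gg th u x + (-1) * (W x * u x)) * h x)"
   using ggl[OF Wsp_Lpp[OF hW]] sq_int_mult[OF Wu test_fun_sq_int[OF h]] by (simp add: left_diff_distrib mult.assoc)
 next
  fix x
  have "\<bar>u x\<bar> <= 1 + \<bar>u x\<bar> powr p"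
  proof (cases "\<bar>u x\<bar> <= 1")
   case False
   hence "\<bar>u x\<bar> powr 1 <= \<bar>u x\<bar> powr p" using p by (intro powr_mono) auto
   thus ?thesis by simp
  qed (simp add: add_increasing2)
  hence b: "cA * (\<bar>u x\<bar> + \<bar>u x\<bar> powr p) <= cA * (2 * (1 + \<bar>u x\<bar> powr p))" "V1 * \<bar>u x\<bar> <= V1 * (1 + \<bar>u x\<bar> powr p)"
   using cA V0 by (auto intro!: mult_left_mono)
  have "\<bar>gg th u x + (-1) * (W x * u x)\<bar> <= \<bar>gg th u x\<bar> + \<bar>W x\<bar> * \<bar>u x\<bar>" using abs_triangle_ineq4[of "gg th u x" "W x * u x"] by (simp add: abs_mult)
  also have "\<dots> <= cA * (\<bar>u x\<bar> + \<bar>u x\<bar> powr p) + V1 * \<bar>u x\<bar>" using gg_bound[of th x u, OF admD(5,6)[OF a] order_refl] admD(7)[OF a, of x] by (intro add_mono mult_right_mono) auto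
  also have "\<dots> <= C0 * (1 + \<bar>u x\<bar> powr p)" using b by (simp add: C0_def algebra_simps)
  finally show "\<bar>gg th u x + (-1) * (W x * u x)\<bar> <= C0 * (1 + \<bar>u x\<bar> powr p)" .
 qed
 thus ?thesis using B by blast
qed

end

text \<open>\<open>V x0 = V0\<close> and \<open>ch x0 = 1\<close> make the rescaled problems tend to
  the reference problem with coefficients \<open>V0\<close> and 1; \<open>near\<close> says that
  below the threshold \<open>a\<close> the truncation is inactive and the slope already at most
  \<open>\<kappa>\<close>.\<close>

locale concentration = penal f gt V0 V1 cA p \<mu> \<nu> \<kappa> ty
 for f gt :: "real => real" and V0 V1 cA p \<mu> \<nu> \<kappa> :: real and ty :: "'n::finite itself" +
 fixes V ch :: "real^'n => real" and x0 :: "real^'n" and eps :: "nat => real" and a R :: real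
 assumes contV: "continuous_on UNIV V" "!!x. V0 <= V x" "!!x. V x <= V1" "V x0 = V0"
  and contch: "continuous_on UNIV ch" "!!x. 0 <= ch x" "!!x. ch x <= 1" "ch x0 = 1" "!!x. R < norm x ==> ch x = 0"
  and eps: "!!n. eps n > 0" "eps -->> 0" and a: "a > 0"
  and near: "!!s. \<bar>s\<bar> <= a ==> gt s = f s" "!!s. \<bar>s\<bar> <= a ==> s * f s <= \<kappa> * s\<^sup>2"
begin

definition "Wn n x = V (x0 + eps n *\<^sub>R x)"
definition "tn n x = ch (x0 + eps n *\<^sub>R x)"

lemma adm_n: "adm (Wn n) (tn n)"
proof -
 note [measurable] = borel_measurable_continuous_onI[OF contV(1)] borel_measurable_continuous_onI[OF contch(1)]
 show ?thesis unfolding adm_def Wn_def[abs_def] tn_def[abs_def] using contV contch by auto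
qed

lemma adm_0: "adm (%_. V0) (%_. 1)" by (intro adm_const) (use V0 in auto)

lemma tn_integrable: "Lint (tn n)"
proof -
 have "Lint ch"
 proof (rule integrable_bnd)
  show "Lint (indicator (cball 0 R) :: real^'n => real)" by (intro integrable_real_indicator emeasure_bounded_finite) auto
  show "AE x in lborel. norm (ch x) <= norm (indicator (cball 0 R) x :: real)" using contch by (intro AE_I2) (auto simp: indicator_def not_le)
 qed (use borel_measurable_continuous_onI[OF contch(1)] in simp)
 from integrable_lborel_affine[OF this, of "eps n" x0] show ?thesis using eps(1)[of n] by (simp add: tn_def[abs_def])
qed

lemma tends_x0: "(%n. Wn n x) -->> V0" "(%n. tn n x) -->> 1"
proof -
 have "(%n. x0 + eps n *\<^sub>R x) -->> x0 + 0 *\<^sub>R x" by (intro tendsto_intros eps)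
 hence l: "(%n. x0 + eps n *\<^sub>R x) -->> x0" by simp
 show "(%n. Wn n x) -->> V0" "(%n. tn n x) -->> 1"
  using continuous_on_tendsto_compose[OF contV(1) l] continuous_on_tendsto_compose[OF contch(1) l] contV(4) contch(4) by (auto simp: Wn_def tn_def)
qed

text \<open>A fixed Nehari function of the reference problem is nearly on the rescaled Nehari sets.
  A projection factor within 1/2 of 1 is enough: \<open>Jf_scale_le\<close> multiplies a bounded
  factor by a defect that tends to zero.\<close>

lemma level_upper:
 assumes u: "Nh (%_. V0) (%_. 1) u v" and e: "e > 0"
 shows "\<forall>\<^sub>F n in sequentially. \<exists>z z'. Nh (Wn n) (tn n) z z' & Jf (Wn n) (tn n) z z' <= Jf (%_. V0) (%_. 1) u v + e"
proof -
 have U: "Wsp u v" and Q0: "Qf (%_. V0) u v = LI (%x. gg (%_. 1) u x * u x)" using u by (auto simp: Nh_def)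
 note u2 = sq_int_integrable[OF WspD(1)[OF U]]
 note [measurable] = WspD(3)[OF U] admD(1,2)[OF adm_n]
 have "(%n. LI (%x. Wn n x * (u x)^2)) -->> LI (%x. V0 * (u x)^2)"
 proof (rule integral_dominated_convergence[where w="%x. V1 * (u x)^2"])
  show "AE x in lborel. (%n. Wn n x * (u x)^2) -->> V0 * (u x)^2" by (intro AE_I2 tendsto_intros tends_x0)
  show "AE x in lborel. norm (Wn n x * (u x)^2) <= V1 * (u x)^2" for n
   using admD(7)[OF adm_n] by (intro AE_I2) (auto simp: abs_mult intro: mult_right_mono)
 qed (use u2 in auto)
 hence Q: "(%n. Qf (Wn n) u v) -->> Qf (%_. V0) u v" unfolding Qf_def by (intro tendsto_intros)
 have g: "(%n. LI (%x. gg (tn n) u x * u x)) -->> LI (%x. gg (%_. 1) u x * u x)" "(%n. LI (%x. GG (tn n) u x)) -->> LI (%x. GG (%_. 1) u x)"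
  by (rule gg_dominated[where w=u and u="%_. u" and h="%_. u"]; use admD[OF adm_n] tends_x0 Wsp_Lpp[OF U] in auto)+
 have near1: "\<forall>\<^sub>F n in sequentially. \<exists>t. 1 - 1/2 <= t & t <= 1 + 1/2 & Nh (Wn n) (tn n) (%x. t * u x) (%x. t * v x)"
  by (rule Nh_near[OF adm_n adm_0 u U Wsp_Lpp[OF U] _ _ _ Q]) (use tends_x0 in auto)
 have "(%n. (Qf (Wn n) u v / 2 - LI (%x. GG (tn n) u x)) + 2 * \<bar>Qf (Wn n) u v - LI (%x. gg (tn n) u x * u x)\<bar>) -->>
  (Qf (%_. V0) u v / 2 - LI (%x. GG (%_. 1) u x)) + 2 * \<bar>Qf (%_. V0) u v - LI (%x. gg (%_. 1) u x * u x)\<bar>"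
  by (intro tendsto_intros Q g) auto
 hence "(%n. Jf (Wn n) (tn n) u v + 2 * \<bar>Qf (Wn n) u v - LI (%x. gg (tn n) u x * u x)\<bar>) -->> Jf (%_. V0) (%_. 1) u v" by (simp add: Jf_def Q0)
 hence "\<forall>\<^sub>F n in sequentially. Jf (Wn n) (tn n) u v + 2 * \<bar>Qf (Wn n) u v - LI (%x. gg (tn n) u x * u x)\<bar> < Jf (%_. V0) (%_. 1) u v + e"
  using e by (intro order_tendstoD) auto
 with near1 show ?thesis
 proof eventually_elim
  case (elim n)
  then obtain t where t: "1/2 <= t" "t <= 3/2" and Nt: "Nh (Wn n) (tn n) (%x. t * u x) (%x. t * v x)" by auto
  define q where "q = Qf (Wn n) u v - LI (%x. gg (tn n) u x * u x)"
  have *: "\<bar>(y - 1) / 2\<bar> <= 2" if "0 <= y" "y <= 9/4" for y :: real using that by auto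
  have "t\<^sup>2 <= (3/2)\<^sup>2" using t by (intro power_mono) auto
  hence "\<bar>(t\<^sup>2 - 1) / 2\<bar> <= 2" by (intro *) (auto simp: power2_eq_square)
  hence "\<bar>(t\<^sup>2 - 1) / 2\<bar> * \<bar>q\<bar> <= 2 * \<bar>q\<bar>" by (rule mult_right_mono) simp
  hence "(t\<^sup>2 - 1) / 2 * q <= 2 * \<bar>q\<bar>" unfolding abs_mult[symmetric] by (rule order_trans[OF abs_ge_self])
  hence "Jf (Wn n) (tn n) (%x. t * u x) (%x. t * v x) <= Jf (%_. V0) (%_. 1) u v + e"
   using Jf_scale_le[OF adm_n U, of t n] t elim(2) unfolding q_def by linarith
  thus ?case using Nt by blast
 qed
qed

text \<open>Below the threshold both nonlinearities have slope at most \<open>V0 / 2\<close>, so the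
  Nehari identity would bound \<open>Qf\<close> by half of itself.\<close>

lemma Nh_attains:
 assumes u: "Nh (Wn n) (tn n) u v" shows "\<exists>y. a <= \<bar>u y\<bar>"
proof (rule ccontr)
 assume "\<not> ?thesis"
 hence ua: "\<bar>u y\<bar> <= a" for y by (meson le_cases)
 have U: "Wsp u v" and Q: "0 < Qf (Wn n) u v" "Qf (Wn n) u v = LI (%x. gg (tn n) u x * u x)" using u by (auto simp: Nh_def)
 note u2 = sq_int_integrable[OF WspD(1)[OF U]]
 have "LI (%x. gg (tn n) u x * u x) <= LI (%x. V0 / 2 * (u x)^2)"
 proof (rule integral_mono[OF gg_int(1)[OF adm_n U U]])
  fix x
  have "gg (tn n) u x = f (u x)" using near(1)[OF ua] by (simp add: gg_def algebra_simps)
  thus "gg (tn n) u x * u x <= V0 / 2 * (u x)^2" using near(2)[OF ua, of x] mult_right_mono[OF kappa(2), of "(u x)^2"] by (simp add: mult.commute)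
 qed (use u2 in simp)
 also have "\<dots> <= Qf (Wn n) u v / 2" using Qf_lower(1)[OF adm_n U, of n] by simp
 finally show False using Q by linarith
qed

lemma Nh_0_exists: "\<exists>u v. Nh (%_. V0) (%_. 1) u v"
proof -
 have "\<not> (AE x in lborel. 1 * rho (x :: real^'n) = 0)"
 proof
  assume "AE x in lborel. 1 * rho (x :: real^'n) = 0"
  hence "LI (%x :: real^'n. rho x) = 0" by (intro integral_eq_zero_AE) simp
  thus False using integral_rho[where 'n='n] by simp
 qed
 from Nh_projection[OF adm_0 test_fun_Wsp[OF test_fun_rho] this] show ?thesis by blast
qed

definition good where
 "good B C n u v \<longleftrightarrow> Nh (Wn n) (tn n) u v & crit (Wn n) (tn n) u v & (\<forall>z z'. Nh (Wn n) (tn n) z z' --> Jf (Wn n) (tn n) u v <= Jf (Wn n) (tn n) z z') &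
  sqn u + sqn v <= C & (\<forall>x. \<bar>u x\<bar> <= B) & (\<forall>x y. \<bar>u x - u y\<bar> <= B * norm (x - y))"

text \<open>If concentration failed, there would be points with \<open>\<bar>u\<bar> >= a\<close>
  along arbitrarily large indices. Either the cutoff tends to zero around their images, which
  \<open>crit_vanishing\<close> excludes, or a subsequence of the images converges to some
  \<open>b\<close>, where level comparison gives \<open>V b = V0\<close> and
  \<open>ch b > 0\<close>; continuity contradicts both ways of being bad.\<close>

lemma solutions_concentrate:
 "\<exists>u v B. (\<forall>\<^sub>F n in sequentially. crit (Wn n) (tn n) (u n) (v n) & (\<forall>x y. \<bar>u n x - u n y\<bar> <= B * norm (x - y)) & (\<exists>y. a <= \<bar>u n y\<bar>)) &
  (\<forall>d>0. \<forall>\<^sub>F n in sequentially. \<forall>y. a <= \<bar>u n y\<bar> --> V (x0 + eps n *\<^sub>R y) < V0 + d & 0 < ch (x0 + eps n *\<^sub>R y))"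
proof -
 define S where "S = {Jf (%_. V0) (%_. 1) z z' | z z'. Nh (%_. V0) (%_. 1) z z'}"
 define c where "c = Inf S"
 have Sne: "S \<noteq> {}" using Nh_0_exists by (auto simp: S_def)
 have S0: "0 <= s" if "s \<in> S" for s
 proof -
  obtain z z' where z: "s = Jf (%_. V0) (%_. 1) z z'" "Nh (%_. V0) (%_. 1) z z'" using \<open>s \<in> S\<close> by (auto simp: S_def)
  thus ?thesis using Nh_energy(2)[OF adm_0 z(2)] nu_pos by (smt (verit) Nh_def mult_pos_pos half_gt_zero)
 qed
 have cl: "c <= Jf (%_. V0) (%_. 1) z z'" if "Nh (%_. V0) (%_. 1) z z'" for z z' unfolding c_def
  using that S0 by (intro cInf_lower bdd_belowI[of _ 0]) (auto simp: S_def)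
 have c0: "0 <= c" unfolding c_def using Sne S0 by (intro cInf_greatest)
 have lev: "\<forall>\<^sub>F n in sequentially. \<exists>z z'. Nh (Wn n) (tn n) z z' & Jf (Wn n) (tn n) z z' <= c + e" if e: "e > 0" for e
 proof -
  have "\<exists>s\<in>S. s < c + e / 2" by (rule cInf_lessD[OF Sne]) (use e in \<open>simp add: c_def\<close>)
  then obtain z z' where z: "Nh (%_. V0) (%_. 1) z z'" "Jf (%_. V0) (%_. 1) z z' < c + e / 2" by (auto simp: S_def)
  from level_upper[OF z(1) half_gt_zero[OF e]] show ?thesis
  proof eventually_elim
   case (elim n)
   then obtain y y' where "Nh (Wn n) (tn n) y y'" "Jf (Wn n) (tn n) y y' <= Jf (%_. V0) (%_. 1) z z' + e / 2" by blast
   moreover from this(2) have "Jf (Wn n) (tn n) y y' <= c + e" using z(2) by simp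
   ultimately show ?case by blast
  qed
 qed
 define C where "C = (1 / V0 + 1) * (2 * (c + 1) / \<nu>)"
 have C: "C >= 0" using V0 c0 nu_pos by (simp add: C_def)
 obtain B where B: "B > 0" "!!W th u v. adm W th ==> crit W th u v ==> sqn u + sqn v <= C ==>
  (\<exists>u'. (AE x in lborel. u x = u' x) & (\<forall>x. \<bar>u' x\<bar> <= B) & (\<forall>x y. \<bar>u' x - u' y\<bar> <= B * norm (x - y)))"
  using crit_regular[OF C] by blast
 have "\<forall>\<^sub>F n in sequentially. \<exists>u v. good B C n u v" using lev[OF zero_less_one]
 proof eventually_elim
  case (elim n)
  then obtain z z' where z: "Nh (Wn n) (tn n) z z'" "Jf (Wn n) (tn n) z z' <= c + 1" by blast
  obtain u v where u: "Nh (Wn n) (tn n) u v" and mn: "!!z z'. Nh (Wn n) (tn n) z z' ==> Jf (Wn n) (tn n) u v <= Jf (Wn n) (tn n) z z'"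
   using minimiser_exists[OF adm_n tn_integrable z(1)] by blast
  have U: "Wsp u v" using u by (simp add: Nh_def)
  have s: "crit (Wn n) (tn n) u v" unfolding crit_def using U minimiser_critical[OF adm_n u mn] by blast
  have bd: "sqn u + sqn v <= C" unfolding C_def by (rule Nh_bounded[OF adm_n u]) (use mn[OF z(1)] z(2) in linarith)
  obtain u' where ae: "AE x in lborel. u x = u' x" and u': "\<forall>x. \<bar>u' x\<bar> <= B" "\<forall>x y. \<bar>u' x - u' y\<bar> <= B * norm (x - y)"
   using B(2)[OF adm_n s bd] by blast
  have "continuous_on UNIV u'"
   by (rule lipschitz_on_continuous_on[OF lipschitz_onI[of _ _ B]]) (use u'(2) B in \<open>auto simp: dist_norm\<close>)
  hence m: "u' \<in> bmeas" by (rule borel_measurable_continuous_onI)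
  note pc = penal_cong[OF adm_n[of n] U ae m]
  have "good B C n u' v" unfolding good_def using pc(1)[OF s] pc(2)[OF u] mn pc(3,4) bd u' by simp
  thus ?case by blast
 qed
 \<comment> \<open>Choice under a guard, so that \<open>u\<close> and \<open>v\<close> are defined
   for all indices although solutions exist only for large ones.\<close>
 moreover obtain u where "\<forall>n. (\<exists>u v. good B C n u v) --> (\<exists>v. good B C n (u n) v)"
  using choice[of "%n u. (\<exists>u v. good B C n u v) --> (\<exists>v. good B C n u v)"] by blast
 moreover obtain v where "\<forall>n. (\<exists>v. good B C n (u n) v) --> good B C n (u n) (v n)"
  using choice[of "%n v. (\<exists>v. good B C n (u n) v) --> good B C n (u n) v"] by blast
 ultimately have gd: "\<forall>\<^sub>F n in sequentially. good B C n (u n) (v n)" by (auto elim!: eventually_mono)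
 then obtain n0 where n0: "!!n. n >= n0 ==> good B C n (u n) (v n)" by (auto simp: eventually_sequentially)
 show ?thesis
 proof (intro exI conjI allI impI)
  show "\<forall>\<^sub>F n in sequentially. crit (Wn n) (tn n) (u n) (v n) & (\<forall>x y. \<bar>u n x - u n y\<bar> <= B * norm (x - y)) & (\<exists>y. a <= \<bar>u n y\<bar>)"
   using gd by eventually_elim (auto simp: good_def dest: Nh_attains)
  fix d :: real assume d: "d > 0"
  define bad where "bad n y \<longleftrightarrow> a <= \<bar>u n y\<bar> & \<not> (V (x0 + eps n *\<^sub>R y) < V0 + d & 0 < ch (x0 + eps n *\<^sub>R y))" for n y
  show "\<forall>\<^sub>F n in sequentially. \<forall>y. a <= \<bar>u n y\<bar> --> V (x0 + eps n *\<^sub>R y) < V0 + d & 0 < ch (x0 + eps n *\<^sub>R y)"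
  proof (rule ccontr)
   assume "\<not> ?thesis"
   \<comment> \<open>The offset \<open>n0\<close> keeps all chosen indices in the range where the
     solutions are good.\<close>
   hence "\<forall>m. \<exists>n y. n >= m + n0 & bad n y" unfolding eventually_sequentially bad_def by blast
   then obtain s where "\<forall>m. \<exists>y. s m >= m + n0 & bad (s m) y" by (rule choice[THEN exE])
   then obtain y where sy: "\<forall>m. s m >= m + n0 & bad (s m) (y m)" by (rule choice[THEN exE])
   define pt where "pt m = x0 + eps (s m) *\<^sub>R y m" for m
   \<comment> \<open>Recentring at the points \<open>y\<close> along any index sequence brings the solutions into the setting of the compactness lemmas.\<close>
   have centre: False if i: "!!m. i m >= m" and lim: "(\<forall>x. (%m. ch (pt (i m) + eps (s (i m)) *\<^sub>R x)) -->> 0) \<or> (%m. pt (i m)) -->> b" for i :: "nat => nat" and b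
   proof -
    define k where "k m = s (i m)" for m
    define z where "z m = y (i m)" for m
    have k: "k m >= m" "k m >= n0" for m using sy i[of m] by (auto simp: k_def intro: order_trans add_leD1 add_leD2)
    have kt: "filterlim k at_top sequentially" by (rule filterlim_at_top_mono[OF filterlim_ident]) (use k in auto)
    have G: "good B C (k m) (u (k m)) (v (k m))" for m by (rule n0[OF k(2)])
    have cr: "crit (Wn (k m)) (tn (k m)) (u (k m)) (v (k m))" for m using G by (simp add: good_def)
    note T = crit_translate[OF adm_n cr]
    have A: "adm (%x. Wn (k m) (z m + x)) (%x. tn (k m) (z m + x))" for m by (rule T(1))
    have X: "crit (%x. Wn (k m) (z m + x)) (%x. tn (k m) (z m + x)) (%x. u (k m) (z m + x)) (%x. v (k m) (z m + x))" for m by (rule T(2))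
    have bd: "LI (%x. (u (k m) (z m + x))^2) + LI (%x. (v (k m) (z m + x))^2) <= C" for m using G[of m] by (simp add: T(3,4) good_def)
    have b1: "\<bar>u (k m) (z m + x)\<bar> <= B" for m x using G[of m] by (simp add: good_def)
    have b2: "\<bar>u (k m) (z m + x) - u (k m) (z m + x')\<bar> <= B * norm (x - x')" for m x x'
    proof -
     have "\<bar>u (k m) (z m + x) - u (k m) (z m + x')\<bar> <= B * norm ((z m + x) - (z m + x'))" using G[of m] unfolding good_def by blast
     thus ?thesis by simp
    qed
    have lo: "a <= \<bar>u (k m) (z m + 0)\<bar>" for m using sy by (simp add: bad_def k_def z_def)
    have arg: "x0 + eps (k m) *\<^sub>R (z m + x) = pt (i m) + eps (k m) *\<^sub>R x" for m x by (simp add: pt_def k_def z_def scaleR_add_right)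
    show False
    proof (cases "\<forall>x. (%m. ch (pt (i m) + eps (k m) *\<^sub>R x)) -->> 0")
     case True
     show False by (rule crit_vanishing[where W="%m x. Wn (k m) (z m + x)" and th="%m x. tn (k m) (z m + x)" and u="%m x. u (k m) (z m + x)" and v="%m x. v (k m) (z m + x)", OF A X bd b1 b2 a lo]) (use True in \<open>simp add: tn_def arg\<close>)
    next
     case False
     hence b: "(%m. pt (i m)) -->> b" using lim unfolding k_def by blast
     have "(%m. pt (i m) + eps (k m) *\<^sub>R x) -->> b + 0 *\<^sub>R x" for x by (intro tendsto_intros b filterlim_compose[OF eps(2) kt])
     hence pl: "(%m. pt (i m) + eps (k m) *\<^sub>R x) -->> b" for x by simp
     have Vl: "(%m. Wn (k m) (z m + x)) -->> V b" "(%m. tn (k m) (z m + x)) -->> ch b" for x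
      using continuous_on_tendsto_compose[OF contV(1) pl] continuous_on_tendsto_compose[OF contch(1) pl] by (auto simp: Wn_def tn_def arg)
     have E: "\<forall>\<^sub>F m in sequentially. LI (%x. gg (%x. tn (k m) (z m + x)) (%x. u (k m) (z m + x)) x * u (k m) (z m + x) / 2 - GG (%x. tn (k m) (z m + x)) (%x. u (k m) (z m + x)) x) <= c + e" if e: "e > 0" for e
      using eventually_compose_filterlim[OF lev[OF e] kt]
     proof eventually_elim
      case (elim m)
      then obtain w w' where w: "Nh (Wn (k m)) (tn (k m)) w w'" "Jf (Wn (k m)) (tn (k m)) w w' <= c + e" by blast
      have Nk: "Nh (Wn (k m)) (tn (k m)) (u (k m)) (v (k m))" "Jf (Wn (k m)) (tn (k m)) (u (k m)) (v (k m)) <= Jf (Wn (k m)) (tn (k m)) w w'" using G[of m] w by (auto simp: good_def)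
      show ?case unfolding T(5) using w(2) Nk(2) Nh_energy(1)[OF adm_n Nk(1)] by linarith
     qed
     obtain u0 v0 where Ab: "adm (%_. V b) (%_. ch b)" and N0: "Nh (%_. V b) (%_. ch b) u0 v0" "Jf (%_. V b) (%_. ch b) u0 v0 <= c"
      using crit_concentration[OF A X bd b1 b2 a lo Vl(2) Vl(1) E] by blast
     have "V b = V0" by (rule level_compare[OF Ab N0 cl])
     moreover have "ch b > 0" using Nh_nonzero[OF Ab N0(1)] contch(2)[of b] by (cases "ch b = 0") auto
     ultimately have "\<forall>\<^sub>F m in sequentially. Wn (k m) (z m + 0) < V0 + d" "\<forall>\<^sub>F m in sequentially. 0 < tn (k m) (z m + 0)"
      using order_tendstoD(2)[OF Vl(1)[of 0], of "V0 + d"] order_tendstoD(1)[OF Vl(2)[of 0], of 0] d by auto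
     hence "\<forall>\<^sub>F m in sequentially. False"
     proof eventually_elim
      case (elim m)
      have "bad (k m) (z m)" using sy by (simp add: k_def z_def)
      thus ?case using elim by (simp add: bad_def Wn_def tn_def)
     qed
     thus False by simp
    qed
   qed
   show False
   proof (cases "\<exists>M. \<forall>m. \<exists>k\<ge>m. norm (pt k) <= M")
    case True
    then obtain M where "\<forall>m. \<exists>k. k >= m & norm (pt k) <= M" by blast
    then obtain k where k: "\<forall>m. k m >= m & norm (pt (k m)) <= M" by (rule choice[THEN exE])
    have "\<forall>m. (pt \<circ> k) m \<in> cball 0 M" using k by simp
    then obtain b r where r: "strict_mono (r :: nat => nat)" "((pt \<circ> k) \<circ> r) -->> b"
     using compact_cball[of "0 :: real^'n" M] unfolding compact_def by metis
    show False
    proof (rule centre[of "%m. k (r m)" b])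
     show "m <= k (r m)" for m using k seq_suble[OF r(1), of m] by (meson order_trans)
    qed (use r(2) in \<open>simp add: o_def\<close>)
   next
    \<comment> \<open>No bounded subsequence, so the images leave every ball. The shifts
      \<open>eps (s m) *\<^sub>R x\<close> stay bounded for fixed \<open>x\<close>, hence the cutoff
      vanishes eventually.\<close>
    case False
    have "(%m. ch (pt m + eps (s m) *\<^sub>R x)) -->> 0" for x
    proof (rule tendsto_eventually)
     obtain e where e: "!!n. eps n <= e" using convergent_imp_Bseq[of eps] eps(2) unfolding convergent_def Bseq_def by (metis abs_le_D1 real_norm_def)
     obtain m0 where m0: "!!m. m >= m0 ==> norm (pt m) > R + e * norm x" using False by (meson not_le)
     have "ch (pt m + eps (s m) *\<^sub>R x) = 0" if "m >= m0" for m
     proof (rule contch(5))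
      have "norm (eps (s m) *\<^sub>R x) <= e * norm x" using e[of "s m"] eps(1)[of "s m"] by (simp add: mult_right_mono)
      thus "R < norm (pt m + eps (s m) *\<^sub>R x)" using m0[OF that] norm_diff_ineq[of "pt m" "eps (s m) *\<^sub>R x"] by linarith
     qed
     thus "\<forall>\<^sub>F m in sequentially. ch (pt m + eps (s m) *\<^sub>R x) = 0" by (auto simp: eventually_sequentially)
    qed
    thus False by (intro centre[of "%m. m"]) auto
   qed
  qed
 qed
qed

end

section \<open>The penalisation and the rescaled solutions\<close>

text \<open>The inequality makes \<open>F s * s powr (- \<mu>)\<close> nondecreasing, so
  \<open>F\<close> grows at least like the power \<open>\<mu> > 2\<close>. \<open>T\<close> is where
  \<open>s powr (\<mu> - 2)\<close> exceeds \<open>\<bar>K\<bar> / (\<mu> * F 1)\<close>.\<close>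

lemma superlinear_of_AR:
 assumes F: "!!s. (F has_real_derivative f s) (at s)" and \<mu>: "\<mu> > 2" and AR: "!!s. s > 0 ==> 0 < \<mu> * F s & \<mu> * F s <= s * f s"
 shows "\<exists>T>0. \<forall>s\<ge>T. K * s\<^sup>2 <= s * f s"
proof -
 have F1: "F 1 > 0" using AR[of 1] \<mu> by (simp add: zero_less_mult_iff)
 have mono: "F 1 <= F s * s powr (-\<mu>)" if s: "s >= 1" for s
 proof -
  have "F 1 * 1 powr (-\<mu>) <= F s * s powr (-\<mu>)"
  proof (rule DERIV_nonneg_imp_nondecreasing[OF s])
   fix x :: real assume x: "1 <= x" "x <= s"
   have "((%x. F x * x powr (-\<mu>)) has_real_derivative f x * x powr (-\<mu>) + (- \<mu> * x powr (- \<mu> - 1)) * F x) (at x)"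
    by (rule DERIV_mult[OF F]) (use x in \<open>auto intro!: derivative_eq_intros simp: powr_diff\<close>)
   moreover have "f x * x powr (-\<mu>) + (- \<mu> * x powr (- \<mu> - 1)) * F x = x powr (-\<mu> - 1) * (x * f x - \<mu> * F x)"
    using x by (simp add: powr_diff field_simps)
   moreover have "0 <= \<dots>" using AR[of x] x by (intro mult_nonneg_nonneg) auto
   ultimately show "\<exists>y. ((%x. F x * x powr (-\<mu>)) has_real_derivative y) (at x) & 0 <= y" by metis
  qed
  thus ?thesis by simp
 qed
 define T where "T = max 1 ((\<bar>K\<bar> / (\<mu> * F 1)) powr (1 / (\<mu> - 2)))"
 have "K * s\<^sup>2 <= s * f s" if s: "s >= T" for s
 proof -
  have s1: "s >= 1" using s by (simp add: T_def)
  have "\<bar>K\<bar> / (\<mu> * F 1) = ((\<bar>K\<bar> / (\<mu> * F 1)) powr (1 / (\<mu> - 2))) powr (\<mu> - 2)" using \<mu> F1 by (simp add: powr_powr)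
  also have "\<dots> <= s powr (\<mu> - 2)" using s \<mu> by (intro powr_mono2) (auto simp: T_def)
  finally have "\<bar>K\<bar> <= s powr (\<mu> - 2) * (\<mu> * F 1)" using \<mu> F1 by (simp add: pos_divide_le_eq)
  hence "K * s\<^sup>2 <= s powr (\<mu> - 2) * (\<mu> * F 1) * s\<^sup>2" by (intro mult_right_mono) auto
  also have "\<dots> = \<mu> * (F 1 * s powr \<mu>)" using s1 by (simp add: powr_diff powr_numeral)
  also have "\<dots> <= \<mu> * (F s * s powr (-\<mu>) * s powr \<mu>)" using mono[OF s1] \<mu> by (intro mult_left_mono mult_right_mono) auto
  also have "\<dots> = \<mu> * F s" using s1 by (simp add: powr_minus)
  also have "\<dots> <= s * f s" using AR[of s] s1 by auto
  finally show ?thesis .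
 qed
 thus ?thesis by (intro exI[of _ T]) (auto simp: T_def)
qed

text \<open>Zero is the value that makes the quotient continuous, as the derivative of
  \<open>f\<close> at 0 vanishes.\<close>

definition quot :: "(real => real) => real => real" where "quot f s = (if s = 0 then 0 else f s / s)"

text \<open>The quotient \<open>f s / s\<close> is frozen outside \<open>[- a, a]\<close>, so the
  truncation is linear on either side and its monotonicity is inherited from that of the
  quotient.\<close>

definition trunc :: "real => (real => real) => real => real" where "trunc a f s = s * quot f (max (- a) (min a s))"

lemma quot_continuous:
 assumes f: "!!s. (f has_real_derivative f' s) (at s)" and z: "f 0 = 0" "f' 0 = 0"
 shows "continuous_on UNIV (quot f)"
proof (rule continuous_at_imp_continuous_on, rule ballI)
 fix s :: real
 show "isCont (quot f) s"
 proof (cases "s = 0")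
  case True
  have "(%h. f h / h) \<midarrow>0\<rightarrow> 0" using f[of 0] z by (simp add: has_field_derivative_iff)
  hence "quot f \<midarrow>0\<rightarrow> 0" by (rule Lim_transform_eventually) (auto simp: eventually_at quot_def intro!: exI[of _ 1])
  thus ?thesis using True by (simp add: isCont_def quot_def)
 next
  case False
  have "isCont (%x. f x / x) s" using DERIV_isCont[OF f] False by (intro continuous_intros)
  moreover have "\<forall>\<^sub>F x in nhds s. quot f x = f x / x" using t1_space_nhds[OF False] by eventually_elim (simp add: quot_def)
  ultimately show ?thesis by (simp add: isCont_cong)
 qed
qed

text \<open>On the overlap of the closed sets \<open>closure S\<close> and \<open>- S\<close>, the
  frontier, the formula vanishes by \<open>fr\<close>, so it glues with zero.\<close>

lemma cutoff_continuous:
 fixes V :: "'a::euclidean_space => real"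
 assumes V: "continuous_on UNIV V" and S: "open S" and d: "d > 0" and fr: "!!x. x \<in> frontier S ==> c <= V x"
 shows "continuous_on UNIV (%x. if x \<in> S then max 0 (min 1 ((c - V x) / d)) else 0)"
proof -
 have V': "continuous_on A V" for A using V continuous_on_subset by blast
 have "continuous_on (closure S \<union> - S) (%x. if x \<in> S then max 0 (min 1 ((c - V x) / d)) else 0)"
 proof (rule continuous_on_If)
  show "continuous_on (closure S) (%x. max 0 (min 1 ((c - V x) / d)))" using d by (intro continuous_intros V') auto
  show "max 0 (min 1 ((c - V x) / d)) = 0" if "x \<in> closure S" "x \<notin> S" for x
  proof -
   have "x \<in> frontier S" using that S by (simp add: frontier_def interior_open)
   hence "(c - V x) / d <= 0" using fr[of x] d by (intro divide_nonpos_pos) auto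
   thus ?thesis by (simp add: min_def)
  qed
 qed (use S in auto)
 moreover have "closure S \<union> - S = UNIV" using closure_subset by auto
 ultimately show ?thesis by simp
qed

text \<open>The weak Laplacian of the rescaled solution carries \<open>(1 / e)^2\<close> and that of
  the pulled-back test function \<open>e^2\<close>; with the factor \<open>e^4\<close> these
  balance, and the Jacobian is common to all three integrals.\<close>

lemma rescaled_solution:
 fixes u v V :: "real^'n::finite => real"
 assumes e: "e > 0" and U: "Wsp u v" and V: "V \<in> bmeas" "!!x. \<bar>V x\<bar> <= B" and f: "f \<in> bmeas"
  and eq: "!!h k. Wsp h k ==> LI (%x. v x * k x) + LI (%x. V (x0 + e *\<^sub>R x) * (u x * h x)) = LI (%x. f (u x) * h x)"
 shows "weak_solution e V f (%x. u ((1 / e) *\<^sub>R (x - x0)))"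
proof -
 define w where "w x = u ((- (1 / e)) *\<^sub>R x0 + (1 / e) *\<^sub>R x)" for x
 define w' where "w' x = (1 / e)^2 * v ((- (1 / e)) *\<^sub>R x0 + (1 / e) *\<^sub>R x)" for x
 have W: "Wsp w w'" unfolding w_def w'_def by (rule Wsp_affine[OF U]) (use e in simp)
 have ww: "w = (%x. u ((1 / e) *\<^sub>R (x - x0)))" by (simp add: w_def fun_eq_iff scaleR_diff_right)
 have bk: "(- (1 / e)) *\<^sub>R x0 + (1 / e) *\<^sub>R (x0 + e *\<^sub>R x) = x" for x using e by (simp add: scaleR_add_right)
 have wb: "w (x0 + e *\<^sub>R x) = u x" "w' (x0 + e *\<^sub>R x) = (1 / e)^2 * v x" for x by (simp_all only: w_def w'_def bk)
 note [measurable] = WspD(3,4)[OF W] V(1) f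
 have "weak_solution e V f w"
 proof (rule weak_solutionI[OF W V f])
  fix h k :: "real^'n => real" assume hk: "Wsp h k"
  note [measurable] = WspD(3,4)[OF hk]
  have hk': "Wsp (%x. h (x0 + e *\<^sub>R x)) (%x. e^2 * k (x0 + e *\<^sub>R x))" by (rule Wsp_affine[OF hk]) (use e in simp)
  define D where "D = \<bar>e\<bar> ^ DIM(real^'n)"
  have "LI (%x. w' x * k x) = D * LI (%x. (1 / e)^2 * v x * k (x0 + e *\<^sub>R x))"
   by (subst integral_lborel_affine[of _ e x0]) (use e in \<open>simp_all add: D_def wb\<close>)
  also have "(%x. (1 / e)^2 * v x * k (x0 + e *\<^sub>R x)) = (%x. (1 / e)^4 * (v x * (e^2 * k (x0 + e *\<^sub>R x))))"
   using e by (simp add: fun_eq_iff power_divide eval_nat_numeral)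
  finally have 1: "e^4 * LI (%x. w' x * k x) = D * LI (%x. v x * (e^2 * k (x0 + e *\<^sub>R x)))" using e by (simp add: power_divide)
  have 2: "LI (%x. V x * w x * h x) = D * LI (%x. V (x0 + e *\<^sub>R x) * (u x * h (x0 + e *\<^sub>R x)))"
   by (subst integral_lborel_affine[of _ e x0]) (use e in \<open>simp_all add: D_def wb mult.assoc\<close>)
  have 3: "LI (%x. f (w x) * h x) = D * LI (%x. f (u x) * h (x0 + e *\<^sub>R x))"
   by (subst integral_lborel_affine[of _ e x0]) (use e in \<open>simp_all add: D_def wb\<close>)
  show "e^4 * LI (%x. w' x * k x) + LI (%x. V x * w x * h x) = LI (%x. f (w x) * h x)"
   unfolding 1 2 3 using eq[OF hk'] by (simp add: distrib_left[symmetric])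
 qed
 thus ?thesis unfolding ww .
qed

text \<open>A maximum point has a meaning only for a definite representative, so the continuous one
  is produced. The subsequence can be taken to be a tail of the given sequence.\<close>

theorem theorem1:
  fixes V :: "real^'n::finite \<Rightarrow> real"
    and f f' :: "real \<Rightarrow> real"
    and \<Omega> :: "(real^'n) set" and x0 :: "real^'n"
    and c1 c2 p \<mu> :: real
    and eps :: "nat \<Rightarrow> real"
  assumes N5: "CARD('n) \<ge> 5"
    and V1: "continuous_on UNIV V" "bounded (range V)"
    and V2: "open \<Omega>" "connected \<Omega>" "bounded \<Omega>" "x0 \<in> \<Omega>"
            "0 < V x0" "V x0 = Inf (range V)" "V x0 < Inf (V ` frontier \<Omega>)"
    and f1: "\<And>s. (f has_real_derivative f' s) (at s)" "continuous_on UNIV f'"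
    and f2: "f 0 = 0" "f' 0 = 0"
    and f3: "c1 > 0" "c2 > 0" "1 < p"
            "p < 2 * real CARD('n) / (real CARD('n) - 4) - 1"
            "\<And>s. \<bar>f s\<bar> \<le> c1 * \<bar>s\<bar> + c2 * \<bar>s\<bar> powr p"
    and f4: "\<mu> > 2"
            "\<And>s. s \<noteq> 0 \<Longrightarrow> 0 < \<mu> * (LBINT t=0..s. f t) \<and> \<mu> * (LBINT t=0..s. f t) \<le> s * f s"
    and f5: "\<And>s t. 0 < s \<Longrightarrow> s < t \<Longrightarrow> f s / s < f t / t"
            "\<And>s t. s < t \<Longrightarrow> t < 0 \<Longrightarrow> f s / s > f t / t"
    and eps: "\<And>n. eps n > 0" "eps \<longlonglongrightarrow> 0"
  shows "\<exists>r u. strict_mono r \<and>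
           (\<forall>k. weak_solution (eps (r k)) V f (u k) \<and>
                \<not> (AE x in lebesgue. u k x = 0) \<and>
                continuous_on UNIV (u k)) \<and>
           (\<forall>k xk. (\<forall>y. \<bar>u k y\<bar> \<le> \<bar>u k xk\<bar>) \<longrightarrow> xk \<in> \<Omega>) \<and>
           (\<forall>xs. (\<forall>k. \<forall>y. \<bar>u k y\<bar> \<le> \<bar>u k (xs k)\<bar>) \<longrightarrow>
                 (\<lambda>k. V (xs k)) \<longlonglongrightarrow> Inf (range V))"
proof -

 \<comment> \<open>The cutoff determined by the potential\<close>
 define V0 where "V0 = V x0"
 define Vf where "Vf = Inf (V ` frontier \<Omega>)"
 \<comment> \<open>Half the gap between the infimum and the values on the frontier: in
   \<open>\<Omega>\<close> the cutoff is 1 where \<open>V <= V0 + d\<close> and falls to 0 before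
   \<open>V\<close> reaches its frontier level \<open>V0 + 2 * d\<close>.\<close>
 define d where "d = (Vf - V0) / 2"
 have d: "d > 0" using V2(7) by (simp add: d_def Vf_def V0_def)
 obtain V1' where V1': "!!x. \<bar>V x\<bar> <= V1'" using V1(2) by (auto simp: bounded_iff)
 have bb: "bdd_below (V ` A)" for A using V1' by (intro bdd_belowI[of _ "- V1'"]) (auto simp: abs_le_iff minus_le_iff)
 have VV: "0 < V0" "V0 <= V1'" "!!x. V0 <= V x" "!!x. V x <= V1'"
  using V2(5) abs_le_D1[OF V1'] cInf_lower[OF _ bb, of _ UNIV] by (auto simp: V0_def) (auto simp: V2(6))
 define ch where "ch x = (if x \<in> \<Omega> then max 0 (min 1 ((V0 + 2 * d - V x) / d)) else 0)" for x
 have Vf: "V0 + 2 * d = Vf" by (simp add: d_def field_simps)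
 have fr: "V0 + 2 * d <= V x" if "x \<in> frontier \<Omega>" for x unfolding Vf Vf_def by (rule cInf_lower[OF imageI[OF that] bb])
 have ch: "continuous_on UNIV ch" "!!x. 0 <= ch x" "!!x. ch x <= 1" "ch x0 = 1"
  using cutoff_continuous[OF V1(1) V2(1) d fr] V2(4) d by (auto simp: ch_def[abs_def] V0_def)
 obtain R where R: "!!x. x \<in> \<Omega> ==> norm x <= R" using V2(3) by (auto simp: bounded_iff)
 have chR: "!!x. R < norm x ==> ch x = 0" using R by (force simp: ch_def)
 have ch1: "x \<in> \<Omega> & ch x = 1" if "V x < V0 + d" "0 < ch x" for x
 proof -
  have "x \<in> \<Omega>" using that(2) by (auto simp: ch_def split: if_splits)
  moreover have "1 <= (V0 + 2 * d - V x) / d" using that(1) d by (simp add: pos_le_divide_eq)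
  ultimately show ?thesis by (simp add: ch_def)
 qed

 \<comment> \<open>The quotient of the nonlinearity by its argument, and the truncation\<close>
 have F: "(prim f has_real_derivative f s) (at s)" for s
  by (rule prim_has_derivative) (use f1(1) DERIV_isCont continuous_at_imp_continuous_on in blast)
 have AR: "!!s. s \<noteq> 0 ==> 0 < \<mu> * prim f s & \<mu> * prim f s <= s * f s" using f4(2) by (simp add: prim_def)
 have sgn: "!!s. s \<noteq> 0 ==> 0 < s * f s" using AR by (meson less_le_trans)
 \<comment> \<open>All structural hypotheses are reduced to properties of the quotient: continuous,
   zero at 0, positive elsewhere, strictly increasing along rays.\<close>
 define m where "m = quot f"
 have fm: "f s = s * m s" for s using f2 by (simp add: m_def quot_def)
 have sf: "s * f s = s\<^sup>2 * m s" for s by (simp add: fm power2_eq_square)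
 have m0: "m 0 = 0" by (simp add: m_def quot_def)
 have mpos: "0 < m s" if "s \<noteq> 0" for s using sgn[OF that] that unfolding sf by (simp add: zero_less_mult_iff)
 hence mnn: "0 <= m s" for s using m0 by (cases "s = 0") (auto intro: less_imp_le)
 have mc: "continuous_on UNIV m" unfolding m_def by (rule quot_continuous[OF f1(1) f2])
 have mlt: "m (t * s) < m s" if "0 < t" "t < 1" "s \<noteq> 0" for s t
 proof (cases "s > 0")
  case True thus ?thesis using f5(1)[of "t * s" s] that by (simp add: m_def quot_def)
 next
  case False
  have "s < t * s" "t * s < 0" using False that by (auto simp: mult_less_0_iff)
  thus ?thesis using f5(2)[of s "t * s"] that by (simp add: m_def quot_def)
 qed
 have mle: "m (t * s) <= m s" if "0 <= t" "t <= 1" for s t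
  using mlt[of t s] mnn m0 that by (cases "t = 0 \<or> t = 1 \<or> s = 0") (auto simp: less_imp_le)
 have msm: "\<exists>b>0. \<forall>s. \<bar>s\<bar> <= b --> m s <= e" if "e > 0" for e
 proof -
  have "isCont m 0" using mc by (simp add: continuous_on_eq_continuous_at)
  hence "\<forall>\<^sub>F s in at 0. m s < e" using that m0 order_tendstoD(2)[of m 0 "at 0" e] by (simp add: isCont_def)
  then obtain b where b: "b > 0" "!!s. s \<noteq> 0 ==> \<bar>s\<bar> < b ==> m s < e" unfolding eventually_at dist_real_def by auto
  have "m s <= e" if "\<bar>s\<bar> <= b / 2" for s using b(2)[of s] that b(1) m0 \<open>e > 0\<close> by (cases "s = 0") auto
  thus ?thesis using b(1) by (intro exI[of _ "b / 2"]) auto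
 qed
 define nu where "nu = 1 / 2 - 1 / \<mu>"
 have nu: "nu > 0" using f4(1) by (simp add: nu_def field_simps)
 define \<kappa> where "\<kappa> = min (V0 / 2) (nu * V0)"
 have \<kappa>: "0 < \<kappa>" "\<kappa> <= V0 / 2" "\<kappa> <= nu * V0" using VV nu by (auto simp: \<kappa>_def)
 \<comment> \<open>The threshold is where the slope of \<open>f\<close> is still at most
   \<open>\<kappa>\<close>; continuity of the quotient at 0 provides it.\<close>
 obtain a where a: "a > 0" "!!s. \<bar>s\<bar> <= a ==> m s <= \<kappa>" using msm[OF \<kappa>(1)] by blast
 define cl where "cl s = max (- a) (min a s)" for s
 have gt: "trunc a f s = s * m (cl s)" for s by (simp add: trunc_def m_def cl_def)
 have sg: "s * trunc a f s = s\<^sup>2 * m (cl s)" for s by (simp add: gt power2_eq_square)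
 have cl: "\<bar>cl s\<bar> <= a" "\<bar>s\<bar> <= a ==> cl s = s" "\<exists>t. 0 <= t & t <= 1 & cl s = t * s" for s
 proof -
  show "\<bar>cl s\<bar> <= a" "\<bar>s\<bar> <= a ==> cl s = s" using a by (auto simp: cl_def)
  show "\<exists>t. 0 <= t & t <= 1 & cl s = t * s"
  proof (cases "s = 0")
   case False
   have "0 <= cl s / s" "cl s / s <= 1" using a False by (auto simp: cl_def divide_simps max_def min_def)
   thus ?thesis using False by (intro exI[of _ "cl s / s"]) auto
  qed (use a in \<open>auto simp: cl_def\<close>)
 qed
 have clle: "m (cl s) <= m s" for s using cl(3)[of s] mle by metis
 \<comment> \<open>Clamping is monotone and preserves signs, so \<open>cl (t * s)\<close> is again a
   multiple of \<open>cl s\<close> with factor in \<open>[0, 1]\<close>, and \<open>mle\<close>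
   applies.\<close>
 have clt: "m (cl (t * s)) <= m (cl s)" if "0 <= t" "t <= 1" for s t
 proof (cases "cl s = 0")
  case True
  hence "s = 0" using a by (auto simp: cl_def max_def min_def split: if_splits)
  thus ?thesis by simp
 next
  case False
  have ts: "t * s <= s" if "s >= 0" using that \<open>t <= 1\<close> mult_right_mono[of t 1 s] by simp
  have ts': "s <= t * s" if "s <= 0" using that \<open>t <= 1\<close> mult_right_mono_neg[of t 1 s] by simp
  have "0 <= cl (t * s) / cl s & cl (t * s) / cl s <= 1"
  proof (cases "s >= 0")
   case True
   have "0 <= t * s" using True that by simp
   hence "0 <= cl (t * s)" "cl (t * s) <= cl s" using a(1) ts[OF True] by (auto simp: cl_def le_max_iff_disj)
   thus ?thesis using False by (auto simp: divide_simps)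
  next
   case neg: False
   have "t * s <= 0" using neg that by (simp add: mult_nonneg_nonpos)
   moreover have "s <= t * s" using ts' neg by simp
   ultimately have "cl (t * s) <= 0" "cl s <= cl (t * s)" using a(1) by (auto simp: cl_def le_max_iff_disj)
   thus ?thesis using False by (auto simp: divide_simps)
  qed
  with mle[of "cl (t * s) / cl s" "cl s"] False show ?thesis by simp
 qed
 define cA where "cA = c1 + c2"
 have growth: "!!s. \<bar>f s\<bar> <= cA * (\<bar>s\<bar> + \<bar>s\<bar> powr p)"
 proof -
  fix s
  have "0 <= c2 * \<bar>s\<bar>" "0 <= c1 * \<bar>s\<bar> powr p" using f3 by auto
  thus "\<bar>f s\<bar> <= cA * (\<bar>s\<bar> + \<bar>s\<bar> powr p)" using f3(5)[of s] by (simp add: cA_def algebra_simps)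
 qed
 have growth': "!!s. \<bar>trunc a f s\<bar> <= cA * (\<bar>s\<bar> + \<bar>s\<bar> powr p)"
 proof -
  fix s
  have "\<bar>trunc a f s\<bar> = \<bar>s\<bar> * m (cl s)" using mnn by (simp add: gt abs_mult)
  also have "\<dots> <= \<bar>s\<bar> * m s" using clle by (intro mult_left_mono) auto
  also have "\<dots> = \<bar>f s\<bar>" using mnn by (simp add: fm abs_mult)
  finally show "\<bar>trunc a f s\<bar> <= cA * (\<bar>s\<bar> + \<bar>s\<bar> powr p)" using growth[of s] by linarith
 qed
 have small: "!!e. e > 0 ==> \<exists>C\<ge>0. \<forall>s. s * f s <= e * s\<^sup>2 + C * \<bar>s\<bar> powr (p + 1)"
 proof -
  fix e :: real assume e: "e > 0"
  obtain b where b: "b > 0" "!!s. \<bar>s\<bar> <= b ==> m s <= e" using msm[OF e] by blast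
  have "s * f s <= e * s\<^sup>2 + (c1 * b powr (1 - p) + c2) * \<bar>s\<bar> powr (p + 1)" for s
  proof (cases "\<bar>s\<bar> <= b")
   case True
   have "s\<^sup>2 * m s <= s\<^sup>2 * e" using b(2)[OF True] by (intro mult_left_mono) auto
   moreover have "0 <= (c1 * b powr (1 - p) + c2) * \<bar>s\<bar> powr (p + 1)" using f3 by simp
   ultimately show ?thesis unfolding sf by (simp add: mult.commute)
  next
   case False
   \<comment> \<open>Away from zero the linear part of the growth bound is absorbed into the power,
     at the price \<open>b powr (1 - p)\<close>.\<close>
   hence s: "\<bar>s\<bar> > 0" using b by linarith
   have "s * f s <= \<bar>s\<bar> * \<bar>f s\<bar>" by (simp add: abs_mult[symmetric])
   also have "\<dots> <= \<bar>s\<bar> * (c1 * \<bar>s\<bar> + c2 * \<bar>s\<bar> powr p)" using f3(5) by (intro mult_left_mono) auto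
   also have "\<dots> = c1 * (\<bar>s\<bar> powr (1 - p) * \<bar>s\<bar> powr (p + 1)) + c2 * \<bar>s\<bar> powr (p + 1)"
   proof -
    have "\<bar>s\<bar> powr (1 - p) * \<bar>s\<bar> powr (p + 1) = \<bar>s\<bar> powr 2" using s by (simp add: powr_add[symmetric])
    moreover have "\<bar>s\<bar> powr (p + 1) = \<bar>s\<bar> powr p * \<bar>s\<bar>" using s by (simp add: powr_add)
    ultimately show ?thesis using s by (simp add: powr_numeral power2_eq_square algebra_simps)
   qed
   also have "\<dots> <= c1 * (b powr (1 - p) * \<bar>s\<bar> powr (p + 1)) + c2 * \<bar>s\<bar> powr (p + 1)"
    using False b f3 by (intro add_mono mult_left_mono mult_right_mono powr_mono2') auto
   also have "\<dots> = (c1 * b powr (1 - p) + c2) * \<bar>s\<bar> powr (p + 1)" by (simp add: distrib_right)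
   also have "\<dots> <= e * s\<^sup>2 + \<dots>" using e by simp
   finally show ?thesis .
  qed
  thus "\<exists>C\<ge>0. \<forall>s. s * f s <= e * s\<^sup>2 + C * \<bar>s\<bar> powr (p + 1)"
   using f3 by (intro exI[of _ "c1 * b powr (1 - p) + c2"]) auto
 qed
 have super: "!!K. \<exists>T>0. \<forall>s. \<bar>s\<bar> >= T --> K * s\<^sup>2 <= s * f s"
 proof -
  fix K
  obtain T where T: "T > 0" "!!s. s >= T ==> K * s\<^sup>2 <= s * f s" using superlinear_of_AR[OF F f4(1), of K] AR by force
  \<comment> \<open>The negative half-line by reflection: \<open>prim f (- s)\<close> is a primitive
    of \<open>- f (- s)\<close>.\<close>
  have F': "((%s. prim f (- s)) has_real_derivative - f (- s)) (at s)" for s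
   using DERIV_chain2[OF F[of "- s"] DERIV_minus[OF DERIV_ident]] by simp
  obtain T' where T': "T' > 0" "!!s. s >= T' ==> K * s\<^sup>2 <= s * - f (- s)" using superlinear_of_AR[OF F' f4(1), of K] AR[of "- _"] by force
  have "K * s\<^sup>2 <= s * f s" if "\<bar>s\<bar> >= max T T'" for s
   using T(2)[of s] T'(2)[of "- s"] that by (cases "s >= 0") auto
  thus "\<exists>T>0. \<forall>s. \<bar>s\<bar> >= T --> K * s\<^sup>2 <= s * f s" using T(1) by (intro exI[of _ "max T T'"]) auto
 qed
 have mono: "!!s t. 0 <= t ==> t <= 1 ==> s * f (t * s) <= t * (s * f s)" "!!s t. 0 <= t ==> t <= 1 ==> s * trunc a f (t * s) <= t * (s * trunc a f s)"
  "!!s t. 0 < t ==> t < 1 ==> s \<noteq> 0 ==> s * f (t * s) < t * (s * f s)"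
 proof -
  fix s t :: real
  have e: "s * f (t * s) = (t * s\<^sup>2) * m (t * s)" "t * (s * f s) = (t * s\<^sup>2) * m s" "s * trunc a f (t * s) = (t * s\<^sup>2) * m (cl (t * s))" "t * (s * trunc a f s) = (t * s\<^sup>2) * m (cl s)"
   by (simp_all add: fm gt power2_eq_square)
  show "0 <= t ==> t <= 1 ==> s * f (t * s) <= t * (s * f s)" unfolding e using mle by (intro mult_left_mono) auto
  show "0 <= t ==> t <= 1 ==> s * trunc a f (t * s) <= t * (s * trunc a f s)" unfolding e using clt by (intro mult_left_mono) auto
  show "0 < t ==> t < 1 ==> s \<noteq> 0 ==> s * f (t * s) < t * (s * f s)" unfolding e using mlt by (intro mult_strict_left_mono) auto
 qed
 have misc: "0 < cA" "continuous_on UNIV f" "continuous_on UNIV (trunc a f)" "!!s. 0 <= s * trunc a f s" "!!s. \<mu> * prim f s <= s * f s"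
  "!!s. s * trunc a f s <= \<kappa> * s\<^sup>2" "!!s. s * trunc a f s <= s * f s" "V x0 = V0" "!!s. \<bar>s\<bar> <= a ==> trunc a f s = f s" "!!s. \<bar>s\<bar> <= a ==> s * f s <= \<kappa> * s\<^sup>2"
 proof -
  show "0 < cA" using f3 by (simp add: cA_def)
  show "continuous_on UNIV f" unfolding fm[abs_def] by (intro continuous_intros mc)
  show "continuous_on UNIV (trunc a f)" unfolding gt[abs_def] cl_def by (intro continuous_intros continuous_on_compose2[OF mc]) auto
  show "0 <= s * trunc a f s" for s unfolding sg using mnn by simp
  show "\<mu> * prim f s <= s * f s" for s using AR[of s] by (cases "s = 0") auto
  show "s * trunc a f s <= \<kappa> * s\<^sup>2" for s using mult_left_mono[OF a(2)[OF cl(1)[of s]], of "s\<^sup>2"] unfolding sg by (simp add: mult.commute)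
  show "s * trunc a f s <= s * f s" for s unfolding sg sf using clle by (intro mult_left_mono) auto
  show "\<bar>s\<bar> <= a ==> trunc a f s = f s" for s by (simp add: gt fm cl(2))
  show "\<bar>s\<bar> <= a ==> s * f s <= \<kappa> * s\<^sup>2" for s unfolding sf using mult_left_mono[OF a(2)[of s], of "s\<^sup>2"] by (simp add: mult.commute)
 qed (simp add: V0_def)

 \<comment> \<open>Application of the concentration result and return to the original
   variable\<close>
 interpret concentration f "trunc a f" V0 V1' cA p \<mu> nu \<kappa> "TYPE('n)" V ch x0 eps a R
  by unfold_locales (fact N5 f3 VV misc growth growth' small sgn mono super f4(1) nu_def \<kappa> V1(1) ch chR eps a(1))+
 obtain u v B where uv: "\<forall>\<^sub>F n in sequentially. crit (Wn n) (tn n) (u n) (v n) & (\<forall>x y. \<bar>u n x - u n y\<bar> <= B * norm (x - y)) & (\<exists>y. a <= \<bar>u n y\<bar>)"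
  and conc: "\<forall>d>0. \<forall>\<^sub>F n in sequentially. \<forall>y. a <= \<bar>u n y\<bar> --> V (x0 + eps n *\<^sub>R y) < V0 + d & 0 < ch (x0 + eps n *\<^sub>R y)"
  using solutions_concentrate by (elim exE conjE) (rule that, assumption+)
 obtain na nb where nab: "\<forall>n\<ge>na. crit (Wn n) (tn n) (u n) (v n) & (\<forall>x y. \<bar>u n x - u n y\<bar> <= B * norm (x - y)) & (\<exists>y. a <= \<bar>u n y\<bar>)"
  "\<forall>n\<ge>nb. \<forall>y. a <= \<bar>u n y\<bar> --> V (x0 + eps n *\<^sub>R y) < V0 + d & 0 < ch (x0 + eps n *\<^sub>R y)"
  using uv conc[rule_format, OF d] unfolding eventually_sequentially by blast
 define n1 where "n1 = max na nb"
 have n1: "!!n. n >= n1 ==> crit (Wn n) (tn n) (u n) (v n) & (\<forall>x y. \<bar>u n x - u n y\<bar> <= B * norm (x - y)) & (\<exists>y. a <= \<bar>u n y\<bar>)"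
  "!!n y. n >= n1 ==> a <= \<bar>u n y\<bar> ==> V (x0 + eps n *\<^sub>R y) < V0 + d & 0 < ch (x0 + eps n *\<^sub>R y)"
  using nab by (simp_all add: n1_def)
 define r where "r k = k + n1" for k
 define w where "w k x = u (r k) ((1 / eps (r k)) *\<^sub>R (x - x0))" for k x
 have r: "strict_mono r" "!!k. r k >= n1" by (auto simp: r_def strict_mono_def)
 have wpt: "u (r k) y = w k (x0 + eps (r k) *\<^sub>R y)" for k y using eps(1)[of "r k"] by (simp add: w_def)
 have wc: "continuous_on UNIV (w k)" for k
 proof -
  have "continuous_on UNIV (u (r k))"
  proof (rule lipschitz_on_continuous_on[OF lipschitz_onI[of _ _ "\<bar>B\<bar>"]])
   fix x y
   have "\<bar>u (r k) x - u (r k) y\<bar> <= B * norm (x - y)" using n1(1)[OF r(2)] by blast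
   also have "\<dots> <= \<bar>B\<bar> * norm (x - y)" by (intro mult_right_mono) auto
   finally show "dist (u (r k) x) (u (r k) y) <= \<bar>B\<bar> * dist x y" by (simp add: dist_norm)
  qed simp
  moreover have "continuous_on UNIV (%x. (1 / eps (r k)) *\<^sub>R (x - x0))" by (intro continuous_intros)
  ultimately have "continuous_on UNIV (%x. u (r k) ((1 / eps (r k)) *\<^sub>R (x - x0)))" by (rule continuous_on_compose2) simp
  thus ?thesis by (simp add: w_def[abs_def])
 qed
 have wa: "\<exists>x. a <= \<bar>w k x\<bar>" for k
 proof -
  obtain y where "a <= \<bar>u (r k) y\<bar>" using n1(1)[OF r(2)[of k]] by blast
  thus ?thesis unfolding wpt by blast
 qed
 have wmax: "a <= \<bar>w k x\<bar>" if "\<forall>y. \<bar>w k y\<bar> <= \<bar>w k x\<bar>" for k x using wa[of k] that by (meson order_trans)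
 have wch: "V x < V0 + d' & 0 < ch x" if "a <= \<bar>w k x\<bar>" "!!y. a <= \<bar>u (r k) y\<bar> ==> V (x0 + eps (r k) *\<^sub>R y) < V0 + d' & 0 < ch (x0 + eps (r k) *\<^sub>R y)" for k x d'
  using that(2)[of "(1 / eps (r k)) *\<^sub>R (x - x0)"] that(1) eps(1)[of "r k"] by (simp add: w_def)
 have sol: "weak_solution (eps (r k)) V f (w k)" for k
  unfolding w_def
 proof (rule rescaled_solution[OF eps(1)])
  have cr: "crit (Wn (r k)) (tn (r k)) (u (r k)) (v (r k))" using n1(1)[OF r(2)] by blast
  show "Wsp (u (r k)) (v (r k))" using cr by (simp add: crit_def)
  show "V \<in> bmeas" "f \<in> bmeas" using V1(1) misc(2) by (auto intro: borel_measurable_continuous_onI)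
  show "\<bar>V x\<bar> <= V1'" for x by (rule V1')
  fix h k' :: "real^'n => real" assume hk: "Wsp h k'"
  \<comment> \<open>Where \<open>\<bar>u\<bar> <= a\<close> the two nonlinearities agree; elsewhere
    concentration with the gap \<open>d\<close> gives cutoff 1. So the penalised equation is the
    original one.\<close>
  have "gg (tn (r k)) (u (r k)) x = f (u (r k) x)" for x
  proof (cases "\<bar>u (r k) x\<bar> <= a")
   case True thus ?thesis using misc(9)[OF True] by (simp add: gg_def algebra_simps)
  next
   case False
   hence "ch (x0 + eps (r k) *\<^sub>R x) = 1" using n1(2)[OF r(2), of k x] ch1 by auto
   thus ?thesis by (simp add: gg_def tn_def)
  qed
  thus "LI (%x. v (r k) x * k' x) + LI (%x. V (x0 + eps (r k) *\<^sub>R x) * (u (r k) x * h x)) = LI (%x. f (u (r k) x) * h x)"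
   using cr hk by (simp add: crit_def Bf_def Wn_def)
 qed
 have nontriv: "\<not> (AE x in lebesgue. w k x = 0)" for k
 proof
  assume "AE x in lebesgue. w k x = 0"
  hence "AE x in lborel. w k x = 0" using AE_lebesgue_iff_borel[of "w k"] borel_measurable_continuous_onI[OF wc] by simp
  hence "w k x = 0" for x by (rule AE_zero_continuous[OF wc])
  thus False using wa[of k] a(1) by simp
 qed
 have dom: "xk \<in> \<Omega>" if "\<forall>y. \<bar>w k y\<bar> <= \<bar>w k xk\<bar>" for k xk
  using wch[OF wmax[OF that] n1(2)[OF r(2)]] ch1 by blast
 have lim: "(%k. V (xs k)) -->> Inf (range V)" if xs: "\<forall>k. \<forall>y. \<bar>w k y\<bar> <= \<bar>w k (xs k)\<bar>" for xs
 proof (rule LIMSEQ_I)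
  fix e :: real assume e: "e > 0"
  obtain n2 where n2: "!!n y. n >= n2 ==> a <= \<bar>u n y\<bar> ==> V (x0 + eps n *\<^sub>R y) < V0 + e & 0 < ch (x0 + eps n *\<^sub>R y)"
   using conc[rule_format, OF e] by (auto simp: eventually_sequentially)
  have "norm (V (xs k) - Inf (range V)) < e" if "k >= n2" for k
  proof -
   have "r k >= n2" using that by (simp add: r_def)
   hence "V (xs k) < V0 + e" using wch[OF wmax[of k "xs k"] n2] xs by blast
   thus ?thesis using VV(3)[of "xs k"] V2(6) by (simp add: V0_def)
  qed
  thus "\<exists>no. \<forall>n\<ge>no. norm (V (xs n) - Inf (range V)) < e" by blast
 qed
 show ?thesis using r(1) sol nontriv wc dom lim by (intro exI[of _ r] exI[of _ w]) blast
qed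

end
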